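(* There is a forcing extension of $L$ by class forcing which satisfies $\mathrm{ZFC}+\neg\mathrm{BA}$.
   Context: The Ground Axiom ($\mathrm{GA}$) asserts that the universe is not a forcing extension of any inner model $W$ by nontrivial set forcing $P\in W$. The Bedrock Axiom ($\mathrm{BA}$) asserts that there is an inner model $W$ such that $V$ is a set-forcing extension of $W$ (possibly trivial) and $W\models\mathrm{GA}$. Class forcing means forcing with a definable proper-class partial order. *)

theory Defs
  imports Main "HOL-Library.Countable_Set"
begin

text \<open>
  A structure for the language of set theory is a carrier \<open>A\<close> together with a binary
  relation \<open>E\<close>, where \<open>E y x\<close> is read as ``\<open>y\<close> is a member of \<open>x\<close>''. Only the restriction
  of \<open>E\<close> to \<open>A\<close> matters, so a substructure is given by a smaller carrier and the same \<open>E\<close>.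
\<close>

section \<open>First-order formulas and definability\<close>

datatype fm = Mem nat nat | Eq nat nat | Neg fm | Conj fm fm | Forall nat fm

primrec fv :: "fm \<Rightarrow> nat set" where
  "fv (Mem i j) = {i, j}"
| "fv (Eq i j) = {i, j}"
| "fv (Neg \<phi>) = fv \<phi>"
| "fv (Conj \<phi> \<psi>) = fv \<phi> \<union> fv \<psi>"
| "fv (Forall i \<phi>) = fv \<phi> - {i}"

primrec sat :: "'a set \<Rightarrow> ('a \<Rightarrow> 'a \<Rightarrow> bool) \<Rightarrow> fm \<Rightarrow> (nat \<Rightarrow> 'a) \<Rightarrow> bool" where
  "sat A E (Mem i j) v \<longleftrightarrow> E (v i) (v j)"
| "sat A E (Eq i j) v \<longleftrightarrow> v i = v j"
| "sat A E (Neg \<phi>) v \<longleftrightarrow> \<not> sat A E \<phi> v"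
| "sat A E (Conj \<phi> \<psi>) v \<longleftrightarrow> sat A E \<phi> v \<and> sat A E \<psi> v"
| "sat A E (Forall i \<phi>) v \<longleftrightarrow> (\<forall>a\<in>A. sat A E \<phi> (v(i := a)))"

text \<open>
  Definability with parameters. Parameters are required to lie in \<open>A\<close> only for the variables
  that occur free, so that the empty structure has a definable subset as well; this is needed
  at the bottom of the constructible hierarchy.
\<close>

definition definable :: "'a set \<Rightarrow> ('a \<Rightarrow> 'a \<Rightarrow> bool) \<Rightarrow> 'a set \<Rightarrow> bool" where
  "definable A E X \<longleftrightarrow>
     (\<exists>\<phi> v. v ` (fv \<phi> - {0}) \<subseteq> A \<and> X = {a \<in> A. sat A E \<phi> (v(0 := a))})"

definition definable_rel :: "'a set \<Rightarrow> ('a \<Rightarrow> 'a \<Rightarrow> bool) \<Rightarrow> ('a \<times> 'a) set \<Rightarrow> bool" where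
  "definable_rel A E R \<longleftrightarrow>
     (\<exists>\<phi> v. v ` (fv \<phi> - {0, 1}) \<subseteq> A \<and>
        R = {(a, b). a \<in> A \<and> b \<in> A \<and> sat A E \<phi> (v(0 := a, 1 := b))})"

section \<open>Models of ZFC\<close>

definition elts :: "'a set \<Rightarrow> ('a \<Rightarrow> 'a \<Rightarrow> bool) \<Rightarrow> 'a \<Rightarrow> 'a set" where
  "elts A E x = {y \<in> A. E y x}"

definition is_opair :: "'a set \<Rightarrow> ('a \<Rightarrow> 'a \<Rightarrow> bool) \<Rightarrow> 'a \<Rightarrow> 'a \<Rightarrow> 'a \<Rightarrow> bool" where
  "is_opair A E z x y \<longleftrightarrow> x \<in> A \<and> y \<in> A \<and> z \<in> A \<and>
     (\<exists>s\<in>A. \<exists>t\<in>A. elts A E s = {x} \<and> elts A E t = {x, y} \<and> elts A E z = {s, t})"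

definition extensional_model :: "'a set \<Rightarrow> ('a \<Rightarrow> 'a \<Rightarrow> bool) \<Rightarrow> bool" where
  "extensional_model A E \<longleftrightarrow> (\<forall>x\<in>A. \<forall>y\<in>A. elts A E x = elts A E y \<longrightarrow> x = y)"

text \<open>
  The axioms are stated as what their satisfaction in \<open>(A, E)\<close> unfolds to; the two schemas
  quantify over the classes and class relations definable with parameters. Choice is the
  existence of a transversal for each set of nonempty, pairwise disjoint sets.
\<close>

definition ZFC :: "'a set \<Rightarrow> ('a \<Rightarrow> 'a \<Rightarrow> bool) \<Rightarrow> bool" where
  "ZFC A E \<longleftrightarrow>
     extensional_model A E \<and>
     (\<forall>x\<in>A. elts A E x \<noteq> {} \<longrightarrow> (\<exists>y\<in>elts A E x. elts A E y \<inter> elts A E x = {})) \<and>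
     (\<forall>x\<in>A. \<forall>y\<in>A. \<exists>z\<in>A. elts A E z = {x, y}) \<and>
     (\<forall>x\<in>A. \<exists>u\<in>A. elts A E u = (\<Union>y\<in>elts A E x. elts A E y)) \<and>
     (\<forall>x\<in>A. \<exists>p\<in>A. elts A E p = {y \<in> A. elts A E y \<subseteq> elts A E x}) \<and>
     (\<exists>w\<in>A. (\<exists>e\<in>elts A E w. elts A E e = {}) \<and>
        (\<forall>x\<in>elts A E w. \<exists>s\<in>elts A E w. elts A E s = insert x (elts A E x))) \<and>
     (\<forall>X. definable A E X \<longrightarrow> (\<forall>x\<in>A. \<exists>y\<in>A. elts A E y = elts A E x \<inter> X)) \<and>
     (\<forall>R. definable_rel A E R \<longrightarrow>
        (\<forall>x\<in>A. (\<forall>a\<in>elts A E x. \<exists>!b. (a, b) \<in> R) \<longrightarrow>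
           (\<exists>y\<in>A. \<forall>a\<in>elts A E x. \<exists>b\<in>elts A E y. (a, b) \<in> R))) \<and>
     (\<forall>x\<in>A. (\<forall>y\<in>elts A E x. elts A E y \<noteq> {}) \<and>
        (\<forall>y\<in>elts A E x. \<forall>z\<in>elts A E x. y \<noteq> z \<longrightarrow> elts A E y \<inter> elts A E z = {}) \<longrightarrow>
        (\<exists>c\<in>A. \<forall>y\<in>elts A E x. \<exists>!z. z \<in> elts A E c \<inter> elts A E y))"

definition mem_rel :: "'a set \<Rightarrow> ('a \<Rightarrow> 'a \<Rightarrow> bool) \<Rightarrow> ('a \<times> 'a) set" where
  "mem_rel A E = {(y, x). x \<in> A \<and> y \<in> elts A E x}"

text \<open>
  By Mostowski's theorem the countable well-founded models of ZFC are, up to isomorphism,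
  the countable transitive ones.
\<close>

definition countable_transitive_model :: "'a set \<Rightarrow> ('a \<Rightarrow> 'a \<Rightarrow> bool) \<Rightarrow> bool" where
  "countable_transitive_model A E \<longleftrightarrow> countable A \<and> wf (mem_rel A E) \<and> ZFC A E"

definition ordinal :: "'a set \<Rightarrow> ('a \<Rightarrow> 'a \<Rightarrow> bool) \<Rightarrow> 'a \<Rightarrow> bool" where
  "ordinal A E x \<longleftrightarrow> x \<in> A \<and>
     (\<forall>y\<in>elts A E x. elts A E y \<subseteq> elts A E x) \<and>
     (\<forall>y\<in>elts A E x. \<forall>z\<in>elts A E y. elts A E z \<subseteq> elts A E y)"

definition inner_model :: "'a set \<Rightarrow> ('a \<Rightarrow> 'a \<Rightarrow> bool) \<Rightarrow> 'a set \<Rightarrow> bool" where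
  "inner_model A E W \<longleftrightarrow> W \<subseteq> A \<and> definable A E W \<and>
     (\<forall>x\<in>W. elts A E x \<subseteq> W) \<and> {\<alpha>. ordinal A E \<alpha>} \<subseteq> W \<and> ZFC W E"

section \<open>The constructible universe of a well-founded model\<close>

definition Def_pow :: "'a set \<Rightarrow> ('a \<Rightarrow> 'a \<Rightarrow> bool) \<Rightarrow> 'a set \<Rightarrow> 'a set" where
  "Def_pow A E X = {x \<in> A. definable X E (elts A E x)}"

definition Lset :: "'a set \<Rightarrow> ('a \<Rightarrow> 'a \<Rightarrow> bool) \<Rightarrow> 'a \<Rightarrow> 'a set" where
  "Lset A E = wfrec (mem_rel A E) (\<lambda>f \<alpha>. \<Union>\<beta>\<in>elts A E \<alpha>. Def_pow A E (f \<beta>))"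

lemma Lset_unfold:
  assumes "wf (mem_rel A E)" and "\<alpha> \<in> A"
  shows "Lset A E \<alpha> = (\<Union>\<beta>\<in>elts A E \<alpha>. Def_pow A E (Lset A E \<beta>))"
  using assms unfolding Lset_def
  by (subst wfrec) (auto simp: mem_rel_def cut_def)

definition L :: "'a set \<Rightarrow> ('a \<Rightarrow> 'a \<Rightarrow> bool) \<Rightarrow> 'a set" where
  "L A E = (\<Union>\<alpha>\<in>{\<alpha>. ordinal A E \<alpha>}. Lset A E \<alpha>)"

section \<open>Forcing\<close>

text \<open>The pair \<open>(p, q) \<in> r\<close> means that \<open>p\<close> is stronger than or equal to \<open>q\<close>.\<close>

definition forcing_poset :: "'a set \<Rightarrow> ('a \<times> 'a) set \<Rightarrow> bool" where
  "forcing_poset P r \<longleftrightarrow> partial_order_on P r \<and> (\<exists>t\<in>P. \<forall>p\<in>P. (p, t) \<in> r)"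

definition dense_in :: "'a set \<Rightarrow> ('a \<times> 'a) set \<Rightarrow> 'a set \<Rightarrow> bool" where
  "dense_in P r D \<longleftrightarrow> D \<subseteq> P \<and> (\<forall>p\<in>P. \<exists>d\<in>D. (d, p) \<in> r)"

definition compatible :: "'a set \<Rightarrow> ('a \<times> 'a) set \<Rightarrow> 'a \<Rightarrow> 'a \<Rightarrow> bool" where
  "compatible P r p q \<longleftrightarrow> (\<exists>s\<in>P. (s, p) \<in> r \<and> (s, q) \<in> r)"

definition nontrivial_poset :: "'a set \<Rightarrow> ('a \<times> 'a) set \<Rightarrow> bool" where
  "nontrivial_poset P r \<longleftrightarrow>
     (\<forall>p\<in>P. \<exists>q\<in>P. \<exists>q'\<in>P. (q, p) \<in> r \<and> (q', p) \<in> r \<and> \<not> compatible P r q q')"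

definition filter_on :: "'a set \<Rightarrow> ('a \<times> 'a) set \<Rightarrow> 'a set \<Rightarrow> bool" where
  "filter_on P r G \<longleftrightarrow> G \<subseteq> P \<and> G \<noteq> {} \<and>
     (\<forall>p\<in>G. \<forall>q\<in>P. (p, q) \<in> r \<longrightarrow> q \<in> G) \<and>
     (\<forall>p\<in>G. \<forall>q\<in>G. \<exists>s\<in>G. (s, p) \<in> r \<and> (s, q) \<in> r)"

definition set_forcing :: "'a set \<Rightarrow> ('a \<Rightarrow> 'a \<Rightarrow> bool) \<Rightarrow> 'a set \<Rightarrow> ('a \<times> 'a) set \<Rightarrow> bool" where
  "set_forcing W E P r \<longleftrightarrow> forcing_poset P r \<and>
     (\<exists>c\<in>W. P = elts W E c) \<and>
     (\<exists>d\<in>W. r = {(p, q). \<exists>z\<in>elts W E d. is_opair W E z p q})"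

definition set_generic ::
  "'a set \<Rightarrow> ('a \<Rightarrow> 'a \<Rightarrow> bool) \<Rightarrow> 'a set \<Rightarrow> ('a \<times> 'a) set \<Rightarrow> 'a set \<Rightarrow> bool" where
  "set_generic W E P r G \<longleftrightarrow> filter_on P r G \<and>
     (\<forall>d\<in>W. dense_in P r (elts W E d) \<longrightarrow> G \<inter> elts W E d \<noteq> {})"

definition class_forcing :: "'a set \<Rightarrow> ('a \<Rightarrow> 'a \<Rightarrow> bool) \<Rightarrow> 'a set \<Rightarrow> ('a \<times> 'a) set \<Rightarrow> bool" where
  "class_forcing A E P r \<longleftrightarrow> forcing_poset P r \<and> definable A E P \<and> definable_rel A E r \<and>
     \<not> (\<exists>c\<in>A. P = elts A E c)"

definition class_generic ::
  "'a set \<Rightarrow> ('a \<Rightarrow> 'a \<Rightarrow> bool) \<Rightarrow> 'a set \<Rightarrow> ('a \<times> 'a) set \<Rightarrow> 'a set \<Rightarrow> bool" where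
  "class_generic A E P r G \<longleftrightarrow> filter_on P r G \<and>
     (\<forall>D. definable A E D \<and> dense_in P r D \<longrightarrow> G \<inter> D \<noteq> {})"

inductive_set names :: "'a set \<Rightarrow> ('a \<Rightarrow> 'a \<Rightarrow> bool) \<Rightarrow> 'a set \<Rightarrow> 'a set"
  for A :: "'a set" and E :: "'a \<Rightarrow> 'a \<Rightarrow> bool" and P :: "'a set" where
  "\<tau> \<in> A \<Longrightarrow> \<forall>z\<in>elts A E \<tau>. \<exists>\<sigma> p. \<sigma> \<in> names A E P \<and> p \<in> P \<and> is_opair A E z \<sigma> p
     \<Longrightarrow> \<tau> \<in> names A E P"

text \<open>
  \<open>(B, F)\<close> is the extension \<open>A[G]\<close>: its elements are exactly the values of the \<open>P\<close>-names in \<open>A\<close>,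
  evaluated by the usual recursion. For well-founded \<open>A\<close> this determines \<open>(B, F)\<close> up to
  isomorphism. If \<open>A\<close> is a transitive subclass of \<open>B\<close> and \<open>F = E\<close> is well-founded on \<open>B\<close>,
  the function \<open>val\<close> is uniquely determined and maps the canonical name of each element
  of \<open>A\<close> to that element, so the definition literally says \<open>B = A[G]\<close>.
\<close>

definition forcing_extension ::
  "'a set \<Rightarrow> ('a \<Rightarrow> 'a \<Rightarrow> bool) \<Rightarrow> 'a set \<Rightarrow> 'a set \<Rightarrow> 'b set \<Rightarrow> ('b \<Rightarrow> 'b \<Rightarrow> bool) \<Rightarrow> bool" where
  "forcing_extension A E P G B F \<longleftrightarrow> extensional_model B F \<and>
     (\<exists>val. val ` names A E P = B \<and>
        (\<forall>\<tau>\<in>names A E P. elts B F (val \<tau>) =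
           {val \<sigma> | \<sigma> p. \<sigma> \<in> names A E P \<and> p \<in> G \<and> (\<exists>z\<in>elts A E \<tau>. is_opair A E z \<sigma> p)}))"

section \<open>The Ground Axiom and the Bedrock Axiom\<close>

definition GA :: "'a set \<Rightarrow> ('a \<Rightarrow> 'a \<Rightarrow> bool) \<Rightarrow> bool" where
  "GA A E \<longleftrightarrow> \<not> (\<exists>W P r G. inner_model A E W \<and> set_forcing W E P r \<and> nontrivial_poset P r \<and>
     set_generic W E P r G \<and> forcing_extension W E P G A E)"

definition BA :: "'a set \<Rightarrow> ('a \<Rightarrow> 'a \<Rightarrow> bool) \<Rightarrow> bool" where
  "BA A E \<longleftrightarrow> (\<exists>W P r G. inner_model A E W \<and> set_forcing W E P r \<and>
     set_generic W E P r G \<and> forcing_extension W E P G A E \<and> GA W E)"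

end

theory Submission
  imports Defs "HOL-Library.Countable_Set_Type" "HOL-Library.Multiset"
begin

text \<open>
  After collapsing, \<open>M\<close> is a transitive set \<open>A\<close> of hereditarily countable sets and \<open>L\<close> is its
  constructible part \<open>K\<close>. The conditions are the partial functions \<open>p\<close> from \<open>K\<close> to \<open>2\<close> such that, for
  every limit ordinal \<open>b\<close>, the part of \<open>p\<close> below the next limit is an image of \<open>V_(b+1)\<close>; this is an
  Easton-support product adding new subsets at unboundedly many levels. Splitting conditions at \<open>b\<close>
  into a small lower and a closed upper part yields the forcing theorem and ZFC in \<open>N = K[G]\<close>.

  Let \<open>M a\<close> be the extension of \<open>K\<close> by the part of \<open>G\<close> above \<open>a\<close>; these models strictly decrease,
  and \<open>N\<close> is a set forcing extension of each. If \<open>W\<close> is a ground of \<open>N\<close> by a forcing of size below \<open>a\<close>,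
  the approximation and covering properties give \<open>M a \<subseteq> W\<close>, and \<open>M a\<close> is definable in \<open>W\<close> from
  the small subsets that lie in \<open>K\<close>. For \<open>b\<close> the next limit after \<open>a\<close>, \<open>W\<close> therefore lies strictly
  between \<open>M b\<close> and the set forcing extension \<open>N\<close> of \<open>M b\<close>. By the intermediate model theorem \<open>W\<close> is
  itself a set forcing extension of \<open>M b\<close>, nontrivial because \<open>W \<noteq> M b\<close>, so \<open>W\<close> violates GA.
\<close>

section \<open>Hereditarily countable sets\<close>

text \<open>Measuring supports by images of \<open>V_(b+1)\<close> replaces cardinals and GCH. This
  smallness is closed under small unions because \<open>V_(b+1)\<close> can code pairs, the
  conditions below \<open>b\<close> are elements of \<open>V_(b+1)\<close>, and by Cantor a
  condition cannot exhaust the coordinates between \<open>b\<close> and the next limit, so every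
  level adds a new set. The shape of the rest is forced by the axiom being refuted. It quantifies
  over arbitrary definable grounds \<open>W\<close>, so \<open>M b\<close> has to be found inside
  \<open>W\<close> and defined there; and the intermediate model theorem must deliver a poset in
  \<open>M b\<close> that splits below every condition. The sets are genuine hereditarily countable
  sets, so that absolute functions such as the constructible hierarchy are the same function in all
  models. Definability is a property of HOL predicates with closure rules, and the truth lemma and
  the ZFC axioms are proved once for the conditions above a parameter \<open>a\<close>, which covers
  both \<open>N\<close> and every \<open>M a\<close>.\<close>

datatype hset = Hc (celts: "hset cset")

text \<open>The type is a copy of HC. \<open>mk X\<close> is meaningful only for countable
  \<open>X\<close>, so a countability argument accompanies its uses; all structures considered are
  countable.\<close>

definition el :: "hset => hset set" where "el x = rcset (celts x)"
definition mk :: "hset set => hset" where "mk X = Hc (acset X)"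
abbreviation mem :: "hset => hset => bool" where "mem y x \<equiv> y : el x"

lemma countable_el[simp, intro]: "countable (el x)"
  unfolding el_def by (transfer) simp

lemma el_mk[simp]: "countable X ==> el (mk X) = X"
  unfolding el_def mk_def by (simp add: acset_inverse)

lemma mk_el[simp]: "mk (el x) = x"
  unfolding el_def mk_def by (simp add: rcset_inverse)

lemma ext_el: "el x = el y ==> x = y"
  by (metis mk_el)

lemma el_induct[case_names step]:
  assumes "!!x. (!!y. y : el x ==> Q y) ==> Q x"
  shows "Q x"
proof (induction x)
  case (Hc c)
  then show ?case using assms[of "Hc c"] unfolding el_def
    by (simp add: cset.set_map cin.rep_eq)
qed

lemma wf_mem: "wf {(y, x). y : el x}"
  unfolding wf_def by (auto intro: el_induct)

lemma mem_not_refl[simp]: "x ~: el x"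
  using wf_mem by (metis (no_types, lifting) case_prodI mem_Collect_eq wf_not_refl)

lemma mem_asym: "x : el y ==> y ~: el x"
  using wf_asym[OF wf_mem] by auto

definition TC :: "hset => hset set" where "TC x = {y. mem\<^sup>+\<^sup>+ y x}"
definition tc :: "hset => hset" where "tc x = mk (TC x)"

lemma TC_unfold: "TC x = el x Un (\<Union>y\<in>el x. TC y)"
  unfolding TC_def
  by (auto intro: tranclp.trancl_into_trancl) (metis (mono_tags) tranclp.cases)

lemma countable_TC[simp]: "countable (TC x)"
proof (induction x rule: el_induct)
  case (step x)
  then show ?case by (subst TC_unfold) auto
qed

lemma el_tc[simp]: "el (tc x) = TC x"
  by (simp add: tc_def)

lemma TC_el: "y : el x ==> y : TC x" by (subst TC_unfold) auto
lemma TC_trans: "y : TC x ==> z : TC y ==> z : TC x"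
  unfolding TC_def by auto
lemma TC_el2: "y : TC x ==> z : el y ==> z : TC x"
  using TC_trans TC_el by blast

text \<open>Recursion runs along the transitive closure because names sit inside pairs: the subnames
  of \<open>x\<close> lie in \<open>TC x\<close>, not in \<open>el x\<close>.\<close>

lemma wf_TC: "wf {(y, x). y : TC x}"
proof -
  have "{(y, x). y : TC x} = {(y, x). y : el x}\<^sup>+"
    unfolding TC_def by (auto simp: trancl_def)
  then show ?thesis using wf_trancl[OF wf_mem] by simp
qed

lemma TC_induct[case_names step]:
  assumes "!!x. (!!y. y : TC x ==> Q y) ==> Q x"
  shows "Q x"
  using wf_TC assms by (rule wf_induct_rule) auto

lemma TC_not_refl[simp]: "x ~: TC x"
  using wf_TC by (metis (no_types, lifting) case_prodI mem_Collect_eq wf_not_refl)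

section \<open>Pairs and functions as sets\<close>

definition zero :: hset where "zero = mk {}"
definition upair where "upair x y = mk {x, y}"
definition opr where "opr x y = upair (upair x x) (upair x y)"
definition succ where "succ x = mk (insert x (el x))"
definition Uni where "Uni x = mk (\<Union>(el ` el x))"
definition one where "one = succ zero"

lemma el_zero[simp]: "el zero = {}" by (simp add: zero_def)
lemma el_upair[simp]: "el (upair x y) = {x, y}" by (simp add: upair_def)
lemma el_succ[simp]: "el (succ x) = insert x (el x)" by (simp add: succ_def)
lemma el_Uni[simp]: "el (Uni x) = \<Union>(el ` el x)" by (simp add: Uni_def)
lemma el_one[simp]: "el one = {zero}" by (simp add: one_def)
lemma one_neq_zero[simp]: "one ~= zero" "zero ~= one"
  by (metis el_one el_zero insert_not_empty)+

lemma upair_eq: "upair x y = upair a b \<longleftrightarrow> (x = a \<and> y = b) \<or> (x = b \<and> y = a)"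
proof
  assume "upair x y = upair a b"
  then have "el (upair x y) = el (upair a b)" by simp
  then show "(x = a \<and> y = b) \<or> (x = b \<and> y = a)" by (simp add: doubleton_eq_iff)
qed (auto simp: upair_def insert_commute)

lemma opr_inject[simp]: "opr x y = opr a b \<longleftrightarrow> x = a \<and> y = b"
  unfolding opr_def by (auto simp: upair_eq)

lemma opr_TC: "x : TC (opr x y)" "y : TC (opr x y)"
  unfolding opr_def by (auto simp: TC_unfold[of "upair _ _"])

lemma opr_el_TC: assumes "opr x y : el z" shows "x : TC z" "y : TC z"
  using assms opr_TC TC_trans TC_el by blast+

definition lam :: "hset => (hset => hset) => hset" where
  "lam x f = mk ((%y. opr y (f y)) ` el x)"
text \<open>Taking the union of all values makes application total: it is \<open>zero\<close>
  outside the domain and the value itself where there is exactly one. The bound \<open>TC g\<close>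
  secures countability.\<close>

definition app :: "hset => hset => hset" where
  "app g x = mk {z : TC g. EX y. opr x y : el g \<and> z : el y}"

lemma el_lam[simp]: "el (lam x f) = (%y. opr y (f y)) ` el x"
  by (simp add: lam_def)

lemma el_app: "el (app g x) = {z. EX y. opr x y : el g \<and> z : el y}"
proof -
  have "countable {z : TC g. EX y. opr x y : el g \<and> z : el y}"
    by (rule countable_subset[OF _ countable_TC[of g]]) auto
  moreover have "z : TC g" if "opr x y : el g" "z : el y" for y z
    using opr_el_TC(2)[OF that(1)] that(2) by (rule TC_el2)
  ultimately show ?thesis unfolding app_def by auto
qed

lemma app_unique: "opr x y : el g ==> (!!z. opr x z : el g ==> z = y) ==> app g x = y"
  by (rule ext_el, unfold el_app) blast

lemma app_lam[simp]: "y : el x ==> app (lam x f) y = f y"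
  by (rule app_unique) auto

lemma lam_cong: "(!!y. y : el x ==> f y = g y) ==> lam x f = lam x g"
  by (rule ext_el) (auto intro!: image_cong)

text \<open>In \<open>dfb\<close> and \<open>dft\<close>, the even variables of the defining formula read the environment and the odd ones
  the parameters.\<close>

definition mrg :: "(nat => hset) => (nat => hset) => nat => hset" where
  "mrg e w k = (if even k then e (k div 2) else w (k div 2))"

definition dfb :: "hset set => ((nat => hset) => bool) => bool" where
  "dfb A \<Phi> \<longleftrightarrow> (EX \<phi> w. range w <= A \<and> (ALL e. range e <= A --> (\<Phi> e \<longleftrightarrow> sat A mem \<phi> (mrg e w))))"

definition dft :: "hset set => ((nat => hset) => hset) => bool" where
  "dft A t \<longleftrightarrow> (ALL e. range e <= A --> t e : A) \<and> dfb A (%e. e 0 = t (%n. e (Suc n)))"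

text \<open>The closure rules follow the syntax of HOL predicates and terms, so that
  \<open>intro df\<close> proves definability of a displayed expression. Binders shift the
  environment: position 0 always holds the newest variable.\<close>

named_theorems df

section \<open>Closure of definability under renaming, connectives, quantifiers and
  substitution\<close>

primrec rn :: "(nat => nat) => fm => fm" where
  "rn f (Mem i j) = Mem (f i) (f j)"
| "rn f (Eq i j) = Eq (f i) (f j)"
| "rn f (Neg \<phi>) = Neg (rn f \<phi>)"
| "rn f (Conj \<phi> \<psi>) = Conj (rn f \<phi>) (rn f \<psi>)"
| "rn f (Forall i \<phi>) = Forall (f i) (rn f \<phi>)"

text \<open>\<open>rn\<close> renames bound variables as well; injectivity is what prevents
  capture.\<close>

lemma sat_rn: "inj f ==> sat A E (rn f \<phi>) v \<longleftrightarrow> sat A E \<phi> (v \<circ> f)"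
proof (induction \<phi> arbitrary: v)
  case (Forall i \<phi>)
  have "v(f i := a) \<circ> f = (v \<circ> f)(i := a)" for a
    using Forall.prems by (auto simp: fun_eq_iff inj_eq)
  then show ?case unfolding rn.simps sat.simps Forall.IH[OF Forall.prems] by simp
qed auto

lemma sat_cong_fv: "(!!i. i : fv \<phi> ==> v i = w i) ==> sat A E \<phi> v \<longleftrightarrow> sat A E \<phi> w"
proof (induction \<phi> arbitrary: v w)
  case (Neg \<phi>) then show ?case by (metis fv.simps(3) sat.simps(3))
next
  case (Conj \<phi> \<psi>) then show ?case by (metis UnCI fv.simps(4) sat.simps(4))
next
  case (Forall i \<phi>)
  have "sat A E \<phi> (v(i := a)) \<longleftrightarrow> sat A E \<phi> (w(i := a))" for a
    by (rule Forall.IH) (use Forall.prems in auto)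
  then show ?case by simp
qed auto

lemma finite_fv[simp]: "finite (fv \<phi>)"
  by (induction \<phi>) auto

text \<open>These four facts give the injectivity of the slot renamings used below: two spread
  parameters over the residue classes modulo 4, one moves a bound variable into a parameter slot,
  one moves parameters to odd slots.\<close>

lemma inj_aux1: "(if even x then x else 2*(x - 1) + 1) = (if even y then y else 2*(y - 1) + (1::nat)) ==> x = y"
  by (cases "even x"; cases "even y") (auto elim!: oddE)
lemma inj_aux2: "(if even x then x else 2*(x - 1) + 3) = (if even y then y else 2*(y - 1) + (3::nat)) ==> x = y"
  by (cases "even x"; cases "even y") (auto elim!: oddE)
lemma inj_aux3: "(if x = 0 then 1 else if even x then x - 2 else x + 2) = (if y = 0 then (1::nat) else if even y then y - 2 else y+2) ==> x = y"
  by (cases "even x"; cases "even y"; auto split: if_splits elim!: oddE evenE; presburger)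
lemma inj_aux4: "(if x < 2 then 2*x else 2*x + 1) = (if y < 2 then 2*y else 2*y+(1::nat)) ==> x = y"
  by presburger

locale carrier =
  fixes A :: "hset set"
  assumes nonempty: "A ~= {}"
begin

lemma dfb_cong: "dfb A \<Phi> ==> (!!e. range e <= A ==> \<Phi> e = \<Psi> e) ==> dfb A \<Psi>"
  unfolding dfb_def by auto

lemma dfb_neg[df]: "dfb A \<Phi> ==> dfb A (%e. \<not> \<Phi> e)"
  unfolding dfb_def by (metis sat.simps(3))

lemma dfb_conj[df]:
  assumes "dfb A \<Phi>" "dfb A \<Psi>" shows "dfb A (%e. \<Phi> e \<and> \<Psi> e)"
proof -
  obtain \<phi> w \<psi> u where a: "range w <= A" "range u <= A"
    "!!e. range e <= A ==> \<Phi> e \<longleftrightarrow> sat A mem \<phi> (mrg e w)"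
    "!!e. range e <= A ==> \<Psi> e \<longleftrightarrow> sat A mem \<psi> (mrg e u)"
    using assms unfolding dfb_def by metis
  \<comment> \<open>The two parameter sequences are interleaved: parameter \<open>m\<close> of the
    first formula moves from slot \<open>2m+1\<close> to \<open>4m+1\<close>, that of the second to
    \<open>4m+3\<close>.\<close>
  let ?f = "%k::nat. if even k then k else 2*(k - 1) + 1"
  let ?g = "%k::nat. if even k then k else 2*(k - 1) + 3"
  have f: "inj ?f"
  proof (rule injI)
    fix x y assume "?f x = ?f y"
    then show "x = y" by (rule inj_aux1)
  qed
  have g: "inj ?g"
  proof (rule injI)
    fix x y assume "?g x = ?g y"
    then show "x = y" by (rule inj_aux2)
  qed
  have m: "mrg e (mrg w u) \<circ> ?f = mrg e w" "mrg e (mrg w u) \<circ> ?g = mrg e u" for e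
    by (auto simp: fun_eq_iff mrg_def elim!: oddE)
  show ?thesis unfolding dfb_def
  proof (intro exI conjI allI impI)
    show "range (mrg w u) <= A" using a by (auto simp: mrg_def)
    fix e :: "nat => hset" assume "range e <= A"
    then show "(\<Phi> e \<and> \<Psi> e) = sat A mem (Conj (rn ?f \<phi>) (rn ?g \<psi>)) (mrg e (mrg w u))"
      using a by (simp only: sat.simps sat_rn[OF f] sat_rn[OF g] m)
  qed
qed

lemma dfb_ren:
  assumes "dfb A \<Phi>" "inj f" shows "dfb A (%e. \<Phi> (e \<circ> f))"
proof -
  obtain \<phi> w where a: "range w <= A"
    "!!e. range e <= A ==> \<Phi> e \<longleftrightarrow> sat A mem \<phi> (mrg e w)"
    using assms unfolding dfb_def by metis
  let ?f = "%k::nat. if even k then 2 * f (k div 2) else k"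
  have i: "inj ?f"
  proof (rule injI)
    fix x y assume "?f x = ?f y"
    then show "x = y" using injD[OF assms(2)]
      by (cases "even x"; cases "even y") (auto, metis dvd_mult_div_cancel)
  qed
  have m: "mrg e w \<circ> ?f = mrg (e \<circ> f) w" for e
    by (auto simp: fun_eq_iff mrg_def)
  show ?thesis unfolding dfb_def
  proof (intro exI conjI allI impI)
    show "range w <= A" by fact
    fix e :: "nat => hset" assume "range e <= A"
    then have "range (e \<circ> f) <= A" by auto
    then show "\<Phi> (e \<circ> f) = sat A mem (rn ?f \<phi>) (mrg e w)"
      using a by (simp only: sat_rn[OF i] m)
  qed
qed

lemma dfb_all_upd:
  assumes "dfb A \<Phi>" shows "dfb A (%e. ALL x:A. \<Phi> (e(k := x)))"
proof -
  obtain \<phi> w where a: "range w <= A"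
    "!!e. range e <= A ==> \<Phi> e \<longleftrightarrow> sat A mem \<phi> (mrg e w)"
    using assms unfolding dfb_def by metis
  have m: "(mrg e w)(2*k := x) = mrg (e(k := x)) w" for e x
    by (auto simp: fun_eq_iff mrg_def)
  show ?thesis unfolding dfb_def
  proof (intro exI conjI allI impI)
    show "range w <= A" by fact
    fix e :: "nat => hset" assume e: "range e <= A"
    have "range (e(k := x)) <= A" if "x : A" for x using e that by (auto simp: image_subset_iff)
    then show "(ALL x:A. \<Phi> (e(k := x))) = sat A mem (Forall (2*k) \<phi>) (mrg e w)"
      using a by (simp add: m)
  qed
qed

lemma dfb_all[df]:
  assumes "dfb A (%e. \<Phi> (%n. e (Suc n)) (e 0))" shows "dfb A (%e. ALL x:A. \<Phi> e x)"
proof -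
  obtain \<phi> w where a: "range w <= A"
    "!!e. range e <= A ==> \<Phi> (%n. e (Suc n)) (e 0) \<longleftrightarrow> sat A mem \<phi> (mrg e w)"
    using assms unfolding dfb_def by metis
  \<comment> \<open>The bound variable takes over parameter slot 1, the other variables move down by
    one place and the parameters up by one; \<open>w 0\<close> is only a filler for the vacated
    parameter.\<close>
  let ?f = "%k::nat. if k = 0 then 1 else if even k then k - 2 else k + 2"
  let ?w = "%k. if k = 0 then w 0 else w (k - 1)"
  have i: "inj ?f"
  proof (rule injI)
    fix x y assume "?f x = ?f y"
    then show "x = y" by (rule inj_aux3)
  qed
  have m: "(mrg e ?w)(1 := x) \<circ> ?f = mrg (%n. case n of 0 => x | Suc m => e m) w" for e x
    by (auto simp: fun_eq_iff mrg_def split: nat.splits elim!: evenE oddE)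
  show ?thesis unfolding dfb_def
  proof (intro exI conjI allI impI)
    show "range ?w <= A" using a by auto
    fix e :: "nat => hset" assume e: "range e <= A"
    have "\<Phi> e x = sat A mem (rn ?f \<phi>) ((mrg e ?w)(1 := x))" if "x : A" for x
    proof -
      have "range (%n. case n of 0 => x | Suc m => e m) <= A"
        using e that by (auto simp: image_subset_iff split: nat.splits)
      from a(2)[OF this] show ?thesis by (simp only: sat_rn[OF i] m) simp
    qed
    then show "(ALL x:A. \<Phi> e x) = sat A mem (Forall 1 (rn ?f \<phi>)) (mrg e ?w)" by simp
  qed
qed

lemma dfb_true: "dfb A (%_. True)"
  unfolding dfb_def by (rule exI[of _ "Eq 0 0"]) (use nonempty in auto)

lemma dfb_const[df]: "dfb A (%_. p)"
  using dfb_true dfb_neg[OF dfb_true] by (cases p) auto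

lemma dfb_disj[df]:
  assumes "dfb A \<Phi>" "dfb A \<Psi>" shows "dfb A (%e. \<Phi> e \<or> \<Psi> e)"
proof -
  have "dfb A (%e. \<not> (\<not> \<Phi> e \<and> \<not> \<Psi> e))" by (intro dfb_neg dfb_conj assms)
  then show ?thesis by (rule dfb_cong) blast
qed
lemma dfb_imp[df]: "dfb A \<Phi> ==> dfb A \<Psi> ==> dfb A (%e. \<Phi> e --> \<Psi> e)"
  unfolding imp_conv_disj by (intro dfb_disj dfb_neg)
lemma dfb_iff[df]: "dfb A \<Phi> ==> dfb A \<Psi> ==> dfb A (%e. \<Phi> e \<longleftrightarrow> \<Psi> e)"
  unfolding iff_conv_conj_imp by (intro dfb_conj dfb_imp)
lemma dfb_ex[df]:
  assumes "dfb A (%e. \<Phi> (%n. e (Suc n)) (e 0))" shows "dfb A (%e. EX x:A. \<Phi> e x)"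
proof -
  have "dfb A (%e. \<not> (ALL x:A. \<not> \<Phi> e x))" by (intro dfb_neg dfb_all assms)
  then show ?thesis by (rule dfb_cong) blast
qed

lemma dfb_var_mem: "dfb A (%e. e i : el (e j))"
  unfolding dfb_def by (rule exI[of _ "Mem (2*i) (2*j)"]) (use nonempty in \<open>auto simp: mrg_def\<close>)
lemma dfb_var_eq: "dfb A (%e. e i = e j)"
  unfolding dfb_def by (rule exI[of _ "Eq (2*i) (2*j)"]) (use nonempty in \<open>auto simp: mrg_def\<close>)
lemma dfb_var_const: "a : A ==> dfb A (%e. e i = a)"
  unfolding dfb_def
  by (rule exI[of _ "Eq (2*i) 1"], rule exI[of _ "%_. a"]) (auto simp: mrg_def)

lemma dft_var[df]: "dft A (%e. e i)"
  unfolding dft_def using dfb_var_eq by auto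
lemma dft_const[df]: "a : A ==> dft A (%_. a)"
  unfolding dft_def using dfb_var_const by auto

lemma dft_in: "dft A t ==> range e <= A ==> t e : A"
  unfolding dft_def by auto

text \<open>Substitution is expressed by \<open>EX x:A. x = t e\<close>, which is why
  \<open>dft\<close> also asks the term to have its values in \<open>A\<close>.\<close>

lemma dfb_sub:
  assumes "dft A t" "dfb A (%e. \<Phi> (%n. e (Suc n)) (e 0))"
  shows "dfb A (%e. \<Phi> e (t e))"
proof -
  have "dfb A (%e. e 0 = t (%n. e (Suc n)))" using assms(1) by (simp add: dft_def)
  from dfb_conj[OF this assms(2)]
  have "dfb A (%e. EX x:A. x = t e \<and> \<Phi> e x)" by (intro dfb_ex)
  then show ?thesis by (rule dfb_cong) (use assms(1) in \<open>auto simp: dft_def\<close>)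
qed

lemma dft_shift: "dft A t ==> dft A (%e. t (%n. e (Suc n)))"
proof -
  assume t: "dft A t"
  let ?f = "%n. if n = 0 then 0 else Suc n"
  have "inj ?f" by (auto simp: inj_def)
  moreover have "dfb A (%e. e 0 = t (%n. e (Suc n)))" using t by (simp add: dft_def)
  ultimately have "dfb A (%e. (e \<circ> ?f) 0 = t (%n. (e \<circ> ?f) (Suc n)))"
    by (rule dfb_ren[rotated])
  then show ?thesis using t by (auto simp: dft_def image_subset_iff comp_def)
qed

lemma df1: "dfb A (%e. Q (e 0)) ==> dft A s ==> dfb A (%e. Q (s e))"
  by (rule dfb_sub[where \<Phi>="%e x. Q x"])
lemma df2: assumes "dfb A (%e. Q (e 0) (e 1))" "dft A s" "dft A t" shows "dfb A (%e. Q (s e) (t e))"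
  by (rule dfb_sub[where \<Phi>="%e x. Q (s e) x" and t=t, OF assms(3)])
     (rule dfb_sub[where \<Phi>="%e x. Q x (e 0)", OF dft_shift[OF assms(2)]], use assms(1) in simp)
lemma df3: assumes "dfb A (%e. Q (e 0) (e 1) (e 2))" "dft A s" "dft A t" "dft A u"
  shows "dfb A (%e. Q (s e) (t e) (u e))"
  by (rule dfb_sub[where \<Phi>="%e x. Q (s e) (t e) x" and t=u, OF assms(4)],
     rule dfb_sub[where \<Phi>="%e x. Q (s (%n. e (Suc n))) x (e 0)", OF dft_shift[OF assms(3)]],
     rule dfb_sub[where \<Phi>="%e x. Q x (e 0) (e (Suc 0))", OF dft_shift[OF dft_shift[OF assms(2)]]])
    (use assms(1) in \<open>simp add: numeral_2_eq_2\<close>)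
lemma dfb_mem[df]: "dft A s ==> dft A t ==> dfb A (%e. s e : el (t e))"
  by (rule df2[where Q="%x y. x : el y"]) (auto intro: dfb_var_mem)
lemma dfb_eq[df]: "dft A s ==> dft A t ==> dfb A (%e. s e = t e)"
  by (rule df2[where Q="%x y. x = y"]) (auto intro: dfb_var_eq)

lemma dft_sub:
  assumes "dft A t" "dft A (%e. f (%n. e (Suc n)) (e 0))"
  shows "dft A (%e. f e (t e))"
proof -
  let ?f = "%n::nat. if n = 0 then 1 else if n = 1 then 0 else n"
  have i: "inj ?f" by (auto simp: inj_def split: if_splits)
  have "dfb A (%e. e 0 = f (%n. e (Suc (Suc n))) (e 1))" using assms(2) by (simp add: dft_def)
  from dfb_ren[OF this i] have "dfb A (%e. e 1 = f (%n. e (Suc (Suc n))) (e 0))"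
    by (simp add: comp_def)
  then have "dfb A (%e. e 0 = f (%n. e (Suc n)) (t (%n. e (Suc n))))"
    by (intro dfb_sub[where \<Phi>="%e x. e 0 = f (%n. e (Suc n)) x", OF dft_shift[OF assms(1)]]) simp
  moreover have "f e (t e) : A" if e: "range e <= A" for e
  proof -
    have "t e : A" using dft_in[OF assms(1) e] .
    then have "range (%n. case n of 0 => t e | Suc m => e m) <= A"
      using e by (auto simp: image_subset_iff split: nat.splits)
    from dft_in[OF assms(2) this] show ?thesis by simp
  qed
  ultimately show ?thesis by (simp add: dft_def)
qed

lemma dff1: "dft A (%e. f (e 0)) ==> dft A s ==> dft A (%e. f (s e))"
  by (rule dft_sub[where f="%e x. f x"])
lemma dff2: assumes "dft A (%e. f (e 0) (e 1))" "dft A s" "dft A t" shows "dft A (%e. f (s e) (t e))"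
  by (rule dft_sub[where f="%e x. f (s e) x" and t=t, OF assms(3)])
     (rule dft_sub[where f="%e x. f x (e 0)", OF dft_shift[OF assms(2)]], use assms(1) in simp)
lemma dff3: assumes "dft A (%e. f (e 0) (e 1) (e 2))" "dft A s" "dft A t" "dft A u"
  shows "dft A (%e. f (s e) (t e) (u e))"
  by (rule dft_sub[where f="%e x. f (s e) (t e) x" and t=u, OF assms(4)],
     rule dft_sub[where f="%e x. f (s (%n. e (Suc n))) x (e 0)", OF dft_shift[OF assms(3)]],
     rule dft_sub[where f="%e x. f x (e 0) (e (Suc 0))", OF dft_shift[OF dft_shift[OF assms(2)]]])
    (use assms(1) in \<open>simp add: numeral_2_eq_2\<close>)
text \<open>\<open>definable\<close> wants parameters in the carrier only at free variables,
  \<open>dfb\<close> wants them everywhere. Since the carrier is nonempty, stray values can be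
  replaced by a fixed \<open>a0\<close>.\<close>

lemma definable_iff_dfb:
  assumes "X <= A" shows "definable A mem X \<longleftrightarrow> dfb A (%e. e 0 : X)"
proof
  assume "definable A mem X"
  then obtain \<phi> v where v: "v ` (fv \<phi> - {0}) <= A" "X = {a : A. sat A mem \<phi> (v(0 := a))}"
    unfolding definable_def by blast
  obtain a0 where a0: "a0 : A" using nonempty by auto
  let ?w = "%k. if v k : A then v k else a0"
  let ?f = "%k::nat. if k = 0 then 0 else 2*k+1"
  have i: "inj ?f" by (auto simp: inj_def)
  show "dfb A (%e. e 0 : X)" unfolding dfb_def
  proof (intro exI conjI allI impI)
    show "range ?w <= A" using a0 by auto
    fix e :: "nat => hset" assume e: "range e <= A"
    have "sat A mem (rn ?f \<phi>) (mrg e ?w) \<longleftrightarrow> sat A mem \<phi> (mrg e ?w \<circ> ?f)" by (rule sat_rn[OF i])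
    also have "... \<longleftrightarrow> sat A mem \<phi> (v(0 := e 0))"
      by (rule sat_cong_fv) (use v(1) in \<open>auto simp: mrg_def image_subset_iff\<close>)
    finally show "(e 0 : X) = sat A mem (rn ?f \<phi>) (mrg e ?w)" using v(2) e by auto
  qed
next
  assume "dfb A (%e. e 0 : X)"
  then obtain \<phi> w where w: "range w <= A" "!!e. range e <= A ==> e 0 : X \<longleftrightarrow> sat A mem \<phi> (mrg e w)"
    unfolding dfb_def by auto
  obtain a0 where a0: "a0 : A" using nonempty by auto
  have "X = {a : A. sat A mem \<phi> ((mrg (%_. a0) w)(0 := a))}"
  proof -
    have "(mrg (%_. a0) w)(0 := a) = mrg ((%_. a0)(0 := a)) w" for a
      by (auto simp: mrg_def fun_eq_iff)
    moreover have "a : X \<longleftrightarrow> sat A mem \<phi> (mrg ((%_. a0)(0 := a)) w)" if "a : A" for a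
      using w(2)[of "(%_. a0)(0 := a)"] that a0 by (auto simp: image_subset_iff)
    ultimately show ?thesis using assms by auto
  qed
  moreover have "mrg (%_. a0) w ` (fv \<phi> - {0}) <= A" using w(1) a0 by (auto simp: mrg_def)
  ultimately show "definable A mem X" unfolding definable_def by blast
qed

lemma definable_rel_iff_dfb:
  assumes "R <= A \<times> A" shows "definable_rel A mem R \<longleftrightarrow> dfb A (%e. (e 0, e 1) : R)"
proof
  assume "definable_rel A mem R"
  then obtain \<phi> v where v: "v ` (fv \<phi> - {0,1}) <= A"
    "R = {(a,b). a : A \<and> b : A \<and> sat A mem \<phi> (v(0 := a, 1 := b))}"
    unfolding definable_rel_def by blast
  obtain a0 where a0: "a0 : A" using nonempty by auto
  let ?w = "%k. if v k : A then v k else a0"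
  let ?f = "%k::nat. if k < 2 then 2*k else 2*k+1"
  have i: "inj ?f"
  proof (rule injI)
    fix x y assume "?f x = ?f y"
    then show "x = y" by (rule inj_aux4)
  qed
  show "dfb A (%e. (e 0, e 1) : R)" unfolding dfb_def
  proof (intro exI conjI allI impI)
    show "range ?w <= A" using a0 by auto
    fix e :: "nat => hset" assume e: "range e <= A"
    have "sat A mem (rn ?f \<phi>) (mrg e ?w) \<longleftrightarrow> sat A mem \<phi> (mrg e ?w \<circ> ?f)" by (rule sat_rn[OF i])
    also have "... \<longleftrightarrow> sat A mem \<phi> (v(0 := e 0, 1 := e 1))"
      by (rule sat_cong_fv) (use v(1) in \<open>auto simp: mrg_def image_subset_iff\<close>)
    finally show "((e 0, e 1) : R) = sat A mem (rn ?f \<phi>) (mrg e ?w)" using v(2) e by auto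
  qed
next
  assume "dfb A (%e. (e 0, e 1) : R)"
  then obtain \<phi> w where w: "range w <= A"
    "!!e. range e <= A ==> (e 0, e 1) : R \<longleftrightarrow> sat A mem \<phi> (mrg e w)"
    unfolding dfb_def by auto
  obtain a0 where a0: "a0 : A" using nonempty by auto
  \<comment> \<open>The second argument sits at the even slot 2 of \<open>mrg\<close> but at
    variable 1 of \<open>definable_rel\<close>.\<close>
  let ?f = "%k::nat. if k = 2 then 1 else if k = 1 then 2 else k"
  have i: "inj ?f" by (auto simp: inj_def split: if_splits)
  let ?v = "mrg (%_. a0) w \<circ> ?f"
  have "R = {(a,b). a : A \<and> b : A \<and> sat A mem (rn ?f \<phi>) (?v(0 := a, 1 := b))}"
  proof -
    have "?v(0 := a, 1 := b) \<circ> ?f = mrg ((%_. a0)(0 := a, 1 := b)) w" for a b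
      by (auto simp: mrg_def fun_eq_iff elim!: evenE oddE)
    moreover have "(a,b) : R \<longleftrightarrow> sat A mem \<phi> (mrg ((%_. a0)(0 := a, 1 := b)) w)" if "a : A" "b : A" for a b
      using w(2)[of "(%_. a0)(0 := a, 1 := b)"] that a0 by (auto simp: image_subset_iff)
    ultimately show ?thesis using assms by (auto simp: sat_rn[OF i])
  qed
  moreover have "?v ` (fv (rn ?f \<phi>) - {0,1}) <= A" using w(1) a0 by (auto simp: mrg_def)
  ultimately show "definable_rel A mem R" unfolding definable_rel_def by blast
qed

end

section \<open>Transitive models, recursion and rank\<close>

text \<open>The functional receives the earlier values only as the set \<open>lam (tc x) f\<close>.
  An approximation to the recursion is then itself a set, possibly an element of a model, and this
  is what makes recursive functions definable there.\<close>

definition recF :: "(hset => hset => hset) => hset => hset" where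
  "recF H = wfrec {(y, x). y : TC x} (%f x. H x (lam (tc x) f))"

lemma recF: "recF H x = H x (lam (tc x) (recF H))"
proof -
  have "lam (tc x) (cut (recF H) {(y, x). y : TC x} x) = lam (tc x) (recF H)"
    by (rule lam_cong) (simp add: cut_def)
  then show ?thesis unfolding recF_def by (subst wfrec[OF wf_TC]) simp
qed

section \<open>Ordinals and rank\<close>

primrec vn :: "nat => hset" where "vn 0 = zero" | "vn (Suc n) = succ (vn n)"
definition omega where "omega = mk (range vn)"
lemma el_omega[simp]: "el omega = range vn" by (simp add: omega_def)

definition Ord where
  "Ord x \<longleftrightarrow> (ALL y:el x. el y <= el x) \<and> (ALL y:el x. ALL z:el y. el z <= el y)"

lemma Ord_in: "Ord x ==> y : el x ==> Ord y" unfolding Ord_def by blast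
lemma Ord_trans: "Ord x ==> y : el x ==> z : el y ==> z : el x" unfolding Ord_def by blast
lemma Ord_zero[simp]: "Ord zero" by (simp add: Ord_def)
lemma Ord_succ[simp]: "Ord x ==> Ord (succ x)" unfolding Ord_def by auto
lemma Ord_mkUN: assumes "countable S" "!!x. x : S ==> Ord x" shows "Ord (mk (\<Union>(el ` S)))"
proof -
  have "el (mk (\<Union>(el ` S))) = \<Union>(el ` S)" using assms(1) by simp
  moreover have "el y <= \<Union>(el ` S)" if "y : \<Union>(el ` S)" for y
    using that assms(2) Ord_trans by blast
  moreover have "el z <= el y" if "y : \<Union>(el ` S)" "z : el y" for y z
    using that assms(2) Ord_in[of _ y] unfolding Ord_def by blast
  ultimately show ?thesis unfolding Ord_def by simp
qed

lemma Ord_linear: "Ord x ==> Ord y ==> x : el y \<or> x = y \<or> y : el x"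
proof (induction x arbitrary: y rule: el_induct)
  case (step x)
  note IHx = step
  show ?case using IHx(3)
  proof (induction y rule: el_induct)
    case (step y)
    show ?case
    proof (rule ccontr)
      assume c: "\<not> ?case"
      have "z : el y" if z: "z : el x" for z
        using IHx(1)[OF z Ord_in[OF IHx(2) z] step.prems] c z Ord_trans[OF IHx(2) z] by blast
      moreover have "z : el x" if z: "z : el y" for z
        using step.IH[OF z Ord_in[OF step.prems z]] c z Ord_trans[OF step.prems z] by blast
      ultimately have "x = y" by (intro ext_el) blast
      then show False using c by simp
    qed
  qed
qed

lemma Ord_subset: "Ord x ==> Ord y ==> el x <= el y \<longleftrightarrow> x = y \<or> x : el y"
  using Ord_linear[of x y] Ord_trans mem_not_refl by blast

lemma Ord_least: "Q a ==> Ord a ==> EX b. Ord b \<and> Q b \<and> (ALL c:el b. \<not> Q c)"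
proof (induction a rule: el_induct)
  case (step x) then show ?case using Ord_in by blast
qed

lemma Ord_succ_le: "Ord x ==> y : el x ==> succ y = x \<or> succ y : el x"
proof -
  assume a: "Ord x" "y : el x"
  then have "el (succ y) <= el x" using Ord_trans[OF a] by auto
  then show ?thesis using Ord_subset[of "succ y" x] Ord_in[OF a] a(1) by simp
qed

lemma Ord_vn[simp]: "Ord (vn n)" by (induction n) auto
lemma Ord_omega[simp]: "Ord omega"
  unfolding Ord_def
proof (intro conjI ballI)
  show "el y <= el omega" if "y : el omega" for y
  proof -
    have "el (vn n) <= range vn" for n by (induction n) auto
    then show ?thesis using that by auto
  qed
  show "el z <= el y" if "y : el omega" "z : el y" for y z
    using that Ord_vn unfolding Ord_def by auto
qed

lemma vn_mem: "vn m : el (vn n) \<longleftrightarrow> m < n"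
proof -
  have a: "m < n ==> vn m : el (vn n)" for m n by (induction n) (auto simp: less_Suc_eq)
  show ?thesis using a[of m n] a[of n m] mem_asym mem_not_refl by (metis linorder_neqE_nat)
qed

lemma vn_inject[simp]: "vn m = vn n \<longleftrightarrow> m = n"
  by (metis vn_mem linorder_neqE_nat mem_not_refl)

definition rankH where "rankH x f = mk (\<Union>y\<in>el x. el (succ (app f y)))"
definition rank where "rank = recF rankH"

lemma el_rank: "el (rank x) = (\<Union>y\<in>el x. insert (rank y) (el (rank y)))"
  unfolding rank_def by (subst recF) (simp add: rankH_def TC_el)

lemma Ord_rank[simp]: "Ord (rank x)"
proof (induction x rule: el_induct)
  case (step x)
  have "rank x = mk (\<Union>(el ` (%y. succ (rank y)) ` el x))" by (rule ext_el) (simp add: el_rank[of x])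
  moreover have "Ord (mk (\<Union>(el ` (%y. succ (rank y)) ` el x)))"
    using step by (intro Ord_mkUN) auto
  ultimately show ?case by simp
qed

lemma rank_mem: "y : el x ==> rank y : el (rank x)" by (subst el_rank) auto

lemma rank_le: "Ord a ==> (!!y. y : el x ==> rank y : el a) ==> el (rank x) <= el a"
  by (subst el_rank) (auto intro: Ord_trans)

lemma rank_Ord: "Ord a ==> rank a = a"
proof (induction a rule: el_induct)
  case (step x)
  then have "rank y = y" if "y : el x" for y using that Ord_in by blast
  then show ?case using step(2) by (intro ext_el) (auto simp: el_rank[of x] intro: Ord_trans)
qed

lemma rank_TC: "y : TC x ==> rank y : el (rank x)"
  unfolding TC_def mem_Collect_eq
  by (induction rule: tranclp.induct) (auto intro: rank_mem Ord_trans[OF Ord_rank])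

definition fs where "fs z = mk {a : TC z. EX x y. z = opr x y \<and> a : el x}"
definition sn where "sn z = mk {a : TC z. EX x y. z = opr x y \<and> a : el y}"
lemma fs_opr[simp]: "fs (opr x y) = x" and sn_opr[simp]: "sn (opr x y) = y"
proof -
  have c: "countable {a : TC z. Q a}" for z Q by (rule countable_subset[OF _ countable_TC[of z]]) auto
  show "fs (opr x y) = x" "sn (opr x y) = y"
    unfolding fs_def sn_def by (auto intro!: ext_el simp: el_mk[OF c] intro: TC_el2[OF opr_TC(1)] TC_el2[OF opr_TC(2)])
qed

lemma fs_nopr: "\<nexists>x y. z = opr x y ==> fs z = zero" "\<nexists>x y. z = opr x y ==> sn z = zero"
  unfolding fs_def sn_def zero_def by (rule arg_cong[of _ _ mk], blast)+

text \<open>Freezing all variables from \<open>n\<close> on lets separation and replacement, stated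
  for one or two variables, act on predicates that depend on a whole environment.\<close>

lemma (in carrier) dfb_fix:
  assumes "dfb A \<Phi>" "range e0 <= A" shows "dfb A (%e. \<Phi> (%k. if k < n then e k else e0 k))"
proof -
  obtain \<phi> w where a: "range w <= A"
    "!!e. range e <= A ==> \<Phi> e \<longleftrightarrow> sat A mem \<phi> (mrg e w)"
    using assms unfolding dfb_def by metis
  let ?f = "%k::nat. if even k \<and> k < 2*n then k else 2*k+1"
  have i: "inj ?f"
    by (rule injI) (auto split: if_splits)
  have m: "mrg e (mrg e0 w) \<circ> ?f = mrg (%k. if k < n then e k else e0 k) w" for e
    by (auto simp: fun_eq_iff mrg_def)
  show ?thesis unfolding dfb_def
  proof (intro exI conjI allI impI)
    show "range (mrg e0 w) <= A" using a assms by (auto simp: mrg_def)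
    fix e :: "nat => hset" assume "range e <= A"
    then have "range (%k. if k < n then e k else e0 k) <= A" using assms by auto
    then show "\<Phi> (%k. if k < n then e k else e0 k) = sat A mem (rn ?f \<phi>) (mrg e (mrg e0 w))"
      using a by (simp only: sat_rn[OF i] m)
  qed
qed

lemma inj_skip1: "inj (%n::nat. if n = 0 then 0 else Suc n)"
  by (rule injI) (auto split: if_splits)
lemma inj_swap01: "inj (%n::nat. if n = 0 then 1 else if n = 1 then 0 else n)"
  by (rule injI) (auto split: if_splits)

lemma (in carrier) dft_ren:
  assumes "dft A t" "inj f" shows "dft A (%e. t (%n. e (f n)))"
proof -
  let ?f = "%n. case n of 0 => 0 | Suc m => Suc (f m)"
  have "inj ?f" by (rule injI) (auto split: nat.splits dest: injD[OF assms(2)])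
  moreover have "dfb A (%e. e 0 = t (%n. e (Suc n)))" using assms(1) by (simp add: dft_def)
  ultimately have "dfb A (%e. (e \<circ> ?f) 0 = t (%n. (e \<circ> ?f) (Suc n)))"
    by (rule dfb_ren[rotated])
  then show ?thesis using assms(1) by (auto simp: dft_def image_subset_iff comp_def)
qed

text \<open>In a transitive carrier of actual sets the axioms become closure under the real
  operations, with only the power set relativized; extensionality and foundation hold in
  \<open>hset\<close>. The schemas range over HOL predicates satisfying \<open>dfb\<close>. Choice
  is kept apart as \<open>AC\<close>.\<close>

locale zf = carrier A for A +
  assumes Atrans: "x : A ==> y : el x ==> y : A"
    and cntA: "countable A"
    and pairA: "x : A ==> y : A ==> upair x y : A"
    and UniA: "x : A ==> Uni x : A"
    and PwA: "x : A ==> mk {y : A. el y <= el x} : A"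
    and omegaA: "omega : A"
    and sepA: "dfb A (%e. Q (e 0)) ==> x : A ==> mk {y : el x. Q y} : A"
    and replA: "dfb A (%e. R (e 0) (e 1)) ==> x : A ==> (!!a. a : el x ==> EX! b. b : A \<and> R a b) ==>
       EX y:A. ALL a:el x. EX b:el y. R a b"
begin

lemma cnt_sub: "X <= A ==> countable X" using cntA countable_subset by blast

lemma el_mkA: "X <= A ==> el (mk X) = X" by (simp add: cnt_sub)
lemma el_mk_el[simp]: "el (mk {y : el x. Q y}) = {y : el x. Q y}"
  by (rule el_mk) (rule countable_subset[OF _ countable_el[of x]], auto)
lemma el_subA: "x : A ==> el x <= A" using Atrans by auto

text \<open>By extensionality a set term is definable as soon as membership in it is.\<close>

lemma dft_setI:
  assumes "!!e. range e <= A ==> t e : A" "dfb A (%e. e 0 : el (t (%n. e (Suc n))))" shows "dft A t"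
proof -
  have "dfb A (%e. ALL z:A. z : el (e 0) \<longleftrightarrow> z : el (t (%n. e (Suc n))))"
  proof (intro dfb_all dfb_iff)
    show "dfb A (%e. e 0 : el (e (Suc 0)))" by (rule dfb_var_mem)
    show "dfb A (%e. e 0 : el (t (%n. e (Suc (Suc n)))))"
      using dfb_ren[OF assms(2) inj_skip1] by simp
  qed
  then have "dfb A (%e. e 0 = t (%n. e (Suc n)))"
  proof (rule dfb_cong)
    fix e :: "nat => hset" assume e: "range e <= A"
    then have "e 0 : A" "t (%n. e (Suc n)) : A" using assms(1)[of "%n. e (Suc n)"] by auto
    then show "(ALL z:A. (z : el (e 0)) = (z : el (t (%n. e (Suc n))))) = (e 0 = t (%n. e (Suc n)))"
      using Atrans by (auto intro!: ext_el)
  qed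
  then show ?thesis using assms(1) by (simp add: dft_def)
qed

lemma dfb_ball[df]: "dft A t ==> dfb A (%e. \<Phi> (%n. e (Suc n)) (e 0)) ==> dfb A (%e. ALL x:el (t e). \<Phi> e x)"
proof -
  assume a: "dft A t" "dfb A (%e. \<Phi> (%n. e (Suc n)) (e 0))"
  have "dfb A (%e. ALL x:A. x : el (t e) --> \<Phi> e x)"
    by (intro dfb_all dfb_imp dfb_mem dft_shift[OF a(1)] a(2) dft_var)
  then show ?thesis by (rule dfb_cong) (use dft_in[OF a(1)] Atrans in blast)
qed

lemma dfb_bex[df]: "dft A t ==> dfb A (%e. \<Phi> (%n. e (Suc n)) (e 0)) ==> dfb A (%e. EX x:el (t e). \<Phi> e x)"
proof -
  assume a: "dft A t" "dfb A (%e. \<Phi> (%n. e (Suc n)) (e 0))"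
  have "dfb A (%e. EX x:A. x : el (t e) \<and> \<Phi> e x)"
    by (intro dfb_ex dfb_conj dfb_mem dft_shift[OF a(1)] a(2) dft_var)
  then show ?thesis by (rule dfb_cong) (use dft_in[OF a(1)] Atrans in blast)
qed

lemma dfb_sub_el[df]: assumes "dft A s" "dft A t" shows "dfb A (%e. el (s e) <= el (t e))"
  unfolding subset_iff Ball_def[symmetric] by (intro dfb_ball dfb_mem dft_shift assms dft_var)

lemma dfb_Suc_fix:
  assumes "dfb A (%e. \<Phi> (%n. e (Suc n)) (e 0))" "range e0 <= A" shows "dfb A (%e. \<Phi> e0 (e 0))"
proof -
  have "range (%n. case n of 0 => e0 0 | Suc n => e0 n) <= A"
    using assms(2) by (auto simp: image_subset_iff split: nat.splits)
  from dfb_fix[OF assms(1) this, of 1] show ?thesis by simp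
qed

lemma dft_sep[df]: assumes "dft A t" "dfb A (%e. \<Phi> (%n. e (Suc n)) (e 0))"
  shows "dft A (%e. mk {x : el (t e). \<Phi> e x})"
proof (rule dft_setI)
  fix e :: "nat => hset" assume e: "range e <= A"
  show "mk {x : el (t e). \<Phi> e x} : A"
    by (rule sepA[OF dfb_Suc_fix[OF assms(2) e] dft_in[OF assms(1) e]])
next
  show "dfb A (%e. e 0 : el (mk {x : el (t (%n. e (Suc n))). \<Phi> (%n. e (Suc n)) x}))"
    using dfb_conj[OF dfb_mem[OF dft_var dft_shift[OF assms(1)], of 0] assms(2)] by simp
qed

lemma dft_upair[df]: assumes "dft A s" "dft A t" shows "dft A (%e. upair (s e) (t e))"
proof (rule dff2[OF dft_setI assms])
  show "dfb A (%e. e 0 : el (upair (e (Suc 0)) (e (Suc 1))))"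
    by (simp, intro df)
qed (auto intro: pairA)

lemma dft_opr[df]: "dft A s ==> dft A t ==> dft A (%e. opr (s e) (t e))"
  unfolding opr_def by (intro df)

lemma oprA[simp]: "x : A ==> y : A ==> opr x y : A" unfolding opr_def by (intro pairA)
lemma oprA_D: assumes "opr x y : A" shows "x : A" "y : A"
proof -
  have "upair x y : A" using Atrans[OF assms, of "upair x y"] by (simp add: opr_def)
  then show "x : A" "y : A" using Atrans[of "upair x y"] by auto
qed
lemma opr_elA: assumes "z : A" "opr x y : el z" shows "x : A" "y : A"
  using oprA_D Atrans assms by blast+

lemma dft_Uni[df]: assumes "dft A t" shows "dft A (%e. Uni (t e))"
proof (rule dff1[OF dft_setI assms])
  show "dfb A (%e. e 0 : el (Uni (e (Suc 0))))"
    by (simp, intro df)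
qed (auto intro: UniA)

lemma repl_fun:
  assumes R: "dfb A (%e. R (e 0) (e 1))" and x: "x : A"
    and f: "!!a. a : el x ==> f a : A" "!!a b. a : el x ==> b : A ==> R a b \<longleftrightarrow> b = f a"
  shows "mk (f ` el x) : A" "lam x f : A"
proof -
  have g: "mk (f ` el x) : A" if R: "dfb A (%e. R (e 0) (e 1))"
    and f: "!!a. a : el x ==> f a : A" "!!a b. a : el x ==> b : A ==> R a b \<longleftrightarrow> b = f a" for R f
  proof -
    obtain y where y: "y : A" "ALL a:el x. EX b:el y. R a b" using replA[OF R x] f by metis
    have "f ` el x = {b : el y. EX a:el x. R a b}" using y f Atrans[OF y(1)] by blast
    moreover have "mk {b : el y. EX a:el x. R a b} : A"
      by (rule sepA[OF _ y(1)], rule dfb_bex, rule dft_const[OF x])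
         (rule df2[OF R dft_var dft_var])
    ultimately show ?thesis by simp
  qed
  show "mk (f ` el x) : A" by (rule g[OF R f])
  show "lam x f : A" unfolding lam_def
  proof (rule g)
    show "dfb A (%e. EX b:A. R (e 0) b \<and> e 1 = opr (e 0) b)"
      by (intro df df2[OF R])
    show "opr a (f a) : A" if "a : el x" for a using that f x Atrans by auto
    show "(EX b:A. R a b \<and> c = opr a b) \<longleftrightarrow> c = opr a (f a)" if "a : el x" "c : A" for a c
      using f that by auto
  qed
qed

lemma dfb_Suc_fix2:
  assumes "dft A (%e. f (%n. e (Suc n)) (e 0))" "range e0 <= A" shows "dfb A (%e. e 1 = f e0 (e 0))"
proof -
  have "range (%n. case n of 0 => e0 0 | Suc 0 => e0 0 | Suc (Suc n) => e0 n) <= A"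
    using assms(2) by (auto simp: image_subset_iff split: nat.splits)
  moreover have "dfb A (%e. e 0 = f (%n. e (Suc (Suc n))) (e 1))"
    using assms(1) by (simp add: dft_def)
  ultimately have "dfb A (%e. e 0 = f e0 (e 1))"
    using dfb_fix[of _ _ 2] by fastforce
  from dfb_ren[OF this inj_swap01] show ?thesis by simp
qed

lemma dft_image[df]: assumes "dft A t" "dft A (%e. f (%n. e (Suc n)) (e 0))"
  shows "dft A (%e. mk ((%x. f e x) ` el (t e)))"
proof (rule dft_setI)
  have fe: "f e a : A" if "range e <= A" "a : A" for e a
  proof -
    have "range (%n. case n of 0 => a | Suc m => e m) <= A"
      using that by (auto simp: image_subset_iff split: nat.splits)
    from dft_in[OF assms(2) this] show ?thesis by simp
  qed
  fix e :: "nat => hset" assume e: "range e <= A"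
  show "mk ((%x. f e x) ` el (t e)) : A"
    by (rule repl_fun(1)[OF dfb_Suc_fix2[OF assms(2) e] dft_in[OF assms(1) e]])
       (use fe e dft_in[OF assms(1) e] Atrans in auto)
next
  have "dfb A (%e. EX x:el (t (%n. e (Suc n))). e 0 = f (%n. e (Suc n)) x)"
  proof (intro df dft_shift assms)
    show "dft A (%e. f (%n. e (Suc (Suc n))) (e 0))"
      using dft_ren[OF assms(2) inj_skip1] by simp
  qed
  then show "dfb A (%e. e 0 : el (mk ((%x. f (%n. e (Suc n)) x) ` el (t (%n. e (Suc n))))))"
    by (simp add: image_iff)
qed

lemma dft_UN: assumes "dft A t" "dft A (%e. f (%n. e (Suc n)) (e 0))"
  shows "dft A (%e. mk (\<Union>x\<in>el (t e). el (f e x)))"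
proof -
  have "mk (\<Union>x\<in>el y. el (g x)) = Uni (mk (g ` el y))" for g y by (simp add: Uni_def)
  then show ?thesis using dft_Uni[OF dft_image[OF assms]] by simp
qed

lemma dft_succ[df]: assumes "dft A t" shows "dft A (%e. succ (t e))"
proof -
  have "succ x = Uni (upair x (upair x x))" for x by (rule ext_el) auto
  then show ?thesis using assms by (simp, intro df)
qed

lemma zeroA[simp]: "zero : A"
proof -
  have "mk {y : el omega. False} : A" by (rule sepA[OF _ omegaA]) (rule dfb_const)
  then show ?thesis by (simp add: zero_def)
qed
lemma succA[simp]: "x : A ==> succ x : A"
  using dft_in[OF dft_succ[OF dft_const], of x "%_. x"] by auto
lemma oneA[simp]: "one : A" by (simp add: one_def)
declare omegaA[simp] pairA[simp]

lemma dft_lam[df]: assumes "dft A t" "dft A (%e. f (%n. e (Suc n)) (e 0))"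
  shows "dft A (%e. lam (t e) (%x. f e x))"
  unfolding lam_def by (intro df assms)

lemma dfb_pex[df]: assumes "dft A t" "dfb A (%e. \<Phi> (%n. e (Suc (Suc n))) (e 1) (e 0))"
  shows "dfb A (%e. EX x y. opr x y : el (t e) \<and> \<Phi> e x y)"
proof -
  have "dfb A (%e. EX x:A. EX y:A. opr x y : el (t e) \<and> \<Phi> e x y)"
    by (intro df dft_shift[OF dft_shift[OF assms(1)]]) (use assms(2) in simp)
  then show ?thesis by (rule dfb_cong) (use opr_elA[OF dft_in[OF assms(1)]] in blast)
qed

lemma dfb_pall[df]: assumes "dft A t" "dfb A (%e. \<Phi> (%n. e (Suc (Suc n))) (e 1) (e 0))"
  shows "dfb A (%e. ALL x y. opr x y : el (t e) --> \<Phi> e x y)"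
proof -
  have "dfb A (%e. ALL x:A. ALL y:A. opr x y : el (t e) --> \<Phi> e x y)"
    by (intro df dft_shift[OF dft_shift[OF assms(1)]]) (use assms(2) in simp)
  then show ?thesis by (rule dfb_cong) (use opr_elA[OF dft_in[OF assms(1)]] in blast)
qed

lemma dfb_pex1[df]: assumes "dft A t" "dft A s" "dfb A (%e. \<Phi> (%n. e (Suc n)) (e 0))"
  shows "dfb A (%e. EX y. opr (s e) y : el (t e) \<and> \<Phi> e y)"
proof -
  have "dfb A (%e. EX y:A. opr (s e) y : el (t e) \<and> \<Phi> e y)"
    by (intro df dft_shift[OF assms(1)] dft_shift[OF assms(2)]) (use assms(3) in simp)
  then show ?thesis by (rule dfb_cong) (use opr_elA[OF dft_in[OF assms(1)]] in blast)
qed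

lemma dfb_peq[df]: assumes "dft A t" "dfb A (%e. \<Phi> (%n. e (Suc (Suc n))) (e 1) (e 0))"
  shows "dfb A (%e. EX x y. t e = opr x y \<and> \<Phi> e x y)"
proof -
  have "dfb A (%e. EX x:A. EX y:A. t e = opr x y \<and> \<Phi> e x y)"
    by (intro df dft_shift[OF dft_shift[OF assms(1)]]) (use assms(2) in simp)
  then show ?thesis by (rule dfb_cong) (metis oprA_D dft_in[OF assms(1)])
qed

text \<open>Three unions reach from \<open>g\<close> to the elements of a second component. This
  bound is visibly definable, whereas definability of \<open>tc\<close> is proved only
  afterwards.\<close>

lemma app_Uni: "app g x = mk {z : el (Uni (Uni (Uni g))). EX y. opr x y : el g \<and> z : el y}"
proof (rule ext_el, unfold el_app el_mk_el, rule Collect_cong)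
  fix z
  have "z : el (Uni (Uni (Uni g)))" if "opr x y : el g" "z : el y" for y
  proof -
    have "upair x y : el (opr x y)" by (simp add: opr_def)
    then have "upair x y : el (Uni g)" using that(1) by (simp only: el_Uni) blast
    moreover have "y : el (upair x y)" by simp
    ultimately have "y : el (Uni (Uni g))" by (simp only: el_Uni[of "Uni g"]) blast
    then show ?thesis using that(2) by (simp only: el_Uni[of "Uni (Uni g)"]) blast
  qed
  then show "(EX y. opr x y : el g \<and> z : el y) =
     (z : el (Uni (Uni (Uni g))) \<and> (EX y. opr x y : el g \<and> z : el y))" by blast
qed

lemma dft_app[df]: "dft A s ==> dft A t ==> dft A (%e. app (s e) (t e))"
  by (rule dff2) (simp_all only: app_Uni, intro df)

lemma appA[simp]: "x : A ==> y : A ==> app x y : A"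
  using dft_in[OF dft_app[OF dft_const dft_const], of x y "%_. x"] by auto

lemma fs_Uni: "fs z = mk {a : el (Uni (Uni z)). EX x y. z = opr x y \<and> a : el x}"
  and sn_Uni: "sn z = mk {a : el (Uni (Uni z)). EX x y. z = opr x y \<and> a : el y}"
proof -
  have U: "el (Uni (Uni (opr x y))) = el x Un el y" for x y by (auto simp: opr_def)
  have a: "{a : el (Uni (Uni (opr x y))). EX x' y'. opr x y = opr x' y' \<and> a : el x'} = el x"
    "{a : el (Uni (Uni (opr x y))). EX x' y'. opr x y = opr x' y' \<and> a : el y'} = el y" for x y
    unfolding U by (simp_all only: opr_inject) blast+
  have b: "fs z = mk {a : el (Uni (Uni z)). EX x y. z = opr x y \<and> a : el x} \<and>
    sn z = mk {a : el (Uni (Uni z)). EX x y. z = opr x y \<and> a : el y}"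
  proof (cases "EX x y. z = opr x y")
    case True
    then obtain x y where z: "z = opr x y" by blast
    show ?thesis unfolding z a by simp
  next
    case False
    then have "{a : el (Uni (Uni z)). EX x y. z = opr x y \<and> a : el x} = {}"
      "{a : el (Uni (Uni z)). EX x y. z = opr x y \<and> a : el y} = {}" by blast+
    then show ?thesis using fs_nopr[OF False] by (simp only: zero_def)
  qed
  from b show "fs z = mk {a : el (Uni (Uni z)). EX x y. z = opr x y \<and> a : el x}" ..
  from b show "sn z = mk {a : el (Uni (Uni z)). EX x y. z = opr x y \<and> a : el y}" ..
qed

lemma dft_fs[df]: "dft A t ==> dft A (%e. fs (t e))"
  by (rule dff1) (simp_all only: fs_Uni, intro df)
lemma dft_sn[df]: "dft A t ==> dft A (%e. sn (t e))"
  by (rule dff1) (simp_all only: sn_Uni, intro df)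

lemma dfb_Ord[df]: "dft A t ==> dfb A (%e. Ord (t e))"
  by (rule df1) (simp_all only: Ord_def, intro df)

abbreviation isTC where "isTC x t \<equiv> (ALL y:el t. el y <= el t) \<and> el x <= el t \<and>
  (ALL t':A. (ALL y:el t'. el y <= el t') \<and> el x <= el t' --> el t <= el t')"

lemma TC_least: assumes "ALL y:t. el y <= t" "el x <= t" shows "TC x <= t"
proof
  fix y assume "y : TC x"
  then have "mem\<^sup>+\<^sup>+ y x" by (simp add: TC_def)
  then show "y : t" using assms(2)
    by (induction rule: converse_tranclp_induct) (use assms(1) in blast)+
qed

lemma isTC: "tc x : A ==> isTC x t \<longleftrightarrow> t = tc x"
proof
  assume x: "tc x : A" and t: "isTC x t"
  have "el t <= TC x" using t x TC_el TC_el2 by (metis (no_types, lifting) el_tc subsetI)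
  moreover have "TC x <= el t" using t by (intro TC_least) auto
  ultimately show "t = tc x" by (intro ext_el) simp
next
  assume "t = tc x"
  then show "isTC x t" using TC_el TC_el2 TC_least by auto
qed

lemma dfb_isTC: "dfb A (%e. isTC (e 0) (e 1))"
  by (intro df)

text \<open>The transitive closure is collected from those of the elements by replacement. The
  relation used is leastness among the transitive supersets in \<open>A\<close>, which singles out
  \<open>tc y\<close> once \<open>tc y\<close> is known to be in \<open>A\<close>.\<close>

lemma tcA: "x : A ==> tc x : A"
proof (induction x rule: el_induct)
  case (step x)
  then have i: "tc y : A" if "y : el x" for y using that Atrans by blast
  have "mk (tc ` el x) : A"
    by (rule repl_fun(1)[OF dfb_isTC step(2)]) (use i isTC in auto)
  then have "Uni (upair x (Uni (mk (tc ` el x)))) : A" using step by (intro UniA pairA)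
  moreover have "Uni (upair x (Uni (mk (tc ` el x)))) = tc x"
    by (rule ext_el) (auto simp: TC_unfold[of x])
  ultimately show ?case by simp
qed

lemma dft_tc[df]: "dft A t ==> dft A (%e. tc (t e))"
proof (rule dff1[where f=tc], simp add: dft_def, intro conjI allI impI)
  show "tc (e 0) : A" if "range e <= A" for e :: "nat => hset" using that by (auto intro: tcA)
  have "dfb A (%e. isTC (e 1) (e 0))" by (intro df)
  then show "dfb A (%e. e 0 = tc (e (Suc 0)))"
    by (rule dfb_cong) (simp add: isTC tcA image_subset_iff)
qed

text \<open>The value is read off from the only attempt \<open>att p x f\<close>, a set function on
  \<open>tc x\<close> obeying the recursion. Attempts are unique by induction and belong to
  \<open>A\<close> by replacement. The parameter \<open>p\<close> is kept as a variable, so that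
  satisfaction and forcing become definable jointly in structure and argument.\<close>

theorem dft_recF_aux:
  assumes H: "dft A (%e. H (e 0) (e 1) (e 2))"
  shows "dft A (%e. recF (H (e 0)) (e 1))"
proof -
  define att where "att p x f \<longleftrightarrow> f = lam (tc x) (app f) \<and>
     (ALL z:el (tc x). app f z = H p z (lam (tc z) (app f)))" for p x f
  have dH: "dft A s ==> dft A t ==> dft A u ==> dft A (%e. H (s e) (t e) (u e))" for s t u
    by (rule dff3[OF H])
  have HA: "H p x f : A" if "p : A" "x : A" "f : A" for p x f
    using dft_in[OF dH[OF dft_const dft_const dft_const], of p x f "%_. p"] that by auto
  have datt: "dft A s ==> dft A t ==> dft A u ==> dfb A (%e. att (s e) (t e) (u e))" for s t u
    by (rule df3) (simp_all only: att_def, intro df dH)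
  have att1: "att p x (lam (tc x) (recF (H p)))" for p x
    unfolding att_def
  proof (intro conjI ballI)
    show "lam (tc x) (recF (H p)) = lam (tc x) (app (lam (tc x) (recF (H p))))"
      by (rule lam_cong) simp
    fix z assume z: "z : el (tc x)"
    have "lam (tc z) (app (lam (tc x) (recF (H p)))) = lam (tc z) (recF (H p))"
      by (rule lam_cong) (use z TC_trans in auto)
    then show "app (lam (tc x) (recF (H p))) z = H p z (lam (tc z) (app (lam (tc x) (recF (H p)))))"
      using z recF[of "H p" z] by simp
  qed
  have att2: "f = lam (tc x) (recF (H p))" if a: "att p x f" for p x f
  proof -
    have "z : TC x --> app f z = recF (H p) z" for z
    proof (induction z rule: TC_induct)
      case (step z)
      show ?case
      proof
        assume z: "z : TC x"
        have "lam (tc z) (app f) = lam (tc z) (recF (H p))"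
          by (rule lam_cong) (use step z TC_trans in auto)
        then show "app f z = recF (H p) z" using a z recF[of "H p" z] unfolding att_def by simp
      qed
    qed
    then have "lam (tc x) (app f) = lam (tc x) (recF (H p))" by (intro lam_cong) auto
    then show ?thesis using a unfolding att_def by simp
  qed
  have lA: "x : A --> lam (tc x) (recF (H p)) : A" if p: "p : A" for p x
  proof (induction x rule: TC_induct)
    case (step x)
    show ?case
    proof
      assume x: "x : A"
      have TA: "TC x <= A" using el_subA[OF tcA[OF x]] by simp
      have i: "lam (tc y) (recF (H p)) : A" if "y : TC x" for y using step that TA by blast
      show "lam (tc x) (recF (H p)) : A"
      proof (rule repl_fun(2)[where R="%y v. EX f:A. att p y f \<and> v = H p y f"])
        show "dfb A (%e. EX f:A. att p (e 0) f \<and> e 1 = H p (e 0) f)"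
          by (intro df datt dH p)
        show "tc x : A" using x by (rule tcA)
        show "recF (H p) y : A" if "y : el (tc x)" for y
          using that TA i p by (subst recF) (auto intro!: HA)
        show "(EX f:A. att p y f \<and> v = H p y f) = (v = recF (H p) y)" if "y : el (tc x)" for y v
        proof -
          have "y : TC x" using that by simp
          then have "(EX f:A. att p y f \<and> v = H p y f) \<longleftrightarrow> v = H p y (lam (tc y) (recF (H p)))"
            using att1[of p y] att2[of p y] i by blast
          then show ?thesis unfolding recF[of "H p" y, symmetric] .
        qed
      qed
    qed
  qed
  have rA: "recF (H p) x : A" if "p : A" "x : A" for p x
    using lA[OF that(1), of x] that by (subst recF) (auto intro!: HA)
  have "dfb A (%e. EX f:A. att (e 1) (e 2) f \<and> e 0 = H (e 1) (e 2) f)"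
    by (intro df datt dH)
  then have "dfb A (%e. e 0 = recF (H (e 1)) (e 2))"
  proof (rule dfb_cong)
    fix e :: "nat => hset" assume "range e <= A"
    then have "e 1 : A" "e 2 : A" by auto
    then have "(EX f:A. att (e 1) (e 2) f \<and> e 0 = H (e 1) (e 2) f) \<longleftrightarrow>
       e 0 = H (e 1) (e 2) (lam (tc (e 2)) (recF (H (e 1))))"
      using att1[of "e 1" "e 2"] att2 lA[of "e 1" "e 2"] by blast
    then show "(EX f:A. att (e 1) (e 2) f \<and> e 0 = H (e 1) (e 2) f) = (e 0 = recF (H (e 1)) (e 2))"
      unfolding recF[of "H (e 1)" "e 2", symmetric] .
  qed
  then show ?thesis using rA by (auto simp: dft_def numeral_2_eq_2 image_subset_iff)
qed

lemma dft_recF: "dft A (%e. H (e 0) (e 1) (e 2)) ==> dft A s ==> dft A t ==> dft A (%e. recF (H (s e)) (t e))"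
  by (rule dff2[OF dft_recF_aux])

lemma dft_rank[df]: "dft A t ==> dft A (%e. rank (t e))"
  unfolding rank_def
  by (rule dft_recF[where H="%p. rankH" and s=t]) (simp only: rankH_def, intro df dft_UN)

lemma rankA[simp]: "x : A ==> rank x : A"
  using dft_in[OF dft_rank[OF dft_const], of x "%_. x"] by auto

definition VV where "VV a = mk {x : A. rank x : el a}"

lemma el_VV[simp]: "el (VV a) = {x : A. rank x : el a}" unfolding VV_def by (rule el_mkA) auto

definition Pw where "Pw x = mk {y : A. el y <= el x}"
lemma el_Pw[simp]: "el (Pw x) = {y : A. el y <= el x}" unfolding Pw_def by (rule el_mkA) auto
lemma dft_Pw[df]: "dft A t ==> dft A (%e. Pw (t e))"
proof (rule dff1[where f=Pw], rule dft_setI)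
  show "Pw (e 0) : A" if "range e <= A" for e :: "nat => hset" using that PwA by (auto simp: Pw_def)
  have "dfb A (%e. el (e 0) <= el (e (Suc 0)))" by (intro df)
  then show "dfb A (%e. e 0 : el (Pw (e (Suc 0))))" by (rule dfb_cong) auto
qed

text \<open>\<open>V_a\<close> is the union of the power sets of the \<open>V_b\<close> with
  \<open>b\<close> in \<open>a\<close>; replacement applies because being equal to
  \<open>V_b\<close> can be said with the definable function \<open>rank\<close>.\<close>

lemma VVA: "Ord a ==> a : A ==> VV a : A"
proof (induction a rule: el_induct)
  case (step a)
  have i: "VV b : A" if "b : el a" for b using step that Ord_in Atrans by blast
  have "dfb A (%e. ALL x:A. x : el (e 1) \<longleftrightarrow> rank x : el (e 0))" by (intro df)
  then have m: "mk (VV ` el a) : A"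
  proof (rule repl_fun(1)[where f=VV and x=a and R="%b t. ALL x:A. x : el t \<longleftrightarrow> rank x : el b"])
    fix b t assume b: "b : el a" and t: "t : A"
    have "(ALL x:A. x : el t \<longleftrightarrow> rank x : el b) \<longleftrightarrow> el t = el (VV b)"
      unfolding el_VV using Atrans[OF t] by blast
    then show "(ALL x:A. x : el t \<longleftrightarrow> rank x : el b) \<longleftrightarrow> t = VV b" using ext_el by blast
  qed (use i step in blast)+
  have "dft A (%e. Uni (mk (Pw ` el (mk (VV ` el a)))))"
    by (rule dft_Uni, rule dft_image[where f="%e x. Pw x" and t="%_. mk (VV ` el a)"]) (intro df dft_Pw m)+
  then have "Uni (mk (Pw ` el (mk (VV ` el a)))) : A"
    using dft_in[of _ "%_. zero"] by force
  moreover have "Uni (mk (Pw ` el (mk (VV ` el a)))) = VV a"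
  proof (rule ext_el, rule set_eqI)
    fix x
    have "rank x : el a" if "b : el a" "x : A" "ALL y:el x. rank y : el b" for b
    proof -
      have "el (rank x) <= el b" using that step Ord_in by (intro rank_le) auto
      then have "rank x = b \<or> rank x : el b" using Ord_subset[of "rank x" b] Ord_in[of a b] step that by simp
      then show ?thesis using that step Ord_trans by blast
    qed
    moreover have "x : el (Uni (mk (Pw ` el (mk (VV ` el a))))) \<longleftrightarrow>
       (EX b:el a. x : A \<and> (ALL y:el x. y : A \<and> rank y : el b))"
    proof -
      have e: "el (mk (VV ` el a)) = VV ` el a" "el (mk (Pw ` VV ` el a)) = Pw ` VV ` el a" by simp_all
      have "x : el (Uni (mk (Pw ` el (mk (VV ` el a))))) \<longleftrightarrow> (EX b:el a. x : el (Pw (VV b)))"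
        unfolding el_Uni e by blast
      then show ?thesis unfolding el_Pw el_VV by blast
    qed
    moreover have "x : el (VV a) \<longleftrightarrow> x : A \<and> rank x : el a" by simp
    ultimately show "x : el (Uni (mk (Pw ` el (mk (VV ` el a))))) \<longleftrightarrow> x : el (VV a)"
      using rank_mem[of _ x] Atrans[of x] by blast
  qed
  ultimately show ?case by simp
qed

lemma dfb_VV: "dft A s ==> dft A t ==> dfb A (%e. s e : el (VV (t e)))"
proof -
  assume a: "dft A s" "dft A t"
  have "dfb A (%e. rank (s e) : el (t e))" by (intro df a)
  then show ?thesis by (rule dfb_cong) (use dft_in[OF a(1)] in auto)
qed

lemma Ord_bound: "X : A ==> EX a:A. Ord a \<and> (ALL x:el X. rank x : el a)"
  by (rule bexI[of _ "rank X"]) (auto intro: rank_mem)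

text \<open>Scott's trick: the least rank of a witness is unique, replacement bounds these ranks,
  and one \<open>VV c\<close> then contains witnesses for all \<open>x\<close>.\<close>

lemma collection:
  assumes \<Phi>: "dfb A (%e. \<Phi> (e 0) (e 1))" and X: "X : A" and ex: "!!x. x : el X ==> EX y:A. \<Phi> x y"
  shows "EX Y:A. ALL x:el X. EX y:el Y. \<Phi> x y"
proof -
  let ?Q = "%x a. Ord a \<and> (EX y:A. rank y = a \<and> \<Phi> x y)"
  let ?R = "%x a. ?Q x a \<and> (ALL b:el a. \<not> ?Q x b)"
  have d: "dfb A (%e. ?R (e 0) (e 1))" by (intro df df2[OF \<Phi>])
  have "EX! a. a : A \<and> ?R x a" if x: "x : el X" for x
  proof -
    obtain y where y: "y : A" "\<Phi> x y" using ex x by auto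
    obtain a where a: "Ord a" "?Q x a" "ALL b:el a. \<not> ?Q x b"
      using Ord_least[of "?Q x" "rank y"] y by auto
    then have "a : A" by auto
    then show ?thesis using a Ord_linear by blast
  qed
  from replA[OF d X this] obtain Y where Y: "Y : A" "ALL x:el X. EX a:el Y. ?R x a" by blast
  obtain c where c: "c : A" "Ord c" "ALL a:el Y. rank a : el c" using Ord_bound[OF Y(1)] by auto
  have "EX y:el (VV c). \<Phi> x y" if x: "x : el X" for x
  proof -
    obtain a y where "a : el Y" "y : A" "rank y = a" "\<Phi> x y" "Ord a" using Y x by blast
    then show ?thesis using c rank_Ord[of a] by (intro bexI[of _ y]) auto
  qed
  then show ?thesis using VVA[OF c(2,1)] by blast
qed

lemma Ord_UniA: "Y : A ==> (!!x. x : el Y ==> Ord x) ==> Ord (Uni Y)"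
  unfolding Uni_def by (rule Ord_mkUN) auto

end

section \<open>The constructible hierarchy\<close>

definition prd where "prd x y = mk (\<Union>a\<in>el x. el (mk ((%b. opr a b) ` el y)))"
lemma el_prd: "el (prd x y) = {opr a b |a b. a : el x \<and> b : el y}"
  unfolding prd_def by auto

definition upd where "upd s i a = Uni (upair (mk {z : el s. fs z ~= i}) (upair (opr i a) (opr i a)))"
lemma el_upd: "el (upd s i a) = insert (opr i a) {z : el s. fs z ~= i}"
proof -
  have "countable {z : el s. fs z ~= i}" by (rule countable_subset[OF _ countable_el[of s]]) auto
  then show ?thesis unfolding upd_def by auto
qed

text \<open>Assignments of the internal satisfaction relation are finite functions on finite
  ordinals, hence elements of each model that contains their values; \<open>env\<close> returns
  \<open>zero\<close> outside the domain.\<close>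

definition asg :: "nat set => (nat => hset) => hset" where
  "asg F f = mk ((%i. opr (vn i) (f i)) ` F)"
definition FA :: "hset => hset set" where
  "FA X = {asg F f |F f. finite F \<and> f ` F <= el X}"
definition env :: "hset => nat => hset" where "env s i = app s (vn i)"

lemma el_asg: "el (asg F f) = (%i. opr (vn i) (f i)) ` F"
  unfolding asg_def by simp

lemma asg_upd: "upd (asg F f) (vn i) a = asg (insert i F) (f(i := a))"
  by (rule ext_el) (auto simp: el_upd el_asg)

lemma env_asg: "env (asg F f) i = (if i : F then f i else zero)"
proof (cases "i : F")
  case True
  then show ?thesis unfolding env_def by (simp, intro app_unique) (auto simp: el_asg)
next
  case False
  then have "el (app (asg F f) (vn i)) = {}" by (auto simp: el_app el_asg)
  then show ?thesis unfolding env_def using False by (intro ext_el) simp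
qed

lemma FA_upd: "s : FA X ==> a : el X ==> upd s (vn i) a : FA X"
proof -
  assume s: "s : FA X" and a: "a : el X"
  then obtain F f where "s = asg F f" "finite F" "f ` F <= el X" unfolding FA_def by blast
  moreover have "(f(i := a)) ` insert i F <= el X" using calculation a by auto
  ultimately show ?thesis unfolding FA_def using asg_upd by blast
qed

lemma env_upd: "s : FA X ==> env (upd s (vn i) a) = (env s)(i := a)"
  unfolding FA_def by (auto simp: asg_upd env_asg fun_eq_iff)

lemma env_FA: "s : FA X ==> env s i : insert zero (el X)"
  unfolding FA_def by (auto simp: env_asg image_subset_iff)

primrec code :: "fm => hset" where
  "code (Mem i j) = opr (vn 0) (opr (vn i) (vn j))"
| "code (Eq i j) = opr (vn 1) (opr (vn i) (vn j))"
| "code (Neg \<phi>) = opr (vn 2) (code \<phi>)"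
| "code (Conj \<phi> \<psi>) = opr (vn 3) (opr (code \<phi>) (code \<psi>))"
| "code (Forall i \<phi>) = opr (vn 4) (opr (vn i) (code \<phi>))"

text \<open>Tarski's recursion on codes. The parameter is the pair of a domain and its set of
  assignments, and the value at a code is the set of assignments satisfying it.\<close>

definition SatH where "SatH p c f = mk {s : el (sn p).
   (EX i:el omega. EX j:el omega. c = opr (vn 0) (opr i j) \<and> app s i : el (app s j)) \<or>
   (EX i:el omega. EX j:el omega. c = opr (vn 1) (opr i j) \<and> app s i = app s j) \<or>
   (EX d:el (tc c). c = opr (vn 2) d \<and> s ~: el (app f d)) \<or>
   (EX d:el (tc c). EX d':el (tc c). c = opr (vn 3) (opr d d') \<and> s : el (app f d) \<and> s : el (app f d')) \<or>
   (EX i:el omega. EX d:el (tc c). c = opr (vn 4) (opr i d) \<and> (ALL a:el (fs p). upd s i a : el (app f d)))}"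
definition Sat where "Sat p = recF (SatH p)"

lemma el_mk_sub[simp]: "el (mk {y : el x. Q y}) = {y : el x. Q y}"
  by (rule el_mk) (rule countable_subset[OF _ countable_el[of x]], auto)

lemma el_Sat: "el (Sat p c) = {s : el (sn p).
   (EX i:el omega. EX j:el omega. c = opr (vn 0) (opr i j) \<and> app s i : el (app s j)) \<or>
   (EX i:el omega. EX j:el omega. c = opr (vn 1) (opr i j) \<and> app s i = app s j) \<or>
   (EX d. c = opr (vn 2) d \<and> s ~: el (Sat p d)) \<or>
   (EX d d'. c = opr (vn 3) (opr d d') \<and> s : el (Sat p d) \<and> s : el (Sat p d')) \<or>
   (EX i:el omega. EX d. c = opr (vn 4) (opr i d) \<and> (ALL a:el (fs p). upd s i a : el (Sat p d)))}"
proof -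
  have t: "d : TC (opr i d)" "d : TC (opr k (opr i d))" "i : TC (opr k (opr i d))" for i d k
    using opr_TC TC_trans by blast+
  show ?thesis unfolding Sat_def
    by (subst recF, unfold SatH_def el_mk_sub el_tc, rule Collect_cong, rule conj_cong[OF refl])
       (intro disj_cong refl bex_cong iffI; (elim bexE exE conjE, simp add: t; fail)?; 
        (elim bexE exE conjE, (rule exI bexI)+, use t in \<open>auto\<close>; fail)?)
qed

definition SX where "SX X = opr X (mk (FA X))"

context
  fixes X assumes cF: "countable (FA X)"
begin

lemma Sat_Mem: "el (Sat (SX X) (opr (vn 0) (opr (vn i) (vn j)))) = {s : FA X. sat (el X) mem (Mem i j) (env s)}"
  by (subst el_Sat) (auto simp: SX_def cF env_def simp del: vn.simps)
lemma Sat_Eq: "el (Sat (SX X) (opr (vn 1) (opr (vn i) (vn j)))) = {s : FA X. sat (el X) mem (Eq i j) (env s)}"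
  by (subst el_Sat) (auto simp: SX_def cF env_def simp del: vn.simps)
lemma Sat_Neg: assumes "el (Sat (SX X) c) = {s : FA X. sat (el X) mem \<phi> (env s)}"
  shows "el (Sat (SX X) (opr (vn 2) c)) = {s : FA X. sat (el X) mem (Neg \<phi>) (env s)}"
  by (subst el_Sat) (auto simp: assms simp del: vn.simps, auto simp: SX_def cF simp del: vn.simps)
lemma Sat_Conj: assumes "el (Sat (SX X) c) = {s : FA X. sat (el X) mem \<phi> (env s)}"
   "el (Sat (SX X) d) = {s : FA X. sat (el X) mem \<psi> (env s)}"
  shows "el (Sat (SX X) (opr (vn 3) (opr c d))) = {s : FA X. sat (el X) mem (Conj \<phi> \<psi>) (env s)}"
  by (subst el_Sat) (auto simp: assms simp del: vn.simps, auto simp: SX_def cF simp del: vn.simps)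
lemma Sat_Forall: assumes "el (Sat (SX X) c) = {s : FA X. sat (el X) mem \<phi> (env s)}"
  shows "el (Sat (SX X) (opr (vn 4) (opr (vn i) c))) = {s : FA X. sat (el X) mem (Forall i \<phi>) (env s)}"
proof -
  have "el (Sat (SX X) (opr (vn 4) (opr (vn i) c))) =
    {s : FA X. ALL a:el X. upd s (vn i) a : el (Sat (SX X) c)}"
    by (subst el_Sat) (auto simp: SX_def cF simp del: vn.simps)
  also have "... = {s : FA X. sat (el X) mem (Forall i \<phi>) (env s)}"
    unfolding assms by (rule Collect_cong) (auto simp: env_upd FA_upd)
  finally show ?thesis .
qed

lemma Sat_code: "el (Sat (SX X) (code \<phi>)) = {s : FA X. sat (el X) mem \<phi> (env s)}"
  by (induction \<phi>) (simp_all only: code.simps Sat_Mem Sat_Eq Sat_Neg Sat_Conj Sat_Forall)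

text \<open>A set of none of the five shapes is satisfied by nothing, like a contradiction, and the
  other cases reduce to smaller sets. Hence the definable power set may let \<open>c\<close> range
  over arbitrary sets instead of a set of well-formed codes.\<close>

lemma Sat_any: "EX \<phi>. el (Sat (SX X) c) = {s : FA X. sat (el X) mem \<phi> (env s)}"
proof (induction c rule: TC_induct)
  case (step c)
  note t = opr_TC TC_trans[OF opr_TC(2) opr_TC(1)] TC_trans[OF opr_TC(2) opr_TC(2)]
  have f: "el (Sat (SX X) c) = {}" if "\<nexists>i j. c = opr (vn 0) (opr (vn i) (vn j))" "\<nexists>i j. c = opr (vn 1) (opr (vn i) (vn j))"
      "\<nexists>d. c = opr (vn 2) d" "\<nexists>d d'. c = opr (vn 3) (opr d d')" "\<nexists>i d. c = opr (vn 4) (opr (vn i) d)"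
  proof -
    have a1: "\<not> (EX i:range vn. EX j:range vn. c = opr (vn 0) (opr i j) \<and> Q i j)" for Q using that(1) by blast
    have a2: "\<not> (EX i:range vn. EX j:range vn. c = opr (vn 1) (opr i j) \<and> Q i j)" for Q using that(2) by blast
    have a3: "\<not> (EX d. c = opr (vn 2) d \<and> Q d)" for Q using that(3) by blast
    have a4: "\<not> (EX d d'. c = opr (vn 3) (opr d d') \<and> Q d d')" for Q using that(4) by blast
    have a5: "\<not> (EX i:range vn. EX d. c = opr (vn 4) (opr i d) \<and> Q i d)" for Q using that(5) by blast
    show ?thesis
    proof (rule equals0I)
      fix s assume "s : el (Sat (SX X) c)"
      from this[unfolded el_Sat[of "SX X" c] el_omega, THEN CollectD, THEN conjunct2]
      show False by (elim disjE) (erule notE[OF a1] notE[OF a2] notE[OF a3] notE[OF a4] notE[OF a5])+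
    qed
  qed
  show ?case
  proof (rule ccontr)
    assume n: "\<not> ?case"
    have "\<nexists>i j. c = opr (vn 0) (opr (vn i) (vn j))" using Sat_Mem n by blast
    moreover have "\<nexists>i j. c = opr (vn 1) (opr (vn i) (vn j))" using Sat_Eq n by blast
    moreover have "\<nexists>d. c = opr (vn 2) d"
    proof (rule notI, elim exE)
      fix d assume c: "c = opr (vn 2) d"
      from step[of d] obtain \<phi> where "el (Sat (SX X) d) = {s : FA X. sat (el X) mem \<phi> (env s)}" using t c by blast
      from Sat_Neg[OF this] show False using n c by blast
    qed
    moreover have "\<nexists>d d'. c = opr (vn 3) (opr d d')"
    proof (rule notI, elim exE)
      fix d d' assume c: "c = opr (vn 3) (opr d d')"
      from step[of d] obtain \<phi> where 1: "el (Sat (SX X) d) = {s : FA X. sat (el X) mem \<phi> (env s)}" using t c by blast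
      from step[of d'] obtain \<psi> where 2: "el (Sat (SX X) d') = {s : FA X. sat (el X) mem \<psi> (env s)}" using t c by blast
      from Sat_Conj[OF 1 2] show False using n c by blast
    qed
    moreover have "\<nexists>i d. c = opr (vn 4) (opr (vn i) d)"
    proof (rule notI, elim exE)
      fix i d assume c: "c = opr (vn 4) (opr (vn i) d)"
      from step[of d] obtain \<phi> where "el (Sat (SX X) d) = {s : FA X. sat (el X) mem \<phi> (env s)}" using t c by blast
      from Sat_Forall[OF this] show False using n c by blast
    qed
    ultimately have "el (Sat (SX X) c) = {}" by (rule f)
    then have "el (Sat (SX X) c) = {s : FA X. sat (el X) mem (Neg (Eq 0 0)) (env s)}" by simp
    then show False using n by blast
  qed
qed

end

definition dset where "dset X c s = mk {a : el X. upd s zero a : el (Sat (SX X) c)}"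
definition DefP where "DefP X = mk {dset X c s |c s. s : FA X}"

definition LH where "LH x f = mk (\<Union>b\<in>el x. el (DefP (app f b)))"
definition Lh where "Lh = recF LH"

text \<open>The default value \<open>zero\<close> of an assignment can act as a parameter, hence the
  hypothesis that a nonempty \<open>X\<close> contains it; over the empty domain the defined set is
  empty anyway.\<close>

lemma FA_cong_sat:
  assumes "X ~= {} --> zero : X" "s : FA Y" "X = el Y"
  shows "definable X mem {a : X. sat X mem \<phi> (env (upd s zero a))}"
proof (cases "X = {}")
  case True then show ?thesis unfolding definable_def by (intro exI[of _ "Eq 0 0"] exI) auto
next
  case False
  then have "env s i : X" for i using env_FA[OF assms(2), of i] assms by auto
  then have "env s ` (fv \<phi> - {0}) <= X" by auto
  moreover have "env (upd s zero a) = (env s)(0 := a)" for a using env_upd[OF assms(2), of 0 a] by simp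
  ultimately show ?thesis unfolding definable_def by (intro exI[of _ \<phi>] exI[of _ "env s"]) simp
qed

context zf
begin

lemma dft_cong: "dft A t ==> (!!e. range e <= A ==> t e = u e) ==> dft A u"
  unfolding dft_def by (auto intro: dfb_cong simp: image_subset_iff)

lemma vnA[simp]: "vn n : A" by (induction n) auto

lemma dft_prd[df]: "dft A s ==> dft A t ==> dft A (%e. prd (s e) (t e))"
  by (rule dff2[where f=prd]) (simp_all only: prd_def, intro df dft_UN)
lemma prdA[simp]: "x : A ==> y : A ==> prd x y : A"
  using dft_in[OF dft_prd[OF dft_const dft_const], of x y "%_. x"] by auto
lemma dft_upd[df]: "dft A s ==> dft A t ==> dft A u ==> dft A (%e. upd (s e) (t e) (u e))"
  by (rule dff3[where f=upd]) (simp_all only: upd_def, intro df)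
lemma updA[simp]: "s : A ==> i : A ==> a : A ==> upd s i a : A"
  using dft_in[OF dft_upd[OF dft_const dft_const dft_const], of s i a "%_. s"] by auto

lemma asgA: "finite F ==> f ` F <= A ==> asg F f : A"
proof (induction F rule: finite_induct)
  case empty then show ?case by (simp add: asg_def zero_def[symmetric])
next
  case (insert i F)
  have "asg (insert i F) f = upd (asg F f) (vn i) (f i)" by (simp add: asg_upd)
  then show ?case using insert by simp
qed

text \<open>Finiteness is expressed internally by a bound \<open>n\<close> in \<open>omega\<close>
  on the domain, so that the set of assignments arises by separation from a power set of
  \<open>A\<close>.\<close>

lemma FA_char: assumes "X : A"
  shows "FA X = {s : el (Pw (prd omega X)). (ALL i x. opr i x : el s --> (ALL j y. opr j y : el s --> i = j --> x = y)) \<and>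
     (EX n:el omega. ALL i x. opr i x : el s --> i : el n)}" (is "_ = ?R")
proof (intro set_eqI iffI)
  fix s assume "s : FA X"
  then obtain F f where s: "s = asg F f" "finite F" "f ` F <= el X" unfolding FA_def by blast
  obtain n where n: "ALL i:F. i < n" using s(2) by (meson finite_nat_set_iff_bounded)
  have "s : A" using s el_subA[OF assms] by (auto intro!: asgA)
  moreover have "el s <= el (prd omega X)" using s by (auto simp: el_asg el_prd image_subset_iff)
  moreover have "vn i : el (vn n)" if "i : F" for i using n that by (simp add: vn_mem)
  then have "EX n:el omega. ALL i x. opr i x : el s --> i : el n"
    by (intro bexI[of _ "vn n"]) (auto simp: s(1) el_asg)
  moreover have "ALL i x. opr i x : el s --> (ALL j y. opr j y : el s --> i = j --> x = y)"
    by (auto simp: s(1) el_asg)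
  ultimately show "s : ?R" by simp
next
  fix s assume s: "s : ?R"
  then obtain n where n: "!!i x. opr i x : el s ==> i : el (vn n)" unfolding el_omega by blast
  have sub: "el s <= {opr a b |a b. a : range vn \<and> b : el X}" using s by (simp add: el_prd)
  have fn: "!!i x y. opr i x : el s ==> opr i y : el s ==> x = y" using s by blast
  let ?F = "{i. EX x. opr (vn i) x : el s}"
  have "?F <= {..<n}" using n vn_mem by blast
  then have F: "finite ?F" by (rule finite_subset) simp
  have ap: "app s (vn i) = x" if "opr (vn i) x : el s" for i x using that fn by (intro app_unique) blast+
  have "el s = el (asg ?F (%i. app s (vn i)))"
  proof (intro set_eqI iffI)
    fix z assume z: "z : el s"
    then obtain i x where "z = opr (vn i) x" using sub by blast
    then show "z : el (asg ?F (%i. app s (vn i)))" using z ap by (auto simp: el_asg)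
  next
    fix z assume "z : el (asg ?F (%i. app s (vn i)))"
    then show "z : el s" using ap by (auto simp: el_asg)
  qed
  then have "s = asg ?F (%i. app s (vn i))" by (rule ext_el)
  moreover have "(%i. app s (vn i)) ` ?F <= el X" using ap sub by fastforce
  ultimately show "s : FA X" unfolding FA_def using F by blast
qed

lemma FA_sub: "X : A ==> FA X <= A" by (auto simp: FA_char)
lemma cFA: "X : A ==> countable (FA X)" using FA_sub cnt_sub by blast

lemma dft_FA[df]: "dft A t ==> dft A (%e. mk (FA (t e)))"
proof (rule dff1[where f="%x. mk (FA x)"])
  have "dft A (%e. mk {s : el (Pw (prd omega (e 0))). (ALL i x. opr i x : el s --> (ALL j y. opr j y : el s --> i = j --> x = y)) \<and>
     (EX n:el omega. ALL i x. opr i x : el s --> i : el n)})" by (intro df omegaA)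
  then show "dft A (%e. mk (FA (e 0)))"
    by (rule dft_cong, subst FA_char) auto
qed

lemma dft_SX[df]: "dft A t ==> dft A (%e. SX (t e))"
  by (rule dff1[where f=SX]) (simp_all only: SX_def, intro df)

lemma dft_Sat[df]: "dft A s ==> dft A t ==> dft A (%e. Sat (s e) (t e))"
  unfolding Sat_def
  by (rule dft_recF[where H=SatH]) (simp_all only: SatH_def, intro df omegaA vnA)

lemma dft_dset[df]: "dft A s ==> dft A t ==> dft A u ==> dft A (%e. dset (s e) (t e) (u e))"
  by (rule dff3[where f=dset]) (simp_all only: dset_def, intro df zeroA)

lemma dsetA: "X : A ==> c : A ==> s : A ==> dset X c s : A"
  using dft_in[OF dft_dset[OF dft_const dft_const dft_const], of X c s "%_. X"] by auto

lemma codeA[simp]: "code \<phi> : A" by (induction \<phi>) auto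

lemma el_dset[simp]: "el (dset X c s) = {a : el X. upd s zero a : el (Sat (SX X) c)}"
  unfolding dset_def by simp

lemma DefP_code: assumes "X : A" shows "{dset X c s |c s. s : FA X} = {dset X (code \<phi>) s |\<phi> s. s : FA X}"
proof -
  have "EX \<phi>. dset X c s = dset X (code \<phi>) s" for c s
    using Sat_any[OF cFA[OF assms], of c] Sat_code[OF cFA[OF assms]] by (metis dset_def)
  then show ?thesis by blast
qed

text \<open>Every set that some \<open>c\<close> defines is already defined by the code of a
  formula, and such codes lie in \<open>A\<close>; so the quantifier over \<open>c\<close> can be
  restricted to \<open>A\<close>.\<close>

lemma DefP_char: assumes "X : A"
  shows "{dset X c s |c s. s : FA X} = {y : el (Pw X). EX c:A. EX s:el (mk (FA X)). y = dset X c s}"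
proof -
  have "{dset X c s |c s. s : FA X} <= {y : el (Pw X). EX c:A. EX s:el (mk (FA X)). y = dset X c s}"
    unfolding DefP_code[OF assms] using dsetA[OF assms codeA] FA_sub[OF assms]
    by (auto simp: cFA[OF assms])
  then show ?thesis by (auto simp: cFA[OF assms])
qed

lemma el_DefP: "X : A ==> el (DefP X) = {dset X c s |c s. s : FA X}"
  by (simp only: DefP_def DefP_char el_mk_el)

lemma dft_DefP[df]: "dft A t ==> dft A (%e. DefP (t e))"
proof (rule dff1[where f=DefP])
  have "dft A (%e. mk {y : el (Pw (e 0)). EX c:A. EX s:el (mk (FA (e 0))). y = dset (e 0) c s})" by (intro df)
  then show "dft A (%e. DefP (e 0))"
    by (rule dft_cong, unfold DefP_def, subst DefP_char) auto
qed

lemma dft_Lh[df]: "dft A t ==> dft A (%e. Lh (t e))"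
  unfolding Lh_def
  by (rule dft_recF[where H="%p. LH" and s=t]) (simp only: LH_def, intro df dft_UN)

lemma LhA[simp]: "x : A ==> Lh x : A"
  using dft_in[OF dft_Lh[OF dft_const], of x "%_. x"] by auto
lemma DefPA[simp]: "x : A ==> DefP x : A"
  using dft_in[OF dft_DefP[OF dft_const], of x "%_. x"] by auto

lemma el_Lh: "x : A ==> el (Lh x) = (\<Union>b\<in>el x. el (DefP (Lh b)))"
  unfolding Lh_def by (subst recF) (simp add: LH_def TC_el)

lemma DefP_definable:
  assumes X: "X : A" and z: "el X ~= {} --> zero : el X"
  shows "y : el (DefP X) \<longleftrightarrow> el y <= el X \<and> definable (el X) mem (el y)"
proof
  note c = cFA[OF X]
  assume "y : el (DefP X)"
  then obtain \<phi> s where s: "y = dset X (code \<phi>) s" "s : FA X" unfolding el_DefP[OF X] DefP_code[OF X] by blast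
  have "el y = {a : el X. sat (el X) mem \<phi> (env (upd s zero a))}"
    unfolding s(1) el_dset Sat_code[OF c] using FA_upd[OF s(2), of _ 0] by auto
  then show "el y <= el X \<and> definable (el X) mem (el y)" using FA_cong_sat[OF z s(2) refl] by auto
next
  note c = cFA[OF X]
  assume "el y <= el X \<and> definable (el X) mem (el y)"
  then obtain \<phi> v where v: "v ` (fv \<phi> - {0}) <= el X" "el y = {a : el X. sat (el X) mem \<phi> (v(0 := a))}"
    unfolding definable_def by blast
  let ?s = "asg (fv \<phi> - {0}) v"
  have s: "?s : FA X" unfolding FA_def using v(1) by (intro CollectI exI conjI) auto
  have "sat (el X) mem \<phi> (v(0 := a)) \<longleftrightarrow> sat (el X) mem \<phi> (env (upd ?s zero a))" for a
    unfolding env_upd[OF s, of 0, simplified] by (rule sat_cong_fv) (auto simp: env_asg)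
  then have "el y = el (dset X (code \<phi>) ?s)" unfolding v(2) el_dset Sat_code[OF c]
    using FA_upd[OF s, of _ 0] by auto
  then show "y : el (DefP X)" unfolding el_DefP[OF X] using s ext_el by blast
qed

end

section \<open>Reflection and ZF in L\<close>

definition OL :: "(hset => bool) => hset" where
  "OL Q = (THE a. Ord a \<and> Q a \<and> (ALL c:el a. \<not> Q c))"

lemma OL_eq: "Ord a ==> Q a ==> ALL c:el a. \<not> Q c ==> OL Q = a"
  unfolding OL_def by (rule the_equality) (use Ord_linear in blast)+

lemma OL: assumes "Q a" "Ord a" shows "Ord (OL Q)" "Q (OL Q)" "c : el (OL Q) ==> \<not> Q c" "a ~: el (OL Q)"
proof -
  obtain b where b: "Ord b" "Q b" "ALL c:el b. \<not> Q c" using Ord_least[of Q a] assms by blast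
  then have "OL Q = b" by (intro OL_eq)
  then show "Ord (OL Q)" "Q (OL Q)" "c : el (OL Q) ==> \<not> Q c" "a ~: el (OL Q)" using b assms by auto
qed

lemma env_upd2: "env (upd s (vn i) a) = (env s)(i := a)"
proof
  fix j
  show "env (upd s (vn i) a) j = ((env s)(i := a)) j"
  proof (cases "j = i")
    case True
    then show ?thesis unfolding env_def by (simp, intro app_unique) (auto simp: el_upd)
  next
    case False
    then have "el (app (upd s (vn i) a) (vn j)) = el (app s (vn j))" by (auto simp: el_app el_upd)
    then show ?thesis unfolding env_def using False ext_el by auto
  qed
qed

definition trn where "trn X \<longleftrightarrow> (ALL y:el X. el y <= el X)"

lemma trn_zero: "trn X ==> el X ~= {} --> zero : el X"
proof
  assume t: "trn X" and "el X ~= {}"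
  then obtain x where "x : el X" by auto
  then show "zero : el X"
  proof (induction x rule: el_induct)
    case (step x)
    show ?case
    proof (cases "el x = {}")
      case True
      then have "x = zero" by (intro ext_el) simp
      then show ?thesis using step by simp
    next
      case False
      then show ?thesis using step t unfolding trn_def by blast
    qed
  qed
qed

definition limo where "limo a \<longleftrightarrow> Ord a \<and> zero : el a \<and> (ALL b:el a. succ b : el a)"

context zf
begin

lemma dft_OL: assumes Q: "dfb A (%e. Q (%n. e (Suc n)) (e 0))"
  and ex: "!!e. range e <= A ==> EX a:A. Ord a \<and> Q e a"
  shows "dft A (%e. OL (Q e))"
proof -
  have Q2: "dfb A (%e. Q (%n. e (Suc (Suc n))) (e 0))"
    using dfb_ren[OF Q inj_skip1] by simp
  have "dfb A (%e. Ord (e 0) \<and> Q (%n. e (Suc n)) (e 0) \<and> (ALL c:el (e 0). \<not> Q (%n. e (Suc n)) c))"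
    by (intro df Q Q2)
  then have "dfb A (%e. e 0 = OL (Q (%n. e (Suc n))))"
  proof (rule dfb_cong)
    fix e :: "nat => hset" assume "range e <= A"
    then obtain a where "Ord a" "Q (%n. e (Suc n)) a" using ex[of "%n. e (Suc n)"] by auto
    from OL[of "Q (%n. e (Suc n))", OF this(2,1)] OL_eq[of "e 0" "Q (%n. e (Suc n))"]
    show "(Ord (e 0) \<and> Q (%n. e (Suc n)) (e 0) \<and> (ALL c:el (e 0). \<not> Q (%n. e (Suc n)) c)) =
       (e 0 = OL (Q (%n. e (Suc n))))" by metis
  qed
  moreover have "OL (Q e) : A" if e: "range e <= A" for e
  proof -
    obtain a where a: "a : A" "Ord a" "Q e a" using ex[OF e] by auto
    from OL[of "Q e", OF a(3,2)] have "OL (Q e) = a \<or> OL (Q e) : el a"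
      using Ord_linear[OF _ a(2), of "OL (Q e)"] by blast
    then show ?thesis using a Atrans by blast
  qed
  ultimately show ?thesis by (simp add: dft_def)
qed

lemma DefPI: assumes X: "X : A" "trn X" "el X ~= {}" and Q: "dfb (el X) (%e. Q (e 0))"
  shows "mk {a : el X. Q a} : el (DefP X)"
proof -
  interpret X: carrier "el X" by unfold_locales fact
  have "dfb (el X) (%e. e 0 : {a : el X. Q a})" using Q by (rule X.dfb_cong) auto
  then have "definable (el X) mem {a : el X. Q a}" by (subst X.definable_iff_dfb) auto
  then show ?thesis using DefP_definable[OF X(1) trn_zero[OF X(2)]] by auto
qed

lemma DefP_sup: assumes X: "X : A" "trn X" shows "el X <= el (DefP X)"
proof
  fix x assume x: "x : el X"
  then interpret X: carrier "el X" by unfold_locales auto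
  have "mk {a : el X. a : el x} : el (DefP X)"
    by (rule DefPI[OF X]) (use x in \<open>auto intro!: df\<close>)
  moreover have "{a : el X. a : el x} = el x" using X x unfolding trn_def by blast
  ultimately show "x : el (DefP X)" by simp
qed

lemma DefP_self: assumes X: "X : A" "trn X" shows "X : el (DefP X)"
proof -
  have "definable (el X) mem (el X)" unfolding definable_def
    by (rule exI[of _ "Eq 0 0"]) auto
  then show ?thesis using DefP_definable[OF X(1) trn_zero[OF X(2)]] by auto
qed

lemma DefP_Pow: "X : A ==> y : el (DefP X) ==> el y <= el X"
  by (auto simp: el_DefP)

lemma trn_Lh: "a : A ==> trn (Lh a)"
proof (induction a rule: el_induct)
  case (step a)
  show ?case unfolding trn_def
  proof
    fix y assume "y : el (Lh a)"
    then obtain b where b: "b : el a" "y : el (DefP (Lh b))" using step(2) el_Lh by blast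
    then have bA: "b : A" using step Atrans by blast
    have "el y <= el (Lh b)" using b DefP_Pow bA by auto
    also have "... <= el (DefP (Lh b))" using step b bA by (intro DefP_sup) auto
    also have "... <= el (Lh a)" using b step(2) el_Lh by blast
    finally show "el y <= el (Lh a)" .
  qed
qed

lemma Lh_mono: "a : A ==> b : el a ==> el (Lh b) <= el (Lh a)"
  using DefP_sup[OF LhA trn_Lh, of b] el_Lh[of a] Atrans by blast
lemma Lh_in: "a : A ==> b : el a ==> Lh b : el (Lh a)"
  using DefP_self[OF LhA trn_Lh, of b] el_Lh[of a] Atrans by blast
lemma Lh_succ: "a : A ==> el (Lh (succ a)) = el (DefP (Lh a))"
  using DefP_sup[OF LhA trn_Lh, of a] el_Lh[of a] el_Lh[of "succ a"] by auto
lemma Lh_le: "a : A ==> b : A ==> Ord a ==> Ord b ==> el b <= el a ==> el (Lh b) <= el (Lh a)"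
  using Lh_mono[of a b] Ord_subset[of b a] by auto

lemma rank_Lh: "a : A ==> Ord a ==> x : el (Lh a) ==> rank x : el a"
proof (induction a arbitrary: x rule: el_induct)
  case (step a)
  then obtain b where b: "b : el a" "x : el (DefP (Lh b))" using el_Lh by blast
  then have bA: "b : A" "Ord b" using step Atrans Ord_in by blast+
  then have "el x <= el (Lh b)" using b DefP_Pow by auto
  then have "rank y : el b" if "y : el x" for y using step(1)[OF b(1) bA] that by blast
  then have "el (rank x) <= el b" using bA by (intro rank_le) auto
  then have "rank x = b \<or> rank x : el b" using Ord_subset[of "rank x" b] bA by simp
  then show ?case using b step Ord_trans by blast
qed

text \<open>The ordinals in \<open>L_a\<close> are exactly the elements of \<open>a\<close>, and
  being an ordinal is a bounded formula, hence absolute for the transitive set \<open>L_a\<close>.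
  An empty \<open>L_a\<close> is treated apart because a \<open>carrier\<close> is nonempty.\<close>

lemma Ord_DefP: "a : A ==> Ord a ==> a : el (DefP (Lh a))"
proof (induction a rule: el_induct)
  case (step a)
  have eq: "el a = {x : el (Lh a). Ord x}"
  proof (intro set_eqI iffI)
    fix x assume x: "x : el a"
    then have "x : A" "Ord x" using step Atrans Ord_in by blast+
    then show "x : {x : el (Lh a). Ord x}" using step x el_Lh[of a] by blast
  next
    fix x assume "x : {x : el (Lh a). Ord x}"
    then show "x : el a" using rank_Lh[of a x] rank_Ord[of x] step by auto
  qed
  show ?case
  proof (cases "el (Lh a) = {}")
    case True
    then have "Lh a = a" using eq by (intro ext_el) auto
    then show ?thesis using DefP_self[of "Lh a"] trn_Lh[of a] step by auto
  next
    case False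
    then interpret X: carrier "el (Lh a)" by unfold_locales
    have t: "!!x y. x : el (Lh a) ==> y : el x ==> y : el (Lh a)" using trn_Lh[of a] step unfolding trn_def by blast
    have "dfb (el (Lh a)) (%e. (ALL y:el (Lh a). y : el (e 0) --> (ALL z:el (Lh a). z : el y --> z : el (e 0))) \<and>
      (ALL y:el (Lh a). y : el (e 0) --> (ALL z:el (Lh a). z : el y --> (ALL w:el (Lh a). w : el z --> w : el y))))"
      by (intro df)
    then have "dfb (el (Lh a)) (%e. Ord (e 0))"
    proof (rule X.dfb_cong)
      fix e :: "nat => hset" assume "range e <= el (Lh a)"
      then have "e 0 : el (Lh a)" by auto
      then show "((ALL y:el (Lh a). y : el (e 0) --> (ALL z:el (Lh a). z : el y --> z : el (e 0))) \<and>
      (ALL y:el (Lh a). y : el (e 0) --> (ALL z:el (Lh a). z : el y --> (ALL w:el (Lh a). w : el z --> w : el y)))) = Ord (e 0)"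
        unfolding Ord_def subset_iff using t by meson
    qed
    then have "mk {x : el (Lh a). Ord x} : el (DefP (Lh a))"
      using False trn_Lh[of a] step by (intro DefPI) auto
    then show ?thesis using eq by (metis mk_el)
  qed
qed

definition LK where "LK = {x : A. EX a:A. Ord a \<and> x : el (Lh a)}"

lemma LK_I: "a : A ==> Ord a ==> x : el (Lh a) ==> x : LK"
  unfolding LK_def using LhA Atrans by blast
lemma LK_Ex: "x : LK ==> EX a:A. Ord a \<and> x : el (Lh a)" unfolding LK_def by blast
lemma LK_sub: "LK <= A" unfolding LK_def by blast
lemma dfb_LK[df]: "dft A t ==> dfb A (%e. t e : LK)"
proof (rule df1[where Q="%x. x : LK"])
  have "dfb A (%e. EX a:A. Ord a \<and> e 0 : el (Lh a))" by (intro df)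
  then show "dfb A (%e. e 0 : LK)" by (rule dfb_cong) (auto simp: LK_def)
qed

lemma LK_trans: "x : LK ==> y : el x ==> y : LK"
  using LK_Ex trn_Lh LK_I unfolding trn_def by blast
lemma LK_Def: "a : A ==> Ord a ==> x : el (DefP (Lh a)) ==> x : LK"
  using LK_I[of "succ a" x] Lh_succ[of a] by simp
lemma Ord_LK: "a : A ==> Ord a ==> a : LK" using LK_Def Ord_DefP by blast
lemma Lh_LK: "a : A ==> Ord a ==> Lh a : LK" using LK_Def DefP_self[OF LhA trn_Lh] by blast

lemma dfb_LK_all: assumes "dfb A (%e. \<Phi> (%n. e (Suc n)) (e 0))" shows "dfb A (%e. ALL x:LK. \<Phi> e x)"
proof -
  have "dfb A (%e. ALL x:A. x : LK --> \<Phi> e x)" by (intro df assms)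
  then show ?thesis by (rule dfb_cong) (use LK_sub in blast)
qed

text \<open>Truth in L is definable one formula at a time. The environment is coded by a single set,
  so that one variable carries all free variables of the formula.\<close>

lemma dfb_satK: "dfb A (%e. sat LK mem \<phi> (env (e 0)))"
proof (induction \<phi>)
  case (Forall i \<phi>)
  have "dfb A (%e. ALL a:LK. sat LK mem \<phi> (env (upd (e 0) (vn i) a)))"
    by (intro dfb_LK_all df1[OF Forall] df vnA)
  then show ?case by (simp add: env_upd2)
qed (auto simp: env_def intro!: df vnA)

section \<open>Levy reflection for the constructible hierarchy\<close>

definition refl where "refl \<phi> a \<longleftrightarrow> (ALL v. range v <= el (Lh a) --> (sat LK mem \<phi> v \<longleftrightarrow> sat (el (Lh a)) mem \<phi> v))"

text \<open>\<open>C b c\<close> is to be read: stage \<open>c\<close> contains the witnesses needed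
  for parameters from stage \<open>b\<close>. Monotonicity in both arguments makes such conditions
  conjoinable and survive limits, so that \<open>closed\<close> ordinals can be reached by
  iteration.\<close>

definition clC where "clC C \<longleftrightarrow> dfb A (%e. C (e 0) (e 1)) \<and> (ALL b:A. Ord b --> (EX c:A. Ord c \<and> C b c)) \<and>
   (ALL b:A. ALL b':A. ALL c:A. ALL c':A. Ord b --> Ord b' --> Ord c --> Ord c' -->
      C b c --> el b' <= el b --> el c <= el c' --> C b' c')"

definition closed where "closed C a \<longleftrightarrow> a : A \<and> limo a \<and> (ALL b:el a. EX c:el a. C b c)"

lemma Ord_max: "b : A ==> c : A ==> Ord b ==> Ord c ==> EX d:A. Ord d \<and> el b <= el d \<and> el c <= el d"
  using Ord_linear[of b c] Ord_subset[of b c] Ord_subset[of c b] by blast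

lemma clC_mono: assumes "clC C" "C b c" "b : A" "b' : A" "c : A" "c' : A" "Ord b" "Ord b'" "Ord c" "Ord c'"
    "el b' <= el b" "el c <= el c'" shows "C b' c'"
  using assms(1)[unfolded clC_def, THEN conjunct2, THEN conjunct2, rule_format, of b b' c c'] assms(2-) by simp

lemma clC_conj: assumes "clC C" "clC D" shows "clC (%b c. C b c \<and> D b c)"
  unfolding clC_def
proof (intro conjI ballI impI)
  show "dfb A (%e. C (e 0) (e 1) \<and> D (e 0) (e 1))" using assms by (intro dfb_conj) (simp_all add: clC_def)
  fix b assume b: "b : A" "Ord b"
  then obtain c d where c: "c : A" "Ord c" "C b c" "d : A" "Ord d" "D b d" using assms unfolding clC_def by blast
  obtain m where m: "m : A" "Ord m" "el c <= el m" "el d <= el m" using Ord_max[of c d] c by blast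
  have "C b m" "D b m" using clC_mono[OF assms(1) c(3)] clC_mono[OF assms(2) c(6)] b c m by blast+
  then show "EX c:A. Ord c \<and> C b c \<and> D b c" using m by blast
next
  fix b b' c c' assume a: "b : A" "b' : A" "c : A" "c' : A" "Ord b" "Ord b'" "Ord c" "Ord c'"
    "C b c \<and> D b c" "el b' <= el b" "el c <= el c'"
  then show "C b' c'" using clC_mono[OF assms(1)] by blast
  show "D b' c'" using a clC_mono[OF assms(2)] by blast
qed

lemma closed_conj: "clC C ==> clC D ==> closed (%b c. C b c \<and> D b c) a ==> closed C a \<and> closed D a"
  unfolding closed_def by blast

lemma Lh_limo: "limo a ==> a : A ==> el (Lh a) = (\<Union>b\<in>el a. el (Lh b))"
proof
  assume a: "limo a" "a : A"
  show "el (Lh a) <= (\<Union>b\<in>el a. el (Lh b))"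
  proof
    fix x assume "x : el (Lh a)"
    then obtain b where b: "b : el a" "x : el (DefP (Lh b))" using el_Lh a by blast
    then have "x : el (Lh (succ b))" using Lh_succ[of b] Atrans a by blast
    then show "x : (\<Union>b\<in>el a. el (Lh b))" using a b unfolding limo_def by blast
  qed
qed (use Lh_mono in blast)

lemma Lh_limo_finite:
  assumes a: "limo a" "a : A" and F: "finite F" "F <= el (Lh a)" shows "EX b:el a. F <= el (Lh b)"
  using F
proof (induction F rule: finite_induct)
  case empty then show ?case using a unfolding limo_def by auto
next
  case (insert x F)
  then obtain b where b: "b : el a" "F <= el (Lh b)" by auto
  obtain c where c: "c : el a" "x : el (Lh c)" using insert Lh_limo[OF a] by auto
  have o: "Ord b" "Ord c" "b : A" "c : A" using a b c Ord_in Atrans unfolding limo_def by blast+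
  then have "el (Lh b) <= el (Lh c) \<or> el (Lh c) <= el (Lh b)" using Ord_linear[of b c] Lh_mono by blast
  then show ?case using b c by blast
qed

text \<open>Only the quantifier needs work. Its condition \<open>D\<close> says that an assignment
  over \<open>L_b\<close> having a counterexample in L has one in \<open>L_c\<close>. At a closed
  limit the finitely many relevant values lie in one earlier stage, so the counterexample is found
  below the limit.\<close>

lemma reflect: "EX C. clC C \<and> (ALL a. closed C a --> refl \<phi> a)"
proof (induction \<phi>)
  case (Mem i j)
  show ?case by (rule exI[of _ "%b c. True"]) (auto simp: clC_def refl_def intro!: dfb_const bexI[of _ zero])
next
  case (Eq i j)
  show ?case by (rule exI[of _ "%b c. True"]) (auto simp: clC_def refl_def intro!: dfb_const bexI[of _ zero])
next
  case (Neg \<phi>)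
  then show ?case unfolding refl_def by auto
next
  case (Conj \<phi> \<psi>)
  then obtain C D where C: "clC C" "ALL a. closed C a --> refl \<phi> a" "clC D" "ALL a. closed D a --> refl \<psi> a" by blast
  show ?case
  proof (intro exI conjI allI impI)
    show "clC (%b c. C b c \<and> D b c)" using C by (intro clC_conj)
    fix a assume "closed (%b c. C b c \<and> D b c) a"
    then have "refl \<phi> a" "refl \<psi> a" using closed_conj C by blast+
    then show "refl (Conj \<phi> \<psi>) a" unfolding refl_def by simp
  qed
next
  case (Forall i \<phi>)
  then obtain C where C: "clC C" "ALL a. closed C a --> refl \<phi> a" by blast
  define N where "N s a \<longleftrightarrow> \<not> sat LK mem \<phi> (env (upd s (vn i) a))" for s a
  define D where "D b c \<longleftrightarrow> (ALL s:el (mk (FA (Lh b))). (EX a:LK. N s a) --> (EX a:el (Lh c). N s a))" for b c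
  have dN: "dft A s ==> dft A t ==> dfb A (%e. N (s e) (t e))" for s t
    unfolding N_def by (intro df df1[OF dfb_satK] vnA)
  have dNL: "dfb A (%e. EX a:LK. N (e k) a)" for k
  proof -
    have "dfb A (%e. \<not> (ALL a:LK. \<not> N (e k) a))" by (intro df dfb_LK_all dN)
    then show ?thesis by (rule dfb_cong) blast
  qed
  have D: "clC D" unfolding clC_def
  proof (intro conjI ballI impI)
    show "dfb A (%e. D (e 0) (e 1))" unfolding D_def by (intro df dNL dN)
    fix b assume b: "b : A" "Ord b"
    have "mk (FA (Lh b)) : A" using dft_in[OF dft_FA[OF dft_const], of "Lh b" "%_. b"] b by auto
    moreover have "dfb A (%e. Ord (e 1) \<and> ((EX a:LK. N (e 0) a) --> (EX a:el (Lh (e 1)). N (e 0) a)))"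
      by (intro df dNL dN)
    moreover have "EX c:A. Ord c \<and> ((EX a:LK. N s a) --> (EX a:el (Lh c). N s a))" for s
    proof (cases "EX a:LK. N s a")
      case True
      then obtain a where a: "a : LK" "N s a" by blast
      then show ?thesis using LK_Ex[OF a(1)] by blast
    next
      case False then show ?thesis using Ord_zero zeroA by blast
    qed
    ultimately have "EX Y:A. ALL s:el (mk (FA (Lh b))). EX c:el Y. Ord c \<and> ((EX a:LK. N s a) --> (EX a:el (Lh c). N s a))"
      by (intro collection)
    then obtain Y where Y: "Y : A" "ALL s:el (mk (FA (Lh b))). EX c:el Y. Ord c \<and> ((EX a:LK. N s a) --> (EX a:el (Lh c). N s a))"
      by blast
    let ?Z = "mk {c : el Y. Ord c}"
    have Z: "?Z : A" by (rule sepA[OF _ Y(1)]) (intro df)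
    have U: "Uni ?Z : A" "Ord (Uni ?Z)" using Z UniA Ord_UniA[OF Z] by auto
    have le: "el (Lh c) <= el (Lh (Uni ?Z))" if "c : el Y" "Ord c" for c
      by (rule Lh_le) (use U Y that Atrans in \<open>auto\<close>)
    have "D b (Uni ?Z)" unfolding D_def using Y(2) le by blast
    then show "EX c:A. Ord c \<and> D b c" using U by blast
  next
    fix b b' c c' assume a: "b : A" "b' : A" "c : A" "c' : A" "Ord b" "Ord b'" "Ord c" "Ord c'" "D b c" "el b' <= el b" "el c <= el c'"
    have "el (Lh b') <= el (Lh b)" "el (Lh c) <= el (Lh c')"
      using a Lh_le[of b b'] Lh_le[of c' c] by simp_all
    moreover have "FA (Lh b') <= FA (Lh b)" using calculation(1) unfolding FA_def by blast
    ultimately show "D b' c'" using a(9) cFA[OF LhA] a(1,2) unfolding D_def by (simp add: subset_iff) blast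
  qed
  show ?case
  proof (intro exI conjI allI impI)
    show "clC (%b c. C b c \<and> D b c)" using C D by (intro clC_conj)
    fix a assume "closed (%b c. C b c \<and> D b c) a"
    then have cl: "refl \<phi> a" "closed D a" using closed_conj C D by blast+
    then have a: "a : A" "limo a" "Ord a" unfolding closed_def limo_def by auto
    have sub: "el (Lh a) <= LK" using LK_I a by blast
    show "refl (Forall i \<phi>) a" unfolding refl_def
    proof (intro allI impI)
      fix v :: "nat => hset" assume v: "range v <= el (Lh a)"
      have vi0: "range (v(i := x)) <= el (Lh a)" if "x : el (Lh a)" for x using v that by (auto simp: image_subset_iff)
      have vi: "sat LK mem \<phi> (v(i := x)) = sat (el (Lh a)) mem \<phi> (v(i := x))" if "x : el (Lh a)" for x
        using cl(1) vi0[OF that] unfolding refl_def by blast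
      show "sat LK mem (Forall i \<phi>) v = sat (el (Lh a)) mem (Forall i \<phi>) v"
      proof
        assume "sat LK mem (Forall i \<phi>) v"
        then show "sat (el (Lh a)) mem (Forall i \<phi>) v" using vi sub by auto
      next
        assume s: "sat (el (Lh a)) mem (Forall i \<phi>) v"
        show "sat LK mem (Forall i \<phi>) v"
        proof (rule ccontr)
          assume "\<not> sat LK mem (Forall i \<phi>) v"
          then obtain x where x: "x : LK" "\<not> sat LK mem \<phi> (v(i := x))" by auto
          have "finite (v ` fv \<phi>)" "v ` fv \<phi> <= el (Lh a)" using v by auto
          then obtain b where b: "b : el a" "v ` fv \<phi> <= el (Lh b)" using Lh_limo_finite[OF a(2,1)] by blast
          let ?s = "asg (fv \<phi>) v"
          have bA: "b : A" using b a Atrans by blast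
          have sF: "?s : FA (Lh b)" unfolding FA_def using b by (intro CollectI exI conjI) auto
          have N: "N ?s y \<longleftrightarrow> \<not> sat LK mem \<phi> (v(i := y))" for y
            unfolding N_def env_upd2 not_not by (rule arg_cong[of _ _ Not], rule sat_cong_fv) (auto simp: env_asg)
          obtain c where c: "c : el a" "D b c" using cl(2) b(1) unfolding closed_def by blast
          then obtain y where y: "y : el (Lh c)" "N ?s y" using sF x N cFA[OF LhA[OF bA]] unfolding D_def by auto
          then have "y : el (Lh a)" using c Lh_mono a by blast
          then show False using y N s vi by auto
        qed
      qed
    qed
  qed
qed

text \<open>The least suitable next ordinal is iterated \<open>omega\<close> times above
  \<open>b0\<close>; the supremum is a limit closed under \<open>C\<close>.\<close>

lemma closed_ex: assumes C: "clC C" and b0: "b0 : A" "Ord b0" shows "EX a. closed C a \<and> b0 : el a"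
proof -
  define Q where "Q b c \<longleftrightarrow> Ord b --> C b c \<and> b : el c" for b c
  define G where "G b = OL (Q b)" for b
  have dC: "dfb A (%e. C (e 0) (e 1))" using C by (simp add: clC_def)
  have exQ: "EX c:A. Ord c \<and> Q b c" if bA: "b : A" for b
  proof (cases "Ord b")
    case True
    then obtain c where c: "c : A" "Ord c" "C b c" using C bA unfolding clC_def by blast
    obtain m where m: "m : A" "Ord m" "el c <= el m" "el (succ b) <= el m"
      using Ord_max[of c "succ b"] c bA True by auto
    have "C b m" using clC_mono[OF C c(3)] bA c m True by blast
    then show ?thesis unfolding Q_def using m by auto
  next
    case False then show ?thesis unfolding Q_def using zeroA Ord_zero by blast
  qed
  have dG: "dft A t ==> dft A (%e. G (t e))" for t
  proof (rule dff1[where f=G], unfold G_def, rule dft_OL)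
    show "dfb A (%e. Q (e (Suc 0)) (e 0))" unfolding Q_def by (intro df df2[OF dC])
  qed (use exQ in auto)
  have G: "G b : A" "Ord (G b)" "C b (G b)" "b : el (G b)" if bA: "b : A" "Ord b" for b
  proof -
    show "G b : A" using dft_in[OF dG[OF dft_const], of b "%_. b"] bA by auto
    obtain c where c: "c : A" "Ord c" "Q b c" using exQ bA by blast
    show "Ord (G b)" "C b (G b)" "b : el (G b)" unfolding G_def using OL[of "Q b", OF c(3,2)] bA Q_def by auto
  qed
  \<comment> \<open>\<open>b x\<close> is the supremum of \<open>succ b0\<close> and of the
    successors of the earlier values \<open>I y\<close>, so each application of \<open>G\<close>
    starts above everything before it.\<close>
  define B where "B x f = Uni (upair (succ b0) (mk (\<Union>y\<in>el x. el (succ (app f y)))))" for x f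
  define I where "I = recF (%x f. G (B x f))"
  define b where "b x = B x (lam (tc x) I)" for x
  have I: "I x = G (b x)" for x unfolding b_def by (subst I_def, subst recF) (simp add: I_def)
  have el_b: "el (b x) = insert b0 (el b0) Un (\<Union>y\<in>el x. insert (I y) (el (I y)))" for x
    unfolding b_def B_def by (simp add: TC_el)
  have dI: "dft A t ==> dft A (%e. I (t e))" for t
    unfolding I_def by (rule dft_recF[where H="%p x f. G (B x f)" and s=t], unfold B_def) (intro df dft_UN dG b0 succA)+
  have IA: "I x : A" if "x : A" for x using dft_in[OF dI[OF dft_const], of x "%_. x"] that by auto
  have bA: "b x : A" if "x : A" for x
  proof -
    have "dft A (%e. Uni (upair (succ b0) (mk (\<Union>y\<in>el (e 0). el (succ (I y))))))" by (intro df dft_UN dI b0 succA)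
    from dft_in[OF this, of "%_. x"] that have "Uni (upair (succ b0) (mk (\<Union>y\<in>el x. el (succ (I y))))) : A" by auto
    moreover have "Uni (upair (succ b0) (mk (\<Union>y\<in>el x. el (succ (I y))))) = b x" by (rule ext_el) (simp add: el_b)
    ultimately show ?thesis by simp
  qed
  have oI: "x : A --> Ord (b x) \<and> Ord (I x)" for x
  proof (induction x rule: el_induct)
    case (step x)
    have "b x = mk (\<Union>(el ` (insert (succ b0) ((%y. succ (I y)) ` el x))))"
      by (rule ext_el) (simp add: el_b)
    moreover have "x : A ==> Ord (mk (\<Union>(el ` (insert (succ b0) ((%y. succ (I y)) ` el x)))))"
      using step Atrans b0 by (intro Ord_mkUN) auto
    ultimately have "x : A ==> Ord (b x)" by (simp only:)
    then show ?case using G(2)[OF bA] I by metis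
  qed
  have bI: "b (vn n) : el (I (vn n))" "C (b (vn n)) (I (vn n))" for n
    using G(3,4)[of "b (vn n)"] bA oI I by auto
  have Ib: "I (vn n) : el (b (vn (Suc n)))" for n unfolding el_b by simp
  have oI': "Ord (I (vn n))" "Ord (b (vn n))" for n using oI by auto
  have II: "I (vn n) : el (I (vn (Suc n)))" for n using Ib[of n] bI(1)[of "Suc n"] Ord_trans[OF oI'(1)] by blast
  define a where "a = mk (\<Union>n\<in>el omega. el (I n))"
  have ela: "el a = (\<Union>n. el (I (vn n)))" unfolding a_def by simp
  have aA: "a : A"
  proof -
    have "dft A (%e. mk (\<Union>n\<in>el (e 0). el (I n)))" by (intro df dft_UN dI)
    from dft_in[OF this, of "%_. omega"] show ?thesis unfolding a_def by auto
  qed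
  have oa: "Ord a"
  proof -
    have "a = mk (\<Union>(el ` range (%n. I (vn n))))" by (rule ext_el) (simp add: ela)
    moreover have "Ord (mk (\<Union>(el ` range (%n. I (vn n)))))" using oI' by (intro Ord_mkUN) auto
    ultimately show ?thesis by simp
  qed
  have suba: "el (I (vn m)) <= el a" for m unfolding ela by blast
  have step: "succ d : el a \<and> (EX c:el a. C d c)" if d: "d : el a" for d
  proof -
    obtain n where n: "d : el (I (vn n))" using d ela by auto
    have dA: "d : A" "Ord d" using n Atrans[OF IA[OF vnA]] Ord_in[OF oI'(1)] by blast+
    have "succ d = I (vn n) \<or> succ d : el (I (vn n))" using Ord_succ_le[OF oI'(1) n] .
    then have 1: "succ d : el a" using subsetD[OF suba II[of n]] subsetD[OF suba[of n]] by metis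
    have "d : el (b (vn (Suc n)))" using n Ib[of n] Ord_trans[OF oI'(2)] by blast
    then have "el d <= el (b (vn (Suc n)))" using oI'(2) Ord_trans by blast
    then have "C d (I (vn (Suc n)))"
      using clC_mono[OF C bI(2)[of "Suc n"]] bA[of "vn (Suc n)"] IA[of "vn (Suc n)"] dA oI' by (metis order_refl vnA)
    moreover have "I (vn (Suc n)) : el a" by (rule subsetD[OF suba II])
    ultimately show ?thesis using 1 by blast
  qed
  have b0a: "b0 : el a"
  proof -
    have "b0 : el (b (vn 0))" unfolding el_b by simp
    then have "b0 : el (I (vn 0))" using bI(1)[of 0] Ord_trans[OF oI'(1)] by blast
    then show ?thesis using suba by blast
  qed
  then have "zero : el a" using trn_zero[of a] oa unfolding trn_def Ord_def by blast
  then show ?thesis using step aA oa b0a unfolding closed_def limo_def by blast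
qed

lemma reflect_ex: assumes "b0 : A" "Ord b0" shows "EX a:A. limo a \<and> b0 : el a \<and> refl \<phi> a"
  using reflect[of \<phi>] closed_ex assms unfolding closed_def by metis

lemma LK_bound: assumes "finite F" "F <= LK" shows "EX b:A. Ord b \<and> F <= el (Lh b)"
  using assms
proof (induction F rule: finite_induct)
  case empty then show ?case using Ord_zero zeroA by blast
next
  case (insert x F)
  then obtain b c where b: "b : A" "Ord b" "F <= el (Lh b)" "c : A" "Ord c" "x : el (Lh c)" using LK_Ex by (metis insert_subset)
  obtain m where "m : A" "Ord m" "el b <= el m" "el c <= el m" using Ord_max[of b c] b by blast
  then show ?case using b Lh_le[of m b] Lh_le[of m c] by blast
qed

lemma LK_carrier: "carrier LK"
  by unfold_locales (use Ord_LK[OF zeroA Ord_zero] in auto)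

text \<open>Only finitely many parameters matter to a formula. They are packed into the set
  \<open>s\<close>, and \<open>dfb_satK\<close> then expresses truth in L by a predicate definable
  over \<open>A\<close>.\<close>

lemma dfb_rel_LK: assumes "dfb LK (%e. R (e 0) (e 1))"
  shows "EX R'. dfb A (%e. R' (e 0) (e 1)) \<and> (ALL x:LK. ALL y:LK. R x y \<longleftrightarrow> R' x y)"
proof -
  obtain \<phi> w where w: "range w <= LK" "!!e. range e <= LK ==> R (e 0) (e 1) \<longleftrightarrow> sat LK mem \<phi> (mrg e w)"
    using assms unfolding dfb_def by blast
  let ?F = "fv \<phi> - {0, 2}"
  define s where "s = asg ?F (mrg (%_. zero) w)"
  have zK: "zero : LK" using Ord_LK[OF zeroA Ord_zero] .
  have sA: "s : A" unfolding s_def using w(1) zK LK_sub by (intro asgA) (auto simp: mrg_def)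
  let ?R = "%x y. sat LK mem \<phi> (env (upd (upd s (vn 0) x) (vn 2) y))"
  have "dfb A (%e. ?R (e 0) (e 1))" by (intro df df1[OF dfb_satK] sA vnA)
  moreover have "R x y \<longleftrightarrow> ?R x y" if "x : LK" "y : LK" for x y
  proof -
    let ?e = "(%_. zero)(0 := x, 1 := y)"
    have "range ?e <= LK" using that zK by auto
    from w(2)[OF this] have "R x y \<longleftrightarrow> sat LK mem \<phi> (mrg ?e w)" by simp
    also have "... \<longleftrightarrow> ?R x y" unfolding env_upd2
      by (rule sat_cong_fv) (auto simp: s_def env_asg mrg_def elim!: evenE oddE)
    finally show ?thesis .
  qed
  ultimately show ?thesis by (intro exI[of _ ?R]) simp
qed

text \<open>For separation, a stage reflecting the formula and containing the parameters makes the
  wanted set definable over that stage. For power set and replacement a set is first found in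
  \<open>A\<close>; collection bounds the stages of its constructible elements, and separation in L
  finishes the power set.\<close>

theorem LK_zf: "zf LK"
proof -
  interpret K: carrier LK by (rule LK_carrier)
  have lim: "el (Lh a) ~= {}" if "limo a" "a : A" for a using that Lh_in unfolding limo_def by blast
  have sep: "mk {y : el x. Q y} : LK" if Q: "dfb LK (%e. Q (e 0))" and x: "x : LK" for Q x
  proof -
    obtain \<phi> w where w: "range w <= LK" "!!e. range e <= LK ==> Q (e 0) \<longleftrightarrow> sat LK mem \<phi> (mrg e w)"
      using Q unfolding dfb_def by blast
    have zK: "zero : LK" using Ord_LK[OF zeroA Ord_zero] .
    let ?v = "%i. if i : fv \<phi> then mrg (%_. zero) w i else zero"
    have "finite (insert x (insert zero (mrg (%_. zero) w ` fv \<phi>)))" "insert x (insert zero (mrg (%_. zero) w ` fv \<phi>)) <= LK"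
      using x w(1) zK by (auto simp: mrg_def)
    then obtain b where b: "b : A" "Ord b" "x : el (Lh b)" "zero : el (Lh b)" "mrg (%_. zero) w ` fv \<phi> <= el (Lh b)"
      using LK_bound[of "insert x (insert zero (mrg (%_. zero) w ` fv \<phi>))"] by auto
    obtain a where a: "a : A" "limo a" "b : el a" "refl \<phi> a" using reflect_ex b by blast
    let ?X = "el (Lh a)"
    have sub: "el (Lh b) <= ?X" using Lh_mono a by blast
    have XK: "?X <= LK" using LK_I a unfolding limo_def by blast
    have xX: "el x <= ?X" using b sub trn_Lh[OF a(1)] unfolding trn_def by blast
    interpret X: carrier ?X using lim a by unfold_locales blast
    have Qy: "Q y \<longleftrightarrow> sat ?X mem \<phi> (?v(0 := y))" if y: "y : ?X" for y
    proof -
      have "range ((%_. zero)(0 := y)) <= LK" using y XK zK by auto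
      from w(2)[OF this] have "Q y \<longleftrightarrow> sat LK mem \<phi> (mrg ((%_. zero)(0 := y)) w)" by simp
      also have "... \<longleftrightarrow> sat LK mem \<phi> (?v(0 := y))" by (rule sat_cong_fv) (auto simp: mrg_def elim!: evenE)
      also have "... \<longleftrightarrow> sat ?X mem \<phi> (?v(0 := y))"
      proof -
        have "range (?v(0 := y)) <= ?X" using b sub y by auto
        then show ?thesis using a(4) unfolding refl_def by blast
      qed
      finally show ?thesis .
    qed
    have "definable ?X mem {y : ?X. Q y}" unfolding definable_def
      by (intro exI[of _ \<phi>] exI[of _ ?v] conjI) (use b sub Qy in \<open>auto simp: image_subset_iff\<close>)
    then have "dfb ?X (%e. e 0 : {y : ?X. Q y})" by (subst (asm) X.definable_iff_dfb) auto
    then have "dfb ?X (%e. e 0 : el x \<and> e 0 : {y : ?X. Q y})"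
      using b(3) sub by (intro df) auto
    then have "mk {y : ?X. y : el x \<and> y : {y : ?X. Q y}} : el (DefP (Lh a))"
      using a lim trn_Lh by (intro DefPI) auto
    moreover have "{y : ?X. y : el x \<and> y : {y : ?X. Q y}} = {y : el x. Q y}" using xX by blast
    ultimately have "mk {y : el x. Q y} : el (DefP (Lh a))" by (simp only:)
    then show ?thesis using LK_Def a unfolding limo_def by blast
  qed
  have bnd: "EX a:A. Ord a \<and> (ALL x:el X. x : LK --> x : el (Lh a))" if X: "X : A" for X
  proof -
    have "dfb A (%e. Ord (e 1) \<and> (e 0 : LK --> e 0 : el (Lh (e 1))))" by (intro df)
    moreover have "EX a:A. Ord a \<and> (x : LK --> x : el (Lh a))" for x using LK_Ex Ord_zero zeroA by blast
    ultimately have "EX Y:A. ALL x:el X. EX a:el Y. Ord a \<and> (x : LK --> x : el (Lh a))" using X by (intro collection)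
    then obtain Y where Y: "Y : A" "ALL x:el X. EX a:el Y. Ord a \<and> (x : LK --> x : el (Lh a))" by blast
    let ?Z = "mk {c : el Y. Ord c}"
    have Z: "?Z : A" by (rule sepA[OF _ Y(1)]) (intro df)
    have U: "Uni ?Z : A" "Ord (Uni ?Z)" using Z UniA Ord_UniA[OF Z] by auto
    have le: "el (Lh c) <= el (Lh (Uni ?Z))" if "c : el Y" "Ord c" for c
      by (rule Lh_le) (use U Y that Atrans in \<open>auto\<close>)
    show ?thesis using U Y(2) le by blast
  qed
  show ?thesis
  proof unfold_locales
    show "y : LK" if "x : LK" "y : el x" for x y using that by (rule LK_trans)
    show "countable LK" using LK_sub cnt_sub by blast
    show "omega : LK" by (rule Ord_LK) auto
    show "mk {y : el x. Q y} : LK" if "dfb LK (%e. Q (e 0))" "x : LK" for Q x using sep that by blast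
    show "upair x y : LK" if xy: "x : LK" "y : LK" for x y
    proof -
      obtain b where b: "b : A" "Ord b" "{x,y} <= el (Lh b)" using LK_bound[of "{x,y}"] xy by auto
      have "mk {z : el (Lh b). z = x \<or> z = y} : LK" by (rule sep) (use xy b Lh_LK in \<open>auto intro!: df\<close>)
      moreover have "{z : el (Lh b). z = x \<or> z = y} = {x, y}" using b by auto
      ultimately show ?thesis by (simp add: upair_def)
    qed
    show "Uni x : LK" if x: "x : LK" for x
    proof -
      obtain b where b: "b : A" "Ord b" "x : el (Lh b)" using LK_Ex x by auto
      have "mk {z : el (Lh b). EX y:LK. y : el x \<and> z : el y} : LK" by (rule sep) (use x b Lh_LK in \<open>auto intro!: df\<close>)
      moreover have "{z : el (Lh b). EX y:LK. y : el x \<and> z : el y} = \<Union>(el ` el x)"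
        using b trn_Lh[OF b(1)] LK_trans[OF x] unfolding trn_def by blast
      ultimately show ?thesis by (simp add: Uni_def)
    qed
    show "mk {y : LK. el y <= el x} : LK" if x: "x : LK" for x
    proof -
      have "Pw x : A" using PwA x LK_sub by (auto simp: Pw_def)
      from bnd[OF this] obtain b where b: "b : A" "Ord b" "ALL y:el (Pw x). y : LK --> y : el (Lh b)" by blast
      have "mk {y : el (Lh b). ALL z:LK. z : el y --> z : el x} : LK"
        by (rule sep) (use x b Lh_LK in \<open>auto intro!: df\<close>)
      moreover have "{y : el (Lh b). ALL z:LK. z : el y --> z : el x} = {y : LK. el y <= el x}"
      proof (intro set_eqI iffI)
        fix y assume y: "y : {y : el (Lh b). ALL z:LK. z : el y --> z : el x}"
        then have "y : LK" using LK_I[OF b(1,2)] by blast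
        then show "y : {y : LK. el y <= el x}" using y LK_trans by blast
      next
        fix y assume y: "y : {y : LK. el y <= el x}"
        then have "y : el (Pw x)" using LK_sub by auto
        then show "y : {y : el (Lh b). ALL z:LK. z : el y --> z : el x}" using y b(3) by blast
      qed
      ultimately show ?thesis by simp
    qed
    show "EX y:LK. ALL a:el x. EX b:el y. R a b" if R: "dfb LK (%e. R (e 0) (e 1))" and x: "x : LK"
      and u: "!!a. a : el x ==> EX! b. b : LK \<and> R a b" for R x
    proof -
      obtain R' where R': "dfb A (%e. R' (e 0) (e 1))" "ALL x:LK. ALL y:LK. R x y \<longleftrightarrow> R' x y" using dfb_rel_LK[OF R] by blast
      have "dfb A (%e. e 1 : LK \<and> R' (e 0) (e 1))" by (intro df R')
      moreover have "EX b:A. b : LK \<and> R' a b" if "a : el x" for a using u[OF that] R' LK_sub LK_trans[OF x that] by blast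
      ultimately have "EX Y:A. ALL a:el x. EX b:el Y. b : LK \<and> R' a b" using x LK_sub by (intro collection) auto
      then obtain Y where Y: "Y : A" "ALL a:el x. EX b:el Y. b : LK \<and> R' a b" by blast
      from bnd[OF Y(1)] obtain b where b: "b : A" "Ord b" "ALL y:el Y. y : LK --> y : el (Lh b)" by blast
      then show ?thesis using Y(2) Lh_LK R'(2) LK_trans[OF x] by (intro bexI[of _ "Lh b"]) blast+
    qed
  qed
qed

end

section \<open>The definable well-order of L\<close>

text \<open>The colexicographic order on finite sets: \<open>z\<close> is the largest element of the
  symmetric difference and belongs to \<open>t\<close>. In this form only \<open>s\<close> and
  \<open>t\<close> are quantified over.\<close>

definition mdS :: "('a => 'a => bool) => 'a set => 'a set => bool" where
  "mdS r s t \<longleftrightarrow> (EX z:t. z ~: s \<and> (ALL w:s. r z w --> w : t) \<and> (ALL w:t. r z w --> w : s))"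

text \<open>Together with \<open>wfo\<close> this is a strict well-order: irreflexivity and
  transitivity follow because a well-founded relation has no cycles.\<close>

definition tot where "tot Y r \<longleftrightarrow> (ALL x:Y. ALL y:Y. x ~= y --> r x y \<or> r y x)"
definition wfo where "wfo Y r \<longleftrightarrow> wf {(x, y). x : Y \<and> y : Y \<and> r x y}"

lemma wfo_min: assumes "wfo Y r" "Q <= Y" "Q ~= {}" shows "EX m:Q. ALL y:Q. \<not> r y m"
proof -
  obtain x where x: "x : Q" using assms(3) by blast
  from wfE_min[OF assms(1)[unfolded wfo_def] x] obtain m where m: "m : Q"
    "!!y. (y, m) : {(x, y). x : Y \<and> y : Y \<and> r x y} ==> y ~: Q" by blast
  then show ?thesis using assms(2) by (intro bexI[of _ m]) auto
qed

lemma wfoI: assumes "!!Q. Q <= Y ==> Q ~= {} ==> EX m:Q. ALL y:Q. \<not> r y m" shows "wfo Y r"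
  unfolding wfo_def wf_eq_minimal
proof (intro allI impI)
  fix Q :: "'a set" and x assume x: "x : Q"
  show "EX z:Q. ALL y. (y, z) : {(x, y). x : Y \<and> y : Y \<and> r x y} --> y ~: Q"
  proof (cases "Q Int Y = {}")
    case True then show ?thesis using x by blast
  next
    case False
    then obtain m where "m : Q Int Y" "ALL y:Q Int Y. \<not> r y m" using assms[of "Q Int Y"] by blast
    then show ?thesis by blast
  qed
qed

text \<open>Everything in \<open>s - t\<close> lies below the element \<open>z\<close> of
  \<open>t - s\<close>, so as multisets \<open>s\<close> is below \<open>t\<close> in the
  well-founded multiset extension.\<close>

lemma mdS_wf: assumes "tot Y r" "wfo Y r" shows "wfo {s. finite s \<and> s <= Y} (mdS r)"
proof -
  let ?R = "{(x, y). x : Y \<and> y : Y \<and> r x y}"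
  have "wf (inv_image (mult ?R) mset_set)" using assms(2) unfolding wfo_def by (intro wf_inv_image wf_mult)
  moreover have "{(s, t). s : {s. finite s \<and> s <= Y} \<and> t : {s. finite s \<and> s <= Y} \<and> mdS r s t} <= inv_image (mult ?R) mset_set"
  proof clarify
    fix s t assume st: "finite s" "s <= Y" "finite t" "t <= Y" "mdS r s t"
    then obtain z where z: "z : t" "z ~: s" "!!w. w : s ==> r z w ==> w : t" unfolding mdS_def by blast
    have "(mset_set (s Int t) + mset_set (s - t), mset_set (s Int t) + mset_set (t - s)) : mult ?R"
    proof (rule one_step_implies_mult)
      show "mset_set (t - s) ~= {#}" using z st by (auto simp: mset_set_empty_iff)
      show "ALL k:set_mset (mset_set (s - t)). EX j:set_mset (mset_set (t - s)). (k, j) : ?R"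
      proof
        fix k assume "k : set_mset (mset_set (s - t))"
        then have k: "k : s" "k ~: t" using st by auto
        then have "r k z" using z assms(1) st unfolding tot_def by (metis subsetD)
        then show "EX j:set_mset (mset_set (t - s)). (k, j) : ?R" using z st k by auto
      qed
    qed
    moreover have "mset_set (s Int t) + mset_set (s - t) = mset_set s"
      using st by (subst mset_set_Union[symmetric]) (auto intro!: arg_cong[of _ _ mset_set])
    moreover have "mset_set (s Int t) + mset_set (t - s) = mset_set t"
      using st by (subst mset_set_Union[symmetric]) (auto intro!: arg_cong[of _ _ mset_set])
    ultimately show "(s, t) : inv_image (mult ?R) mset_set" by simp
  qed
  ultimately show ?thesis unfolding wfo_def by (rule wf_subset)
qed

text \<open>The finite symmetric difference has a maximal element, since the converse of a finite
  acyclic relation is well-founded; the side on which it lies decides the comparison.\<close>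

lemma mdS_tot: assumes "tot Y r" "wfo Y r" shows "tot {s. finite s \<and> s <= Y} (mdS r)"
  unfolding tot_def
proof (intro ballI impI)
  fix s t assume st: "s : {s. finite s \<and> s <= Y}" "t : {s. finite s \<and> s <= Y}" "s ~= t"
  let ?D = "(s - t) Un (t - s)"
  let ?R = "{(x, y). x : ?D \<and> y : ?D \<and> r x y}"
  have "finite ?R" by (rule finite_subset[of _ "?D \<times> ?D"]) (use st in auto)
  moreover have "acyclic ?R" by (rule wf_acyclic, rule wf_subset[OF assms(2)[unfolded wfo_def]]) (use st in auto)
  ultimately have "wf (?R\<inverse>)" by (rule finite_acyclic_wf_converse)
  moreover obtain d where "d : ?D" using st by blast
  ultimately obtain z where z: "z : ?D" "!!y. (y, z) : ?R\<inverse> ==> y ~: ?D" using wfE_min[of "?R\<inverse>" d ?D] by blast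
  have z2: "\<not> r z w" if "w : ?D" for w using z(1) z(2)[of w] that by auto
  show "mdS r s t \<or> mdS r t s"
  proof (cases "z : t")
    case True
    then have "mdS r s t" unfolding mdS_def using z z2 by blast
    then show ?thesis ..
  next
    case False
    then have "mdS r t s" unfolding mdS_def using z z2 by blast
    then show ?thesis ..
  qed
qed

lemma lex_wfo: assumes "wfo Y r" "wfo Z q" shows "wfo (Y \<times> Z) (%a b. r (fst a) (fst b) \<or> fst a = fst b \<and> q (snd a) (snd b))"
proof -
  have "wf ({(x, y). x : Y \<and> y : Y \<and> r x y} <*lex*> {(x, y). x : Z \<and> y : Z \<and> q x y})"
    using assms unfolding wfo_def by (rule wf_lex_prod)
  then show ?thesis unfolding wfo_def by (rule wf_subset) auto
qed

lemma wfo_image: assumes "wfo Y r" "f ` Z <= Y" "!!x y. x : Z ==> y : Z ==> q x y ==> r (f x) (f y)" shows "wfo Z q"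
proof -
  have "wf (inv_image {(x, y). x : Y \<and> y : Y \<and> r x y} f)" using assms(1) unfolding wfo_def by (rule wf_inv_image)
  then show ?thesis unfolding wfo_def by (rule wf_subset) (use assms in \<open>auto simp: image_subset_iff\<close>)
qed

abbreviation md where "md r s t \<equiv> mdS r (el s) (el t)"

locale zfL = zf +
  assumes VL: "x : A ==> EX a:A. Ord a \<and> x : el (Lh a)"
begin

section \<open>The well-order of L, built stage by stage\<close>

definition lr where "lr x = OL (%a. x : el (DefP (Lh a)))"

lemma lr_ex: "x : A ==> EX a:A. Ord a \<and> x : el (DefP (Lh a))"
  using VL[of x] el_Lh Ord_in Atrans by blast

lemma lr: assumes "x : A" shows "Ord (lr x)" "x : el (DefP (Lh (lr x)))" "lr x : A"
  "!!a. a : A ==> Ord a ==> x : el (DefP (Lh a)) ==> lr x = a \<or> lr x : el a"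
proof -
  obtain b where b: "b : A" "Ord b" "x : el (DefP (Lh b))" using lr_ex[OF assms] by blast
  note o = OL[of "%a. x : el (DefP (Lh a))", OF b(3,2), folded lr_def]
  show 1: "Ord (lr x)" "x : el (DefP (Lh (lr x)))" using o by auto
  show 2: "lr x = a \<or> lr x : el a" if "a : A" "Ord a" "x : el (DefP (Lh a))" for a
    using o(3)[of a] that Ord_linear[OF 1(1) that(2)] by blast
  show "lr x : A" using 2[OF b] b Atrans by blast
qed

lemma dft_lr[df]: "dft A t ==> dft A (%e. lr (t e))"
  by (rule dff1[where f=lr], unfold lr_def, rule dft_OL) (intro df, use lr_ex in auto)

lemma lr_Lh: "a : A ==> Ord a ==> x : el (Lh a) ==> x : A \<and> lr x : el a"
proof -
  assume a: "a : A" "Ord a" "x : el (Lh a)"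
  then obtain b where b: "b : el a" "x : el (DefP (Lh b))" using el_Lh by blast
  then have "b : A" "Ord b" "x : A" using a Atrans Ord_in LhA by blast+
  then show ?thesis using lr(4)[of x b] b a Ord_trans by blast
qed

definition lessf where "lessf f x y \<longleftrightarrow> lr x : el (lr y) \<or> lr x = lr y \<and> opr x y : el (app f (lr x))"
definition r2 where "r2 r u v \<longleftrightarrow> r (sn u) (sn v) \<or> sn u = sn v \<and> fs u : el (fs v)"
definition lt2 where "lt2 r c s c' s' \<longleftrightarrow> r c c' \<or> c = c' \<and> md (r2 r) s s'"
text \<open>A key of \<open>x\<close> is a code together with an assignment that defines
  \<open>x\<close>. The quantifier pattern says that the least key of \<open>x\<close> precedes the
  least key of \<open>y\<close>, without naming least keys.\<close>

definition keyless where "keyless r X x y \<longleftrightarrow> (EX c:el X. EX s:el (mk (FA X)). x = dset X c s \<and>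
   (ALL c':el X. ALL s':el (mk (FA X)). y = dset X c' s' --> lt2 r c s c' s'))"
text \<open>Ordering the sets of stage \<open>a\<close> by least keys needs the codes themselves to
  be ordered, that is, to be elements of \<open>L_a\<close>; this holds from \<open>omega\<close>
  on. At finite stages all members are finite sets, and their elements are compared
  colexicographically instead.\<close>

definition stg where "stg r a x y \<longleftrightarrow> lr x = a \<and> lr y = a \<and>
   (a : el omega \<and> md r x y \<or> a ~: el omega \<and> keyless r (Lh a) x y)"
definition WH where "WH a f = mk {z : el (prd (DefP (Lh a)) (DefP (Lh a))). stg (lessf f) a (fs z) (sn z)}"
definition RW where "RW = recF WH"
definition wl where "wl x y \<longleftrightarrow> lr x : el (lr y) \<or> lr x = lr y \<and> opr x y : el (RW (lr x))"

lemma dft_RW[df]: "dft A t ==> dft A (%e. RW (t e))"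
  unfolding RW_def
  by (rule dft_recF[where H="%p. WH" and s=t],
      unfold WH_def stg_def keyless_def lt2_def mdS_def r2_def lessf_def) (intro df omegaA)+

lemma dfb_wl[df]: "dft A s ==> dft A t ==> dfb A (%e. wl (s e) (t e))"
  by (rule df2[where Q=wl], unfold wl_def) (intro df)+

lemma lessf_RW: "lr x : el a ==> lessf (lam (tc a) RW) x y \<longleftrightarrow> wl x y"
  unfolding lessf_def wl_def by (simp add: TC_el)

lemma wl_stage: "x : A ==> y : A ==> wl x y \<longleftrightarrow> lr x : el (lr y) \<or> stg (lessf (lam (tc (lr x)) RW)) (lr x) x y"
proof -
  assume xy: "x : A" "y : A"
  have "el (RW a) = {z : el (prd (DefP (Lh a)) (DefP (Lh a))). stg (lessf (lam (tc a) RW)) a (fs z) (sn z)}" for a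
    unfolding RW_def by (subst recF) (simp only: WH_def el_mk_el)
  then have "opr x y : el (RW (lr x)) \<longleftrightarrow> stg (lessf (lam (tc (lr x)) RW)) (lr x) x y" if "lr x = lr y"
    using lr(2)[OF xy(1)] lr(2)[OF xy(2)] that by (simp add: el_prd)
  moreover have "stg r (lr x) x y ==> lr x = lr y" for r unfolding stg_def by simp
  ultimately show ?thesis unfolding wl_def by blast
qed

lemma upair_Lh: assumes "b : A" "x : el (Lh b)" "y : el (Lh b)" shows "upair x y : el (Lh (succ b))"
proof -
  interpret X: carrier "el (Lh b)" using assms by unfold_locales blast
  have "mk {z : el (Lh b). z = x \<or> z = y} : el (DefP (Lh b))"
    using assms trn_Lh by (intro DefPI df) auto
  moreover have "{z : el (Lh b). z = x \<or> z = y} = {x, y}" using assms by auto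
  ultimately show ?thesis using Lh_succ[OF assms(1)] by (simp add: upair_def)
qed

lemma limo_omega: "limo omega" unfolding limo_def by (auto intro: range_eqI[of _ _ 0] range_eqI[of _ _ "Suc _"])

lemma opr_limo: assumes a: "limo a" "a : A" "x : el (Lh a)" "y : el (Lh a)" shows "opr x y : el (Lh a)"
proof -
  have u: "upair x y : el (Lh a)" if xy: "x : el (Lh a)" "y : el (Lh a)" for x y
  proof -
    obtain b where b: "b : el a" "{x, y} <= el (Lh b)" using Lh_limo_finite[OF a(1,2), of "{x,y}"] xy by auto
    then have "upair x y : el (Lh (succ b))" using upair_Lh[of b x y] a Atrans by auto
    then show ?thesis using Lh_mono[of a "succ b"] a b unfolding limo_def by blast
  qed
  show ?thesis unfolding opr_def using u a by blast
qed

lemma code_Lh: "code \<phi> : el (Lh omega)"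
proof -
  have "vn n : el (Lh omega)" for n
  proof -
    have "vn n : el (Lh (vn (Suc n)))" using Ord_DefP[of "vn n"] Lh_succ[of "vn n"] by simp
    moreover have "vn (Suc n) : el omega" by (simp del: vn.simps)
    ultimately show ?thesis using Lh_mono[OF omegaA] by blast
  qed
  then show ?thesis by (induction \<phi>) (auto intro!: opr_limo limo_omega simp del: vn.simps)
qed

lemma finite_Lh: "finite (el (Lh (vn n)))"
proof (induction n)
  case 0 then show ?case by (simp add: el_Lh)
next
  case (Suc n)
  have "el ` el (DefP (Lh (vn n))) <= Pow (el (Lh (vn n)))" using DefP_Pow[OF LhA[OF vnA]] by blast
  then have "finite (el ` el (DefP (Lh (vn n))))" using Suc finite_subset by blast
  then have "finite (el (DefP (Lh (vn n))))" by (rule finite_imageD) (auto intro: inj_onI ext_el)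
  then show ?case using Lh_succ[of "vn n"] by simp
qed

lemma stage_ok:
  assumes a: "a : A" "Ord a" and t: "tot (el (Lh a)) r" and w: "wfo (el (Lh a)) r"
  shows "tot {x : A. lr x = a} (stg r a) \<and> wfo {x : A. lr x = a} (stg r a)"
proof (cases "a : el omega")
  case True
  then obtain n where n: "a = vn n" by auto
  let ?F = "{s. finite s \<and> s <= el (Lh a)}"
  have sub: "el x : ?F" if "x : A" "lr x = a" for x
  proof -
    have "el x <= el (Lh a)" using DefP_Pow[OF LhA[OF a(1)]] lr(2)[OF that(1)] that(2) by simp
    then show ?thesis using finite_subset[OF _ finite_Lh[of n]] n by simp
  qed
  have st: "stg r a x y \<longleftrightarrow> md r x y" if "lr x = a" "lr y = a" for x y unfolding stg_def using True that by blast
  have "tot {x : A. lr x = a} (stg r a)" unfolding tot_def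
  proof (intro ballI impI)
    fix x y assume xy: "x : {x : A. lr x = a}" "y : {x : A. lr x = a}" "x ~= y"
    then have "el x ~= el y" using ext_el by blast
    then have "md r x y \<or> md r y x" using mdS_tot[OF t w] sub xy unfolding tot_def by blast
    then show "stg r a x y \<or> stg r a y x" using st xy by blast
  qed
  moreover have "wfo {x : A. lr x = a} (stg r a)"
    by (rule wfo_image[OF mdS_wf[OF t w], of el]) (use sub st in blast)+
  ultimately show ?thesis ..
next
  case False
  let ?X = "Lh a"
  have XA: "?X : A" using a by simp
  have fa: "el (mk (FA ?X)) = FA ?X" using cFA[OF XA] by simp
  let ?P = "{opr (vn i) b |i b. b : el ?X}"
  have P: "tot ?P (r2 r)" unfolding tot_def
  proof (intro ballI impI)
    fix u v assume "u : ?P" "v : ?P" "u ~= v"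
    then obtain i b j c where uv: "u = opr (vn i) b" "v = opr (vn j) c" "b : el ?X" "c : el ?X" "i ~= j \<or> b ~= c" by auto
    then show "r2 r u v \<or> r2 r v u" using t unfolding tot_def r2_def by (auto simp: vn_mem)
  qed
  have P2: "wfo ?P (r2 r)"
  proof (rule wfo_image[OF lex_wfo[OF w, of UNIV "%x y. x : el y"], of "%u. (sn u, fs u)"])
    show "wfo UNIV (%x y. x : el y)" unfolding wfo_def using wf_mem by simp
  qed (auto simp: r2_def)
  have FP: "el s : {s. finite s \<and> s <= ?P}" if "s : FA ?X" for s using that unfolding FA_def by (auto simp: el_asg image_subset_iff)
  let ?K = "el ?X \<times> FA ?X"
  let ?l = "%k k'. lt2 r (fst k) (snd k) (fst k') (snd k')"
  have Kt: "tot ?K ?l" unfolding tot_def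
  proof (intro ballI impI)
    fix k k' assume k: "k : ?K" "k' : ?K" "k ~= k'"
    show "?l k k' \<or> ?l k' k"
    proof (cases "fst k = fst k'")
      case True
      then have "el (snd k) ~= el (snd k')" using k ext_el prod_eqI by blast
      then have "md (r2 r) (snd k) (snd k') \<or> md (r2 r) (snd k') (snd k)"
        using mdS_tot[OF P P2, unfolded tot_def, rule_format, OF FP FP, of "snd k" "snd k'"] k by (auto simp: mem_Times_iff)
      then show ?thesis using True unfolding lt2_def by metis
    next
      case False
      then have "r (fst k) (fst k') \<or> r (fst k') (fst k)"
        using t[unfolded tot_def, rule_format, of "fst k" "fst k'"] k by (auto simp: mem_Times_iff)
      then show ?thesis unfolding lt2_def by blast
    qed
  qed
  have Kw: "wfo ?K ?l"
    by (rule wfo_image[OF lex_wfo[OF w mdS_wf[OF P P2]], of "%k. (fst k, el (snd k))"])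
       (rule image_subsetI, unfold mem_Times_iff fst_conv snd_conv, use FP in blast, simp add: lt2_def)
  define key where "key x = {k : ?K. x = dset ?X (fst k) (snd k)}" for x
  have kn: "key x ~= {}" if x: "x : A" "lr x = a" for x
  proof -
    have "x : el (DefP ?X)" using lr(2) x by blast
    then obtain \<phi> s where s: "x = dset ?X (code \<phi>) s" "s : FA ?X" unfolding el_DefP[OF XA] DefP_code[OF XA] by blast
    have "el (Lh omega) <= el ?X" using Ord_linear[of a omega] a False Lh_mono[of a omega] by auto
    then have "(code \<phi>, s) : key x" unfolding key_def using s code_Lh by auto
    then show ?thesis by blast
  qed
  have st: "stg r a x y \<longleftrightarrow> (EX k:key x. ALL k':key y. ?l k k')" if "lr x = a" "lr y = a" for x y
    unfolding stg_def keyless_def key_def fa using False that by fastforce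
  have "tot {x : A. lr x = a} (stg r a)" unfolding tot_def
  proof (intro ballI impI)
    fix x y assume xy: "x : {x : A. lr x = a}" "y : {x : A. lr x = a}" "x ~= y"
    have g: "stg r a x y" if xy: "x : {x : A. lr x = a}" "y : {x : A. lr x = a}" "x ~= y"
      and k: "k : key x" "ALL k':key x Un key y. \<not> ?l k' k" for x y k
    proof -
      have "?l k k'" if k': "k' : key y" for k'
      proof -
        have "k ~= k'" using k(1) k' xy(3) unfolding key_def by blast
        then show ?thesis using Kt k k' unfolding tot_def key_def by blast
      qed
      then show ?thesis using st xy k by blast
    qed
    have "key x Un key y <= ?K" "key x Un key y ~= {}" using kn xy unfolding key_def by auto
    from wfo_min[OF Kw this] obtain k where k: "k : key x Un key y" "ALL k':key x Un key y. \<not> ?l k' k" by blast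
    then show "stg r a x y \<or> stg r a y x" using g[OF xy, of k] g[of y x k] xy by blast
  qed
  moreover have "wfo {x : A. lr x = a} (stg r a)"
  proof (rule wfoI)
    fix Q assume Q: "Q <= {x : A. lr x = a}" "Q ~= {}"
    have "\<Union>(key ` Q) <= ?K" "\<Union>(key ` Q) ~= {}" using kn Q unfolding key_def by blast+
    from wfo_min[OF Kw this] obtain k where k: "k : \<Union>(key ` Q)" "ALL k':\<Union>(key ` Q). \<not> ?l k' k" by blast
    then obtain x where x: "x : Q" "k : key x" by blast
    have "\<not> stg r a y x" if y: "y : Q" for y
    proof
      assume s: "stg r a y x"
      have "lr y = a" "lr x = a" using Q x y by auto
      then obtain k' where "k' : key y" "?l k' k" using s st x by blast
      then show False using k y by blast
    qed
    then show "EX m:Q. ALL y:Q. \<not> stg r a y m" using x by blast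
  qed
  ultimately show ?thesis ..
qed

lemma tot_cong: "tot Y r ==> (!!x y. x : Y ==> y : Y ==> r x y \<longleftrightarrow> q x y) ==> tot Y q" unfolding tot_def by blast
lemma wfo_cong: "wfo Y r ==> (!!x y. x : Y ==> y : Y ==> r x y \<longleftrightarrow> q x y) ==> wfo Y q"
  using wfo_image[of Y r "%x. x" Y q] by auto

lemma wl_glue: assumes "Y <= A" "!!b. b : lr ` Y ==> tot {x : A. lr x = b} wl \<and> wfo {x : A. lr x = b} wl"
  shows "tot Y wl \<and> wfo Y wl"
proof
  show "tot Y wl" unfolding tot_def
  proof (intro ballI impI)
    fix x y assume xy: "x : Y" "y : Y" "x ~= y"
    show "wl x y \<or> wl y x"
    proof (cases "lr x = lr y")
      case True
      have "tot {z : A. lr z = lr x} wl" using assms(2)[of "lr x"] xy by simp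
      moreover have "x : {z : A. lr z = lr x}" "y : {z : A. lr z = lr x}" using True xy assms(1) by auto
      ultimately show ?thesis using xy(3) unfolding tot_def by blast
    next
      case False then show ?thesis using Ord_linear[of "lr x" "lr y"] lr(1) assms(1) xy unfolding wl_def by blast
    qed
  qed
  show "wfo Y wl"
  proof (rule wfoI)
    fix Q assume Q: "Q <= Y" "Q ~= {}"
    then obtain x0 where "x0 : Q" by blast
    then obtain b where b: "b : lr ` Q" "!!c. c : el b ==> c ~: lr ` Q"
      using wfE_min[OF wf_mem, of "lr x0" "lr ` Q"] by auto
    have "{x : Q. lr x = b} <= {x : A. lr x = b}" "{x : Q. lr x = b} ~= {}" using Q assms b by auto
    moreover have "wfo {x : A. lr x = b} wl" using assms Q b by blast
    ultimately obtain m where m: "m : Q" "lr m = b" "ALL y:{x : Q. lr x = b}. \<not> wl y m"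
      using wfo_min[of "{x : A. lr x = b}" wl "{x : Q. lr x = b}"] by blast
    have "\<not> wl y m" if y: "y : Q" for y
    proof
      assume "wl y m"
      then have "lr y : el b \<or> lr y = b" unfolding wl_def using m by auto
      then show False using b(2) m(3) y \<open>wl y m\<close> by blast
    qed
    then show "EX m:Q. ALL y:Q. \<not> wl y m" using m by blast
  qed
qed

lemma wl_stages: "a : A ==> Ord a ==> tot {x : A. lr x = a} wl \<and> wfo {x : A. lr x = a} wl"
proof (induction a rule: el_induct)
  case (step a)
  have LA: "x : A \<and> lr x : el a" if "x : el (Lh a)" for x using lr_Lh step that by blast
  have "tot (el (Lh a)) wl \<and> wfo (el (Lh a)) wl"
    by (rule wl_glue) (use LA step Ord_in Atrans in blast)+
  then have "tot (el (Lh a)) (lessf (lam (tc a) RW))" "wfo (el (Lh a)) (lessf (lam (tc a) RW))"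
    using lessf_RW LA by (auto intro: tot_cong wfo_cong)
  from stage_ok[OF step(2,3) this]
  have "tot {x : A. lr x = a} (stg (lessf (lam (tc a) RW)) a) \<and> wfo {x : A. lr x = a} (stg (lessf (lam (tc a) RW)) a)" .
  moreover have "stg (lessf (lam (tc a) RW)) a x y \<longleftrightarrow> wl x y" if "x : A" "y : A" "lr x = a" "lr y = a" for x y
    using wl_stage that by auto
  ultimately show ?case using tot_cong[of "{x : A. lr x = a}" _ wl] wfo_cong[of "{x : A. lr x = a}" _ wl] by auto
qed

theorem wl_wellorder: "tot A wl" "wfo A wl"
proof -
  have "tot A wl \<and> wfo A wl" by (rule wl_glue) (use wl_stages lr in auto)
  then show "tot A wl" "wfo A wl" by auto
qed

text \<open>A definable choice operator: through \<open>dft_WL\<close> a witness becomes a term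
  depending definably on the parameters.\<close>

definition WL where "WL Q = (THE x. x : A \<and> Q x \<and> (ALL y:A. Q y --> \<not> wl y x))"

lemma WL_ex1: assumes "x : A" "Q x" shows "EX! x. x : A \<and> Q x \<and> (ALL y:A. Q y --> \<not> wl y x)"
proof -
  obtain m where "m : {x : A. Q x}" "ALL y:{x : A. Q x}. \<not> wl y m"
    using wfo_min[OF wl_wellorder(2), of "{x : A. Q x}"] assms by blast
  then show ?thesis using wl_wellorder(1) unfolding tot_def by blast
qed

lemma WL: assumes "x : A" "Q x" shows "WL Q : A" "Q (WL Q)" "y : A ==> Q y ==> \<not> wl y (WL Q)"
  using theI'[OF WL_ex1[of x Q, OF assms]] unfolding WL_def by blast+

lemma WL_eq: assumes "x : A" "Q x" "!!y. y : A ==> Q y ==> \<not> wl y x" shows "WL Q = x"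
  unfolding WL_def using WL_ex1[of x Q, OF assms(1,2)] by (rule the1_equality) (use assms in blast)

lemma dft_WL: assumes Q: "dfb A (%e. Q (%n. e (Suc n)) (e 0))" and ex: "!!e. range e <= A ==> EX x:A. Q e x"
  shows "dft A (%e. WL (Q e))"
proof -
  have Q2: "dfb A (%e. Q (%n. e (Suc (Suc n))) (e 0))"
    using dfb_ren[OF Q inj_skip1] by simp
  have "dfb A (%e. Q (%n. e (Suc n)) (e 0) \<and> (ALL y:A. Q (%n. e (Suc n)) y --> \<not> wl y (e 0)))"
    by (intro df Q Q2)
  then have "dfb A (%e. e 0 = WL (Q (%n. e (Suc n))))"
  proof (rule dfb_cong)
    fix e :: "nat => hset" assume e: "range e <= A"
    then obtain x where "x : A" "Q (%n. e (Suc n)) x" using ex[of "%n. e (Suc n)"] by auto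
    from WL_eq[of "e 0" "Q (%n. e (Suc n))"] WL[of x "Q (%n. e (Suc n))", OF this]
    show "(Q (%n. e (Suc n)) (e 0) \<and> (ALL y:A. Q (%n. e (Suc n)) y --> \<not> wl y (e 0))) =
       (e 0 = WL (Q (%n. e (Suc n))))" using e by (metis range_subsetD)
  qed
  moreover have "WL (Q e) : A" if e: "range e <= A" for e using ex[OF e] WL(1) by blast
  ultimately show ?thesis by (simp add: dft_def)
qed

end

lemma (in zf) LK_zfL: "zfL LK"
proof -
  interpret K: zf LK by (rule LK_zf)
  show ?thesis by unfold_locales (use LK_Ex Ord_LK in blast)
qed

section \<open>Set forcing\<close>

definition valH where "valH G x f = mk ((%z. app f (fs z)) ` {z : el x. (EX s p. z = opr s p \<and> p : G)})"
definition val :: "hset set => hset => hset" where "val G = recF (valH G)"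

lemma val_cnt: "countable {val G s |s p. p : G \<and> opr s p : el x}"
  by (rule countable_subset[of _ "(%z. val G (fs z)) ` el x"]) force+

lemma el_val: "el (val G x) = {val G s |s p. p : G \<and> opr s p : el x}"
proof -
  have "(%z. app (lam (tc x) (recF (valH G))) (fs z)) ` {z : el x. (EX s p. z = opr s p \<and> p : G)} =
     {val G s |s p. p : G \<and> opr s p : el x}" (is "?L = ?R")
  proof (intro set_eqI iffI)
    fix y assume "y : ?L"
    then obtain s p where "opr s p : el x" "p : G" "y = app (lam (tc x) (recF (valH G))) s" by auto
    moreover have "s : TC x" using calculation opr_el_TC by blast
    ultimately show "y : ?R" by (auto simp: val_def)
  next
    fix y assume "y : ?R"
    then obtain s p where s: "opr s p : el x" "p : G" "y = val G s" by auto
    moreover have "s : TC x" using calculation opr_el_TC by blast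
    ultimately have "y = app (lam (tc x) (recF (valH G))) (fs (opr s p))" by (simp add: val_def)
    then show "y : ?L" using s by blast
  qed
  moreover have "val G x = mk ?L" unfolding val_def by (subst recF) (simp only: valH_def)
  ultimately show ?thesis using val_cnt[of G x] by simp
qed

text \<open>The canonical names, with \<open>o1\<close> in the role of the top condition; any
  element of the filter serves.\<close>

definition chk where "chk o1 = recF (%x f. mk ((%y. opr (app f y) o1) ` el x))"

lemma el_chk: "el (chk o1 x) = (%y. opr (chk o1 y) o1) ` el x"
  unfolding chk_def by (subst recF) (auto simp: TC_el)

lemma val_chk: "o1 : G ==> val G (chk o1 x) = x"
proof (induction x rule: el_induct)
  case (step x)
  have "el (val G (chk o1 x)) = {val G (chk o1 y) |y. y : el x}" using step(2) by (auto simp: el_val el_chk)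
  also have "... = el x"
  proof -
    have e: "val G (chk o1 y) = y" if "y : el x" for y using step that by blast
    then have "(%y. val G (chk o1 y)) ` el x = el x" by simp
    moreover have "{val G (chk o1 y) |y. y : el x} = (%y. val G (chk o1 y)) ` el x" by blast
    ultimately show ?thesis by (simp only:)
  qed
  finally show ?case by (rule ext_el)
qed

lemma rank_val: "el (rank (val G x)) <= el (rank x)"
proof (induction x rule: TC_induct)
  case (step x)
  show ?case
  proof (rule rank_le)
    fix y assume "y : el (val G x)"
    then obtain s p where s: "opr s p : el x" "y = val G s" by (auto simp: el_val)
    then have "s : TC x" using opr_el_TC by blast
    then have "el (rank y) <= el (rank s)" "rank s : el (rank x)" using step rank_TC s by auto
    then show "rank y : el (rank x)" using Ord_subset[of "rank y" "rank s"] Ord_trans[OF Ord_rank, of "rank s" x "rank y"] by auto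
  qed simp
qed

text \<open>\<open>FE (opr (opr c r) t) x\<close> maps each \<open>y\<close> in the transitive set \<open>t\<close> to the conditions forcing \<open>x = y\<close>;
  the recursion is on \<open>x\<close> only.\<close>

definition FEH where "FEH P x f = lam (sn P) (%y. mk {p : el (fs (fs P)).
   (ALL s a. opr s a : el x --> (ALL q:el (fs (fs P)). opr q p : el (sn (fs P)) --> opr q a : el (sn (fs P)) -->
      (EX q':el (fs (fs P)). opr q' q : el (sn (fs P)) \<and>
         (EX t b. opr t b : el y \<and> (opr q' b : el (sn (fs P)) \<and> q' : el (app (app f s) t)))))) \<and>
   (ALL t b. opr t b : el y --> (ALL q:el (fs (fs P)). opr q p : el (sn (fs P)) --> opr q b : el (sn (fs P)) -->
      (EX q':el (fs (fs P)). opr q' q : el (sn (fs P)) \<and>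
         (EX s a. opr s a : el x \<and> (opr q' a : el (sn (fs P)) \<and> q' : el (app (app f s) t))))))})"
definition FE where "FE P = recF (FEH P)"

context zf
begin

lemma dft_val[df]: "dft A s ==> dft A t ==> dft A (%e. val (el (s e)) (t e))"
  unfolding val_def by (rule dft_recF[where H="%g. valH (el g)"], unfold valH_def)
    ((rule dft_image[where t="%e. mk {z : el (t e). Q e z}" for t Q, simplified el_mk_el], intro df, intro df), assumption+)

lemma dft_chk[df]: "dft A s ==> dft A t ==> dft A (%e. chk (s e) (t e))"
  unfolding chk_def by (rule dft_recF[where H="%o1 x f. mk ((%y. opr (app f y) o1) ` el x)"]) (intro df)

lemma chkA[simp]: "o1 : A ==> x : A ==> chk o1 x : A"
  using dft_in[OF dft_chk[OF dft_const dft_const], of o1 x "%_. x"] by auto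
lemma valA: "g : A ==> x : A ==> val (el g) x : A"
  using dft_in[OF dft_val[OF dft_const dft_const], of g x "%_. x"] by auto

lemma dft_FE[df]: "dft A s ==> dft A t ==> dft A (%e. FE (s e) (t e))"
  unfolding FE_def by (rule dft_recF[where H=FEH], unfold FEH_def) (intro df)+

end

definition le where "le r p q \<longleftrightarrow> opr p q : el r"

locale pos = zf +
  fixes c r assumes cA: "c : A" and rA: "r : A"
    and le_refl: "p : el c ==> le r p p"
    and le_trans: "p : el c ==> q : el c ==> s : el c ==> le r p q ==> le r q s ==> le r p s"
    and le_c: "le r p q ==> p : el c \<and> q : el c"
begin

definition FF where "FF t p x y \<longleftrightarrow> p : el (app (FE (opr (opr c r) t) x) y)"

text \<open>\<open>FF t p x y\<close> means that \<open>p\<close> forces \<open>x = y\<close>: below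
  \<open>p\<close>, whatever enters one side is densely equal to something entering the other. In
  both clauses the recursive call compares a subname of \<open>x\<close> with a subname of
  \<open>y\<close> in this order.\<close>

lemma FF: assumes "y : el t" shows "FF t p x y \<longleftrightarrow> p : el c \<and>
  (ALL s a. opr s a : el x --> (ALL q. le r q p --> le r q a --> (EX q'. le r q' q \<and> (EX u b. opr u b : el y \<and> le r q' b \<and> FF t q' s u)))) \<and>
  (ALL u b. opr u b : el y --> (ALL q. le r q p --> le r q b --> (EX q'. le r q' q \<and> (EX s a. opr s a : el x \<and> le r q' a \<and> FF t q' s u))))"
proof -
  let ?P = "opr (opr c r) t"
  have "app (FE ?P x) y = mk {p : el c.
   (ALL s a. opr s a : el x --> (ALL q:el c. opr q p : el r --> opr q a : el r -->
      (EX q':el c. opr q' q : el r \<and> (EX t b. opr t b : el y \<and> (opr q' b : el r \<and> q' : el (app (app (lam (tc x) (FE ?P)) s) t)))))) \<and>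
   (ALL t b. opr t b : el y --> (ALL q:el c. opr q p : el r --> opr q b : el r -->
      (EX q':el c. opr q' q : el r \<and> (EX s a. opr s a : el x \<and> (opr q' a : el r \<and> q' : el (app (app (lam (tc x) (FE ?P)) s) t))))))}"
    unfolding FE_def by (subst recF, unfold FEH_def sn_opr fs_opr, subst app_lam) (use assms in simp_all)
  then have *: "el (app (FE ?P x) y) = {p : el c.
   (ALL s a. opr s a : el x --> (ALL q:el c. opr q p : el r --> opr q a : el r -->
      (EX q':el c. opr q' q : el r \<and> (EX t b. opr t b : el y \<and> (opr q' b : el r \<and> q' : el (app (app (lam (tc x) (FE ?P)) s) t)))))) \<and>
   (ALL t b. opr t b : el y --> (ALL q:el c. opr q p : el r --> opr q b : el r -->
      (EX q':el c. opr q' q : el r \<and> (EX s a. opr s a : el x \<and> (opr q' a : el r \<and> q' : el (app (app (lam (tc x) (FE ?P)) s) t))))))}"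
    by (simp only: el_mk_el)
  have **: "app (lam (tc x) (FE ?P)) s = FE ?P s" if "opr s a : el x" for s a
    using opr_el_TC(1)[OF that] by simp
  have cc: "(ALL q:el c. opr q p : el r --> Q q) \<longleftrightarrow> (ALL q. le r q p --> Q q)" for p Q using le_c unfolding le_def by blast
  have cd: "(EX q:el c. opr q p : el r \<and> Q q) \<longleftrightarrow> (EX q. le r q p \<and> Q q)" for p Q using le_c unfolding le_def by blast
  show ?thesis unfolding FF_def * mem_Collect_eq cc cd unfolding le_def
    by (intro conj_cong iff_allI imp_cong iff_exI HOL.refl) (simp_all only: **)
qed

lemma FF_mono: assumes "y : el t" "FF t p x y" "le r q p" shows "FF t q x y"
proof -
  have "le r w p" if "le r w q" for w using le_trans assms(3) that le_c by blast
  then show ?thesis using assms le_c[OF assms(3)] unfolding FF[OF assms(1), of p] FF[OF assms(1), of q] by blast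
qed

lemma FF_dense: assumes y: "y : el t" and p: "p : el c" and d: "!!q. le r q p ==> EX q'. le r q' q \<and> FF t q' x y"
  shows "FF t p x y"
  unfolding FF[OF y, of p]
proof (intro conjI allI impI)
  show "p : el c" by fact
next
  fix s a q assume *: "opr s a : el x" "le r q p" "le r q a"
  obtain q1 where q1: "le r q1 q" "FF t q1 x y" using d *(2) by blast
  have "le r q1 q1" "le r q1 a" using q1 * le_refl le_trans le_c by blast+
  then obtain q' where "le r q' q1" "EX u b. opr u b : el y \<and> le r q' b \<and> FF t q' s u" using q1(2) *(1) unfolding FF[OF y] by blast
  then show "EX q'. le r q' q \<and> (EX u b. opr u b : el y \<and> le r q' b \<and> FF t q' s u)" using q1 le_trans le_c by blast
next
  fix u b q assume *: "opr u b : el y" "le r q p" "le r q b"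
  obtain q1 where q1: "le r q1 q" "FF t q1 x y" using d *(2) by blast
  have "le r q1 q1" "le r q1 b" using q1 * le_refl le_trans le_c by blast+
  then obtain q' where "le r q' q1" "EX s a. opr s a : el x \<and> le r q' a \<and> FF t q' s u" using q1(2) *(1) unfolding FF[OF y] by blast
  then show "EX q'. le r q' q \<and> (EX s a. opr s a : el x \<and> le r q' a \<and> FF t q' s u)" using q1 le_trans le_c by blast
qed

lemma dfb_FF: "dft A t ==> dft A p ==> dft A x ==> dft A y ==> dfb A (%e. FF (t e) (p e) (x e) (y e))"
  unfolding FF_def by (intro df cA rA)

end

locale gen = pos +
  fixes G assumes Gc: "G <= el c" and Gne: "G ~= {}"
    and Gup: "p : G ==> le r p q ==> q : G"
    and Gdir: "p : G ==> q : G ==> EX s:G. le r s p \<and> le r s q"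
    and Ggen: "D : A ==> el D <= el c ==> (!!p. p : el c ==> EX d:el D. le r d p) ==> G Int el D ~= {}"
begin

lemma Ggen2: assumes Q: "dfb A (%e. Q (e 0))" and d: "!!p. p : el c ==> EX d. le r d p \<and> Q d"
  shows "EX p:G. Q p"
proof -
  let ?D = "mk {p : el c. Q p}"
  have "?D : A" by (rule sepA[OF Q cA])
  then have "G Int el ?D ~= {}" using d le_c by (intro Ggen) (auto, blast)
  then show ?thesis by auto
qed

lemma dfb_le[df]: "dft A s ==> dft A t ==> dfb A (%e. le r (s e) (t e))"
  unfolding le_def by (intro df rA)

text \<open>A predicate dense only below \<open>p\<close> is made dense everywhere by adding the
  conditions without a common extension with \<open>p\<close>; these cannot belong to a filter
  containing \<open>p\<close>.\<close>

lemma Ggen_below: assumes Q: "dfb A (%e. Q (e 0))" and p: "p : G"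
  and d: "!!q. le r q p ==> EX d. le r d q \<and> Q d"
  shows "EX q:G. le r q p \<and> Q q"
proof -
  have pA: "p : A" using p Gc el_subA[OF cA] by auto
  let ?R = "%q. (le r q p \<and> Q q) \<or> (ALL s:el c. le r s q --> \<not> le r s p)"
  have "EX q:G. ?R q"
  proof (rule Ggen2)
    show "dfb A (%e. ?R (e 0))" by (intro df df1[OF Q] pA cA)
    fix q assume q: "q : el c"
    show "EX d. le r d q \<and> ?R d"
    proof (cases "EX s. le r s q \<and> le r s p")
      case True
      then obtain s where s: "le r s q" "le r s p" by blast
      then obtain d where "le r d s" "Q d" using d by blast
      then show ?thesis using s le_trans le_c by blast
    next
      case False then show ?thesis using q le_refl by blast
    qed
  qed
  then obtain q where q: "q : G" "?R q" by blast
  obtain s where "s : G" "le r s q" "le r s p" using Gdir q p by blast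
  then have "le r q p \<and> Q q" using q(2) le_c by blast
  then show ?thesis using q by blast
qed

lemma truth: assumes tA: "t : A" and t: "trn t"
  shows "x : A --> y : el t --> (val G x = val G y \<longleftrightarrow> (EX p:G. FF t p x y))"
proof (induction x arbitrary: y rule: TC_induct)
  case (step x)
  show ?case
  proof (intro impI)
    assume xA: "x : A" and y: "y : el t"
    have yA: "y : A" using y tA Atrans by blast
    have IH: "val G s = val G u \<longleftrightarrow> (EX p:G. FF t p s u)" if "opr s a : el x" "opr u b : el y" for s a u b
    proof -
      have "u : el t"
      proof -
        have "TC y <= el t" using t y unfolding trn_def by (intro TC_least) auto
        then show ?thesis using opr_el_TC that by blast
      qed
      moreover have "s : TC x" "s : A" using that opr_el_TC opr_elA xA by blast+
      ultimately show ?thesis using step by blast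
    qed
    have tu: "u : el t" if "opr u b : el y" for u b
    proof -
      have "TC y <= el t" using t y unfolding trn_def by (intro TC_least) auto
      then show ?thesis using opr_el_TC that by blast
    qed
    define N1 where "N1 p \<longleftrightarrow> (EX u b. opr u b : el y \<and> (EX s a. opr s a : el x \<and> (le r p a \<and> le r p b \<and> FF t p s u)))" for p
    define L where "L s p \<longleftrightarrow> (EX u b. opr u b : el y \<and> le r p b \<and> FF t p s u)" for s p
    define R where "R u p \<longleftrightarrow> (EX s a. opr s a : el x \<and> le r p a \<and> FF t p s u)" for u p
    have dL: "dft A s ==> dft A p ==> dfb A (%e. L (s e) (p e))" for s p
      by (rule df2[where Q=L], unfold L_def) (intro df dfb_FF yA tA)+
    have dR: "dft A s ==> dft A p ==> dfb A (%e. R (s e) (p e))" for s p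
      by (rule df2[where Q=R], unfold R_def) (intro df dfb_FF xA tA)+
    have F: "FF t p x y \<longleftrightarrow> p : el c \<and> (ALL s a. opr s a : el x --> (ALL q. le r q p --> le r q a --> (EX q'. le r q' q \<and> L s q'))) \<and>
       (ALL u b. opr u b : el y --> (ALL q. le r q p --> le r q b --> (EX q'. le r q' q \<and> R u q')))" for p
      unfolding L_def R_def by (rule FF[OF y])
    show "val G x = val G y \<longleftrightarrow> (EX p:G. FF t p x y)"
    proof
      assume "EX p:G. FF t p x y"
      then obtain p where p: "p : G" "FF t p x y" by blast
      show "val G x = val G y"
      proof (rule ext_el, intro set_eqI iffI)
        fix z assume "z : el (val G x)"
        then obtain s a where s: "opr s a : el x" "a : G" "z = val G s" by (auto simp: el_val)
        obtain q where q: "q : G" "le r q p" "le r q a" using Gdir p s by blast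
        have "EX q':G. le r q' q \<and> L s q'"
        proof (rule Ggen_below[OF dL q(1)])
          show "dft A (%_. s)" by (rule dft_const) (use s xA opr_elA in blast)
          show "EX d. le r d q' \<and> L s d" if "le r q' q" for q'
          proof -
            have "le r q' p" "le r q' a" using that q le_trans le_c by blast+
            then show ?thesis using p(2) s(1) unfolding F by blast
          qed
        qed (rule df)
        then obtain q' where q': "q' : G" "L s q'" by blast
        then obtain u b where u: "opr u b : el y" "le r q' b" "FF t q' s u" unfolding L_def by blast
        then have "val G s = val G u" "b : G" using IH s q' Gup by blast+
        then show "z : el (val G y)" using u s by (auto simp: el_val)
      next
        fix z assume "z : el (val G y)"
        then obtain u b where s: "opr u b : el y" "b : G" "z = val G u" by (auto simp: el_val)
        obtain q where q: "q : G" "le r q p" "le r q b" using Gdir p s by blast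
        have "EX q':G. le r q' q \<and> R u q'"
        proof (rule Ggen_below[OF dR q(1)])
          show "dft A (%_. u)" by (rule dft_const) (use s yA opr_elA in blast)
          show "EX d. le r d q' \<and> R u d" if "le r q' q" for q'
          proof -
            have "le r q' p" "le r q' b" using that q le_trans le_c by blast+
            then show ?thesis using p(2) s(1) unfolding F by blast
          qed
        qed (rule df)
        then obtain q' where q': "q' : G" "R u q'" by blast
        then obtain w a where u: "opr w a : el x" "le r q' a" "FF t q' w u" unfolding R_def by blast
        then have "val G w = val G u" "a : G" using IH s q' Gup by blast+
        then show "z : el (val G x)" using u(1) s(3) unfolding el_val by (intro CollectI exI[of _ w] exI[of _ a]) simp
      qed
    next
      assume eq: "val G x = val G y"
      \<comment> \<open>Densely, a condition forces equality or exhibits an element of one side that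
        no stronger condition makes equal to an element of the other. If the values are equal, the
        last two alternatives contradict the induction hypothesis.\<close>
      let ?Q = "%p. FF t p x y \<or> (EX s a. opr s a : el x \<and> (le r p a \<and> (ALL q:el c. le r q p --> \<not> L s q))) \<or>
         (EX u b. opr u b : el y \<and> (le r p b \<and> (ALL q:el c. le r q p --> \<not> R u q)))"
      have "EX p:G. ?Q p"
      proof (rule Ggen2)
        show "dfb A (%e. ?Q (e 0))" by (intro df dL dR dfb_FF xA yA tA cA)
        fix p assume p: "p : el c"
        show "EX d. le r d p \<and> ?Q d"
        proof (cases "FF t p x y")
          case True then show ?thesis using p le_refl by blast
        next
          case False
          then consider (1) s a q where "opr s a : el x" "le r q p" "le r q a" "!!q'. le r q' q ==> \<not> L s q'"
            | (2) u b q where "opr u b : el y" "le r q p" "le r q b" "!!q'. le r q' q ==> \<not> R u q'"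
            unfolding F using p by blast
          then show ?thesis by cases blast+
        qed
      qed
      then obtain p where p: "p : G" "?Q p" by blast
      from p(2) show "EX p:G. FF t p x y"
      proof (elim disjE)
        assume "FF t p x y" then show ?thesis using p by blast
      next
        assume "EX s a. opr s a : el x \<and> (le r p a \<and> (ALL q:el c. le r q p --> \<not> L s q))"
        then obtain s a where s: "opr s a : el x" "le r p a" "!!q. le r q p ==> \<not> L s q" using le_c by blast
        then have "a : G" using p(1) Gup by blast
        then have "val G s : el (val G x)" using s(1) unfolding el_val by blast
        then obtain u b where u: "opr u b : el y" "b : G" "val G s = val G u" unfolding eq by (auto simp: el_val)
        then obtain p' where p': "p' : G" "FF t p' s u" using IH s by blast
        obtain q1 where "q1 : G" "le r q1 p'" "le r q1 b" using Gdir p' u by blast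
        moreover obtain q where "q : G" "le r q q1" "le r q p" using Gdir calculation p by blast
        ultimately have "le r q p" "le r q b" "le r q p'" using le_trans le_c by blast+
        then have "L s q" unfolding L_def using u FF_mono[OF tu p'(2)] by blast
        then show ?thesis using s \<open>le r q p\<close> by blast
      next
        assume "EX u b. opr u b : el y \<and> (le r p b \<and> (ALL q:el c. le r q p --> \<not> R u q))"
        then obtain u b where s: "opr u b : el y" "le r p b" "!!q. le r q p ==> \<not> R u q" using le_c by blast
        then have "b : G" using p(1) Gup by blast
        then have "val G u : el (val G y)" using s(1) unfolding el_val by blast
        then obtain w a where u: "opr w a : el x" "a : G" "val G w = val G u" unfolding eq[symmetric] by (auto simp: el_val)
        then obtain p' where p': "p' : G" "FF t p' w u" using IH s by blast
        obtain q1 where "q1 : G" "le r q1 p'" "le r q1 a" using Gdir p' u by blast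
        moreover obtain q where "q : G" "le r q q1" "le r q p" using Gdir calculation p by blast
        ultimately have "le r q p" "le r q a" "le r q p'" using le_trans le_c by blast+
        then have "R u q" unfolding R_def using u FF_mono[OF tu[OF s(1)] p'(2)] by blast
        then show ?thesis using s \<open>le r q p\<close> by blast
      qed
    qed
  qed
qed

lemma trn_tc: "trn (tc x)" unfolding trn_def using TC_el2 by auto

text \<open>The trace of a set of the extension on a ground model set \<open>w\<close> is described
  by the conditions forcing \<open>y\<close> into it. So a relation between \<open>w\<close> and the
  poset serves as a name, however complicated \<open>x\<close> is.\<close>

lemma nice: assumes x: "x : A" and w: "w : A" and o1: "o1 : G"
  shows "EX rho:A. el (val G x) Int el w = {y : el w. EX q:G. opr y q : el rho}"
proof -
  let ?t = "tc x"
  have oA: "o1 : A" using o1 Gc el_subA[OF cA] by auto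
  let ?Q = "%y q. EX u b. opr u b : el x \<and> (le r q b \<and> FF ?t q (chk o1 y) u)"
  let ?rho = "mk {z : el (prd w c). ?Q (fs z) (sn z)}"
  have dQ: "dfb A (%e. ?Q (fs (e 0)) (sn (e 0)))" by (intro df dfb_FF x oA tcA)
  have er: "el ?rho = {z : el (prd w c). ?Q (fs z) (sn z)}" by (simp only: el_mk_el)
  have "?rho : A" by (rule sepA[OF dQ]) (use w cA in simp)
  moreover have "el (val G x) Int el w = {y : el w. EX q:G. opr y q : el ?rho}"
  proof (intro set_eqI iffI)
    fix y assume "y : el (val G x) Int el w"
    then obtain u b where u: "opr u b : el x" "b : G" "y = val G u" and y: "y : el w" by (auto simp: el_val)
    have "val G (chk o1 y) = val G u" using u val_chk[OF o1] by simp
    moreover have "chk o1 y : A" using y w Atrans oA by auto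
    moreover have "u : el ?t" using u opr_el_TC by simp
    ultimately obtain p where p: "p : G" "FF ?t p (chk o1 y) u" using truth[OF tcA[OF x] trn_tc] by blast
    obtain q where q: "q : G" "le r q p" "le r q b" using Gdir p u by blast
    then have "FF ?t q (chk o1 y) u" using FF_mono[OF \<open>u : el ?t\<close> p(2)] by blast
    then have "opr y q : el ?rho" unfolding er using u q y Gc by (auto simp: el_prd)
    then show "y : {y : el w. EX q:G. opr y q : el ?rho}" using q y by blast
  next
    fix y assume "y : {y : el w. EX q:G. opr y q : el ?rho}"
    then obtain q u b where u: "y : el w" "q : G" "opr u b : el x" "le r q b" "FF ?t q (chk o1 y) u" unfolding er by auto
    moreover have "chk o1 y : A" using u(1) w Atrans oA by auto
    moreover have "u : el ?t" using u opr_el_TC by simp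
    ultimately have "val G (chk o1 y) = val G u" using truth[OF tcA[OF x] trn_tc] by blast
    then have "y = val G u" using val_chk[OF o1] by simp
    moreover have "b : G" using u Gup by blast
    ultimately show "y : el (val G x) Int el w" using u by (auto simp: el_val)
  qed
  ultimately show ?thesis by blast
qed

end

section \<open>The class of conditions\<close>

definition cup where "cup x y = Uni (upair x y)"
lemma el_cup[simp]: "el (cup x y) = el x Un el y" by (auto simp: cup_def)
definition low where "low b p = mk {z : el p. rank z : el b}"
definition hi where "hi b p = mk {z : el p. rank z ~: el b}"
lemma el_low[simp]: "el (low b p) = {z : el p. rank z : el b}" unfolding low_def by simp
lemma el_hi[simp]: "el (hi b p) = {z : el p. rank z ~: el b}" unfolding hi_def by simp

text \<open>The slice at tag \<open>i\<close> of a disjoint sum. Pairs of sets are coded as tagged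
  disjoint sums because, unlike a Kuratowski pair, such a sum stays inside \<open>V_(b+1)\<close>
  when \<open>b\<close> is a limit.\<close>

definition d0 where "d0 i w = mk {x : el (Uni (Uni w)). opr i x : el w}"
lemma el_d0: "el (d0 i w) = {x. opr i x : el w}"
proof -
  have "x : el (Uni (Uni w))" if "opr i x : el w" for x
  proof -
    have "upair i x : el (opr i x)" by (simp add: opr_def)
    then have "upair i x : el (Uni w)" using that unfolding el_Uni by blast
    moreover have "x : el (upair i x)" by simp
    ultimately show ?thesis unfolding el_Uni[of "Uni w"] by blast
  qed
  then show ?thesis unfolding d0_def el_mk_sub by blast
qed

lemma rank_in_limo: assumes b: "limo b" and x: "!!y. y : el x ==> rank y : el c" "c : el b" shows "rank x : el b"
proof -
  have o: "Ord b" "Ord c" using b x(2) Ord_in unfolding limo_def by blast+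
  have "el (rank x) <= el c" using x(1) o by (intro rank_le)
  then have "rank x = c \<or> rank x : el c" using Ord_subset[of "rank x" c] o by simp
  then show ?thesis using x(2) o Ord_trans by blast
qed

lemma limo_max: assumes b: "limo b" "c : el b" "d : el b" shows "EX m:el b. c : el m \<and> d : el m"
proof -
  have o: "Ord b" "Ord c" "Ord d" "succ c : el b" "succ d : el b" using b Ord_in unfolding limo_def by blast+
  have "c : el d \<or> c = d \<or> d : el c" using o Ord_linear by blast
  then show ?thesis
  proof (elim disjE)
    assume "c : el d" then show ?thesis using o by (intro bexI[of _ "succ d"]) auto
  next
    assume "c = d" then show ?thesis using o by (intro bexI[of _ "succ d"]) auto
  next
    assume "d : el c" then show ?thesis using o by (intro bexI[of _ "succ c"]) auto
  qed
qed

lemma rank_upair: assumes b: "limo b" shows "rank (upair x y) : el b \<longleftrightarrow> rank x : el b \<and> rank y : el b"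
proof
  assume u: "rank (upair x y) : el b"
  have "rank x : el (rank (upair x y))" "rank y : el (rank (upair x y))" by (auto intro: rank_mem)
  then show "rank x : el b \<and> rank y : el b" using u b Ord_trans unfolding limo_def by blast
next
  assume xy: "rank x : el b \<and> rank y : el b"
  then obtain m where "m : el b" "rank x : el m" "rank y : el m" using limo_max[OF b] by blast
  then show "rank (upair x y) : el b" by (intro rank_in_limo[OF b, of _ m]) auto
qed

lemma rank_opr: "limo b ==> rank (opr x y) : el b \<longleftrightarrow> rank x : el b \<and> rank y : el b"
  unfolding opr_def by (auto simp: rank_upair)

lemma rank_zero: "rank zero = zero" by (rule rank_Ord) simp
lemma rank_one: "rank one = one" by (rule rank_Ord) (simp add: one_def)
lemma limo_01: "limo b ==> rank zero : el b \<and> rank one : el b"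
  by (simp only: rank_zero rank_one) (auto simp: limo_def one_def)

context zf
begin

lemma dft_cup[df]: "dft A s ==> dft A t ==> dft A (%e. cup (s e) (t e))" unfolding cup_def by (intro df)
lemma cupA[simp]: "x : A ==> y : A ==> cup x y : A" unfolding cup_def by (intro UniA pairA)
lemma dft_low[df]: "dft A s ==> dft A t ==> dft A (%e. low (s e) (t e))"
  by (rule dff2[where f=low], unfold low_def) (intro df)+
lemma dft_hi[df]: "dft A s ==> dft A t ==> dft A (%e. hi (s e) (t e))"
  by (rule dff2[where f=hi], unfold hi_def) (intro df)+
lemma lowA[simp]: "x : A ==> y : A ==> low x y : A"
  using dft_in[OF dft_low[OF dft_const dft_const], of x y "%_. x"] by auto
lemma hiA[simp]: "x : A ==> y : A ==> hi x y : A"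
  using dft_in[OF dft_hi[OF dft_const dft_const], of x y "%_. x"] by auto
lemma dft_d0[df]: "dft A s ==> dft A t ==> dft A (%e. d0 (s e) (t e))"
  by (rule dff2[where f=d0], unfold d0_def) (intro df)+
lemma dfb_limo[df]: "dft A t ==> dfb A (%e. limo (t e))"
  by (rule df1[where Q=limo], unfold limo_def) (intro df zeroA)+

lemma limo_ex: "b : A ==> Ord b ==> EX c:A. limo c \<and> b : el c"
proof -
  assume b: "b : A" "Ord b"
  have "clC (%b c. True)" unfolding clC_def by (auto intro: dfb_const bexI[of _ zero])
  from closed_ex[OF this b] show ?thesis unfolding closed_def by blast
qed

definition nl where "nl b = OL (%c. limo c \<and> rank b : el c)"
lemma nl: assumes "b : A" shows "nl b : A" "limo (nl b)" "rank b : el (nl b)"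
  "!!c. limo c ==> rank b : el c ==> el (nl b) <= el c"
proof -
  obtain c where c: "c : A" "limo c" "rank b : el c" using limo_ex[of "rank b"] assms by auto
  have oc: "Ord c" using c unfolding limo_def by simp
  note o = OL[of "%c. limo c \<and> rank b : el c" c, folded nl_def, OF conjI[OF c(2,3)] oc]
  show "limo (nl b)" "rank b : el (nl b)" using o(2) by auto
  show le: "el (nl b) <= el c" if "limo c" "rank b : el c" for c
  proof -
    have "Ord c" using that unfolding limo_def by simp
    then show ?thesis using o(3)[of c] that Ord_linear[OF o(1), of c] Ord_subset[OF o(1), of c] by blast
  qed
  show "nl b : A" using le[OF c(2,3)] Ord_subset[OF o(1) oc] c(1) Atrans by blast
qed
lemma dft_nl[df]: "dft A t ==> dft A (%e. nl (t e))"
proof (rule dff1[where f=nl], unfold nl_def, rule dft_OL)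
  show "dfb A (%e. limo (e 0) \<and> rank (e (Suc 0)) : el (e 0))" by (intro df)
  show "EX a:A. Ord a \<and> limo a \<and> rank (e 0) : el a" if "range e <= A" for e :: "nat => hset"
  proof -
    have "e 0 : A" using that by blast
    then obtain c where "c : A" "limo c" "rank (e 0) : el c" using limo_ex[of "rank (e 0)"] by auto
    then show ?thesis unfolding limo_def by blast
  qed
qed

lemma dft_VV[df]: "dft A t ==> dft A (%e. VV (rank (t e)))"
proof (rule dff1[where f="%x. VV (rank x)"], rule dft_setI)
  show "VV (rank (e 0)) : A" if "range e <= A" for e :: "nat => hset"
    using VVA[OF Ord_rank rankA, of "e 0"] that by blast
  show "dfb A (%e. e 0 : el (VV (rank (e (Suc 0)))))" by (intro dfb_VV df)
qed

text \<open>Transfinite recursion applies \<open>g\<close> to what is left of \<open>x\<close>. It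
  has to stop: otherwise the ordinals would inject into \<open>x\<close>, and collection would put
  all ordinals of the model into one set.\<close>

lemma enum: assumes x: "x : A" and g: "g : A" "!!y. y : A ==> el y <= el x ==> el y ~= {} ==> app g y : el y"
  shows "EX l:A. EX f:A. Ord l \<and> app f ` el l = el x \<and> inj_on (app f) (el l)"
proof -
  define H where "H P z h = app (fs P) (mk {w : el (sn P). \<not> (EX k:el z. app h k = w)})" for P z h
  define En where "En = recF (H (opr g x))"
  define R where "R z = mk {w : el x. \<not> (EX k:el z. En k = w)}" for z
  have PA: "opr g x : A" using x g by simp
  have dE: "dft A t ==> dft A (%e. En (t e))" for t
    unfolding En_def by (rule dft_recF[where H=H and s="%_. opr g x"], unfold H_def) (intro df PA)+
  have dR: "dft A t ==> dft A (%e. R (t e))" for t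
    by (rule dff1[where f=R], unfold R_def) (intro df dE x)+
  have E: "En z = app g (R z)" for z
  proof -
    have "{w : el x. \<not> (EX k:el z. app (lam (tc z) En) k = w)} = {w : el x. \<not> (EX k:el z. En k = w)}"
      using TC_el by auto
    then show ?thesis unfolding R_def by (subst En_def, subst recF) (simp add: H_def En_def)
  qed
  have elR: "el (R z) = {w : el x. \<not> (EX k:el z. En k = w)}" for z unfolding R_def by simp
  have RA: "R z : A" if "z : A" for z using dft_in[OF dR[OF dft_const], of z "%_. z"] that by auto
  have ER: "En z : el (R z)" if "z : A" "el (R z) ~= {}" for z unfolding E using that RA by (intro g) (auto simp: elR)
  have inj: "En k ~= En z" if "z : A" "el (R z) ~= {}" "k : el z" for z k using ER[OF that(1,2)] that(3) elR by auto
  have "EX l:A. Ord l \<and> el (R l) = {}"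
  proof (rule ccontr)
    assume n: "\<not> ?thesis"
    have u: "k = l" if "k : A" "l : A" "Ord k" "Ord l" "En k = En l" for k l
    proof -
      have "el (R k) ~= {}" "el (R l) ~= {}" using n that by blast+
      then show ?thesis using inj[of k l] inj[of l k] that Ord_linear[of k l] by auto
    qed
    have "dfb A (%e. e 0 : el x --> (EX k:A. Ord k \<and> En k = e 0) --> Ord (e 1) \<and> En (e 1) = e 0)"
      by (intro df dE x)
    from collection[where \<Phi>="%w k. w : el x --> (EX k:A. Ord k \<and> En k = w) --> Ord k \<and> En k = w", OF this x]
    obtain Y where Y: "Y : A" "ALL w:el x. EX k:el Y. w : el x --> (EX k:A. Ord k \<and> En k = w) --> Ord k \<and> En k = w"
      using x by blast
    have all: "k : el Y" if k: "k : A" "Ord k" for k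
    proof -
      have "En k : el x" using ER[OF k(1)] n k elR by auto
      then obtain k' where "k' : el Y" "Ord k' \<and> En k' = En k" using Y k by blast
      then show ?thesis using u k Y(1) Atrans by blast
    qed
    have "rank Y : el Y" using all[of "rank Y"] Y by simp
    then show False using rank_mem[of "rank Y" Y] rank_Ord[of "rank Y"] by simp
  qed
  then obtain l0 where l0: "l0 : A" "Ord l0" "el (R l0) = {}" by blast
  then obtain l where l: "Ord l" "el (R l) = {}" "ALL k:el l. el (R k) ~= {}" using Ord_least[of "%l. el (R l) = {}" l0] by blast
  have "l = l0 \<or> l : el l0" using Ord_linear[OF l(1) l0(2)] l l0 by blast
  then have lA: "l : A" using l0 Atrans by blast
  have "dft A (%e. lam (e 0) En)" by (intro df dE)
  from dft_in[OF this, of "%_. l"] have fA: "lam l En : A" using lA by auto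
  have "app (lam l En) ` el l = En ` el l" by (intro image_cong) auto
  also have "... = el x"
  proof (intro set_eqI iffI)
    fix w assume "w : En ` el l"
    then obtain k where k: "k : el l" "w = En k" by blast
    then have "En k : el (R k)" using ER[of k] l(3) Atrans[OF lA] by blast
    then show "w : el x" using k unfolding elR by simp
  next
    fix w assume "w : el x"
    then show "w : En ` el l" using l(2) unfolding elR by blast
  qed
  finally have 1: "app (lam l En) ` el l = el x" .
  have "inj_on En (el l)"
  proof (rule inj_onI)
    fix j k assume jk: "j : el l" "k : el l" "En j = En k"
    then have "j : A" "k : A" "Ord j" "Ord k" using lA Atrans l(1) Ord_in by blast+
    moreover have "el (R j) ~= {}" "el (R k) ~= {}" using l(3) jk by blast+
    ultimately show "j = k" using inj[of j k] inj[of k j] jk(3) Ord_linear[of j k] by auto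
  qed
  then have "inj_on (app (lam l En)) (el l)" by (simp add: inj_on_def)
  then show ?thesis using 1 lA fA l(1) by blast
qed

text \<open>\<open>VV (rank (succ b))\<close> is \<open>V_(b+1)\<close>; the \<open>rank\<close> makes it a total term.\<close>

definition sm where "sm b X \<longleftrightarrow> (EX f:A. ALL z:el X. EX u:el (VV (rank (succ b))). app f u = z)"
lemma dfb_sm[df]: "dft A s ==> dft A t ==> dfb A (%e. sm (s e) (t e))"
  by (rule df2[where Q=sm], unfold sm_def) (intro df)+

lemma sm_sub: "sm b X ==> el Y <= el X ==> sm b Y" unfolding sm_def by blast
lemma VV_succ: "Ord b ==> el (VV (rank (succ b))) = {x : A. rank x = b \<or> rank x : el b}" by (auto simp: rank_Ord)

lemma sm_V: assumes "b : A" "Ord b" "el X <= el (VV (rank (succ b)))" shows "sm b X"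
proof -
  let ?V = "VV (rank (succ b))"
  have "?V : A" using assms by (intro VVA) auto
  then have "dft A (%e. lam ?V (%u. u))" by (intro df)
  from dft_in[OF this, of "%_. b"] have "lam ?V (%u. u) : A" using assms by auto
  moreover have "app (lam ?V (%u. u)) z = z" if "z : el X" for z using assms that by (intro app_lam) blast
  ultimately show ?thesis unfolding sm_def using assms(3) by (intro bexI[of _ "lam ?V (%u. u)"]) blast+
qed

lemma sm_mono: assumes "sm b X" "b : el c" "c : A" "Ord c" shows "sm c X"
proof -
  have "Ord b" using assms Ord_in by blast
  then have "el (VV (rank (succ b))) <= el (VV (rank (succ c)))" unfolding VV_succ[OF \<open>Ord b\<close>] VV_succ[OF assms(4)]
    using assms Ord_trans by blast
  then show ?thesis using assms(1) unfolding sm_def by blast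
qed

lemma pair_V: assumes b: "limo b" "b : A" and u: "u : el (VV (rank (succ b)))" "v : el (VV (rank (succ b)))"
  shows "EX w:el (VV (rank (succ b))). d0 zero w = u \<and> d0 one w = v"
proof -
  have o: "Ord b" using b unfolding limo_def by simp
  let ?w = "cup (mk ((%x. opr zero x) ` el u)) (mk ((%x. opr one x) ` el v))"
  have uv: "u : A" "v : A" "!!x. x : el u ==> rank x : el b" "!!x. x : el v ==> rank x : el b"
  proof -
    show "u : A" "v : A" using u by auto
    have rr: "rank x : el b" if "x : el w" "rank w = b \<or> rank w : el b" for x w
      using rank_mem[OF that(1)] Ord_trans[OF o, of "rank w" "rank x"] that(2) by auto
    show "!!x. x : el u ==> rank x : el b" "!!x. x : el v ==> rank x : el b"
      using rr u unfolding VV_succ[OF o] by simp_all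
  qed
  have "dft A (%e. cup (mk ((%x. opr zero x) ` el (e 0))) (mk ((%x. opr one x) ` el (e 1))))" by (intro df zeroA oneA)
  from dft_in[OF this, of "%n. if n = 0 then u else v"] have wA: "?w : A" using uv by auto
  have "rank z : el b" if "z : el ?w" for z using that uv limo_01[OF b(1)] by (auto simp: rank_opr[OF b(1)])
  then have "el (rank ?w) <= el b" by (intro rank_le o)
  then have "rank ?w = b \<or> rank ?w : el b" using Ord_subset[of "rank ?w" b] o by simp
  then have "?w : el (VV (rank (succ b)))" unfolding VV_succ[OF o] using wA by simp
  moreover have "d0 zero ?w = u" "d0 one ?w = v" by (rule ext_el, auto simp: el_d0)+
  ultimately show ?thesis by blast
qed

end

context zfL
begin

text \<open>\<open>WL\<close> chooses enumerations of all the sets \<open>X i\<close> at once, and a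
  pair of an argument for \<open>i\<close> and an argument for the element of \<open>X i\<close> is
  coded by one element of \<open>V_(b+1)\<close>.\<close>

lemma sm_UN: assumes b: "limo b" "b : A" and X: "dft A (%e. X (e 0))" and I: "I : A" "sm b I"
  and s: "!!i. i : el I ==> sm b (X i)"
  shows "sm b (mk (\<Union>i\<in>el I. el (X i)))"
proof -
  let ?V = "VV (rank (succ b))"
  have VA: "?V : A" using b by (intro VVA) auto
  define Q where "Q i f \<longleftrightarrow> (i : el I --> (ALL z:el (X i). EX u:el ?V. app f u = z))" for i f
  have dX: "dft A t ==> dft A (%e. X (t e))" for t by (rule dff1[OF X])
  have dQ: "dfb A (%e. Q (e (Suc 0)) (e 0))" unfolding Q_def by (intro df dX I VA)
  have exQ: "EX f:A. Q i f" for i using s[of i] zeroA unfolding Q_def sm_def by blast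
  have dF: "dft A t ==> dft A (%e. WL (Q (t e)))" for t
    by (rule dff1[where f="%i. WL (Q i)"], rule dft_WL[OF dQ]) (use exQ in auto)
  have F: "Q i (WL (Q i))" for i using exQ WL(2) by blast
  obtain g where g: "g : A" "ALL i:el I. EX u:el ?V. app g u = i" using I unfolding sm_def by blast
  let ?h = "lam ?V (%w. app (WL (Q (app g (d0 zero w)))) (d0 one w))"
  have "dft A (%e. ?h)" by (intro df dF VA g zeroA oneA)
  from dft_in[OF this, of "%_. b"] have hA: "?h : A" using b by auto
  have "EX w:el ?V. app ?h w = z" if z: "i : el I" "z : el (X i)" for i z
  proof -
    obtain u where u: "u : el ?V" "app g u = i" using g z by blast
    obtain v where v: "v : el ?V" "app (WL (Q i)) v = z" using F[of i] z unfolding Q_def by blast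
    obtain w where w: "w : el ?V" "d0 zero w = u" "d0 one w = v" using pair_V[OF b u(1) v(1)] by blast
    have "app ?h w = z" using w u v by simp
    then show ?thesis using w by blast
  qed
  moreover have "el (mk (\<Union>i\<in>el I. el (X i))) = (\<Union>i\<in>el I. el (X i))" by (rule el_mk) auto
  ultimately show ?thesis unfolding sm_def using hA by (intro bexI[of _ ?h]) (simp, blast)
qed

lemma sm_upair: assumes b: "limo b" "b : A" "p : A" "q : A" shows "sm b (upair p q)"
proof -
  have o: "Ord b" using b unfolding limo_def by simp
  let ?f = "upair (opr zero p) (opr one q)"
  have "?f : A" using b by simp
  moreover have "app ?f zero = p" "app ?f one = q" by (rule app_unique; auto)+
  moreover have "zero : el (VV (rank (succ b)))" "one : el (VV (rank (succ b)))"
    unfolding VV_succ[OF o] using limo_01[OF b(1)] by auto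
  ultimately show ?thesis unfolding sm_def el_upair by (intro bexI[of _ ?f]) blast+
qed

lemma sm_cup: assumes b: "limo b" "b : A" "p : A" "q : A" "sm b p" "sm b q" shows "sm b (cup p q)"
proof -
  have "sm b (mk (\<Union>i\<in>el (upair p q). el i))"
    by (rule sm_UN[OF b(1,2) dft_var]) (use b sm_upair in auto)
  moreover have "mk (\<Union>i\<in>el (upair p q). el i) = cup p q" by (rule ext_el) simp
  ultimately show ?thesis by simp
qed

lemma sm_image: assumes b: "b : A" and X: "sm b X" and f: "dft A (%e. f (e 0))" and Y: "el Y <= f ` el X" shows "sm b Y"
proof -
  let ?V = "VV (rank (succ b))"
  have VA: "?V : A" using b by (intro VVA) auto
  obtain g where g: "g : A" "ALL i:el X. EX u:el ?V. app g u = i" using X unfolding sm_def by blast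
  have "dft A (%e. lam ?V (%u. f (app g u)))" by (intro df dff1[OF f] VA g)
  from dft_in[OF this, of "%_. b"] have hA: "lam ?V (%u. f (app g u)) : A" using b by auto
  have "EX u:el ?V. app (lam ?V (%u. f (app g u))) u = z" if z: "z : el Y" for z
  proof -
    obtain i where i: "i : el X" "z = f i" using Y z by blast
    then obtain u where "u : el ?V" "app g u = i" using g by blast
    then show ?thesis using i by (intro bexI[of _ u]) auto
  qed
  then show ?thesis unfolding sm_def using hA by blast
qed

lemma sm_prd: assumes b: "limo b" "b : A" "I : A" "J : A" "sm b I" "sm b J" shows "sm b (prd I J)"
  unfolding prd_def
proof (rule sm_UN[OF b(1,2)])
  show "dft A (%e. mk ((%c. opr (e 0) c) ` el J))" by (intro df b)
  show "sm b (mk ((%c. opr i c) ` el J))" if "i : el I" for i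
    by (rule sm_image[OF b(2,6), of "%c. opr i c"]) (use b Atrans that in \<open>auto intro!: df\<close>)
qed fact+

section \<open>Easton-style conditions and their factors\<close>

definition fnc where "fnc p \<longleftrightarrow> (ALL z:el p. EX x y. z = opr x y \<and> (y = zero \<or> y = one)) \<and>
   (ALL x y. opr x y : el p --> (ALL x' y'. opr x' y' : el p --> x = x' --> y = y'))"
text \<open>The support is bounded at \<open>nl b\<close>, one limit beyond \<open>b\<close>. This
  leaves room for new coordinates between \<open>b\<close> and \<open>nl b\<close>, while a union
  indexed by an image of \<open>V_(b+1)\<close> keeps the bounds at \<open>b\<close> and at every
  later limit.\<close>

definition isc where "isc p \<longleftrightarrow> p : A \<and> fnc p \<and> (ALL b:A. limo b --> sm b (low (nl b) p))"
definition Pc where "Pc a p \<longleftrightarrow> isc p \<and> (ALL z:el p. rank z ~: el a)"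

lemma dfb_isc[df]: "dft A t ==> dfb A (%e. isc (t e))"
proof (rule df1[where Q=isc])
  have "dfb A (%e. fnc (e 0) \<and> (ALL b:A. limo b --> sm b (low (nl b) (e 0))))" unfolding fnc_def by (intro df zeroA oneA)
  then show "dfb A (%e. isc (e 0))" by (rule dfb_cong) (auto simp: isc_def)
qed
lemma dfb_Pc[df]: "dft A s ==> dft A t ==> dfb A (%e. Pc (s e) (t e))"
  by (rule df2[where Q=Pc], unfold Pc_def) (intro df)+

lemma fnc_sub: assumes "fnc p" "el q <= el p" shows "fnc q"
  unfolding fnc_def
proof (intro conjI ballI allI impI)
  show "EX x y. z = opr x y \<and> (y = zero \<or> y = one)" if "z : el q" for z
    using assms(1)[unfolded fnc_def, THEN conjunct1] assms(2) that by blast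
  fix x y x' y' assume "opr x y : el q" "opr x' y' : el q" "x = x'"
  then show "y = y'" using assms(1)[unfolded fnc_def, THEN conjunct2, rule_format, of x y x' y'] assms(2) by blast
qed

lemma isc_sub: assumes p: "isc p" and q: "q : A" "el q <= el p" shows "isc q"
  unfolding isc_def
proof (intro conjI ballI impI)
  show "q : A" by fact
  show "fnc q" using p q fnc_sub unfolding isc_def by blast
  fix b assume b: "b : A" "limo b"
  have "sm b (low (nl b) p)" using p b unfolding isc_def by blast
  then show "sm b (low (nl b) q)" by (rule sm_sub) (use q in auto)
qed

lemma Pc_sub: "Pc a p ==> q : A ==> el q <= el p ==> Pc a q" unfolding Pc_def using isc_sub by blast
lemma PcA: "Pc a p ==> p : A" unfolding Pc_def isc_def by blast
lemma Pc_zero: "Pc a zero"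
proof -
  have "sm b (low c zero)" for b c unfolding sm_def by (rule bexI[of _ zero]) auto
  then show ?thesis unfolding Pc_def isc_def fnc_def by auto
qed

lemma isc_cup: assumes p: "isc p" "isc q" and f: "fnc (cup p q)" shows "isc (cup p q)"
  unfolding isc_def
proof (intro conjI ballI impI f)
  show "cup p q : A" using p unfolding isc_def by simp
  fix b assume b: "b : A" "limo b"
  have "sm b (cup (low (nl b) p) (low (nl b) q))" using p b nl(1) unfolding isc_def by (intro sm_cup) auto
  then show "sm b (low (nl b) (cup p q))" by (rule sm_sub) auto
qed

lemma Pc_cup: "Pc a p ==> Pc a q ==> fnc (cup p q) ==> Pc a (cup p q)" unfolding Pc_def using isc_cup by auto
lemma Pc_cup_sub: "Pc a s ==> p : A ==> q : A ==> el p <= el s ==> el q <= el s ==> Pc a (cup p q)"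
  by (rule Pc_sub) auto

text \<open>An entry \<open>(x, i)\<close> lies below the limit \<open>b\<close> exactly when
  \<open>x\<close> does, as \<open>i\<close> is 0 or 1. So two entries with the same argument never
  fall on different sides of \<open>b\<close>.\<close>

lemma fnc_lowhi: assumes b: "limo b" and p: "fnc p" "fnc q" "!!z. z : el p ==> rank z : el b" "!!z. z : el q ==> rank z ~: el b"
  shows "fnc (cup p q)"
proof -
  have "rank (opr x y) : el b \<longleftrightarrow> rank x : el b" if "opr x y : el p Un el q" for x y
  proof -
    have "y = zero \<or> y = one" using that p unfolding fnc_def by (metis Un_iff opr_inject)
    then show ?thesis using rank_opr[OF b] limo_01[OF b] by auto
  qed
  then have d: "\<not> (opr x y : el p \<and> opr x y' : el q)" for x y y' using p by (metis Un_iff)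
  show ?thesis unfolding fnc_def
  proof (intro conjI ballI allI impI)
    show "EX x y. z = opr x y \<and> (y = zero \<or> y = one)" if "z : el (cup p q)" for z using that p unfolding fnc_def by auto
    fix x y x' y' assume "opr x y : el (cup p q)" "opr x' y' : el (cup p q)" "x = x'"
    then show "y = y'" using d p unfolding fnc_def el_cup by (metis Un_iff)
  qed
qed

text \<open>This is the product structure of the forcing at \<open>b\<close>: an extension of the
  lower part of \<open>p\<close> may be combined freely with the upper part.\<close>

lemma Pc_glue: assumes b: "limo b" "b : A" and u: "Pc a u" "!!z. z : el u ==> rank z : el b" and p: "Pc a p" "el (low b p) <= el u"
  shows "Pc a (cup u p)"
proof -
  have A: "u : A" "p : A" using u p PcA by auto
  have "Pc a (hi b p)" using p A b by (intro Pc_sub[OF p(1)]) auto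
  moreover have "fnc (cup u (hi b p))" using u p b calculation by (intro fnc_lowhi[OF b(1)]) (auto simp: Pc_def isc_def)
  ultimately have "Pc a (cup u (hi b p))" using u by (intro Pc_cup)
  moreover have "cup u (hi b p) = cup u p" using p(2) by (intro ext_el) auto
  ultimately show ?thesis by simp
qed

definition cc where "cc a b = mk {p : el (Pw (VV (rank b))). Pc a p}"
lemma el_cc: "Ord b ==> el (cc a b) = {p. Pc a p \<and> (ALL z:el p. rank z : el b)}"
proof -
  assume o: "Ord b"
  have "el (cc a b) = {p : el (Pw (VV (rank b))). Pc a p}" unfolding cc_def by (rule el_mk_el)
  then show ?thesis unfolding el_Pw el_VV rank_Ord[OF o] using PcA Atrans by blast
qed
lemma dft_cc[df]: "dft A s ==> dft A t ==> dft A (%e. cc (s e) (t e))"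
  by (rule dff2[where f=cc], unfold cc_def) (intro df)+
lemma ccA[simp]: "x : A ==> y : A ==> cc x y : A"
  using dft_in[OF dft_cc[OF dft_const dft_const], of x y "%_. x"] by auto

text \<open>Conditions with support below \<open>b\<close> are subsets of \<open>V_b\<close>, hence
  elements of \<open>V_(b+1)\<close>. This fixes \<open>V_(b+1)\<close> as the measure of
  smallness.\<close>

lemma sm_cc: assumes "b : A" "Ord b" shows "sm b (cc a b)"
proof (rule sm_V[OF assms])
  show "el (cc a b) <= el (VV (rank (succ b)))"
  proof
    fix p assume "p : el (cc a b)"
    then have p: "p : A" "!!z. z : el p ==> rank z : el b" unfolding el_cc[OF assms(2)] using PcA by blast+
    have "el (rank p) <= el b" using p(2) assms(2) by (intro rank_le)
    then show "p : el (VV (rank (succ b)))" unfolding VV_succ[OF assms(2)] using p Ord_subset[of "rank p" b] assms by auto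
  qed
qed

lemma choice_fn: assumes x: "x : A" shows "EX g:A. ALL y:A. el y <= el x --> el y ~= {} --> app g y : el y"
proof -
  define Q where "Q y z \<longleftrightarrow> ((EX w:el y. True) --> z : el y)" for y z
  have dQ: "dfb A (%e. Q (e (Suc 0)) (e 0))" unfolding Q_def by (intro df)
  have ex: "EX z:A. Q y z" if "y : A" for y unfolding Q_def using that Atrans zeroA by blast
  have dW: "dft A t ==> dft A (%e. WL (Q (t e)))" for t
    by (rule dff1[where f="%y. WL (Q y)"], rule dft_WL[OF dQ]) (use ex in auto)
  have "dft A (%e. lam (Pw (e 0)) (%y. WL (Q y)))" by (intro df dW)
  from dft_in[OF this, of "%_. x"] have "lam (Pw x) (%y. WL (Q y)) : A" using x by auto
  moreover have "app (lam (Pw x) (%y. WL (Q y))) y : el y" if y: "y : A" "el y <= el x" "el y ~= {}" for y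
  proof -
    obtain z where "z : A" "Q y z" using ex y by blast
    then have "Q y (WL (Q y))" using WL(2)[of z "Q y"] by blast
    then have "WL (Q y) : el y" using y(3) unfolding Q_def[of y "WL (Q y)"] by blast
    moreover have "y : el (Pw x)" using y by simp
    ultimately show ?thesis by (simp only: app_lam)
  qed
  ultimately show ?thesis by blast
qed

text \<open>The upper part of \<open>p\<close> is extended along an enumeration of the pairs \<open>(i, u)\<close>; at each stage a lower
  extension \<open>u'\<close> of \<open>u\<close> is found together with the next upper part so that their union is in \<open>D i\<close>.\<close>

lemma key:
  assumes aA: "a : A" and b: "limo b" "b : A" and I: "I : A" "sm b I"
    and dD: "dfb A (%e. D (e 0) (e 1))"
    and dense: "!!i p. i : el I ==> Pc a p ==> EX d. Pc a d \<and> el p <= el d \<and> D i d"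
    and opn: "!!i p q. i : el I ==> Pc a p ==> D i p ==> Pc a q ==> el p <= el q ==> D i q"
    and p: "Pc a p"
  shows "EX q. Pc a q \<and> el p <= el q \<and> low b q = low b p \<and>
     (ALL i:el I. ALL u:el (cc a b). el (low b p) <= el u --> (EX u':el (cc a b). el u <= el u' \<and> D i (cup u' q)))"
proof -
  have o: "Ord b" using b unfolding limo_def by simp
  have pA: "p : A" using p PcA by blast
  define c where "c = cc a b"
  have cA: "c : A" unfolding c_def using aA b by simp
  have elc: "el c = {p. Pc a p \<and> (ALL z:el p. rank z : el b)}" unfolding c_def by (rule el_cc[OF o])
  define J where "J = prd I c"
  have JA: "J : A" unfolding J_def using I cA by simp
  have smJ: "sm b J" unfolding J_def using I cA b sm_cc[OF b(2) o] by (intro sm_prd) (auto simp: c_def)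
  obtain g where g: "g : A" "ALL y:A. el y <= el J --> el y ~= {} --> app g y : el y" using choice_fn[OF JA] by blast
  obtain l f where l: "l : A" "f : A" "Ord l" "app f ` el l = el J" "inj_on (app f) (el l)"
    using enum[OF JA g(1)] g(2) by blast
  \<comment> \<open>The length \<open>l\<close> is an image of the small set \<open>J\<close> under
    the inverse of the enumeration, written as a least ordinal to obtain a total definable
    term.\<close>
  have sml: "sm b l"
  proof (rule sm_image[OF b(2) smJ])
    let ?Q = "%j k. (EX m:el l. app f m = j) --> k : el l \<and> app f k = j"
    show "dft A (%e. OL (?Q (e 0)))"
    proof (rule dft_OL)
      show "dfb A (%e. ?Q (e (Suc 0)) (e 0))" by (intro df l)
      show "EX k:A. Ord k \<and> ?Q (e 0) k" for e :: "nat => hset"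
      proof (cases "EX m:el l. app f m = e 0")
        case True
        then obtain m where m: "m : el l" "app f m = e 0" by blast
        then have "m : A" "Ord m" using Atrans[OF l(1)] Ord_in[OF l(3)] by blast+
        then show ?thesis using m by blast
      next
        case False then show ?thesis using zeroA Ord_zero by blast
      qed
    qed
    show "el l <= (%j. OL (?Q j)) ` el J"
    proof
      fix k assume k: "k : el l"
      have ok: "Ord k" using k l Ord_in by blast
      have e: "OL (?Q (app f k)) = k"
      proof (rule OL_eq[OF ok])
        show "?Q (app f k) k" using k by blast
        show "ALL m:el k. \<not> ?Q (app f k) m"
        proof
          fix m assume m: "m : el k"
          then have "m ~= k" by auto
          then show "\<not> ?Q (app f k) m" using k l(5) unfolding inj_on_def by blast
        qed
      qed
      have "app f k : el J" using k l(4) by blast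
      then show "k : (%j. OL (?Q j)) ` el J" by (rule image_eqI[rotated]) (rule e[symmetric])
    qed
  qed
  define tail where "tail x \<longleftrightarrow> Pc a x \<and> (ALL z:el x. rank z ~: el b)" for x
  \<comment> \<open>\<open>t'\<close> is a good next upper part for the task \<open>j\<close> if,
    joined with a lower extension of the second component of \<open>j\<close>, it meets the class
    given by the first component. \<open>Q2\<close> keeps \<open>t\<close> when there is none, so
    that \<open>ext\<close> is a total term.\<close>
  define S where "S t j t' \<longleftrightarrow> tail t' \<and> el t <= el t' \<and> (EX u':el c. el (sn j) <= el u' \<and> D (fs j) (cup u' t'))" for t j t'
  define Q2 where "Q2 t j t' \<longleftrightarrow> ((EX s:A. S t j s) --> S t j t') \<and> (\<not> (EX s:A. S t j s) --> t' = t)" for t j t'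
  define ext where "ext t j = WL (Q2 t j)" for t j
  have dS: "dft A x ==> dft A y ==> dft A z ==> dfb A (%e. S (x e) (y e) (z e))" for x y z
    by (rule df3[where Q=S], unfold S_def tail_def) (intro df df2[OF dD] aA b cA)+
  have exQ: "EX t':A. Q2 t j t'" if "t : A" for t j unfolding Q2_def using that by blast
  have dext: "dft A x ==> dft A y ==> dft A (%e. ext (x e) (y e))" for x y
  proof (rule dff2[where f=ext], unfold ext_def, rule dft_WL)
    show "dfb A (%e. Q2 (e (Suc 0)) (e (Suc 1)) (e 0))" unfolding Q2_def by (intro df dS)
  qed (use exQ in auto)
  define T where "T = recF (%k h. ext (cup (hi b p) (mk (\<Union>m\<in>el k. el (app h m)))) (app f k))"
  define t where "t k = cup (hi b p) (mk (\<Union>m\<in>el k. el (T m)))" for k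
  have T: "T k = ext (t k) (app f k)" for k
    unfolding t_def by (subst T_def, subst recF) (simp add: T_def TC_el)
  have hA: "hi b p : A" using pA b by simp
  have dT: "dft A x ==> dft A (%e. T (x e))" for x
    unfolding T_def by (rule dft_recF[where H="%q k h. ext (cup (hi b p) (mk (\<Union>m\<in>el k. el (app h m)))) (app f k)" and s=x])
      (intro df dft_UN dext hA l)+
  have tA: "t k : A" if "k : A" for k
  proof -
    have "dft A (%e. t (e 0))" unfolding t_def by (intro df dft_UN dT hA)
    from dft_in[OF this, of "%_. k"] show ?thesis using that by auto
  qed
  have elt: "el (t k) = el (hi b p) Un (\<Union>m\<in>el k. el (T m))" for k unfolding t_def by simp
  have TQ: "Q2 (t k) (app f k) (T k)" if "k : A" for k
    unfolding T ext_def using exQ[OF tA[OF that]] WL(2) by blast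
  have main: "Ord k --> el k <= el l --> k : A --> tail (t k) \<and> (k : el l --> S (t k) (app f k) (T k))" for k
  proof (induction k rule: el_induct)
    case (step k)
    show ?case
    proof (intro impI)
      assume k: "Ord k" "el k <= el l" "k : A"
      have IH: "tail (T m)" "el (t m) <= el (T m)" if m: "m : el k" for m
      proof -
        have "Ord m" "el m <= el l" "m : A" "m : el l" using m k Ord_in Ord_trans[OF k(1)] Atrans by blast+
        then have "S (t m) (app f m) (T m)" using step m by blast
        then show "tail (T m)" "el (t m) <= el (T m)" unfolding S_def by auto
      qed
      have chain: "el (T m) <= el (T n)" if "m : el n" "n : el k" for m n
        using IH(2)[OF that(2)] that(1) unfolding elt by blast
      have hp: "tail (hi b p)" unfolding tail_def using Pc_sub[OF p hA] by auto
      have hT: "el (hi b p) <= el (T m)" if "m : el k" for m using IH(2)[OF that] unfolding elt by blast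
      have tt: "tail (t k)" unfolding tail_def Pc_def isc_def
      proof (intro conjI ballI impI)
        show "t k : A" using tA k by blast
        show "rank z ~: el a" if "z : el (t k)" for z using that IH(1) hp unfolding elt tail_def Pc_def by blast
        show "rank z ~: el b" if "z : el (t k)" for z using that IH(1) hp unfolding elt tail_def by blast
        have fn: "fnc x" if "tail x" for x using that unfolding tail_def Pc_def isc_def by blast
        show "fnc (t k)"
        proof -
          have two: "EX x. fnc x \<and> z : el x \<and> z' : el x" if z: "z : el (t k)" "z' : el (t k)" for z z'
          proof -
            consider "z : el (hi b p)" "z' : el (hi b p)" | m where "m : el k" "z : el (hi b p)" "z' : el (T m)"
              | m where "m : el k" "z' : el (hi b p)" "z : el (T m)" | m n where "m : el k" "n : el k" "z : el (T m)" "z' : el (T n)"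
              using z unfolding elt by blast
            then show ?thesis
            proof cases
              case 1 then show ?thesis using fn hp by blast
            next
              case 2 then show ?thesis using fn IH(1) hT by blast
            next
              case 3 then show ?thesis using fn IH(1) hT by blast
            next
              case 4
              have "m : el n \<or> m = n \<or> n : el m" using 4 k Ord_in Ord_linear by blast
              then show ?thesis using 4 chain fn IH(1) by blast
            qed
          qed
          show ?thesis unfolding fnc_def
          proof (intro conjI ballI allI impI)
            fix z assume "z : el (t k)"
            then obtain x where "fnc x" "z : el x" using two by blast
            then show "EX x y. z = opr x y \<and> (y = zero \<or> y = one)" unfolding fnc_def by blast
          next
            fix x y x' y' assume "opr x y : el (t k)" "opr x' y' : el (t k)" and e: "x = x'"
            then obtain w where w: "fnc w" "opr x y : el w" "opr x' y' : el w" using two by blast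
            show "y = y'" using w(1)[unfolded fnc_def, THEN conjunct2, rule_format, OF w(2,3) e] .
          qed
        qed
        fix d assume d: "d : A" "limo d"
        have od: "Ord d" using d unfolding limo_def by simp
        \<comment> \<open>If \<open>d\<close> is below \<open>b\<close>, then \<open>nl d\<close>
          does not exceed \<open>b\<close> and the upper parts have nothing there. From
          \<open>b\<close> on, a union of length \<open>k\<close>, an image of
          \<open>V_(b+1)\<close>, respects the bound at \<open>d\<close>.\<close>
        show "sm d (low (nl d) (t k))"
        proof (cases "d : el b")
          case True
          then have "el (nl d) <= el b" using nl(4)[OF d(1) b(1)] rank_Ord[OF od] by simp
          then have "el (low (nl d) (t k)) = {}" using IH(1) hp unfolding el_low elt tail_def by blast
          then show ?thesis unfolding sm_def by (intro bexI[of _ zero]) auto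
        next
          case False
          then have db: "d = b \<or> b : el d" using Ord_linear[OF od o] by blast
          have "sm b k" using sm_sub[OF sml k(2)] .
          then have smk: "sm d k" using db sm_mono d od by blast
          have nA: "nl d : A" using nl d by blast
          have "sm d (mk (\<Union>m\<in>el k. el (low (nl d) (T m))))"
          proof (rule sm_UN[OF d(2,1) _ k(3) smk])
            show "dft A (%e. low (nl d) (T (e 0)))" by (intro df dT nA)
            show "sm d (low (nl d) (T m))" if "m : el k" for m using IH(1)[OF that] d unfolding tail_def Pc_def isc_def by blast
          qed
          moreover have "sm d (low (nl d) (hi b p))" using hp d unfolding tail_def Pc_def isc_def by blast
          moreover have "mk (\<Union>m\<in>el k. el (low (nl d) (T m))) : A"
          proof -
            have "dft A (%e. mk (\<Union>m\<in>el (e 0). el (low (nl d) (T m))))" by (intro df dft_UN dT nA)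
            from dft_in[OF this, of "%_. k"] show ?thesis using k by auto
          qed
          ultimately have "sm d (cup (low (nl d) (hi b p)) (mk (\<Union>m\<in>el k. el (low (nl d) (T m)))))"
            using d nA hA by (intro sm_cup) auto
          then show ?thesis by (rule sm_sub) (auto simp: elt)
        qed
      qed
      moreover have "S (t k) (app f k) (T k)" if kl: "k : el l"
      proof -
        have "app f k : el J" using kl l(4) by blast
        then obtain i u where iu: "app f k = opr i u" "i : el I" "u : el c" unfolding J_def el_prd by blast
        have u: "Pc a u" "!!z. z : el u ==> rank z : el b" using iu(3) unfolding elc by blast+
        have tP: "Pc a (t k)" "el (low b (t k)) <= el u" using tt unfolding tail_def by auto
        \<comment> \<open>Density is applied to the glued condition; splitting the result at
          \<open>b\<close> gives the lower extension and the next upper part.\<close>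
        obtain d where d: "Pc a d" "el (cup u (t k)) <= el d" "D i d" using dense[OF iu(2) Pc_glue[OF b u tP]] by blast
        have dA: "d : A" using d PcA by blast
        have "tail (hi b d)" unfolding tail_def using Pc_sub[OF d(1)] dA b by auto
        moreover have "el (t k) <= el (hi b d)" using d(2) tt unfolding tail_def by auto
        moreover have "low b d : el c" unfolding elc using Pc_sub[OF d(1)] dA b by auto
        moreover have "el u <= el (low b d)" using d(2) u(2) by auto
        moreover have "cup (low b d) (hi b d) = d" by (rule ext_el) auto
        ultimately have "S (t k) (app f k) (hi b d)" unfolding S_def iu(1) using d(3)
          by (intro conjI bexI[of _ "low b d"]) simp_all
        moreover have "hi b d : A" using dA b by simp
        ultimately show ?thesis using TQ[OF k(3)] unfolding Q2_def by blast
      qed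
      ultimately show "tail (t k) \<and> (k : el l --> S (t k) (app f k) (T k))" by blast
    qed
  qed
  have tl: "tail (t l)" using main[of l] l by blast
  let ?q = "cup (low b p) (t l)"
  have lowp: "Pc a (low b p)" "!!z. z : el (low b p) ==> rank z : el b" using Pc_sub[OF p] pA b by auto
  have q: "Pc a ?q" by (rule Pc_glue[OF b lowp]) (use tl in \<open>auto simp: tail_def\<close>)
  have pq: "el p <= el ?q" by (auto simp: elt)
  have lq: "low b ?q = low b p" by (rule ext_el) (use tl in \<open>auto simp: tail_def\<close>)
  have "EX u':el (cc a b). el u <= el u' \<and> D i (cup u' ?q)" if i: "i : el I" and u: "u : el (cc a b)" "el (low b p) <= el u" for i u
  proof -
    have "opr i u : el J" unfolding J_def el_prd c_def using i u by blast
    then obtain k where k: "k : el l" "app f k = opr i u" using l(4) by (metis imageE)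
    have "Ord k" "el k <= el l" "k : A" using k l Ord_in Ord_trans[OF l(3)] Atrans by blast+
    then have "S (t k) (opr i u) (T k)" using main k by metis
    then obtain u' where u': "u' : el c" "el u <= el u'" "D i (cup u' (T k))" "tail (T k)" unfolding S_def by auto
    have uc: "Pc a u'" "!!z. z : el u' ==> rank z : el b" using u'(1) unfolding elc by blast+
    have 1: "Pc a (cup u' ?q)" by (rule Pc_glue[OF b uc q]) (use u u' lq in auto)
    have "Pc a (cup u' (T k))" by (rule Pc_glue[OF b uc]) (use u' in \<open>auto simp: tail_def\<close>)
    moreover have "el (cup u' (T k)) <= el (cup u' ?q)" using k by (auto simp: elt)
    ultimately have "D i (cup u' ?q)" using opn[OF i _ u'(3) 1] by blast
    then show ?thesis using u' unfolding c_def by blast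
  qed
  then show ?thesis using q pq lq by blast
qed

end

section \<open>Class forcing\<close>

lemma val_cong: assumes "!!p. p : TC x ==> p : G \<longleftrightarrow> p : H" shows "val G x = val H x"
  using assms
proof (induction x rule: TC_induct)
  case (step x)
  have s: "val G s = val H s" "p : G \<longleftrightarrow> p : H" if "opr s p : el x" for s p
  proof -
    have "s : TC x" "p : TC x" using opr_el_TC[OF that] by auto
    then show "val G s = val H s" "p : G \<longleftrightarrow> p : H" using step TC_trans by blast+
  qed
  show ?case by (rule ext_el, unfold el_val, rule Collect_cong) (metis s)
qed

definition AC where "AC A \<longleftrightarrow> (ALL x:A. (ALL y:el x. el y ~= {}) \<and>
   (ALL y:el x. ALL z:el x. y ~= z --> el y Int el z = {}) --> (EX c:A. ALL y:el x. EX! z. z : el c Int el y))"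

text \<open>\<open>G\<close> meets all definable dense classes of the conditions supported from
  \<open>a\<close> upwards. Keeping \<open>a\<close> as a parameter makes the development available
  both for the whole generic and for its upper parts.\<close>

locale cls = zfL +
  fixes a G
  assumes aA: "a : A" and GP: "p : G ==> Pc a p" and G0: "zero : G"
    and Gup: "p : G ==> Pc a q ==> el q <= el p ==> q : G"
    and Gdir: "p : G ==> q : G ==> EX s:G. el p <= el s \<and> el q <= el s"
    and Ggen: "dfb A (%e. Q (e 0)) ==> (!!p. Pc a p ==> EX d. Pc a d \<and> el p <= el d \<and> Q d) ==> EX p:G. Q p"
begin

lemma GA: "p : G ==> p : A" using GP PcA by blast

lemma Gcup: assumes "p : G" "q : G" shows "cup p q : G"
proof -
  obtain s where s: "s : G" "el p <= el s" "el q <= el s" using Gdir assms by blast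
  have "Pc a (cup p q)" using GP[OF s(1)] GA assms s by (intro Pc_cup_sub) auto
  then show ?thesis using Gup[OF s(1)] s by auto
qed

lemma Ggen_below: assumes Q: "dfb A (%e. Q (e 0))" and p: "p : G"
  and d: "!!q. Pc a q ==> el p <= el q ==> EX d. Pc a d \<and> el q <= el d \<and> Q d"
  shows "EX q:G. el p <= el q \<and> Q q"
proof -
  let ?R = "%q. (el p <= el q \<and> Q q) \<or> (ALL s:A. Pc a s --> el q <= el s --> \<not> el p <= el s)"
  have "EX q:G. ?R q"
  proof (rule Ggen)
    show "dfb A (%e. ?R (e 0))" by (intro df df1[OF Q] GA[OF p] aA)
    fix q assume q: "Pc a q"
    show "EX d. Pc a d \<and> el q <= el d \<and> ?R d"
    proof (cases "EX s. Pc a s \<and> el q <= el s \<and> el p <= el s")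
      case True
      then obtain s where s: "Pc a s" "el q <= el s" "el p <= el s" by blast
      then obtain t where "Pc a t" "el s <= el t" "Q t" using d by blast
      then show ?thesis using s by blast
    next
      case False then show ?thesis using q by blast
    qed
  qed
  then obtain q where q: "q : G" "?R q" by blast
  obtain s where "s : G" "el q <= el s" "el p <= el s" using Gdir[OF q(1) p] by blast
  then have "\<not> (ALL s:A. Pc a s --> el q <= el s --> \<not> el p <= el s)" using GP[of s] GA[of s] by blast
  then have "el p <= el q \<and> Q q" using q(2) by argo
  then show ?thesis using q(1) by blast
qed

section \<open>Set-sized lower factors of the generic\<close>

definition rr where "rr b = mk {z : el (prd (cc a b) (cc a b)). el (sn z) <= el (fs z)}"
definition Gb where "Gb b = {p : G. ALL z:el p. rank z : el b}"

lemma dft_rr[df]: "dft A t ==> dft A (%e. rr (t e))"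
  by (rule dff1[where f=rr], unfold rr_def) (intro df aA)+
lemma rrA: "b : A ==> rr b : A" using dft_in[OF dft_rr[OF dft_const], of b "%_. b"] by auto

lemma le_rr: "le (rr b) p q \<longleftrightarrow> p : el (cc a b) \<and> q : el (cc a b) \<and> el q <= el p"
proof -
  have "el (rr b) = {z : el (prd (cc a b) (cc a b)). el (sn z) <= el (fs z)}" unfolding rr_def by (rule el_mk_el)
  then show ?thesis unfolding le_def el_prd by auto
qed

lemma pos_b: "b : A ==> pos A (cc a b) (rr b)"
  by unfold_locales (use aA rrA le_rr in auto)

lemma low_Gb: "b : A ==> p : G ==> low b p : Gb b"
  unfolding Gb_def using Gup[of p "low b p"] Pc_sub[OF GP, of p "low b p"] GA by auto

lemma Gb_cc: "Ord b ==> Gb b <= el (cc a b)" unfolding Gb_def using GP by (auto simp: el_cc)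

lemma Pc_lift: assumes b: "limo b" "b : A" and p: "Pc a p" and u: "u : el (cc a b)" "el (low b p) <= el u" shows "Pc a (cup u p)"
proof -
  have o: "Ord b" using b unfolding limo_def by simp
  show ?thesis by (rule Pc_glue[OF b]) (use u p in \<open>auto simp: el_cc[OF o]\<close>)
qed

text \<open>A set dense among the conditions below \<open>b\<close> is met by extending the lower
  part of any condition into it and gluing the upper part back on.\<close>

lemma gen_b: assumes b: "limo b" "b : A" shows "gen A (cc a b) (rr b) (Gb b)"
proof -
  have o: "Ord b" using b unfolding limo_def by simp
  interpret pos A "cc a b" "rr b" by (rule pos_b[OF b(2)])
  show ?thesis
  proof unfold_locales
    show "Gb b <= el (cc a b)" by (rule Gb_cc[OF o])
    show "Gb b ~= {}" using low_Gb[OF b(2) G0] by blast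
    show "q : Gb b" if "p : Gb b" "le (rr b) p q" for p q
      using that Gup unfolding Gb_def le_rr el_cc[OF o] by blast
    show "EX s:Gb b. le (rr b) s p \<and> le (rr b) s q" if pq: "p : Gb b" "q : Gb b" for p q
    proof (rule bexI[of _ "cup p q"])
      show c: "cup p q : Gb b" using pq Gcup unfolding Gb_def by auto
      show "le (rr b) (cup p q) p \<and> le (rr b) (cup p q) q" unfolding le_rr using c pq Gb_cc[OF o] by auto
    qed
    show "Gb b Int el D ~= {}" if D: "D : A" "el D <= el (cc a b)" "!!p. p : el (cc a b) ==> EX d:el D. le (rr b) d p" for D
    proof -
      have "EX p:G. EX d:el D. el d <= el p"
      proof (rule Ggen)
        show "dfb A (%e. EX d:el D. el d <= el (e 0))" by (intro df D)
        fix p assume p: "Pc a p"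
        have "low b p : el (cc a b)" unfolding el_cc[OF o] using Pc_sub[OF p, of "low b p"] PcA[OF p] b by auto
        then obtain d where d: "d : el D" "el (low b p) <= el d" "d : el (cc a b)" using D(3) unfolding le_rr by blast
        have "Pc a (cup d p)" using Pc_lift[OF b p d(3,2)] .
        then show "EX q. Pc a q \<and> el p <= el q \<and> (EX d:el D. el d <= el q)" using d by (intro exI[of _ "cup d p"]) auto
      qed
      then obtain p d where d: "p : G" "d : el D" "el d <= el p" by blast
      have "Pc a d" "ALL z:el d. rank z : el b" using d D(2) unfolding el_cc[OF o] by blast+
      then have "d : Gb b" using Gup d unfolding Gb_def by blast
      then show ?thesis using d by blast
    qed
  qed
qed

text \<open>All conditions occurring in a name of rank below \<open>b\<close> have their support
  below \<open>b\<close>, so the lower factor already evaluates the name.\<close>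

lemma val_b: assumes b: "limo b" and x: "rank x : el b" shows "val G x = val (Gb b) x"
proof (rule val_cong)
  fix p assume "p : TC x"
  then have "rank p : el b" using rank_TC x b Ord_trans unfolding limo_def by blast
  then have "ALL z:el p. rank z : el b" using rank_mem b Ord_trans unfolding limo_def by blast
  then show "p : G \<longleftrightarrow> p : Gb b" unfolding Gb_def by blast
qed

text \<open>Forcing an equality is delegated to the set poset below the next limit above both names,
  where all relevant conditions live. This gives a definable atomic forcing relation, which class
  forcing does not provide automatically.\<close>

definition fE where "fE p x y \<longleftrightarrow> low (nl (upair x y)) p :
   el (app (FE (opr (opr (cc a (nl (upair x y))) (rr (nl (upair x y)))) (tc (upair x y))) x) y)"

lemma dfb_fE[df]: "dft A p ==> dft A x ==> dft A y ==> dfb A (%e. fE (p e) (x e) (y e))"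
  unfolding fE_def by (intro df aA)

lemma b_facts: assumes "x : A" "y : A"
  shows "limo (nl (upair x y))" "nl (upair x y) : A" "rank x : el (nl (upair x y))" "rank y : el (nl (upair x y))"
  using nl[of "upair x y"] rank_upair[of "nl (upair x y)" x y] assms by auto

lemma fE_FF: "x : A ==> y : A ==>
  fE p x y \<longleftrightarrow> pos.FF (cc a (nl (upair x y))) (rr (nl (upair x y))) (tc (upair x y)) (low (nl (upair x y)) p) x y"
  unfolding fE_def by (subst pos.FF_def[OF pos_b]) (use b_facts in auto)

lemma low_cc: "b : A ==> Ord b ==> Pc a p ==> low b p : el (cc a b)"
  using Pc_sub[of a p "low b p"] PcA by (auto simp: el_cc)

lemma fE_truth: assumes "x : A" "y : A" shows "val G x = val G y \<longleftrightarrow> (EX p:G. fE p x y)"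
proof -
  let ?b = "nl (upair x y)"
  note b = b_facts[OF assms]
  interpret gen A "cc a ?b" "rr ?b" "Gb ?b" by (rule gen_b[OF b(1,2)])
  have "val G x = val G y \<longleftrightarrow> val (Gb ?b) x = val (Gb ?b) y" using val_b b by simp
  also have "... \<longleftrightarrow> (EX p:Gb ?b. FF (tc (upair x y)) p x y)"
    using truth[of "tc (upair x y)" x y] trn_tc tcA assms TC_el[of y "upair x y"] by simp
  also have "... \<longleftrightarrow> (EX p:G. fE p x y)"
  proof
    assume "EX p:Gb ?b. FF (tc (upair x y)) p x y"
    then obtain p where p: "p : Gb ?b" "FF (tc (upair x y)) p x y" by blast
    moreover have "low ?b p = p" using p unfolding Gb_def by (intro ext_el) auto
    ultimately show "EX p:G. fE p x y" unfolding fE_FF[OF assms] Gb_def by (intro bexI[of _ p]) simp_all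
  next
    assume "EX p:G. fE p x y"
    then show "EX p:Gb ?b. FF (tc (upair x y)) p x y" unfolding fE_FF[OF assms] using low_Gb[OF b(2)] by blast
  qed
  finally show ?thesis .
qed

lemma fE_mono: assumes "x : A" "y : A" "fE p x y" "Pc a p" "Pc a q" "el p <= el q" shows "fE q x y"
proof -
  let ?b = "nl (upair x y)"
  note b = b_facts[OF assms(1,2)]
  have o: "Ord ?b" using b unfolding limo_def by simp
  interpret pos A "cc a ?b" "rr ?b" by (rule pos_b[OF b(2)])
  have "le (rr ?b) (low ?b q) (low ?b p)" unfolding le_rr using low_cc[OF b(2) o] assms by auto
  then show ?thesis using FF_mono[of y "tc (upair x y)"] assms(3) TC_el[of y "upair x y"] unfolding fE_FF[OF assms(1,2)] by simp
qed

lemma fE_dense: assumes xy: "x : A" "y : A" and p: "Pc a p" and d: "!!q. Pc a q ==> el p <= el q ==> EX q'. Pc a q' \<and> el q <= el q' \<and> fE q' x y"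
  shows "fE p x y"
proof -
  let ?b = "nl (upair x y)"
  note b = b_facts[OF xy]
  have o: "Ord ?b" using b unfolding limo_def by simp
  interpret pos A "cc a ?b" "rr ?b" by (rule pos_b[OF b(2)])
  show ?thesis unfolding fE_FF[OF xy]
  proof (rule FF_dense)
    show "y : el (tc (upair x y))" using TC_el[of y "upair x y"] by simp
    show "low ?b p : el (cc a ?b)" using low_cc[OF b(2) o p] .
    fix u assume "le (rr ?b) u (low ?b p)"
    then have u: "u : el (cc a ?b)" "el (low ?b p) <= el u" unfolding le_rr by auto
    then have "Pc a (cup u p)" using Pc_lift[OF b(1,2) p] by blast
    then obtain q' where q': "Pc a q'" "el (cup u p) <= el q'" "fE q' x y" using d[of "cup u p"] by auto
    have "el u <= el (low ?b q')" using q'(2) u(1) unfolding el_cc[OF o] by auto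
    then have "le (rr ?b) (low ?b q') u" unfolding le_rr using low_cc[OF b(2) o q'(1)] u by blast
    then show "EX q'. le (rr ?b) q' u \<and> FF (tc (upair x y)) q' x y" using q'(3) unfolding fE_FF[OF xy] by blast
  qed
qed

section \<open>The forcing relation for the class of conditions\<close>

definition fM0 where "fM0 p x y \<longleftrightarrow> (EX u s. opr u s : el y \<and> (Pc a s \<and> el s <= el p \<and> fE p x u))"
text \<open>\<open>fM0\<close> exhibits a witness for membership but does not follow from holding
  densely; passing to density below \<open>p\<close> gives the atomic case of
  \<open>fo_dense\<close>.\<close>

definition dns where "dns Q p \<longleftrightarrow> (ALL q:A. Pc a q --> el p <= el q --> (EX q':A. Pc a q' \<and> el q <= el q' \<and> Q q'))"

lemma dns_mono: "dns Q p ==> el p <= el q ==> dns Q q" unfolding dns_def by blast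
lemma dns_dense: "(!!q. Pc a q ==> el p <= el q ==> EX q'. Pc a q' \<and> el q <= el q' \<and> dns Q q') ==> dns Q p"
  unfolding dns_def using PcA by (meson order_refl order_trans)

primrec fo :: "fm => hset => (nat => hset) => bool" where
  "fo (Mem i j) p v = dns (%q. fM0 q (v i) (v j)) p"
| "fo (Eq i j) p v = fE p (v i) (v j)"
| "fo (Neg \<phi>) p v = (ALL q:A. Pc a q --> el p <= el q --> \<not> fo \<phi> q v)"
| "fo (Conj \<phi> \<psi>) p v = (fo \<phi> p v \<and> fo \<psi> p v)"
| "fo (Forall i \<phi>) p v = (ALL x:A. fo \<phi> p (v(i := x)))"

lemma dfb_fo: "dfb A (%e. fo \<phi> (e 0) (%n. e (Suc n)))"
proof (induction \<phi>)
  case (Mem i j) show ?case unfolding fo.simps dns_def fM0_def by (intro df aA)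
next
  case (Eq i j) show ?case unfolding fo.simps by (intro df)
next
  case (Neg \<phi>)
  have "dfb A (%e. fo \<phi> (e 0) (%n. e (Suc (Suc n))))" using dfb_ren[OF Neg inj_skip1] by simp
  then show ?case unfolding fo.simps by (intro df aA)
next
  case (Conj \<phi> \<psi>) then show ?case unfolding fo.simps by (intro df)
next
  case (Forall i \<phi>)
  have "dfb A (%e. ALL x:A. fo \<phi> ((e(Suc i := x)) 0) (%n. (e(Suc i := x)) (Suc n)))" by (rule dfb_all_upd[OF Forall])
  moreover have "(%n. (e(Suc i := x)) (Suc n)) = (%n. e (Suc n))(i := x)" for e :: "nat => hset" and x by auto
  ultimately show ?case by simp
qed

lemma fo_mono: "range v <= A ==> fo \<phi> p v ==> Pc a p ==> Pc a q ==> el p <= el q ==> fo \<phi> q v"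
proof (induction \<phi> arbitrary: v)
  case (Mem i j) then show ?case using dns_mono by simp
next
  case (Eq i j)
  then have "v i : A" "v j : A" by auto
  then show ?case using Eq fE_mono by simp
next
  case (Neg \<phi>) show ?case using Neg.prems(2,5) unfolding fo.simps by blast
next
  case (Conj \<phi> \<psi>) then show ?case by simp
next
  case (Forall i \<phi>)
  have "range (v(i := x)) <= A" if "x : A" for x using Forall.prems(1) that by (auto simp: image_subset_iff)
  then have "fo \<phi> q (v(i := x))" if "x : A" for x
    using Forall.IH[of "v(i := x)"] Forall.prems(2-5) that unfolding fo.simps by blast
  then show ?case by simp
qed

lemma fo_dense: "range v <= A ==> Pc a p ==> (!!q. Pc a q ==> el p <= el q ==> EX q'. Pc a q' \<and> el q <= el q' \<and> fo \<phi> q' v) ==> fo \<phi> p v"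
proof (induction \<phi> arbitrary: v)
  case (Mem i j) then show ?case using dns_dense[of p] by simp
next
  case (Eq i j)
  then have "v i : A" "v j : A" by auto
  then show ?case using Eq fE_dense[of "v i" "v j" p] by simp
next
  case (Neg \<phi>)
  show ?case unfolding fo.simps
  proof (intro ballI impI notI)
    fix q assume q: "q : A" "Pc a q" "el p <= el q" "fo \<phi> q v"
    obtain q' where q': "Pc a q'" "el q <= el q'" "fo (Neg \<phi>) q' v" using Neg.prems(3)[OF q(2,3)] by blast
    have "fo \<phi> q' v" using fo_mono[OF Neg.prems(1) q(4,2) q'(1,2)] .
    then show False using q' PcA by auto
  qed
next
  case (Conj \<phi> \<psi>)
  have "fo \<phi> p v" by (rule Conj.IH(1)[OF Conj.prems(1,2)]) (use Conj.prems(3) in fastforce)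
  moreover have "fo \<psi> p v" by (rule Conj.IH(2)[OF Conj.prems(1,2)]) (use Conj.prems(3) in fastforce)
  ultimately show ?case by simp
next
  case (Forall i \<phi>)
  have "fo \<phi> p (v(i := x))" if x: "x : A" for x
  proof (rule Forall.IH)
    show "range (v(i := x)) <= A" using Forall.prems(1) x by (auto simp: image_subset_iff)
    show "EX q'. Pc a q' \<and> el q <= el q' \<and> fo \<phi> q' (v(i := x))" if "Pc a q" "el p <= el q" for q
      using Forall.prems(3)[OF that] x by auto
  qed (use Forall.prems in blast)
  then show ?case by simp
qed

definition N where "N = val G ` A"

lemma dfb_fo_v: assumes "range v <= A" shows "dfb A (%e. fo \<phi> (e 0) v)"
proof -
  have "range (%n. case n of 0 => v 0 | Suc n => v n) <= A" using assms by (auto simp: image_subset_iff split: nat.splits)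
  from dfb_fix[OF dfb_fo this, of \<phi> 1] show ?thesis by simp
qed

lemma fo_em: assumes "range v <= A" "Pc a p" shows "EX q. Pc a q \<and> el p <= el q \<and> (fo \<phi> q v \<or> fo (Neg \<phi>) q v)"
proof (cases "fo (Neg \<phi>) p v")
  case True then show ?thesis using assms by blast
next
  case False
  then obtain q where "Pc a q" "el p <= el q" "fo \<phi> q v" by auto
  then show ?thesis by blast
qed

lemma fo_contra: assumes v: "range v <= A" and "p : G" "q : G" "fo \<phi> p v" "fo (Neg \<phi>) q v" shows False
proof -
  obtain s where s: "s : G" "el p <= el s" "el q <= el s" using Gdir assms by blast
  have "fo \<phi> s v" using fo_mono[OF v assms(4)] GP s assms by blast
  then show False using assms(5) s GP GA by auto
qed

theorem truth: "range v <= A ==> sat N mem \<phi> (%i. val G (v i)) \<longleftrightarrow> (EX p:G. fo \<phi> p v)"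
proof (induction \<phi> arbitrary: v)
  case (Mem i j)
  have vA: "v i : A" "v j : A" using Mem by auto
  have d: "dfb A (%e. fM0 (e 0) (v i) (v j))" unfolding fM0_def by (intro df aA vA)
  show ?case unfolding sat.simps fo.simps
  proof
    assume "val G (v i) : el (val G (v j))"
    then obtain u s where u: "val G (v i) = val G u" "s : G" "opr u s : el (v j)" by (auto simp: el_val)
    have uA: "u : A" using u vA opr_elA by blast
    obtain p where p: "p : G" "fE p (v i) u" using u fE_truth[OF vA(1) uA] by blast
    let ?q = "cup p s"
    have q: "?q : G" using Gcup p u by blast
    have "dns (%q. fM0 q (v i) (v j)) ?q" unfolding dns_def fM0_def
    proof (intro ballI impI)
      fix r assume r: "r : A" "Pc a r" "el ?q <= el r"
      have "fE r (v i) u" using fE_mono[OF vA(1) uA p(2) GP[OF p(1)] r(2)] r by auto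
      then show "EX q':A. Pc a q' \<and> el r <= el q' \<and> (EX u s. opr u s : el (v j) \<and> Pc a s \<and> el s <= el q' \<and> fE q' (v i) u)"
        using r u GP by (intro bexI[of _ r]) auto
    qed
    then show "EX p:G. dns (%q. fM0 q (v i) (v j)) p" using q by blast
  next
    assume "EX p:G. dns (%q. fM0 q (v i) (v j)) p"
    then obtain p where p: "p : G" "dns (%q. fM0 q (v i) (v j)) p" by blast
    have "EX q:G. el p <= el q \<and> fM0 q (v i) (v j)"
      by (rule Ggen_below[OF d p(1)]) (use p(2) PcA in \<open>unfold dns_def, blast\<close>)
    then obtain q u s where q: "q : G" "opr u s : el (v j)" "Pc a s" "el s <= el q" "fE q (v i) u" unfolding fM0_def by blast
    have uA: "u : A" using q vA opr_elA by blast
    have "val G (v i) = val G u" using fE_truth[OF vA(1) uA] q by blast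
    moreover have "s : G" using Gup q by blast
    ultimately show "val G (v i) : el (val G (v j))" using q(2) unfolding el_val by blast
  qed
next
  case (Eq i j)
  then have "v i : A" "v j : A" by auto
  then show ?case using fE_truth by simp
next
  case (Neg \<phi>)
  show ?case
  proof
    assume "sat N mem (Neg \<phi>) (%i. val G (v i))"
    then have n: "\<not> (EX p:G. fo \<phi> p v)" using Neg by simp
    have "EX p:G. fo \<phi> p v \<or> fo (Neg \<phi>) p v"
      by (rule Ggen) (intro df dfb_fo_v Neg.prems, rule fo_em[OF Neg.prems])
    then show "EX p:G. fo (Neg \<phi>) p v" using n by blast
  next
    assume "EX p:G. fo (Neg \<phi>) p v"
    then have "\<not> (EX p:G. fo \<phi> p v)" using fo_contra[OF Neg.prems] by blast
    then show "sat N mem (Neg \<phi>) (%i. val G (v i))" using Neg by simp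
  qed
next
  case (Conj \<phi> \<psi>)
  show ?case
  proof
    assume "sat N mem (Conj \<phi> \<psi>) (%i. val G (v i))"
    then obtain p q where pq: "p : G" "q : G" "fo \<phi> p v" "fo \<psi> q v" using Conj by auto
    obtain s where s: "s : G" "el p <= el s" "el q <= el s" using Gdir pq by blast
    then have "fo \<phi> s v" "fo \<psi> s v" using fo_mono[OF Conj.prems] pq GP by blast+
    then show "EX p:G. fo (Conj \<phi> \<psi>) p v" using s by auto
  next
    assume "EX p:G. fo (Conj \<phi> \<psi>) p v"
    then show "sat N mem (Conj \<phi> \<psi>) (%i. val G (v i))" using Conj by auto
  qed
next
  case (Forall i \<phi>)
  have vx: "range (v(i := x)) <= A" if "x : A" for x using Forall.prems that by (auto simp: image_subset_iff)
  have vv: "(%k. val G (v k))(i := val G x) = (%k. val G ((v(i := x)) k))" for x by auto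
  have s: "sat N mem (Forall i \<phi>) (%i. val G (v i)) \<longleftrightarrow> (ALL x:A. EX p:G. fo \<phi> p (v(i := x)))"
  proof -
    have "sat N mem (Forall i \<phi>) (%i. val G (v i)) \<longleftrightarrow> (ALL x:A. sat N mem \<phi> ((%k. val G (v k))(i := val G x)))"
      unfolding N_def by simp
    also have "... \<longleftrightarrow> (ALL x:A. EX p:G. fo \<phi> p (v(i := x)))"
      by (intro ball_cong HOL.refl) (simp only: vv Forall.IH[OF vx])
    finally show ?thesis .
  qed
  show ?case
  proof
    assume l: "sat N mem (Forall i \<phi>) (%i. val G (v i))"
    \<comment> \<open>By \<open>fo_dense\<close>, a condition not forcing the universal statement
      has an extension forcing the negation of some instance; so this disjunction is dense.\<close>
    let ?Q = "%p. fo (Forall i \<phi>) p v \<or> (EX x:A. fo (Neg \<phi>) p (v(i := x)))"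
    have "EX p:G. ?Q p"
    proof (rule Ggen)
      have "dfb A (%e. fo (Neg \<phi>) (e 0) (%n. e (Suc n)))" by (rule dfb_fo)
      from dfb_neg[OF dfb_all_upd[OF dfb_neg[OF this], of "Suc i"]]
      have "dfb A (%e. EX x:A. fo (Neg \<phi>) (e 0) ((%n. e (Suc n))(i := x)))"
      proof (rule dfb_cong)
        fix e :: "nat => hset"
        have "(%n. (e(Suc i := x)) (Suc n)) = (%n. e (Suc n))(i := x)" for x by auto
        then show "(\<not> (ALL x:A. \<not> fo (Neg \<phi>) ((e(Suc i := x)) 0) (%n. (e(Suc i := x)) (Suc n)))) =
          (EX x:A. fo (Neg \<phi>) (e 0) ((%n. e (Suc n))(i := x)))" by (simp del: fo.simps)
      qed
      moreover have "range (%n. case n of 0 => v 0 | Suc n => v n) <= A"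
        using Forall.prems by (auto simp: image_subset_iff split: nat.splits)
      ultimately have "dfb A (%e. EX x:A. fo (Neg \<phi>) (e 0) (v(i := x)))" using dfb_fix[of _ _ 1] by fastforce
      then show "dfb A (%e. ?Q (e 0))" by (intro dfb_disj dfb_fo_v Forall.prems)
      fix p assume p: "Pc a p"
      show "EX d. Pc a d \<and> el p <= el d \<and> ?Q d"
      proof (cases "fo (Forall i \<phi>) p v")
        case True then show ?thesis using p by blast
      next
        case False
        then obtain x where x: "x : A" "\<not> fo \<phi> p (v(i := x))" by auto
        then obtain q where q: "Pc a q" "el p <= el q" "!!q'. Pc a q' ==> el q <= el q' ==> \<not> fo \<phi> q' (v(i := x))"
          using fo_dense[OF vx[OF x(1)] p] by blast
        then have "fo (Neg \<phi>) q (v(i := x))" by simp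
        then show ?thesis using q x by blast
      qed
    qed
    then obtain p where p: "p : G" "?Q p" by blast
    have "\<not> (EX x:A. fo (Neg \<phi>) p (v(i := x)))"
    proof
      assume "EX x:A. fo (Neg \<phi>) p (v(i := x))"
      then obtain x where x: "x : A" "fo (Neg \<phi>) p (v(i := x))" by blast
      obtain q where "q : G" "fo \<phi> q (v(i := x))" using l[unfolded s] x by blast
      then show False using fo_contra[OF vx[OF x(1)] _ p(1) _ x(2)] by blast
    qed
    then show "EX p:G. fo (Forall i \<phi>) p v" using p by blast
  next
    assume "EX p:G. fo (Forall i \<phi>) p v"
    then show "sat N mem (Forall i \<phi>) (%i. val G (v i))" unfolding s by auto
  qed
qed

text \<open>Genericity puts a condition as built in \<open>key\<close> into \<open>G\<close>; it
  then needs only lower conditions to meet each \<open>D i\<close>, and the lower generic supplies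
  them. This takes the place of pretameness in the proof of ZFC.\<close>

lemma key_G: assumes b: "limo b" "b : A" and I: "I : A" "sm b I"
    and dD: "dfb A (%e. D (e 0) (e 1))"
    and dense: "!!i p. i : el I ==> Pc a p ==> EX d. Pc a d \<and> el p <= el d \<and> D i d"
    and opn: "!!i p q. i : el I ==> Pc a p ==> D i p ==> Pc a q ==> el p <= el q ==> D i q"
  shows "EX q:G. ALL i:el I. EX u:Gb b. D i (cup u q)"
proof -
  have o: "Ord b" using b unfolding limo_def by simp
  let ?Q = "%q. ALL i:el I. ALL u:el (cc a b). el (low b q) <= el u --> (EX u':el (cc a b). el u <= el u' \<and> D i (cup u' q))"
  have "EX q:G. ?Q q"
  proof (rule Ggen)
    show "dfb A (%e. ?Q (e 0))" by (intro df df2[OF dD] I aA b ccA)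
    fix p assume p: "Pc a p"
    have "EX q. Pc a q \<and> el p <= el q \<and> low b q = low b p \<and>
      (ALL i:el I. ALL u:el (cc a b). el (low b p) <= el u --> (EX u':el (cc a b). el u <= el u' \<and> D i (cup u' q)))"
      by (rule key[OF aA b I dD _ _ p]) (fact dense, fact opn)
    then obtain q where q: "Pc a q" "el p <= el q" "low b q = low b p"
      "ALL i:el I. ALL u:el (cc a b). el (low b p) <= el u --> (EX u':el (cc a b). el u <= el u' \<and> D i (cup u' q))"
      by (elim exE conjE) (rule that)
    then show "EX d. Pc a d \<and> el p <= el d \<and> ?Q d" by (intro exI[of _ q]) simp
  qed
  then obtain q where q: "q : G" "?Q q" by blast
  interpret g: gen A "cc a b" "rr b" "Gb b" by (rule gen_b[OF b])
  have "EX u:Gb b. D i (cup u q)" if i: "i : el I" for i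
  proof -
    have iA: "i : A" using i I Atrans by blast
    have "EX u:Gb b. le (rr b) u (low b q) \<and> D i (cup u q)"
    proof (rule g.Ggen_below)
      show "dfb A (%e. D i (cup (e 0) q))" by (intro df df2[OF dD] iA GA[OF q(1)])
      show "low b q : Gb b" using low_Gb[OF b(2) q(1)] .
      show "EX d. le (rr b) d u \<and> D i (cup d q)" if "le (rr b) u (low b q)" for u
        using q(2) i that unfolding le_rr by blast
    qed
    then show ?thesis by blast
  qed
  then show ?thesis using q(1) by blast
qed

end

section \<open>The class extension satisfies ZFC\<close>

context zfL
begin

lemma sm_rank: assumes "b : A" "limo b" "rank I : el b" "I : A" shows "sm b I"
proof -
  have o: "Ord b" using assms unfolding limo_def by simp
  show ?thesis
  proof (rule sm_V[OF assms(1) o], unfold VV_succ[OF o], rule subsetI)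
    fix x assume x: "x : el I"
    then have "rank x : el b" using rank_mem assms(3) Ord_trans[OF o] by blast
    then show "x : {x : A. rank x = b \<or> rank x : el b}" using x assms(4) Atrans by blast
  qed
qed

end

section \<open>Names for pairs and for families of values\<close>

definition upn where "upn s t = upair (opr s zero) (opr t zero)"
definition opn where "opn s t = upn (upn s s) (upn s t)"

lemma val_upn: "zero : G ==> val G (upn s t) = upair (val G s) (val G t)"
  by (rule ext_el) (auto simp: el_val upn_def)
lemma val_opn: "zero : G ==> val G (opn s t) = opr (val G s) (val G t)"
  unfolding opn_def by (simp add: val_upn opr_def)

definition nmz where "nmz X = mk ((%s. opr s zero) ` el X)"
lemma val_nmz: "zero : G ==> el (val G (nmz X)) = val G ` el X"
  by (auto simp: el_val nmz_def)

context zf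
begin
lemma dft_opn[df]: "dft A s ==> dft A t ==> dft A (%e. opn (s e) (t e))"
  by (rule dff2[where f=opn], unfold opn_def upn_def) (intro df zeroA)+
lemma dft_nmz[df]: "dft A t ==> dft A (%e. nmz (t e))"
  by (rule dff1[where f=nmz], unfold nmz_def) (intro df zeroA)+
lemma nmzA[simp]: "x : A ==> nmz x : A"
  using dft_in[OF dft_nmz[OF dft_const], of x "%_. x"] by auto
lemma PwA2[simp]: "x : A ==> Pw x : A" using PwA unfolding Pw_def .
declare tcA[simp] UniA[simp]
end

context cls
begin

lemma N_I: "x : A ==> val G x : N" unfolding N_def by blast
lemma A_N: "x : A ==> x : N" using val_chk[OF G0, of x] N_I[of "chk zero x"] chkA[OF zeroA] by simp
lemma N_trans: "x : N ==> y : el x ==> y : N"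
proof -
  assume "x : N" "y : el x"
  then obtain x0 s p where "x0 : A" "y = val G s" "opr s p : el x0" unfolding N_def by (auto simp: el_val)
  then show ?thesis using opr_elA(1) N_I by blast
qed
lemma cntN: "countable N" unfolding N_def using cntA by simp
lemma carrN: "carrier N" by unfold_locales (use A_N[OF zeroA] in auto)

lemma dfb_fo2: assumes v: "range v <= A" and s: "dft A s" and t: "dft A t" shows "dfb A (%e. fo \<phi> (s e) (v(0 := t e)))"
proof (rule df2[where Q="%p x. fo \<phi> p (v(0 := x))", OF _ s t])
  have "range (%n. case n of 0 => v 0 | Suc n => v n) <= A" using v by (auto simp: image_subset_iff split: nat.splits)
  from dfb_fix[OF dfb_fo this, of \<phi> 2]
  have "dfb A (%e. fo \<phi> (e 0) (%n. if n = 0 then e (Suc n) else v n))" by (simp add: less_Suc_eq numeral_2_eq_2 cong: if_cong)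
  moreover have "(%n. if n = 0 then e (Suc n) else v n) = v(0 := e 1)" for e by auto
  ultimately show "dfb A (%e. fo \<phi> (e 0) (v(0 := e 1)))" by simp
qed

lemma dfb_fo3: assumes v: "range v <= A" and s: "dft A s" and t: "dft A t" and u: "dft A u"
  shows "dfb A (%e. fo \<phi> (s e) (v(0 := t e, 2 := u e)))"
proof (rule df3[where Q="%p x y. fo \<phi> p (v(0 := x, 2 := y))", OF _ s t u])
  \<comment> \<open>In \<open>fo\<close> the condition is read at slot 0 and formula variable
    \<open>n\<close> at slot \<open>Suc n\<close>. Variables 0 and 2 are the even places where
    \<open>mrg\<close> puts the two arguments of a relation, so slots 2 and 3 must be
    exchanged.\<close>
  let ?f = "%n::nat. if n = 2 then 3 else if n = 3 then 2 else n"
  have i: "inj ?f" by (rule injI) (auto split: if_splits)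
  have "range (%n. case n of 0 => v 0 | Suc n => v n) <= A" using v by (auto simp: image_subset_iff split: nat.splits)
  moreover have "dfb A (%e. fo \<phi> (e 0) (%n. if n = 1 then e 2 else if n = 2 then e 2 else e (Suc n)))" if "False" using that by blast
  moreover have "dfb A (%e. fo \<phi> (e 0) (%n. (e \<circ> ?f) (Suc n)))" using dfb_ren[OF dfb_fo i, of \<phi>] by simp
  ultimately have "dfb A (%e. fo \<phi> (e 0) (%n. ((%k. if k < 3 then e k else case k of 0 => v 0 | Suc n => v1 n) \<circ> ?f) (Suc n)))"
    if "range v1 <= A" for v1
    using dfb_fix[of "%e. fo \<phi> (e 0) (%n. (e \<circ> ?f) (Suc n))" "%k. case k of 0 => v 0 | Suc n => v1 n" 3] that v
    by (auto simp: image_subset_iff split: nat.splits)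
  from this[of "v(2 := v 1)"] v
  have "dfb A (%e. fo \<phi> (e 0) (%n. ((%k. if k < 3 then e k else case k of 0 => v 0 | Suc n => (v(2 := v 1)) n) \<circ> ?f) (Suc n)))"
    by (auto simp: image_subset_iff)
  moreover have "(%n. ((%k. if k < 3 then e k else case k of 0 => v 0 | Suc n => (v(2 := v 1)) n) \<circ> ?f) (Suc n)) = v(0 := e 1, 2 := e 2)" for e
    by (auto simp: fun_eq_iff)
  ultimately show "dfb A (%e. fo \<phi> (e 0) (v(0 := e 1, 2 := e 2)))" by simp
qed

text \<open>\<open>key_G\<close> is applied to the conditions deciding \<open>Q (val G i)\<close>.
  With the upper part \<open>q\<close> fixed, the answer at \<open>i\<close> depends only on a lower
  condition \<open>u\<close>, so it is read off from a subset of \<open>prd I (cc a b)\<close>. That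
  bound on \<open>f\<close> is used for power set and for the absence of new small sets.\<close>

lemma Sep_name: assumes Q: "dfb N (%e. Q (e 0))" and b: "limo b" "b : A" and I: "I : A" "sm b I"
  shows "EX f:A. el f <= el (prd I (cc a b)) \<and> (ALL i:el I. Q (val G i) \<longleftrightarrow> (EX u:G. opr i u : el f))"
proof -
  have o: "Ord b" using b unfolding limo_def by simp
  obtain \<phi> w where w: "range w <= N" "!!e. range e <= N ==> Q (e 0) \<longleftrightarrow> sat N mem \<phi> (mrg e w)"
    using Q unfolding dfb_def by blast
  have "ALL k. EX x. x : A \<and> w k = val G x" using w(1) unfolding N_def by blast
  then obtain w' where w': "!!k. w' k : A" "!!k. w k = val G (w' k)" by metis
  define v where "v = mrg (%_. zero) w'"
  have v: "range v <= A" unfolding v_def mrg_def using w' by auto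
  have vi: "range (v(0 := i)) <= A" if "i : A" for i using v that by (auto simp: image_subset_iff)
  have Qi: "Q (val G i) \<longleftrightarrow> (EX p:G. fo \<phi> p (v(0 := i)))" if i: "i : A" for i
  proof -
    let ?e = "(%_. val G zero)(0 := val G i)"
    have "range ?e <= N" using N_I i zeroA by auto
    from w(2)[OF this] have "Q (val G i) \<longleftrightarrow> sat N mem \<phi> (mrg ?e w)" by simp
    also have "mrg ?e w = (%k. val G ((v(0 := i)) k))" unfolding v_def by (auto simp: fun_eq_iff mrg_def w' elim!: evenE)
    finally show ?thesis using truth[OF vi[OF i]] by simp
  qed
  let ?D = "%i p. fo \<phi> p (v(0 := i)) \<or> fo (Neg \<phi>) p (v(0 := i))"
  have "EX q:G. ALL i:el I. EX u:Gb b. ?D i (cup u q)"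
  proof (rule key_G[OF b I])
    show "dfb A (%e. ?D (e 0) (e 1))" by (intro dfb_disj dfb_fo2 v df)
    show "EX d. Pc a d \<and> el p <= el d \<and> ?D i d" if "i : el I" "Pc a p" for i p
      using fo_em[OF vi] that I Atrans by blast
    show "?D i q" if "i : el I" "Pc a p" "?D i p" "Pc a q" "el p <= el q" for i p q
      using fo_mono[OF vi] that I Atrans by blast
  qed
  then obtain q where q: "q : G" "ALL i:el I. EX u:Gb b. ?D i (cup u q)" by blast
  let ?f = "mk {z : el (prd I (cc a b)). fo \<phi> (cup (sn z) q) (v(0 := fs z))}"
  have fA: "?f : A" by (rule sepA) (intro dfb_fo2 v df GA[OF q(1)], use I aA b in simp)
  have elf: "el ?f = {z : el (prd I (cc a b)). fo \<phi> (cup (sn z) q) (v(0 := fs z))}" by (rule el_mk_el)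
  have "Q (val G i) \<longleftrightarrow> (EX u:G. opr i u : el ?f)" if i: "i : el I" for i
  proof
    have iA: "i : A" using i I Atrans by blast
    assume "Q (val G i)"
    then obtain p where p: "p : G" "fo \<phi> p (v(0 := i))" using Qi[OF iA] by blast
    obtain u where u: "u : Gb b" "?D i (cup u q)" using q i by blast
    have uG: "u : G" "cup u q : G" using u q Gcup unfolding Gb_def by auto
    have "fo \<phi> (cup u q) (v(0 := i))" using u(2) fo_contra[OF vi[OF iA] p(1) uG(2) p(2)] by blast
    then have "opr i u : el ?f" unfolding elf using i u Gb_cc[OF o] by (auto simp: el_prd)
    then show "EX u:G. opr i u : el ?f" using uG by blast
  next
    have iA: "i : A" using i I Atrans by blast
    assume "EX u:G. opr i u : el ?f"
    then obtain u where "u : G" "fo \<phi> (cup u q) (v(0 := i))" unfolding elf by auto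
    then show "Q (val G i)" using Qi[OF iA] Gcup q by blast
  qed
  moreover have "el ?f <= el (prd I (cc a b))" unfolding elf by blast
  ultimately show ?thesis using fA by blast
qed

lemma Sep_val: assumes Q: "dfb N (%e. Q (e 0))" and b: "limo b" "b : A" and I: "I : A" "sm b I"
  shows "EX f:A. el f <= el (prd I (cc a b)) \<and> el (val G f) = {val G i |i. i : el I \<and> Q (val G i)}"
proof -
  obtain f where f: "f : A" "el f <= el (prd I (cc a b))" "ALL i:el I. Q (val G i) \<longleftrightarrow> (EX u:G. opr i u : el f)"
    using Sep_name[OF assms] by blast
  have fI: "i : el I" if "opr i u : el f" for i u using subsetD[OF f(2) that] by (auto simp: el_prd)
  have "el (val G f) = {val G i |i. i : el I \<and> Q (val G i)}" unfolding el_val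
  proof (intro set_eqI iffI)
    fix z assume "z : {val G s |s p. p : G \<and> opr s p : el f}"
    then obtain s p where "z = val G s" "p : G" "opr s p : el f" by blast
    then show "z : {val G i |i. i : el I \<and> Q (val G i)}" using f(3) fI by blast
  next
    fix z assume "z : {val G i |i. i : el I \<and> Q (val G i)}"
    then show "z : {val G s |s p. p : G \<and> opr s p : el f}" using f(3) by blast
  qed
  then show ?thesis using f by blast
qed

definition dm where "dm x = mk (fs ` el x)"
lemma dmA: "x : A ==> dm x : A"
proof -
  assume x: "x : A"
  have "dft A (%e. dm (e 0))" unfolding dm_def by (intro df)
  from dft_in[OF this, of "%_. x"] show ?thesis using x by auto
qed
lemma val_dm: "el (val G x) <= val G ` el (dm x)"
  unfolding dm_def by (auto simp: el_val image_iff) force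

lemma nl_sm: "I : A ==> limo (nl I) \<and> nl I : A \<and> sm (nl I) I" using nl[of I] sm_rank[of "nl I" I] by blast

lemma sepN: assumes Q: "dfb N (%e. Q (e 0))" and x: "x : N" shows "mk {y : el x. Q y} : N"
proof -
  interpret N: carrier N by (rule carrN)
  obtain x0 where x0: "x0 : A" "x = val G x0" using x unfolding N_def by blast
  let ?I = "dm x0"
  have I: "?I : A" using dmA x0 by blast
  have "dfb N (%e. e 0 : el x \<and> Q (e 0))" by (intro N.dfb_conj N.dfb_mem N.dft_var N.dft_const x Q)
  from Sep_val[OF this, of "nl ?I" ?I] nl_sm[OF I] I
  obtain f where f: "f : A" "el (val G f) = {val G i |i. i : el ?I \<and> (val G i : el x \<and> Q (val G i))}" by blast
  have "el (val G f) = {y : el x. Q y}" unfolding f(2) using val_dm[of x0] x0(2) by blast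
  then have "mk {y : el x. Q y} = val G f" by (metis mk_el)
  then show ?thesis using N_I f by simp
qed

theorem N_zf: "zf N"
proof -
  interpret N: carrier N by (rule carrN)
  note z = G0
  show ?thesis
  proof unfold_locales
    show "y : N" if "x : N" "y : el x" for x y using N_trans that by blast
    show "countable N" by (rule cntN)
    show "upair x y : N" if xy: "x : N" "y : N" for x y
    proof -
      obtain s t where "s : A" "t : A" "x = val G s" "y = val G t" using xy unfolding N_def by blast
      then show ?thesis using val_upn[OF z, of s t] N_I[of "upn s t"] by (simp add: upn_def)
    qed
    show "omega : N" using A_N omegaA by blast
    show "mk {y : el x. Q y} : N" if "dfb N (%e. Q (e 0))" "x : N" for Q x using sepN that by blast
    show "Uni x : N" if x: "x : N" for x
    proof -
      obtain x0 where x0: "x0 : A" "x = val G x0" using x unfolding N_def by blast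
      have T: "val G (nmz (tc x0)) : N" using x0 by (intro N_I) simp
      have "mk {y : el (val G (nmz (tc x0))). EX w:N. w : el x \<and> y : el w} : N"
        by (rule sepN[OF _ T]) (intro N.dfb_ex N.dfb_conj N.dfb_mem N.dft_var N.dft_const x)
      moreover have "{y : el (val G (nmz (tc x0))). EX w:N. w : el x \<and> y : el w} = \<Union>(el ` el x)"
      proof (intro set_eqI iffI)
        fix y assume "y : \<Union>(el ` el x)"
        then obtain w where w: "w : el x" "y : el w" by blast
        then obtain s p where s: "w = val G s" "opr s p : el x0" unfolding x0(2) el_val by blast
        then obtain t q where t: "y = val G t" "opr t q : el s" using w(2) unfolding s(1) el_val by blast
        have "t : TC x0" using opr_el_TC(1)[OF s(2)] opr_el_TC(1)[OF t(2)] TC_trans by blast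
        then have "y : el (val G (nmz (tc x0)))" unfolding val_nmz[OF z] t(1) by simp
        then show "y : {y : el (val G (nmz (tc x0))). EX w:N. w : el x \<and> y : el w}" using w N_trans[OF x] by blast
      qed blast
      ultimately show ?thesis by (simp add: Uni_def)
    qed
    show "mk {y : N. el y <= el x} : N" if x: "x : N" for x
    proof -
      obtain x0 where x0: "x0 : A" "x = val G x0" using x unfolding N_def by blast
      let ?I = "dm x0"
      have I: "?I : A" using dmA x0 by blast
      \<comment> \<open>By \<open>Sep_val\<close> each subset of \<open>x\<close> in the extension
        is the value of a subset of this product, so one name collects them all.\<close>
      let ?T = "nmz (Pw (prd ?I (cc a (nl ?I))))"
      have T: "val G ?T : N" using I aA nl_sm[OF I] by (intro N_I) simp
      have "mk {y : el (val G ?T). ALL w:N. w : el y --> w : el x} : N"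
        by (rule sepN[OF _ T]) (intro N.dfb_all N.dfb_imp N.dfb_mem N.dft_var N.dft_const x)
      moreover have "{y : el (val G ?T). ALL w:N. w : el y --> w : el x} = {y : N. el y <= el x}"
      proof (intro set_eqI iffI)
        fix y assume y: "y : {y : el (val G ?T). ALL w:N. w : el y --> w : el x}"
        then have "y : N" using N_trans[OF T] by blast
        then show "y : {y : N. el y <= el x}" using y N_trans by blast
      next
        fix y assume y: "y : {y : N. el y <= el x}"
        have "dfb N (%e. e 0 : el y)" using y by (intro N.dfb_mem N.dft_var N.dft_const) simp
        from Sep_val[OF this, of "nl ?I" ?I] nl_sm[OF I] I
        obtain f where f: "f : A" "el f <= el (prd ?I (cc a (nl ?I)))" "el (val G f) = {val G i |i. i : el ?I \<and> val G i : el y}" by blast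
        have "el (val G f) = el y" unfolding f(3) using val_dm[of x0] x0(2) y by blast
        then have "y = val G f" by (rule ext_el[symmetric])
        moreover have "f : el (Pw (prd ?I (cc a (nl ?I))))" using f by simp
        ultimately have "y : el (val G ?T)" unfolding val_nmz[OF z] by blast
        then show "y : {y : el (val G ?T). ALL w:N. w : el y --> w : el x}" using y by blast
      qed
      ultimately show ?thesis by simp
    qed
    show "EX y:N. ALL c:el x. EX d:el y. R c d" if R: "dfb N (%e. R (e 0) (e 1))" and x: "x : N"
      and ex: "!!c. c : el x ==> EX! d. d : N \<and> R c d" for R x
    proof -
      obtain \<phi> w where w: "range w <= N" "!!e. range e <= N ==> R (e 0) (e 1) \<longleftrightarrow> sat N mem \<phi> (mrg e w)"
        using R unfolding dfb_def by blast
      have "ALL k. EX x. x : A \<and> w k = val G x" using w(1) unfolding N_def by blast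
      then obtain w' where w': "!!k. w' k : A" "!!k. w k = val G (w' k)" by metis
      define v where "v = mrg (%_. zero) w'"
      have v: "range v <= A" unfolding v_def mrg_def using w' by auto
      have vi: "range (v(0 := i, 2 := t)) <= A" if "i : A" "t : A" for i t using v that by (auto simp: image_subset_iff)
      have Ri: "R (val G i) (val G t) \<longleftrightarrow> (EX p:G. fo \<phi> p (v(0 := i, 2 := t)))" if i: "i : A" "t : A" for i t
      proof -
        let ?e = "(%_. val G zero)(0 := val G i, 1 := val G t)"
        have "range ?e <= N" using N_I i zeroA by auto
        from w(2)[OF this] have "R (val G i) (val G t) \<longleftrightarrow> sat N mem \<phi> (mrg ?e w)" by simp
        also have "mrg ?e w = (%k. val G ((v(0 := i, 2 := t)) k))" unfolding v_def by (auto simp: fun_eq_iff mrg_def w' elim!: evenE)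
        finally show ?thesis using truth[OF vi[OF i]] by simp
      qed
      obtain x0 where x0: "x0 : A" "x = val G x0" using x unfolding N_def by blast
      let ?I = "dm x0"
      have I: "?I : A" using dmA x0 by blast
      let ?b = "nl ?I"
      have b: "limo ?b" "?b : A" "sm ?b ?I" using nl_sm[OF I] by auto
      have o: "Ord ?b" using b unfolding limo_def by simp
      \<comment> \<open>Either a witness is forced or all candidates are refuted. Since one
        \<open>q\<close> serves for all \<open>i\<close>, witnesses have to be collected only for
        the pairs \<open>(i, u)\<close>, which form a set.\<close>
      let ?D = "%i p. (EX t:A. fo \<phi> p (v(0 := i, 2 := t))) \<or> (ALL t:A. fo (Neg \<phi>) p (v(0 := i, 2 := t)))"
      have dD: "dfb A (%e. ?D (e 0) (e 1))" by (intro dfb_disj dfb_ex dfb_all dfb_fo3 v dft_var)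
      have "EX q:G. ALL i:el ?I. EX u:Gb ?b. ?D i (cup u q)"
      proof (rule key_G[OF b(1,2) I b(3) dD])
        fix i p assume i: "i : el ?I" and p: "Pc a p"
        have iA: "i : A" using i I Atrans by blast
        show "EX d. Pc a d \<and> el p <= el d \<and> ?D i d"
        proof (cases "ALL t:A. fo (Neg \<phi>) p (v(0 := i, 2 := t))")
          case True then show ?thesis using p by blast
        next
          case False
          then obtain t q where "t : A" "q : A" "Pc a q" "el p <= el q" "fo \<phi> q (v(0 := i, 2 := t))" by auto
          then show ?thesis by blast
        qed
        fix q assume "?D i p" "Pc a q" "el p <= el q"
        then show "?D i q" using fo_mono[OF vi[OF iA] _ p] by blast
      qed
      then obtain q where q: "q : G" "ALL i:el ?I. EX u:Gb ?b. ?D i (cup u q)" by blast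
      have qA: "q : A" using q GA by blast
      let ?F = "%z t. fo \<phi> (cup (sn z) q) (v(0 := fs z, 2 := t))"
      let ?PP = "prd ?I (cc a ?b)"
      have "EX Y:A. ALL z:el ?PP. EX t:el Y. (EX t:A. ?F z t) --> ?F z t"
      proof (rule collection)
        show "dfb A (%e. (EX t:A. ?F (e 0) t) --> ?F (e 0) (e 1))" by (intro dfb_imp dfb_ex dfb_fo3 v df qA)
        show "?PP : A" using I aA b by simp
        show "EX t:A. (EX t:A. ?F z t) --> ?F z t" for z using zeroA by blast
      qed
      then obtain Y where Y: "Y : A" "ALL z:el ?PP. EX t:el Y. (EX t:A. ?F z t) --> ?F z t" by blast
      show ?thesis
      proof (rule bexI[of _ "val G (nmz Y)"], rule ballI)
        show "val G (nmz Y) : N" using Y by (intro N_I) simp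
        fix c assume c: "c : el x"
        then obtain i where i: "i : el ?I" "c = val G i" using val_dm[of x0] x0 by blast
        have iA: "i : A" using i I Atrans by blast
        obtain d where "d : N" "R c d" using ex[OF c] by blast
        then obtain t0 where t0: "t0 : A" "R c (val G t0)" unfolding N_def by blast
        then obtain p where p: "p : G" "fo \<phi> p (v(0 := i, 2 := t0))" using Ri[OF iA] i by blast
        obtain u where u: "u : Gb ?b" "?D i (cup u q)" using q i by blast
        have uG: "cup u q : G" using u q Gcup unfolding Gb_def by auto
        have "EX t:A. ?F (opr i u) t" using u(2) fo_contra[OF vi[OF iA t0(1)] p(1) uG p(2)] t0(1) by (auto simp del: fo.simps)
        moreover have "opr i u : el ?PP" using i u Gb_cc[OF o] by (auto simp: el_prd)
        ultimately obtain t where t: "t : el Y" "?F (opr i u) t" using Y(2) by blast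
        have "t : A" using t Y Atrans by blast
        then have "R c (val G t)" using Ri[OF iA] t(2) uG i(2) by auto
        then show "EX d:el (val G (nmz Y)). R c d" unfolding val_nmz[OF z] using t by blast
      qed
    qed
  qed
qed

lemma valset: assumes I: "I : A" shows "lam I (val G) : N"
proof -
  let ?T = "nmz (mk ((%s. opn (chk zero s) s) ` el I))"
  have "dft A (%e. nmz (mk ((%s. opn (chk zero s) s) ` el (e 0))))" by (intro df zeroA)
  from dft_in[OF this, of "%_. I"] have "?T : A" using I by auto
  moreover have "val G ?T = lam I (val G)"
  proof (rule ext_el)
    have "el (val G ?T) = val G ` (%s. opn (chk zero s) s) ` el I" unfolding val_nmz[OF G0] by simp
    also have "... = (%s. opr s (val G s)) ` el I" by (simp add: image_image val_opn[OF G0] val_chk[OF G0])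
    finally show "el (val G ?T) = el (lam I (val G))" by simp
  qed
  ultimately show ?thesis using N_I by metis
qed

text \<open>The evaluation map on the names in \<open>tc x0\<close> and the order \<open>wl\<close>
  on them are both elements of the extension; from each member of \<open>x\<close> the value of its
  \<open>wl\<close>-least name is selected.\<close>

theorem N_AC: "AC N"
  unfolding AC_def
proof (intro ballI impI, elim conjE)
  interpret N: zf N by (rule N_zf)
  fix x assume x: "x : N" and ne: "ALL y:el x. el y ~= {}" and dj: "ALL y:el x. ALL z:el x. y ~= z --> el y Int el z = {}"
  obtain x0 where x0: "x0 : A" "x = val G x0" using x unfolding N_def by blast
  let ?I = "tc x0"
  define F where "F = lam ?I (val G)"
  have FN: "F : N" unfolding F_def using valset x0 by simp
  have IN: "?I : N" using A_N x0 by simp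
  define w where "w = mk {z : el (prd ?I ?I). wl (fs z) (sn z)}"
  have "w : A" unfolding w_def by (rule sepA) (intro df, use x0 in simp)
  then have wN: "w : N" using A_N by blast
  have elw: "opr s t : el w \<longleftrightarrow> s : TC x0 \<and> t : TC x0 \<and> wl s t" for s t
  proof -
    have "el w = {z : el (prd ?I ?I). wl (fs z) (sn z)}" unfolding w_def by (rule el_mk_el)
    then show ?thesis by (auto simp: el_prd)
  qed
  have elF: "opr s d : el F \<longleftrightarrow> s : TC x0 \<and> d = val G s" for s d unfolding F_def by auto
  let ?Q = "%d. EX y:el x. d : el y \<and> (EX s:el ?I. opr s d : el F \<and> (ALL t:el ?I. ALL d':el y. opr t d' : el F --> opr t s ~: el w))"
  let ?c = "mk {d : el (Uni x). ?Q d}"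
  have cN: "?c : N" by (rule N.sepA) (intro df x IN FN wN, use x in simp)
  have elc: "el ?c = {d : el (Uni x). ?Q d}" by (rule el_mk_el)
  have TA: "TC x0 <= A" using el_subA[OF tcA[OF x0(1)]] by simp
  have "EX! z. z : el ?c Int el y" if y: "y : el x" for y
  proof -
    obtain sy py where sy: "y = val G sy" "opr sy py : el x0" using y unfolding x0(2) el_val by blast
    have cover: "EX s:TC x0. d = val G s" if "d : el y" for d
    proof -
      obtain t q where t: "d = val G t" "opr t q : el sy" using \<open>d : el y\<close> unfolding sy(1) el_val by blast
      have "t : TC x0" using opr_el_TC(1)[OF sy(2)] opr_el_TC(1)[OF t(2)] TC_trans by blast
      then show ?thesis using t by blast
    qed
    let ?S = "{s : TC x0. val G s : el y}"
    obtain d0 where "d0 : el y" using ne y by blast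
    then have "?S ~= {}" using cover by blast
    moreover have "?S <= A" using TA by blast
    ultimately obtain s where s: "s : ?S" "ALL t:?S. \<not> wl t s" using wfo_min[OF wl_wellorder(2), of ?S] by blast
    have uq: "t = s" if "t : ?S" "ALL r:?S. \<not> wl r t" for t
      using wl_wellorder(1) s that TA unfolding tot_def by blast
    show ?thesis
    proof (rule ex1I[of _ "val G s"])
      have "?Q (val G s)"
        by (rule bexI[OF _ y]) (use s elF elw in auto)
      moreover have "val G s : el (Uni x)" using s y by auto
      ultimately show "val G s : el ?c Int el y" unfolding elc using s by blast
    next
      fix d assume "d : el ?c Int el y"
      then have d: "d : el y" "?Q d" unfolding elc by blast+
      then obtain y' t where y': "y' : el x" "d : el y'" "opr t d : el F" "ALL r:el ?I. ALL d':el y'. opr r d' : el F --> opr r t ~: el w" by blast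
      have "y' = y" using dj y y' d by blast
      then have t: "t : ?S" "ALL r:?S. \<not> wl r t" using y' elF elw by auto
      then have "t = s" by (rule uq)
      then show "d = val G s" using y'(3) elF by blast
    qed
  qed
  then show "EX c:N. ALL y:el x. EX! z. z : el c Int el y" using cN by blast
qed

end

section \<open>Transitive models of ZFC\<close>

lemma elts_el: "ALL x:A. el x <= A ==> x : A ==> elts A mem x = el x"
  unfolding elts_def by auto

lemma ZFC_zf: assumes c: "countable A" and t: "ALL x:A. el x <= A" and Z: "ZFC A mem"
  shows "zf A" "AC A"
proof -
  note e = elts_el[OF t]
  have ext: "u = mk X" if "u : A" "elts A mem u = X" for u X using that e by auto
  have inf: "EX w:A. (EX x:elts A mem w. elts A mem x = {}) \<and>
        (ALL x:elts A mem w. EX s:elts A mem w. elts A mem s = insert x (elts A mem x))" using Z unfolding ZFC_def by (elim conjE)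
  have Zp: "ALL x:A. ALL y:A. EX z:A. elts A mem z = {x, y}" using Z unfolding ZFC_def by (elim conjE)
  have Zu: "ALL x:A. EX u:A. elts A mem u = (\<Union>y\<in>elts A mem x. elts A mem y)" using Z unfolding ZFC_def by (elim conjE)
  have Zw: "ALL x:A. EX p:A. elts A mem p = {y : A. elts A mem y <= elts A mem x}" using Z unfolding ZFC_def by (elim conjE)
  have Zs: "ALL X. definable A mem X --> (ALL x:A. EX y:A. elts A mem y = elts A mem x Int X)" using Z unfolding ZFC_def by (elim conjE)
  have Zr: "ALL R. definable_rel A mem R --> (ALL x:A. (ALL a:elts A mem x. EX! b. (a, b) : R) -->
           (EX y:A. ALL a:elts A mem x. EX b:elts A mem y. (a, b) : R))" using Z unfolding ZFC_def by (elim conjE)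
  have Zc: "ALL x:A. (ALL y:elts A mem x. elts A mem y ~= {}) \<and>
        (ALL y:elts A mem x. ALL z:elts A mem x. y ~= z --> elts A mem y Int elts A mem z = {}) -->
        (EX c:A. ALL y:elts A mem x. EX! z. z : elts A mem c Int elts A mem y)" using Z unfolding ZFC_def by (elim conjE)
  from inf obtain w where w: "w : A" "EX x:el w. elts A mem x = {}" "ALL x:el w. EX s:el w. elts A mem s = insert x (elts A mem x)"
    using e by auto
  interpret carrier A by unfold_locales (use w in blast)
  have wA: "x : A" if "x : el w" for x using that w t by blast
  have sep: "mk {y : el x. Q y} : A" if Q: "dfb A (%e. Q (e 0))" and x: "x : A" for Q x
  proof -
    have "dfb A (%e. e 0 : {y : A. Q y})" using Q by (rule dfb_cong) auto
    then have "definable A mem {y : A. Q y}" by (subst definable_iff_dfb) auto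
    then obtain y where y: "y : A" "elts A mem y = elts A mem x Int {y : A. Q y}" using Zs x by blast
    moreover have "elts A mem x Int {y : A. Q y} = {y : el x. Q y}" using e[OF x] t x by auto
    ultimately show ?thesis using ext by metis
  qed
  have om: "omega : A"
  proof -
    have z: "zero : el w"
    proof -
      obtain x where x: "x : el w" "elts A mem x = {}" using w by blast
      then have "x = zero" using e[OF wA[OF x(1)]] by (intro ext_el) simp
      then show ?thesis using x by simp
    qed
    have s: "succ x : el w" if x: "x : el w" for x
    proof -
      obtain s where s: "s : el w" "elts A mem s = insert x (elts A mem x)" using w x by blast
      then have "s = succ x" using e[OF wA[OF s(1)]] e[OF wA[OF x]] by (intro ext_el) simp
      then show ?thesis using s by simp
    qed
    have vw: "vn n : el w" for n by (induction n) (use z s in auto)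
    \<comment> \<open>The finite ordinals are cut out of the inductive set: \<open>n\<close> and
      each of its elements is empty or a successor, which by foundation leaves only finite
      ordinals.\<close>
    let ?P = "%n. ALL m:A. (m : el n \<or> m = n) --> (ALL z:A. z ~: el m) \<or> (EX k:A. k : el m \<and> (ALL z:A. z : el m \<longleftrightarrow> z = k \<or> z : el k))"
    have "dfb A (%e. ?P (e 0))" by (intro df)
    from sep[OF this w(1)] have "mk {n : el w. ?P n} : A" .
    moreover have "{n : el w. ?P n} = range vn"
    proof (intro set_eqI iffI)
      fix n assume "n : {n : el w. ?P n}"
      then have "n : A" "?P n" using wA by auto
      then show "n : range vn"
      proof (induction n rule: el_induct)
        case (step n)
        have tn: "el n <= A" using t step by blast
        from step(3)[rule_format, OF step(2)] consider "ALL z:A. z ~: el n" | k where "k : A" "k : el n" "ALL z:A. z : el n \<longleftrightarrow> z = k \<or> z : el k" by blast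
        then show ?case
        proof cases
          case 1
          then have "n = vn 0" using tn by (intro ext_el) auto
          then show ?thesis by blast
        next
          case 2
          have n: "n = succ k" by (rule ext_el) (use 2 tn t in auto)
          have "?P k" using step(3) n by auto
          then obtain i where "k = vn i" using step(1) 2 by blast
          then have "n = vn (Suc i)" using n by simp
          then show ?thesis by blast
        qed
      qed
    next
      fix n assume "n : range vn"
      then obtain i where i: "n = vn i" by blast
      have "?P (vn i)"
      proof (intro ballI impI)
        fix m assume "m : A" "m : el (vn i) \<or> m = vn i"
        moreover have "el (vn i) <= range vn" using Ord_omega unfolding Ord_def by simp
        ultimately obtain j where j: "m = vn j" by auto
        show "(ALL z:A. z ~: el m) \<or> (EX k:A. k : el m \<and> (ALL z:A. z : el m \<longleftrightarrow> z = k \<or> z : el k))"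
        proof (cases j)
          case 0 then show ?thesis using j by simp
        next
          case (Suc l)
          have "vn l : A" using vw wA by blast
          then show ?thesis using j Suc by (intro disjI2 bexI[of _ "vn l"]) auto
        qed
      qed
      then show "n : {n : el w. ?P n}" using vw i by simp
    qed
    ultimately show ?thesis by (simp add: omega_def)
  qed
  show "zf A"
  proof unfold_locales
    show "y : A" if "x : A" "y : el x" for x y using t that by blast
    show "countable A" by fact
    show "upair x y : A" if xy: "x : A" "y : A" for x y
    proof -
      obtain z where "z : A" "elts A mem z = {x, y}" using Zp xy by blast
      then show ?thesis using ext unfolding upair_def by metis
    qed
    show "Uni x : A" if x: "x : A" for x
    proof -
      obtain u where u: "u : A" "elts A mem u = (\<Union>y\<in>elts A mem x. elts A mem y)" using Zu x by blast
      moreover have "(\<Union>y\<in>elts A mem x. elts A mem y) = \<Union>(el ` el x)" using e x t by (simp add: subset_iff)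
      ultimately show ?thesis using ext unfolding Uni_def by metis
    qed
    show "mk {y : A. el y <= el x} : A" if x: "x : A" for x
    proof -
      obtain u where u: "u : A" "elts A mem u = {y : A. elts A mem y <= elts A mem x}" using Zw x by blast
      moreover have "{y : A. elts A mem y <= elts A mem x} = {y : A. el y <= el x}" using e x by auto
      ultimately show ?thesis using ext by metis
    qed
    show "omega : A" by (rule om)
    show "mk {y : el x. Q y} : A" if "dfb A (%e. Q (e 0))" "x : A" for Q x using sep that by blast
    show "EX y:A. ALL a:el x. EX b:el y. R a b" if R: "dfb A (%e. R (e 0) (e 1))" and x: "x : A"
      and u: "!!a. a : el x ==> EX! b. b : A \<and> R a b" for R x
    proof -
      let ?R = "{(a, b). a : A \<and> b : A \<and> R a b}"
      have "dfb A (%e. (e 0, e 1) : ?R)" using R by (rule dfb_cong) auto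
      then have "definable_rel A mem ?R" by (subst definable_rel_iff_dfb) auto
      moreover have "ALL a:elts A mem x. EX! b. (a, b) : ?R"
      proof
        fix a assume "a : elts A mem x"
        then have "a : el x" "a : A" using e[OF x] t x by auto
        then show "EX! b. (a, b) : ?R" using u[of a] by simp
      qed
      ultimately have "EX y:A. ALL a:elts A mem x. EX b:elts A mem y. (a, b) : ?R" using Zr x by blast
      then obtain y where "y : A" "ALL a:elts A mem x. EX b:elts A mem y. (a, b) : ?R" by blast
      then show ?thesis using e[OF x] e[of y] by (intro bexI[of _ y]) auto
    qed
  qed
  show "AC A" unfolding AC_def
  proof (intro ballI impI)
    fix x assume x: "x : A" and h: "(ALL y:el x. el y ~= {}) \<and> (ALL y:el x. ALL z:el x. y ~= z --> el y Int el z = {})"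
    have ey: "elts A mem y = el y" if "y : el x" for y using e t x that by blast
    have "(ALL y:elts A mem x. elts A mem y ~= {}) \<and> (ALL y:elts A mem x. ALL z:elts A mem x. y ~= z --> elts A mem y Int elts A mem z = {})"
      using h e[OF x] ey by simp
    then have "EX c:A. ALL y:elts A mem x. EX! z. z : elts A mem c Int elts A mem y" using Zc x by blast
    then obtain c where "c : A" "ALL y:elts A mem x. EX! z. z : elts A mem c Int elts A mem y" by blast
    then show "EX c:A. ALL y:el x. EX! z. z : el c Int el y" using e x ey by auto
  qed
qed

lemma zf_ZFC: assumes "zf A" "AC A" shows "ZFC A mem"
proof -
  interpret zf A by fact
  have t: "ALL x:A. el x <= A" using el_subA by blast
  note e = elts_el[OF t]
  have ey: "elts A mem y = el y" if "x : A" "y : el x" for x y using e that Atrans by blast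
  show ?thesis unfolding ZFC_def
  proof (intro conjI)
    show "extensional_model A mem" unfolding extensional_model_def using e ext_el by auto
    show "ALL x:A. elts A mem x ~= {} --> (EX y:elts A mem x. elts A mem y Int elts A mem x = {})"
    proof (intro ballI impI)
      fix x assume x: "x : A" "elts A mem x ~= {}"
      then obtain y0 where "y0 : el x" using e by auto
      then obtain y where y: "y : el x" "!!z. z : el y ==> z ~: el x" using wfE_min[OF wf_mem, of y0 "el x"] by auto
      then show "EX y:elts A mem x. elts A mem y Int elts A mem x = {}" using e[OF x(1)] ey[OF x(1)] by auto
    qed
    show "ALL x:A. ALL y:A. EX z:A. elts A mem z = {x, y}" using e pairA el_upair by metis
    show "ALL x:A. EX u:A. elts A mem u = (\<Union>y\<in>elts A mem x. elts A mem y)"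
    proof
      fix x assume x: "x : A"
      show "EX u:A. elts A mem u = (\<Union>y\<in>elts A mem x. elts A mem y)"
        by (rule bexI[of _ "Uni x"]) (use x e[OF UniA[OF x]] e[OF x] ey[OF x] in auto)
    qed
    show "ALL x:A. EX p:A. elts A mem p = {y : A. elts A mem y <= elts A mem x}"
    proof
      fix x assume x: "x : A"
      show "EX u:A. elts A mem u = {y : A. elts A mem y <= elts A mem x}"
        by (rule bexI[of _ "Pw x"]) (use x e[OF PwA2[OF x]] e in auto)
    qed
    show "EX w:A. (EX e:elts A mem w. elts A mem e = {}) \<and> (ALL x:elts A mem w. EX s:elts A mem w. elts A mem s = insert x (elts A mem x))"
    proof (rule bexI[OF _ omegaA], intro conjI ballI)
      show "EX e:elts A mem omega. elts A mem e = {}"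
        by (rule bexI[of _ "vn 0"]) (simp_all add: e del: el_omega, simp add: image_iff, metis vn.simps(1))
      fix x assume "x : elts A mem omega"
      then obtain n where n: "x = vn n" using e[OF omegaA] by auto
      show "EX s:elts A mem omega. elts A mem s = insert x (elts A mem x)"
        by (rule bexI[of _ "vn (Suc n)"]) (simp_all add: n e del: vn.simps, simp)
    qed
    show "ALL X. definable A mem X --> (ALL x:A. EX y:A. elts A mem y = elts A mem x Int X)"
    proof (intro allI impI ballI)
      fix X x assume X: "definable A mem X" and x: "x : A"
      have XA: "X <= A" using X unfolding definable_def by blast
      have "dfb A (%e. e 0 : X)" using X definable_iff_dfb[OF XA] by blast
      from sepA[OF this x] have "mk {y : el x. y : X} : A" .
      then show "EX y:A. elts A mem y = elts A mem x Int X"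
        by (rule bexI[rotated]) (use e[OF x] e[OF \<open>mk {y : el x. y : X} : A\<close>] in auto)
    qed
    show "ALL R. definable_rel A mem R --> (ALL x:A. (ALL a:elts A mem x. EX! b. (a, b) : R) -->
           (EX y:A. ALL a:elts A mem x. EX b:elts A mem y. (a, b) : R))"
    proof (intro allI impI ballI)
      fix R x assume R: "definable_rel A mem R" and x: "x : A" and u: "ALL a:elts A mem x. EX! b. (a, b) : R"
      have RA: "R <= A \<times> A" using R unfolding definable_rel_def by blast
      have d: "dfb A (%e. (e 0, e 1) : R)" using R definable_rel_iff_dfb[OF RA] by blast
      have "EX y:A. ALL a:el x. EX b:el y. (a, b) : R"
      proof (rule replA[OF d x])
        fix a assume "a : el x"
        then have "EX! b. (a, b) : R" using u e[OF x] by simp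
        then show "EX! b. b : A \<and> (a, b) : R" using RA by blast
      qed
      then show "EX y:A. ALL a:elts A mem x. EX b:elts A mem y. (a, b) : R" using e x by auto
    qed
    show "ALL x:A. (ALL y:elts A mem x. elts A mem y ~= {}) \<and>
        (ALL y:elts A mem x. ALL z:elts A mem x. y ~= z --> elts A mem y Int elts A mem z = {}) -->
        (EX c:A. ALL y:elts A mem x. EX! z. z : elts A mem c Int elts A mem y)"
    proof (intro ballI impI)
      fix x assume x: "x : A" and h: "(ALL y:elts A mem x. elts A mem y ~= {}) \<and>
        (ALL y:elts A mem x. ALL z:elts A mem x. y ~= z --> elts A mem y Int elts A mem z = {})"
      have "(ALL y:el x. el y ~= {}) \<and> (ALL y:el x. ALL z:el x. y ~= z --> el y Int el z = {})" using h e[OF x] ey[OF x] by simp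
      from bspec[OF assms(2)[unfolded AC_def] x, THEN mp, OF this] obtain c where "c : A" "ALL y:el x. EX! z. z : el c Int el y" by (elim bexE) (rule that)
      then show "EX c:A. ALL y:elts A mem x. EX! z. z : elts A mem c Int elts A mem y" using e x ey[OF x] by auto
    qed
  qed
qed

text \<open>Transversals yield a choice function once the nonempty subsets \<open>y\<close> are made
  disjoint as products of \<open>{y}\<close> with \<open>y\<close>; the choice function is then fed
  to \<open>enum\<close>.\<close>

lemma (in zf) wellorder: assumes "AC A" and x: "x : A"
  shows "EX l:A. EX f:A. Ord l \<and> app f ` el l = el x \<and> inj_on (app f) (el l)"
proof -
  let ?B = "mk {y : el (Pw x). EX z:el y. True}"
  let ?F = "mk ((%y. prd (upair y y) y) ` el ?B)"
  have BA: "?B : A" by (rule sepA) (intro df, use x in simp)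
  have "el ?B = {y : el (Pw x). EX z:el y. True}" by (rule el_mk_el)
  then have eB: "el ?B = {y : A. el y <= el x \<and> el y ~= {}}" unfolding el_Pw by blast
  have "dft A (%e. mk ((%y. prd (upair y y) y) ` el (e 0)))" by (intro df)
  from dft_in[OF this, of "%_. ?B"] have FA: "?F : A" using BA by auto
  have elF: "el ?F = (%y. prd (upair y y) y) ` el ?B" by simp
  have ne: "ALL y:el ?F. el y ~= {}"
  proof
    fix y assume "y : el ?F"
    then obtain u where u: "u : el ?B" "y = prd (upair u u) u" unfolding elF by blast
    then obtain w where "w : el u" unfolding eB by blast
    then have "opr u w : el y" unfolding u(2) el_prd by auto
    then show "el y ~= {}" by blast
  qed
  have dj: "ALL y:el ?F. ALL z:el ?F. y ~= z --> el y Int el z = {}"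
  proof (intro ballI impI)
    fix y z assume "y : el ?F" "z : el ?F" "y ~= z"
    then obtain u v where "y = prd (upair u u) u" "z = prd (upair v v) v" "u ~= v" unfolding elF by blast
    then show "el y Int el z = {}" by (auto simp: el_prd)
  qed
  from bspec[OF assms(1)[unfolded AC_def] FA, THEN mp, OF conjI[OF ne dj]]
  obtain c where c: "c : A" "ALL y:el ?F. EX! z. z : el c Int el y" by (elim bexE) (rule that)
  show ?thesis
  proof (rule enum[OF x])
    let ?g = "mk {z : el c. z : el (prd ?B x) \<and> sn z : el (fs z)}"
    show "?g : A" by (rule sepA[OF _ c(1)]) (intro df BA x prdA)
    have elg: "el ?g = {z : el c. z : el (prd ?B x) \<and> sn z : el (fs z)}" by (rule el_mk_el)
    fix y assume y: "y : A" "el y <= el x" "el y ~= {}"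
    then have yB: "y : el ?B" unfolding eB by simp
    then have "prd (upair y y) y : el ?F" unfolding elF by (rule imageI)
    from bspec[OF c(2) this] obtain z where z0: "z : el c Int el (prd (upair y y) y)" "!!z'. z' : el c Int el (prd (upair y y) y) ==> z' = z"
      by (elim ex1E) metis
    then have z: "z : el c" "z : el (prd (upair y y) y)" "!!z'. z' : el c ==> z' : el (prd (upair y y) y) ==> z' = z" by blast+
    from z(2) obtain w where w: "z = opr y w" "w : el y" by (auto simp: el_prd)
    have "app ?g y = w"
    proof (rule app_unique)
      have 1: "opr y w : el c" using z(1) w(1) by simp
      have 2: "opr y w : el (prd ?B x)" unfolding el_prd using yB w(2) y(2) by blast
      show "opr y w : el ?g" unfolding elg by (intro CollectI conjI 1 2) (simp only: fs_opr sn_opr w(2))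
      fix v assume "opr y v : el ?g"
      then have v: "opr y v : el c" "sn (opr y v) : el (fs (opr y v))" unfolding elg by blast+
      then have "opr y v : el (prd (upair y y) y)" unfolding el_prd by simp
      from z(3)[OF v(1) this] show "v = w" using w(1) by simp
    qed
    then show "app ?g y : el y" using w by simp
  qed
qed

section \<open>Small subsets and approximation\<close>

text \<open>Hereditary pruning: pairs whose condition fails \<open>Q\<close> are removed at every
  level. It turns arbitrary sets into names for a prescribed poset without changing their values
  under a filter inside it.\<close>

definition pn where "pn Q = recF (%x f. mk ((%z. opr (app f (fs z)) (sn z)) ` el (mk {z : el x. EX s p. z = opr s p \<and> Q p})))"

lemma el_pn: "el (pn Q x) = {opr (pn Q s) p |s p. opr s p : el x \<and> Q p}"
proof -
  have "el (pn Q x) = (%z. opr (app (lam (tc x) (pn Q)) (fs z)) (sn z)) ` {z : el x. EX s p. z = opr s p \<and> Q p}"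
    unfolding pn_def by (subst recF) (simp only: el_mk_sub, simp)
  also have "... = {opr (pn Q s) p |s p. opr s p : el x \<and> Q p}"
  proof (intro set_eqI iffI)
    fix y assume "y : (%z. opr (app (lam (tc x) (pn Q)) (fs z)) (sn z)) ` {z : el x. EX s p. z = opr s p \<and> Q p}"
    then obtain s p where s: "opr s p : el x" "Q p" "y = opr (app (lam (tc x) (pn Q)) s) p" by auto
    then show "y : {opr (pn Q s) p |s p. opr s p : el x \<and> Q p}" using opr_el_TC(1)[OF s(1)] by auto
  next
    fix y assume "y : {opr (pn Q s) p |s p. opr s p : el x \<and> Q p}"
    then obtain s p where s: "opr s p : el x" "Q p" "y = opr (pn Q s) p" by blast
    then have "y = opr (app (lam (tc x) (pn Q)) (fs (opr s p))) (sn (opr s p))" using opr_el_TC(1)[OF s(1)] by simp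
    then show "y : (%z. opr (app (lam (tc x) (pn Q)) (fs z)) (sn z)) ` {z : el x. EX s p. z = opr s p \<and> Q p}" using s by blast
  qed
  finally show ?thesis .
qed

lemma val_pn: "val G (pn Q x) = val (G Int {p. Q p}) x"
proof (induction x rule: TC_induct)
  case (step x)
  have s: "val G (pn Q s) = val (G Int {p. Q p}) s" if "opr s p : el x" for s p using step opr_el_TC(1)[OF that] by blast
  show ?case
  proof (rule ext_el, intro set_eqI iffI)
    fix y assume "y : el (val G (pn Q x))"
    then obtain s p where "y = val G (pn Q s)" "p : G" "opr s p : el x" "Q p" unfolding el_val el_pn by auto
    then show "y : el (val (G Int {p. Q p}) x)" using s unfolding el_val by blast
  next
    fix y assume "y : el (val (G Int {p. Q p}) x)"
    then obtain s p where y: "y = val (G Int {p. Q p}) s" "p : G" "Q p" "opr s p : el x" unfolding el_val by blast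
    then have "y = val G (pn Q s)" "opr (pn Q s) p : el (pn Q x)" using s unfolding el_pn by auto
    then show "y : el (val G (pn Q x))" using y(2) unfolding el_val by blast
  qed
qed

lemma (in zf) dft_pn: assumes Q: "dfb A (%e. Q (e 0))" and t: "dft A t" shows "dft A (%e. pn Q (t e))"
proof -
  have Qd: "dft A u ==> dfb A (%e. Q (u e))" for u by (rule df1[where Q=Q, OF Q])
  show ?thesis unfolding pn_def
    by (rule dft_recF[where H="%q x f. mk ((%z. opr (app f (fs z)) (sn z)) ` el (mk {z : el x. EX s p. z = opr s p \<and> Q p}))" and s=t, OF _ t t])
       (intro df Qd)
qed

lemma (in zf) pnA: "dfb A (%e. Q (e 0)) ==> x : A ==> pn Q x : A"
  using dft_in[OF dft_pn[OF _ dft_const], of Q x "%_. x"] by auto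

context cls
begin

lemma Gset: "c : A ==> mk (G Int el c) : N"
proof -
  assume c: "c : A"
  have "dft A (%e. mk ((%p. opr (chk zero p) p) ` el (e 0)))" by (intro df zeroA)
  from dft_in[OF this, of "%_. c"] have "mk ((%p. opr (chk zero p) p) ` el c) : A" using c by auto
  moreover have "el (val G (mk ((%p. opr (chk zero p) p) ` el c))) = G Int el c"
  proof (intro set_eqI iffI)
    fix x assume "x : G Int el c"
    then show "x : el (val G (mk ((%p. opr (chk zero p) p) ` el c)))" unfolding el_val
      by (intro CollectI exI[of _ "chk zero x"] exI[of _ x]) (simp add: val_chk[OF G0])
  qed (auto simp: el_val val_chk[OF G0])
  ultimately show ?thesis using N_I by (metis mk_el)
qed

lemma cc_self: assumes "Ord a" shows "el (cc a a) = {zero}"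
proof -
  have "p = zero" if "Pc a p" "ALL z:el p. rank z : el a" for p
    using that unfolding Pc_def by (intro ext_el) auto
  then show ?thesis unfolding el_cc[OF assms] using Pc_zero by auto
qed

text \<open>At \<open>b = a\<close> the lower factor \<open>cc a a\<close> contains only
  \<open>zero\<close>, so the set of pairs given by \<open>Sep_name\<close> describes the subset
  without reference to the generic. This is the closure of the upper forcing.\<close>

lemma smallK: assumes a: "limo a" and Z: "Z : N" "el Z <= el w" and w: "w : A" "sm a w" shows "Z : A"
proof -
  have o: "Ord a" using a unfolding limo_def by simp
  interpret N: carrier N by (rule carrN)
  let ?I = "mk ((%x. chk zero x) ` el w)"
  have "dft A (%e. mk ((%x. chk zero x) ` el (e 0)))" by (intro df zeroA)
  from dft_in[OF this, of "%_. w"] have I: "?I : A" using w by auto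
  have elI: "el ?I = (%x. chk zero x) ` el w" by simp
  have sI: "sm a ?I" by (rule sm_image[OF aA w(2), of "%x. chk zero x"]) (intro df zeroA, simp)
  have "dfb N (%e. e 0 : el Z)" by (intro N.dfb_mem N.dft_var N.dft_const Z)
  from Sep_name[OF this a aA I sI] obtain f where f: "f : A" "el f <= el (prd ?I (cc a a))"
    "ALL i:el ?I. val G i : el Z \<longleftrightarrow> (EX u:G. opr i u : el f)" by blast
  have z0: "u = zero" if "opr i u : el f" for i u using subsetD[OF f(2) that] unfolding el_prd cc_self[OF o] by auto
  have "x : el Z \<longleftrightarrow> opr (chk zero x) zero : el f" if x: "x : el w" for x
  proof -
    have "chk zero x : el ?I" unfolding elI using x by blast
    then have "x : el Z \<longleftrightarrow> (EX u:G. opr (chk zero x) u : el f)" using bspec[OF f(3), of "chk zero x"] val_chk[OF G0, of x] by simp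
    then show ?thesis using z0 G0 by blast
  qed
  then have "el Z = {x : el w. opr (chk zero x) zero : el f}" using Z(2) by blast
  moreover have "mk {x : el w. opr (chk zero x) zero : el f} : A" by (rule sepA[OF _ w(1)]) (intro df zeroA f)
  ultimately show ?thesis by (metis mk_el)
qed

text \<open>Here the domain is small but \<open>w\<close> may be large, so \<open>smallK\<close>
  does not apply to the graph. Instead a condition decides the value at \<open>i\<close>, or that
  none lies in \<open>w\<close>, and one \<open>q\<close> in \<open>G\<close> does this for all
  \<open>i\<close>.\<close>

lemma funK: assumes a: "limo a" and h: "h : N" and I: "I : A" "sm a I" and w: "w : A"
    and fn: "!!i y y'. i : el I ==> y : el w ==> y' : el w ==> opr i y : el h ==> opr i y' : el h ==> y = y'"
  shows "mk {z : el (prd I w). z : el h} : A"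
proof -
  have o: "Ord a" using a unfolding limo_def by simp
  obtain h0 where h0: "h0 : A" "h = val G h0" using h unfolding N_def by blast
  let ?v = "(%_. h0)"
  have v: "range ?v <= A" using h0 by auto
  let ?F = "%p i y. fo (Mem 0 1) p (?v(0 := chk zero (opr i y)))"
  let ?Fn = "%p i y. fo (Neg (Mem 0 1)) p (?v(0 := chk zero (opr i y)))"
  have vA: "range (?v(0 := chk zero (opr i y))) <= A" if "i : A" "y : A" for i y using that h0 by auto
  have T: "opr i y : el h \<longleftrightarrow> (EX p:G. ?F p i y)" if "i : A" "y : A" for i y
    using truth[OF vA[OF that], of "Mem 0 1"] val_chk[OF G0] h0(2) by simp
  let ?D = "%i p. (EX y:el w. ?F p i y) \<or> (ALL y:el w. ?Fn p i y)"
  have dD: "dfb A (%e. ?D (e 0) (e 1))" by (intro dfb_disj dfb_bex dfb_ball dfb_fo2 v df zeroA w)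
  have "EX q:G. ALL i:el I. EX u:Gb a. ?D i (cup u q)"
  proof (rule key_G[OF a aA I dD])
    fix i p assume i: "i : el I" and p: "Pc a p"
    have iA: "i : A" using i I Atrans by blast
    show "EX d. Pc a d \<and> el p <= el d \<and> ?D i d"
    proof (cases "ALL y:el w. ?Fn p i y")
      case True then show ?thesis using p by blast
    next
      case False
      then obtain y q where "y : el w" "Pc a q" "el p <= el q" "?F q i y" unfolding fo.simps(3) by blast
      then show ?thesis by blast
    qed
    fix q assume "?D i p" "Pc a q" "el p <= el q"
    then show "?D i q" using fo_mono[OF vA[OF iA] _ p] w Atrans by blast
  qed
  then obtain q where q: "q : G" "ALL i:el I. EX u:Gb a. ?D i (cup u q)" by blast
  have Dq: "?D i q" if i: "i : el I" for i
  proof -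
    obtain u where u: "u : Gb a" "?D i (cup u q)" using q i by blast
    have "u = zero" using u Gb_cc[OF o] cc_self[OF o] by blast
    then have "cup u q = q" by (intro ext_el) simp
    then show ?thesis using u by simp
  qed
  let ?g = "mk {z : el (prd I w). ?F q (fs z) (sn z)}"
  have gA: "?g : A" by (rule sepA) (intro dfb_fo2 v df zeroA GA[OF q(1)], use I w in simp)
  have "{z : el (prd I w). ?F q (fs z) (sn z)} = {z : el (prd I w). z : el h}"
  proof (rule Collect_cong, rule conj_cong[OF HOL.refl])
    fix z assume "z : el (prd I w)"
    then obtain i y where z: "z = opr i y" "i : el I" "y : el w" unfolding el_prd by blast
    have A: "i : A" "y : A" using z I w Atrans by blast+
    have "?F q i y \<longleftrightarrow> opr i y : el h"
    proof
      assume "?F q i y" then show "opr i y : el h" using T[OF A] q(1) by blast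
    next
      assume m: "opr i y : el h"
      have "\<not> ?Fn q i y" using T[OF A] m fo_contra[OF vA[OF A] _ q(1)] by blast
      then obtain y' where y': "y' : el w" "?F q i y'" using Dq[OF z(2)] z(3) by blast
      then have "opr i y' : el h" using T[OF A(1)] q(1) w Atrans by blast
      then have "y' = y" using fn z y' m by blast
      then show "?F q i y" using y' by blast
    qed
    then show "?F q (fs z) (sn z) \<longleftrightarrow> z : el h" unfolding z fs_opr sn_opr .
  qed
  then show ?thesis using gA by (simp only:)
qed

end

text \<open>If \<open>Z\<close> is not in \<open>A\<close>, each condition of \<open>G\<close>
  leaves some element of \<open>w\<close> undecided; \<open>s\<close> sends it to the least one. By
  hypothesis the trace of \<open>Z\<close> on the range of \<open>s\<close> is in \<open>A\<close>,
  so genericity gives a \<open>q\<close> in \<open>G\<close> that decides the whole range correctly,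
  including the element \<open>app s q\<close> that it was to leave undecided.\<close>

lemma (in gen) approx:
  assumes w: "w : A" and W: "W : A" "!!s t. opr s t : el W \<longleftrightarrow> s : el w \<and> t : el w \<and> R s t" "tot (el w) R" "wfo (el w) R"
    and rho: "rho : A" and Z: "Z = {x : el w. EX q:G. opr x q : el rho}"
    and ap: "!!s. s : A ==> mk (Z Int app s ` el c) : A"
  shows "mk Z : A"
proof (rule ccontr)
  assume nA: "mk Z ~: A"
  define fN where "fN q x \<longleftrightarrow> (ALL q1:el c. le r q1 q --> \<not> (EX q3. opr x q3 : el rho \<and> le r q1 q3))" for q x
  define fP where "fP q x \<longleftrightarrow> (ALL q1:el c. le r q1 q --> \<not> fN q1 x)" for q x
  have dN: "dft A s ==> dft A t ==> dfb A (%e. fN (s e) (t e))" for s t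
    by (rule df2[where Q=fN], unfold fN_def) (intro df cA rho)+
  have dP: "dft A s ==> dft A t ==> dfb A (%e. fP (s e) (t e))" for s t
    by (rule df2[where Q=fP], unfold fP_def) (intro df cA dN)+
  have GcA: "q : A" "q : el c" if "q : G" for q using that Gc el_subA[OF cA] by auto
  have sN: "x ~: Z" if Nq: "q : G" "fN q x" for q x
  proof
    assume "x : Z"
    then obtain q3 where q3: "q3 : G" "opr x q3 : el rho" unfolding Z by blast
    obtain s where "s : G" "le r s q" "le r s q3" using Gdir[OF Nq(1) q3(1)] by blast
    then show False using Nq(2) q3(2) GcA unfolding fN_def by blast
  qed
  have sP: "x : Z" if q: "q : G" "fP q x" and x: "x : el w" for q x
  proof -
    have xA: "x : A" using x w Atrans by blast
    have "EX q':G. le r q' q \<and> (EX q3. opr x q3 : el rho \<and> le r q' q3)"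
    proof (rule Ggen_below[OF _ q(1)])
      show "dfb A (%e. EX q3. opr x q3 : el rho \<and> le r (e 0) q3)" by (intro df rho xA)
      fix q' assume q': "le r q' q"
      then have "\<not> fN q' x" using q(2) le_c unfolding fP_def by blast
      then show "EX d. le r d q' \<and> (EX q3. opr x q3 : el rho \<and> le r d q3)" unfolding fN_def by blast
    qed
    then obtain q' q3 where "q' : G" "opr x q3 : el rho" "le r q' q3" by blast
    then show ?thesis unfolding Z using x Gup by blast
  qed
  define und where "und q x \<longleftrightarrow> \<not> fP q x \<and> \<not> fN q x" for q x
  have ex: "EX x:el w. und q x" if q: "q : G" for q
  proof (rule ccontr)
    assume n: "\<not> ?thesis"
    have "Z = {x : el w. fP q x}"
    proof (intro set_eqI iffI)
      fix x assume x: "x : Z"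
      then have xw: "x : el w" unfolding Z by blast
      then show "x : {x : el w. fP q x}" using n sN[OF q, of x] x unfolding und_def by blast
    next
      fix x assume "x : {x : el w. fP q x}"
      then show "x : Z" using sP[OF q] by blast
    qed
    moreover have "mk {x : el w. fP q x} : A" by (rule sepA[OF _ w]) (intro df dP GcA q)
    ultimately show False using nA by simp
  qed
  define s where "s = mk {z : el (prd c w). und (fs z) (sn z) \<and> (ALL y:el w. und (fs z) y --> opr y (sn z) ~: el W)}"
  have du: "dft A s ==> dft A t ==> dfb A (%e. und (s e) (t e))" for s t unfolding und_def by (intro df dN dP)
  have sA: "s : A" unfolding s_def by (rule sepA) (intro df du w W, use cA w in simp)
  have els: "opr q x : el s \<longleftrightarrow> q : el c \<and> x : el w \<and> und q x \<and> (ALL y:el w. und q y --> \<not> R y x)" for q x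
  proof -
    have "el s = {z : el (prd c w). und (fs z) (sn z) \<and> (ALL y:el w. und (fs z) y --> opr y (sn z) ~: el W)}"
      unfolding s_def by (rule el_mk_el)
    then show ?thesis using W(2) by (auto simp: el_prd)
  qed
  have sq: "app s q : el w \<and> und q (app s q)" if q: "q : G" for q
  proof -
    have "{x : el w. und q x} <= el w" "{x : el w. und q x} ~= {}" using ex[OF q] by auto
    from wfo_min[OF W(4) this] obtain m where m: "m : el w" "und q m" "ALL y:el w. und q y --> \<not> R y m" by blast
    have "app s q = m"
    proof (rule app_unique)
      show "opr q m : el s" unfolding els using m GcA(2)[OF q] by blast
      fix z assume "opr q z : el s"
      then have "z : el w" "und q z" "ALL y:el w. und q y --> \<not> R y z" unfolding els by auto
      then show "z = m" using m W(3) unfolding tot_def by blast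
    qed
    then show ?thesis using m by simp
  qed
  define y where "y = mk (Z Int app s ` el c)"
  have yA: "y : A" unfolding y_def by (rule ap[OF sA])
  have ely: "el y = Z Int app s ` el c"
  proof -
    have "Z Int app s ` el c <= A" using el_subA[OF w] unfolding Z by blast
    then show ?thesis unfolding y_def by (rule el_mkA)
  qed
  let ?a = "%x. EX q:el c. x = app s q"
  let ?Q = "%q. (ALL x:el w. ?a x --> (x : el y --> fP q x) \<and> (x ~: el y --> fN q x)) \<or>
     (EX x:el w. ?a x \<and> ((x : el y \<and> fN q x) \<or> (x ~: el y \<and> fP q x)))"
  have "EX q:G. ?Q q"
  proof (rule Ggen2)
    show "dfb A (%e. ?Q (e 0))" by (intro df dP dN w cA sA yA)
    fix p assume p: "p : el c"
    show "EX d. le r d p \<and> ?Q d"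
    proof (cases "ALL x:el w. ?a x --> (x : el y --> fP p x) \<and> (x ~: el y --> fN p x)")
      case True then show ?thesis using le_refl[OF p] by blast
    next
      case False
      then obtain x where x: "x : el w" "?a x" "(x : el y \<and> \<not> fP p x) \<or> (x ~: el y \<and> \<not> fN p x)" by blast
      have "EX d. le r d p \<and> ((x : el y \<and> fN d x) \<or> (x ~: el y \<and> fP d x))"
      proof (cases "x : el y")
        case True then show ?thesis using x(3) unfolding fP_def by blast
      next
        case False
        then obtain q1 q3 where q: "le r q1 p" "opr x q3 : el rho" "le r q1 q3" using x(3) unfolding fN_def by blast
        have "fP q1 x" unfolding fP_def fN_def
        proof (intro ballI impI notI)
          fix q2 assume q2: "q2 : el c" "le r q2 q1" "ALL q1:el c. le r q1 q2 --> \<not> (EX q3. opr x q3 : el rho \<and> le r q1 q3)"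
          have "le r q2 q3" using le_trans[OF _ _ _ q2(2) q(3)] le_c[OF q2(2)] le_c[OF q(3)] by blast
          then show False using q2(3) le_refl[OF q2(1)] q2(1) q(2) by blast
        qed
        then show ?thesis using False q by blast
      qed
      then show ?thesis using x by blast
    qed
  qed
  then obtain q where q: "q : G" "?Q q" by blast
  have "\<not> (EX x:el w. ?a x \<and> ((x : el y \<and> fN q x) \<or> (x ~: el y \<and> fP q x)))"
  proof
    assume "EX x:el w. ?a x \<and> ((x : el y \<and> fN q x) \<or> (x ~: el y \<and> fP q x))"
    then obtain x where x: "x : el w" "?a x" "(x : el y \<and> fN q x) \<or> (x ~: el y \<and> fP q x)" by blast
    have "x : el y \<longleftrightarrow> x : Z" using x(2) unfolding ely by blast
    then show False using x sN[OF q(1), of x] sP[OF q(1), of x] by blast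
  qed
  then have al: "ALL x:el w. ?a x --> (x : el y --> fP q x) \<and> (x ~: el y --> fN q x)" using q(2) by blast
  have "?a (app s q)" using GcA(2)[OF q(1)] by blast
  then show False using al sq[OF q(1)] unfolding und_def by blast
qed

section \<open>The tower of inner models\<close>

definition TTH where "TTH P x f = lam (sn P) (%i. mk ((%z. opr (app (app f (sn (fs z))) (fs (fs (fs z)))) (sn z)) `
   el (mk {z : el (fs P). sn (fs z) : el x \<and> fs (fs (fs z)) : el (sn P) \<and>
     z = opr (opr (opr (fs (fs (fs z))) i) (sn (fs z))) (sn z)})))"
definition TT where "TT P = recF (TTH P)"

text \<open>\<open>TN \<rho> l k i\<close> is a name for a set of rank \<open>k\<close>: if \<open>\<rho>\<close> names the membership relation of the
  sets enumerated along the ordinal \<open>l\<close> (tagged with the ranks of the elements), then it is a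
  name for the \<open>i\<close>-th of them.\<close>

definition TN where "TN rho l k i = app (TT (opr rho l) k) i"

lemma el_TN: assumes i: "i : el l"
  shows "el (TN rho l k i) = {opr (TN rho l n j) r |n j r. n : el k \<and> j : el l \<and> opr (opr (opr j i) n) r : el rho}"
proof -
  let ?S = "{z : el rho. sn (fs z) : el k \<and> fs (fs (fs z)) : el l \<and> z = opr (opr (opr (fs (fs (fs z))) i) (sn (fs z))) (sn z)}"
  have "el (TN rho l k i) = (%z. opr (app (app (lam (tc k) (TT (opr rho l))) (sn (fs z))) (fs (fs (fs z)))) (sn z)) ` ?S"
    unfolding TN_def TT_def recF[of _ k] by (subst TTH_def) (simp only: sn_opr fs_opr app_lam[OF i] el_mk_sub, simp)
  also have "... = {opr (TN rho l n j) r |n j r. n : el k \<and> j : el l \<and> opr (opr (opr j i) n) r : el rho}"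
  proof (intro set_eqI iffI)
    fix y assume "y : (%z. opr (app (app (lam (tc k) (TT (opr rho l))) (sn (fs z))) (fs (fs (fs z)))) (sn z)) ` ?S"
    then obtain z where z: "z : ?S" "y = opr (app (app (lam (tc k) (TT (opr rho l))) (sn (fs z))) (fs (fs (fs z)))) (sn z)" by blast
    define n where "n = sn (fs z)" define j where "j = fs (fs (fs z))" define r where "r = sn z"
    have a: "n : el k" "j : el l" "opr (opr (opr j i) n) r : el rho" "y = opr (app (app (lam (tc k) (TT (opr rho l))) n) j) r"
      using z unfolding n_def j_def r_def by auto
    then have "y = opr (TN rho l n j) r" unfolding TN_def by (simp add: TC_el)
    then show "y : {opr (TN rho l n j) r |n j r. n : el k \<and> j : el l \<and> opr (opr (opr j i) n) r : el rho}" using a by blast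
  next
    fix y assume "y : {opr (TN rho l n j) r |n j r. n : el k \<and> j : el l \<and> opr (opr (opr j i) n) r : el rho}"
    then obtain n j r where a: "y = opr (TN rho l n j) r" "n : el k" "j : el l" "opr (opr (opr j i) n) r : el rho" by blast
    show "y : (%z. opr (app (app (lam (tc k) (TT (opr rho l))) (sn (fs z))) (fs (fs (fs z)))) (sn z)) ` ?S"
    proof (rule image_eqI)
      show "opr (opr (opr j i) n) r : ?S" using a by simp
      show "y = opr (app (app (lam (tc k) (TT (opr rho l))) (sn (fs (opr (opr (opr j i) n) r)))) (fs (fs (fs (opr (opr (opr j i) n) r))))) (sn (opr (opr (opr j i) n) r))"
        using a unfolding TN_def by (simp add: TC_el)
    qed
  qed
  finally show ?thesis .
qed

lemma (in zf) dft_TN[df]: assumes "dft A s" "dft A t" "dft A u" "dft A v" shows "dft A (%e. TN (s e) (t e) (u e) (v e))"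
proof -
  have "dft A (%e. TT (e 0) (e 1))" unfolding TT_def
    by (rule dft_recF[where H=TTH, OF _ dft_var dft_var]) (unfold TTH_def, intro df)
  from dff2[where f=TT, OF this] have T: "dft A s ==> dft A t ==> dft A (%e. TT (s e) (t e))" for s t .
  show ?thesis unfolding TN_def by (intro df T assms)
qed

lemma (in zf) TNA: "s : A ==> t : A ==> u : A ==> v : A ==> TN s t u v : A"
  using dft_in[OF dft_TN[OF dft_const dft_const dft_const dft_const], of s t u v "%_. s"] by auto

lemma val_TN: assumes h: "!!i j n. i : el l ==> j : el l ==> n : el k ==>
      (EX r:H. opr (opr (opr j i) n) r : el rho) \<longleftrightarrow> f j : el (f i) \<and> n = rank (f j)"
    and t: "!!i y. i : el l ==> y : el (f i) ==> EX j:el l. f j = y"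
    and k: "!!i. i : el l ==> el (rank (f i)) <= el k"
    and i: "i : el l"
  shows "val H (TN rho l (rank (f i)) i) = f i"
proof -
  have "ALL i. i : el l --> x = f i --> val H (TN rho l (rank (f i)) i) = f i" for x
  proof (induction x rule: el_induct)
    case (step x)
    show ?case
    proof (intro allI impI ext_el set_eqI iffI)
      fix i y assume i: "i : el l" "x = f i" and "y : el (val H (TN rho l (rank (f i)) i))"
      then obtain n j r where a: "y = val H (TN rho l n j)" "r : H" "n : el (rank (f i))" "j : el l" "opr (opr (opr j i) n) r : el rho"
        unfolding el_val el_TN[OF i(1)] by auto
      have "n : el k" using a(3) k[OF i(1)] by blast
      then have b: "f j : el (f i)" "n = rank (f j)" using h[OF i(1) a(4)] a by blast+
      then have "y = f j" using step[of "f j"] i a by blast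
      then show "y : el (f i)" using b by simp
    next
      fix i y assume i: "i : el l" "x = f i" and y: "y : el (f i)"
      then obtain j where j: "j : el l" "f j = y" using t by blast
      have n: "rank y : el (rank (f i))" using y rank_mem by blast
      then have "rank y : el k" using k[OF i(1)] by blast
      then obtain r where r: "r : H" "opr (opr (opr j i) (rank y)) r : el rho" using h[OF i(1) j(1)] j y by blast
      have "val H (TN rho l (rank y) j) = y" using step[of y] i y j by blast
      moreover have "opr (TN rho l (rank y) j) r : el (TN rho l (rank (f i)) i)" unfolding el_TN[OF i(1)] using r n j by blast
      ultimately show "y : el (val H (TN rho l (rank (f i)) i))" unfolding el_val using r(1)
        by (intro CollectI exI[of _ "TN rho l (rank y) j"] exI[of _ r]) simp
    qed
  qed
  then show ?thesis using i by blast
qed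

text \<open>The transitive closure of \<open>{x}\<close> is enumerated along an ordinal and its
  membership relation transported there. Letting \<open>H\<close> and \<open>rho\<close> be
  arbitrary turns a nice name for this code, over any poset, into a name for
  \<open>x\<close>.\<close>

lemma (in zf) set_code: assumes AC: "AC A" and x: "x : A"
  shows "EX e:A. EX l:A. EX k:A. EX i:el l. Ord l \<and> Ord k \<and> el e <= el (prd (prd l l) k) \<and>
    (ALL H rho. el e = {z : el (prd (prd l l) k). EX r:H. opr z r : el rho} --> val H (TN rho l k i) = x)"
proof -
  have TCx: "TC (upair x x) = insert x (TC x)" by (subst TC_unfold) simp
  have "tc (upair x x) : A" using x by (simp add: pairA)
  from wellorder[OF AC this] obtain l f where l: "l : A" "f : A" "Ord l" "app f ` el l = TC (upair x x)" by auto
  have "x : app f ` el l" unfolding l TCx by simp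
  then obtain i where i: "i : el l" "app f i = x" by blast
  define e where "e = mk {z : el (prd (prd l l) (rank x)). app f (fs (fs z)) : el (app f (sn (fs z))) \<and> sn z = rank (app f (fs (fs z)))}"
  have eA: "e : A" unfolding e_def by (rule sepA) (intro df l, use l x in simp)
  have ele: "opr (opr j i) n : el e \<longleftrightarrow> j : el l \<and> i : el l \<and> n : el (rank x) \<and> app f j : el (app f i) \<and> n = rank (app f j)" for i j n
    unfolding e_def el_mk_sub by (auto simp: el_prd)
  have "val H (TN rho l (rank x) i) = x" if H: "el e = {z : el (prd (prd l l) (rank x)). EX r:H. opr z r : el rho}" for H rho
  proof -
    have "val H (TN rho l (rank (app f i)) i) = app f i"
    proof (rule val_TN[where k="rank x"])
      fix i' j n assume a: "i' : el l" "j : el l" "n : el (rank x)"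
      have "opr (opr j i') n : el (prd (prd l l) (rank x))" using a by (simp add: el_prd)
      then have "(EX r:H. opr (opr (opr j i') n) r : el rho) \<longleftrightarrow> opr (opr j i') n : el e" unfolding H by blast
      then show "(EX r:H. opr (opr (opr j i') n) r : el rho) \<longleftrightarrow> app f j : el (app f i') \<and> n = rank (app f j)"
        unfolding ele using a by simp
    next
      fix i' y assume a: "i' : el l" "y : el (app f i')"
      have "app f i' : insert x (TC x)" using l(4) a(1) unfolding TCx by blast
      then have "y : insert x (TC x)" using a(2) TC_el TC_el2 by blast
      then show "EX j:el l. app f j = y" using l(4) unfolding TCx by (metis imageE)
    next
      fix i' assume "i' : el l"
      then have "app f i' : insert x (TC x)" using l(4) unfolding TCx by blast
      then show "el (rank (app f i')) <= el (rank x)" using rank_TC Ord_trans[OF Ord_rank] by blast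
    qed (rule i)
    then show ?thesis unfolding i .
  qed
  moreover have "el e <= el (prd (prd l l) (rank x))" unfolding e_def el_mk_sub by blast
  ultimately show ?thesis using eA l i x by (intro bexI[of _ e] bexI[of _ l] bexI[of _ "rank x"] bexI[of _ i]) auto
qed

text \<open>A model of ZFC is determined by its sets of ordinals. They are decoded by forcing with a
  one-point poset: \<open>prd e one\<close> is a nice name for \<open>e\<close> itself.\<close>

lemma zf_subset: assumes B: "zf B" and C: "zf C" "AC C" and o: "!!a. a : C ==> Ord a ==> a : B"
    and s: "!!e l k. e : C ==> l : C ==> k : C ==> Ord l ==> Ord k ==> el e <= el (prd (prd l l) k) ==> e : B"
  shows "C <= B"
proof
  interpret B: zf B by fact
  interpret C: zf C by fact
  fix x assume "x : C"
  from C.set_code[OF C(2) this] obtain e l k i where a: "e : C" "l : C" "k : C" "i : el l" "Ord l" "Ord k" "el e <= el (prd (prd l l) k)"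
    and x: "ALL H rho. el e = {z : el (prd (prd l l) k). EX r:H. opr z r : el rho} --> val H (TN rho l k i) = x" by blast
  have b: "e : B" "l : B" "k : B" "i : B" using s[OF a(1-3) a(5-7)] o a B.Atrans by blast+
  have "el e = {z : el (prd (prd l l) k). EX r:el one. opr z r : el (prd e one)}" using a(7) by (auto simp: el_prd)
  then have "val (el one) (TN (prd e one) l k i) = x" using x by blast
  moreover have "val (el one) (TN (prd e one) l k i) : B" by (intro B.valA B.TNA B.oneA B.prdA b)
  ultimately show "x : B" by simp
qed

section \<open>Extensions by the upper parts of the generic filter\<close>

lemma (in zfL) Pc_sing: assumes y: "y : A" and i: "i = zero \<or> i = one" and r: "rank (opr y i) ~: el a"
  shows "Pc a (upair (opr y i) (opr y i))"
proof -
  let ?z = "opr y i" let ?s = "upair ?z ?z"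
  have zA: "?z : A" using y i by auto
  have "fnc ?s" unfolding fnc_def using i by auto
  moreover have "sm c (low (nl c) ?s)" if "c : A" "limo c" for c
    by (rule sm_sub[OF sm_upair[OF that(2,1) zA zA]]) auto
  ultimately show ?thesis unfolding Pc_def isc_def using zA pairA r by auto
qed

locale tow = cls A zero G for A G
begin

definition Ga where "Ga a = {p : G. Pc a p}"
definition M where "M a = val (Ga a) ` A"

lemma Pc0: "Pc a p ==> Pc zero p" unfolding Pc_def by simp

lemma Pc_hi: "a : A ==> Pc zero p ==> Pc a (hi a p)"
  unfolding Pc_def using isc_sub[of p "hi a p"] hiA isc_def by auto

text \<open>A dense class of upper conditions is pulled back along \<open>hi a\<close>, since every
  extension of an upper part can be glued to the lower part.\<close>

lemma cls_a: assumes a: "limo a" "a : A" shows "cls A a (Ga a)"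
proof unfold_locales
  show "a : A" by fact
  show "zero : Ga a" unfolding Ga_def using G0 Pc_zero by blast
  fix p assume p: "p : Ga a"
  show "Pc a p" using p unfolding Ga_def by blast
  { fix q assume "Pc a q" "el q <= el p" then show "q : Ga a" using p Gup Pc0 unfolding Ga_def by blast }
  fix q assume q: "q : Ga a"
  have "cup p q : G" using p q Gcup unfolding Ga_def by blast
  moreover from this have "Pc a (cup p q)" using p q GP unfolding Ga_def Pc_def by auto
  ultimately have "cup p q : Ga a" unfolding Ga_def by blast
  then show "EX s:Ga a. el p <= el s \<and> el q <= el s" by (rule bexI[rotated]) auto
next
  fix Q assume Q: "dfb A (%e. Q (e 0))" and d: "!!p. Pc a p ==> EX d. Pc a d \<and> el p <= el d \<and> Q d"
  have "EX p:G. Q (hi a p)"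
  proof (rule Ggen[where Q="%p. Q (hi a p)"])
    show "dfb A (%e. Q (hi a (e 0)))" by (rule df1[where Q=Q, OF Q]) (intro df a)
    fix p assume p: "Pc zero p"
    obtain d where dd: "Pc a d" "el (hi a p) <= el d" "Q d" using d[OF Pc_hi[OF a(2) p]] by blast
    have dr: "rank z ~: el a" if "z : el d" for z using dd(1) that unfolding Pc_def by blast
    have "Pc zero (cup (low a p) d)"
    proof (rule Pc_glue[OF a _ _ Pc0[OF dd(1)]])
      show "Pc zero (low a p)" by (rule Pc_sub[OF p]) (use a PcA[OF p] in auto)
    qed (use dr in auto)
    moreover have "hi a (cup (low a p) d) = d" by (rule ext_el) (use dr in auto)
    moreover have "el p <= el (cup (low a p) d)" using dd(2) by auto
    ultimately show "EX d. Pc zero d \<and> el p <= el d \<and> Q (hi a d)" using dd(3) by metis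
  qed
  then obtain p where p: "p : G" "Q (hi a p)" by blast
  have "Pc a (hi a p)" using Pc_hi[OF a(2) GP[OF p(1)]] .
  then have "hi a p : Ga a" unfolding Ga_def using Gup[OF p(1) Pc0] by auto
  then show "EX p:Ga a. Q p" using p by blast
qed

lemma M_N: assumes "limo a" "a : A" shows "cls.N A (Ga a) = M a"
  unfolding cls.N_def[OF cls_a[OF assms]] M_def ..

lemma M_zf: assumes a: "limo a" "a : A" shows "zf (M a)" "AC (M a)" "x : A ==> x : M a" "M a <= N"
proof -
  interpret a: cls A a "Ga a" by (rule cls_a[OF a])
  show "zf (M a)" "AC (M a)" "x : A ==> x : M a" using a.N_zf a.N_AC a.A_N unfolding M_N[OF a] by auto
  have "val (Ga a) x : N" if x: "x : A" for x
  proof -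
    have "pn (Pc a) x : A" by (rule pnA[OF _ x]) (intro df a)
    moreover have "Ga a = G Int {p. Pc a p}" unfolding Ga_def by blast
    ultimately show ?thesis using val_pn[of G "Pc a" x] N_I by metis
  qed
  then show "M a <= N" unfolding M_def by blast
qed

lemma Ord_N: "x : N ==> Ord x ==> x : A"
proof -
  assume x: "x : N" "Ord x"
  then obtain y where y: "y : A" "x = val G y" unfolding N_def by blast
  have "el x <= el (rank y)" using rank_val[of G y] rank_Ord[OF x(2)] y by simp
  then have "x = rank y \<or> x : el (rank y)" using Ord_subset x Ord_rank by blast
  then show "x : A" using rankA[OF y(1)] Atrans by blast
qed

text \<open>This is \<open>N = M a [Gb a]\<close> for nice names. A nice name over the conditions
  below a larger \<open>b\<close> is taken; the part of each condition below \<open>a\<close> is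
  kept, and the part above is evaluated by the piece \<open>g\<close> of the upper generic, which
  belongs to \<open>M a\<close>.\<close>

lemma niceM: assumes a: "limo a" "a : A" and Z: "Z : N" "el Z <= el w" and w: "w : A"
  shows "EX rho:M a. el Z = {x : el w. EX u:Gb a. opr x u : el rho}"
proof -
  interpret a: cls A a "Ga a" by (rule cls_a[OF a])
  interpret Ma: zf "M a" by (rule M_zf[OF a])
  interpret N: carrier N by (rule carrN)
  have oa: "Ord a" using a unfolding limo_def by simp
  let ?I = "mk ((%x. chk zero x) ` el w)"
  have "dft A (%e. mk ((%x. chk zero x) ` el (e 0)))" by (intro df zeroA)
  from dft_in[OF this, of "%_. w"] have I: "?I : A" using w by auto
  define b where "b = nl (opr a ?I)"
  have b: "limo b" "b : A" "rank a : el b" "rank ?I : el b"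
    using nl[of "opr a ?I"] a I rank_opr[of b a ?I] unfolding b_def by auto
  have ob: "Ord b" using b unfolding limo_def by simp
  have sI: "sm b ?I" by (rule sm_rank[OF b(2,1,4) I])
  have "dfb N (%e. e 0 : el Z)" by (intro N.dfb_mem N.dft_var N.dft_const Z)
  from Sep_name[OF this b(1,2) I sI] obtain f where f: "f : A" "el f <= el (prd ?I (cc zero b))"
    "ALL i:el ?I. val G i : el Z \<longleftrightarrow> (EX u:G. opr i u : el f)" by blast
  define g where "g = mk (Ga a Int el (cc a b))"
  have g: "g : M a" using a.Gset[of "cc a b"] a b unfolding g_def M_N[OF a] by simp
  have elg: "el g = Ga a Int el (cc a b)" unfolding g_def by (rule el_mk) (rule countable_subset[OF _ countable_el[of "cc a b"]], blast)
  define rho where "rho = mk {z : el (prd w (cc zero a)). EX u:el (cc zero b). opr (chk zero (fs z)) u : el f \<and> low a u = sn z \<and> hi a u : el g}"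
  have "rho : M a" unfolding rho_def
    by (rule Ma.sepA) (intro Ma.dfb_bex Ma.dfb_conj Ma.dfb_mem Ma.dfb_eq Ma.dft_const Ma.dft_opr Ma.dft_chk Ma.dft_fs Ma.dft_sn Ma.dft_low Ma.dft_hi Ma.dft_var Ma.zeroA g M_zf(3)[OF a] f ccA zeroA b a prdA w)+
  moreover have "x : el Z \<longleftrightarrow> (EX v:Gb a. opr x v : el rho)" if x: "x : el w" for x
  proof -
    have "chk zero x : el ?I" using x by simp
    then have 1: "x : el Z \<longleftrightarrow> (EX u:G. opr (chk zero x) u : el f)" using bspec[OF f(3), of "chk zero x"] val_chk[OF G0, of x] by simp
    have 2: "opr x v : el rho \<longleftrightarrow> v : el (cc zero a) \<and> (EX u:el (cc zero b). opr (chk zero x) u : el f \<and> low a u = v \<and> hi a u : el g)" for v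
      unfolding rho_def el_mk_sub using x by (simp add: el_prd)
    have 3: "u : G \<longleftrightarrow> low a u : Gb a \<and> hi a u : el g" if u: "u : el (cc zero b)" for u
    proof
      assume uG: "u : G"
      have h: "Pc a (hi a u)" using Pc_hi[OF a(2) GP[OF uG]] .
      then have "hi a u : Ga a" unfolding Ga_def using Gup[OF uG Pc0] by auto
      moreover have "hi a u : el (cc a b)" unfolding el_cc[OF ob] using h u unfolding el_cc[OF ob] by auto
      ultimately show "low a u : Gb a \<and> hi a u : el g" unfolding elg using low_Gb[OF a(2) uG] by blast
    next
      assume m: "low a u : Gb a \<and> hi a u : el g"
      have "cup (low a u) (hi a u) = u" by (rule ext_el) auto
      moreover have "low a u : G" "hi a u : G" using m unfolding elg Ga_def Gb_def by auto
      ultimately show "u : G" using Gcup by metis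
    qed
    have 4: "u : el (cc zero b)" if "opr i u : el f" for i u using subsetD[OF f(2) that] by (auto simp: el_prd)
    show ?thesis unfolding 1
    proof
      assume "EX u:G. opr (chk zero x) u : el f"
      then obtain u where u: "u : G" "opr (chk zero x) u : el f" by blast
      then have "low a u : Gb a" "hi a u : el g" using 3 4 by blast+
      then show "EX v:Gb a. opr x v : el rho" unfolding 2 using u 4 Gb_cc[OF oa] by blast
    next
      assume "EX v:Gb a. opr x v : el rho"
      then obtain u where "u : el (cc zero b)" "opr (chk zero x) u : el f" "low a u : Gb a" "hi a u : el g" unfolding 2 by blast
      then show "EX u:G. opr (chk zero x) u : el f" using 3 by blast
    qed
  qed
  ultimately show ?thesis using Z(2) by (intro bexI[of _ rho]) blast+
qed

text \<open>The upper forcing adds no subsets of the small set \<open>cc zero a\<close>, so every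
  dense set that has to be met is already in \<open>A\<close>.\<close>

lemma genM: assumes a: "limo a" "a : A" shows "gen (M a) (cc zero a) (rr a) (Gb a)"
proof -
  interpret a: cls A a "Ga a" by (rule cls_a[OF a])
  interpret Ma: zf "M a" by (rule M_zf[OF a])
  interpret g: gen A "cc zero a" "rr a" "Gb a" by (rule gen_b[OF a])
  have oa: "Ord a" using a unfolding limo_def by simp
  show ?thesis
  proof unfold_locales
    show "cc zero a : M a" "rr a : M a" using M_zf(3)[OF a] g.cA g.rA by auto
    fix D assume D: "D : M a" "el D <= el (cc zero a)" "!!p. p : el (cc zero a) ==> EX d:el D. le (rr a) d p"
    have "D : A" by (rule a.smallK[OF a(1) _ D(2) g.cA sm_cc[OF a(2) oa]]) (use D in \<open>simp add: M_N[OF a]\<close>)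
    then show "Gb a Int el D ~= {}" using g.Ggen D by blast
  qed (fact g.le_refl g.le_trans g.le_c g.Gc g.Gne g.Gup g.Gdir)+
qed

text \<open>The witness is the generic function restricted to the levels from \<open>a\<close> to
  the next limit \<open>b\<close>. In \<open>M b\<close> it would be a new small set, so by
  \<open>smallK\<close> it would lie in \<open>A\<close>; but a generic function differs from every
  function of the ground model.\<close>

lemma M_proper: assumes a: "limo a" "a : A" shows "EX U. U : M a \<and> U ~: M (nl a)"
proof -
  define b where "b = nl a"
  have oa: "Ord a" using a unfolding limo_def by simp
  have b: "b : A" "limo b" "a : el b" using nl[OF a(2)] rank_Ord[OF oa] unfolding b_def by auto
  have ob: "Ord b" using b unfolding limo_def by simp
  interpret a: cls A a "Ga a" by (rule cls_a[OF a])
  interpret b: cls A b "Ga b" by (rule cls_a[OF b(2,1)])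
  interpret Ma: zf "M a" by (rule M_zf[OF a])
  define g where "g = mk (Ga a Int el (cc a b))"
  have g: "g : M a" using a.Gset[of "cc a b"] a b unfolding g_def M_N[OF a] by simp
  have elg: "el g = Ga a Int el (cc a b)" unfolding g_def by (rule el_mk) (rule countable_subset[OF _ countable_el[of "cc a b"]], blast)
  have U: "Uni g : M a" using Ma.UniA g by simp
  have "Uni g ~: M b"
  proof
    assume "Uni g : M b"
    have VA: "VV (rank (succ b)) : A" by (rule VVA) (use b in simp_all)
    have "el (Uni g) <= el (VV (rank (succ b)))"
    proof
      fix z assume "z : el (Uni g)"
      then obtain p where "p : el (cc a b)" "z : el p" unfolding el_Uni elg by blast
      then have "Pc a p" "rank z : el b" unfolding el_cc[OF ob] by auto
      then show "z : el (VV (rank (succ b)))" using PcA \<open>z : el p\<close> Atrans unfolding VV_succ[OF ob] by blast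
    qed
    moreover have "sm b (VV (rank (succ b)))" by (rule sm_V[OF b(1) ob]) simp
    ultimately have UA: "Uni g : A" using b.smallK[OF b(2) _ _ VA] \<open>Uni g : M b\<close> unfolding M_N[OF b(2,1)] by blast
    have "EX p:Ga a. EX z:el p. rank z : el b \<and> z ~: el (Uni g)"
    proof (rule a.Ggen)
      show "dfb A (%e. EX z:el (e 0). rank z : el b \<and> z ~: el (Uni g))" by (intro df b UA)
      fix p assume p: "Pc a p"
      have "sm a (low b p)" using p a unfolding Pc_def isc_def b_def by blast
      then obtain f where f: "f : A" "ALL z:el (low b p). EX u:el (VV (rank (succ a))). app f u = z" unfolding sm_def by blast
      define V where "V = VV (rank (succ a))"
      have VA: "V : A" unfolding V_def by (rule VVA) (use a in simp_all)
      have Vr: "rank u : el (succ a)" if "u : el V" for u using that unfolding V_def VV_succ[OF oa] by auto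
      define x where "x = mk {u : el V. u ~: el (fs (fs (app f u)))}"
      have xA: "x : A" unfolding x_def by (rule sepA[OF _ VA]) (intro df f)
      have elx: "u : el x \<longleftrightarrow> u : el V \<and> u ~: el (fs (fs (app f u)))" for u unfolding x_def by simp
      have sa: "succ a : el b" using b unfolding limo_def by blast
      have rx: "rank x : el b" by (rule rank_in_limo[OF b(2) _ sa]) (use Vr elx in blast)
      define y where "y = opr x a"
      have yA: "y : A" unfolding y_def using xA a by simp
      have ry: "rank (opr y i) : el b" if "rank i : el b" for i unfolding y_def rank_opr[OF b(2)] using rx that b(3) rank_Ord[OF oa] by simp
      have ry2: "rank (opr y i) ~: el a" for i unfolding y_def rank_opr[OF a(1)] using rank_Ord[OF oa] by simp
      have nd: "opr y i ~: el p" if i: "rank i : el b" for i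
      proof
        assume "opr y i : el p"
        then have "opr y i : el (low b p)" using ry[OF i] by simp
        then obtain u where u: "u : el V" "app f u = opr y i" using f(2) unfolding V_def by blast
        then show False using elx[of u] unfolding y_def by auto
      qed
      \<comment> \<open>The given set is single-valued at \<open>y\<close>, so one of the two
        entries at \<open>y\<close> is missing from it and may be added to \<open>p\<close>.\<close>
      have "\<not> (opr y zero : el (Uni g) \<and> opr y one : el (Uni g))"
      proof
        assume "opr y zero : el (Uni g) \<and> opr y one : el (Uni g)"
        then obtain p1 p2 where pp: "p1 : G" "p2 : G" "opr y zero : el p1" "opr y one : el p2" unfolding el_Uni elg Ga_def by blast
        have "fnc (cup p1 p2)" using GP[OF Gcup[OF pp(1,2)]] unfolding Pc_def isc_def by blast
        moreover have "opr y zero : el (cup p1 p2)" "opr y one : el (cup p1 p2)" using pp by auto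
        ultimately show False unfolding fnc_def using one_neq_zero by blast
      qed
      then obtain i where i: "i = zero \<or> i = one" "opr y i ~: el (Uni g)" by blast
      have ri: "rank i : el b" using limo_01[OF b(2)] i by auto
      let ?z = "opr y i"
      let ?s = "upair ?z ?z"
      have "Pc a ?s" by (rule Pc_sing[OF yA i(1) ry2])
      moreover have "fnc (cup p ?s)"
      proof -
        have fp: "fnc p" using p unfolding Pc_def isc_def by blast
        have nz: "opr y zero ~: el p" "opr y one ~: el p" using nd limo_01[OF b(2)] by auto
        have k: "k = zero \<or> k = one" if "opr x k : el p" for x k using fp that unfolding fnc_def by fastforce
        have ny: "opr y k ~: el p" for k using nz k by blast
        have f2: "k = k'" if "opr x k : el p" "opr x k' : el p" for x k k' using fp that unfolding fnc_def by blast
        show ?thesis unfolding fnc_def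
        proof (intro conjI ballI allI impI)
          fix z assume "z : el (cup p ?s)" then show "EX x k. z = opr x k \<and> (k = zero \<or> k = one)"
            using fp i(1) unfolding fnc_def by auto
        next
          fix x k x' k' assume "opr x k : el (cup p ?s)" "opr x' k' : el (cup p ?s)" "x = x'"
          then show "k = k'" using f2 ny by auto
        qed
      qed
      ultimately have "Pc a (cup p ?s)" using Pc_cup[OF p] by blast
      moreover have "EX z:el (cup p ?s). rank z : el b \<and> z ~: el (Uni g)" using ry[OF ri] i by (intro bexI[of _ ?z]) auto
      moreover have "el p <= el (cup p ?s)" by auto
      ultimately show "EX d. Pc a d \<and> el p <= el d \<and> (EX z:el d. rank z : el b \<and> z ~: el (Uni g))" by blast
    qed
    then obtain p z where pz: "p : Ga a" "z : el p" "rank z : el b" "z ~: el (Uni g)" by blast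
    have "low b p : Ga a" by (rule a.Gup[OF pz(1)]) (use a.GP[OF pz(1)] b a.GA[OF pz(1)] in \<open>auto intro!: Pc_sub[of a p]\<close>)
    moreover from this have "low b p : el (cc a b)" unfolding el_cc[OF ob] using a.GP by auto
    ultimately have "z : el (Uni g)" unfolding el_Uni elg using pz(2,3) by (intro UN_I[of "low b p"]) auto
    then show False using pz by blast
  qed
  then show ?thesis using U unfolding b_def by blast
qed

end

section \<open>Grounds of the extension\<close>

locale grd = tow A G for A G +
  fixes W c r h
  assumes gW: "gen W c r h" and WN: "val h ` W = N" and WAC: "AC W" and WO: "a : A ==> Ord a ==> a : W"
begin

interpretation w: gen W c r h by (rule gW)

text \<open>\<open>Lh\<close> is one fixed function on sets, and every transitive model of ZF is
  closed under it; so a model with all ordinals of \<open>A\<close> contains L.\<close>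

lemma A_W: "x : A ==> x : W"
proof -
  assume "x : A"
  then obtain a where "a : A" "Ord a" "x : el (Lh a)" using VL by blast
  then show "x : W" using WO w.LhA w.Atrans by blast
qed

lemma W_N: "x : W ==> x : N"
proof -
  assume x: "x : W"
  obtain o1 where o: "o1 : h" using w.Gne by blast
  then have "o1 : W" using w.Gc w.cA w.Atrans by blast
  then have "chk o1 x : W" using x by simp
  then show "x : N" using val_chk[OF o, of x] WN by (metis imageI)
qed

lemma Ord_W: "x : W ==> Ord x ==> x : A" using W_N Ord_N by blast

lemma dfbK: "dft W t ==> dfb W (%e. t e : A)"
proof -
  have "w.LK = A"
  proof (intro set_eqI iffI)
    fix x assume "x : w.LK"
    then obtain a where "a : W" "Ord a" "x : el (Lh a)" using w.LK_Ex by blast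
    then show "x : A" using Ord_W LhA Atrans by blast
  next
    fix x assume "x : A"
    then show "x : w.LK" using VL WO w.LK_I by blast
  qed
  then show "dft W t ==> dfb W (%e. t e : A)" using w.dfb_LK by simp
qed

lemma kappa: "EX l:A. EX f:W. Ord l \<and> app f ` el l = el c"
  using w.wellorder[OF WAC w.cA] Ord_W by blast

definition wlg where "wlg w0 = mk {z : el (prd w0 w0). wl (fs z) (sn z)}"

lemma wlg: assumes w0: "w0 : A" shows "wlg w0 : A" "!!s t. opr s t : el (wlg w0) \<longleftrightarrow> s : el w0 \<and> t : el w0 \<and> wl s t"
  "tot (el w0) wl" "wfo (el w0) wl"
proof -
  show "wlg w0 : A" unfolding wlg_def by (rule sepA) (intro df, use w0 in simp)
  show "!!s t. opr s t : el (wlg w0) \<longleftrightarrow> s : el w0 \<and> t : el w0 \<and> wl s t" unfolding wlg_def el_mk_sub by (auto simp: el_prd)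
  show "tot (el w0) wl" using wl_wellorder(1) el_subA[OF w0] unfolding tot_def by blast
  show "wfo (el w0) wl" using wl_wellorder(2) el_subA[OF w0] unfolding wfo_def by (rule_tac wf_subset) auto
qed

text \<open>Over \<open>M a\<close>, sequences of length \<open>\<kappa> < a\<close> in \<open>N\<close> are covered by small sets of \<open>A\<close>, and
  on those \<open>M a\<close> has no new subsets; so the approximation property of \<open>W\<close> applies.\<close>

lemma M_W: assumes a: "limo a" "a : A" and l: "l0 : el a" "f : W" "app f ` el l0 = el c" shows "M a <= W"
proof (rule zf_subset[OF w.zf_axioms M_zf(1,2)[OF a]])
  interpret a: cls A a "Ga a" by (rule cls_a[OF a])
  interpret Ma: zf "M a" by (rule M_zf[OF a])
  have oa: "Ord a" using a unfolding limo_def by simp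
  have MN: "x : N" if "x : M a" for x using that M_zf(4)[OF a] by blast
  { fix x assume "x : M a" "Ord x" then show "x : W" using MN Ord_N WO by blast }
  fix e l k assume e: "e : M a" and lk: "l : M a" "k : M a" "Ord l" "Ord k" and sub: "el e <= el (prd (prd l l) k)"
  define w0 where "w0 = prd (prd l l) k"
  have "l : A" "k : A" using lk MN Ord_N by blast+
  then have w0: "w0 : A" unfolding w0_def by simp
  have l0: "l0 : A" "Ord l0" using l(1) a Atrans oa Ord_in by blast+
  have eN: "e : N" by (rule MN[OF e])
  then obtain x where x: "x : W" "e = val h x" using WN by blast
  obtain o1 where o: "o1 : h" using w.Gne by blast
  have "el (val h x) Int el w0 = el e" using sub unfolding x(2) w0_def by blast
  with w.nice[OF x(1) A_W[OF w0] o] obtain rho where rho: "rho : W" "el e = {y : el w0. EX q:h. opr y q : el rho}" by auto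
  have "mk (el e) : W"
  proof (rule w.approx[OF A_W[OF w0] A_W[OF wlg(1)[OF w0]] wlg(2-4)[OF w0] rho])
    fix s assume s: "s : W"
    \<comment> \<open>The trace to be shown in \<open>W\<close> lies in the range of this sequence,
      reindexed by the ordinal \<open>l0\<close>. The sequence is known only to be in
      \<open>W\<close>, so it is treated as an element of \<open>N\<close> and given a nice name
      over \<open>M a\<close>.\<close>
    define t where "t = mk {z : el (prd l0 w0). sn z = app s (app f (fs z))}"
    have "t : W" unfolding t_def by (rule w.sepA) (intro w.dfb_eq w.dft_sn w.dft_fs w.dft_var w.dft_app w.dft_const s l w.prdA A_W l0 w0)+
    then have tN: "t : N" by (rule W_N)
    have elt: "opr i y : el t \<longleftrightarrow> i : el l0 \<and> y : el w0 \<and> y = app s (app f i)" for i y unfolding t_def el_mk_sub by (auto simp: el_prd)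
    have tsub: "el t <= el (prd l0 w0)" unfolding t_def el_mk_sub by blast
    obtain rh where rh: "rh : M a" "el t = {x : el (prd l0 w0). EX u:Gb a. opr x u : el rh}"
      using niceM[OF a tN tsub] l0 w0 by auto
    define I where "I = prd l0 (cc zero a)"
    have I: "I : A" unfolding I_def using l0 a by simp
    have "sm a l0" by (rule sm_rank[OF a(2,1)]) (use l0 l(1) rank_Ord in auto)
    then have sI: "sm a I" unfolding I_def by (intro sm_prd a l0 ccA zeroA sm_cc oa)
    \<comment> \<open>For an index \<open>i\<close> and a lower condition \<open>u\<close>, the
      \<open>wl\<close>-least value that the nice name permits; minimality makes this a function.
      Its domain is small, so \<open>funK\<close> moves it from \<open>M a\<close> to
      \<open>A\<close>.\<close>
    define g where "g = mk {z : el (prd I w0). opr (opr (fs (fs z)) (sn z)) (sn (fs z)) : el rh \<and>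
      (ALL y:el w0. opr (opr (fs (fs z)) y) (sn (fs z)) : el rh --> opr y (sn z) ~: el (wlg w0))}"
    have gM: "g : M a" unfolding g_def
      by (rule Ma.sepA) (intro Ma.dfb_conj Ma.dfb_ball Ma.dfb_imp Ma.dfb_neg Ma.dfb_mem Ma.dft_opr Ma.dft_fs Ma.dft_sn Ma.dft_var Ma.dft_const rh M_zf(3)[OF a] w0 wlg(1) prdA I)+
    have elg: "opr (opr i u) y : el g \<longleftrightarrow> i : el l0 \<and> u : el (cc zero a) \<and> y : el w0 \<and> opr (opr i y) u : el rh \<and>
      (ALL y':el w0. opr (opr i y') u : el rh --> \<not> wl y' y)" for i u y
      unfolding g_def el_mk_sub I_def using wlg(2)[OF w0] by (auto simp: el_prd)
    have fn: "y = y'" if i: "i : el I" and y: "opr i y : el g" "opr i y' : el g" for i y y'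
    proof -
      obtain j u where j: "i = opr j u" using i unfolding I_def el_prd by blast
      have y1: "y : el w0" "opr (opr j y) u : el rh" "ALL y':el w0. opr (opr j y') u : el rh --> \<not> wl y' y"
        using y(1) unfolding j elg by blast+
      have y2: "y' : el w0" "opr (opr j y') u : el rh" "ALL y:el w0. opr (opr j y) u : el rh --> \<not> wl y y'"
        using y(2) unfolding j elg by blast+
      have "\<not> wl y y'" "\<not> wl y' y" using y1 y2 by blast+
      then show "y = y'" using wlg(3)[OF w0] y1(1) y2(1) unfolding tot_def by blast
    qed
    have "mk {z : el (prd I w0). z : el g} : A"
      by (rule a.funK[OF a(1) _ I sI w0]) (use gM fn M_N[OF a] in auto)
    moreover have "{z : el (prd I w0). z : el g} = el g" unfolding g_def el_mk_sub by blast
    ultimately have gA: "g : A" by simp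
    \<comment> \<open>The range of \<open>g\<close> is a small set of \<open>A\<close> covering the
      sequence. Hence \<open>e\<close> meets it in a set of \<open>A\<close>, from which
      \<open>W\<close> can separate the trace.\<close>
    define b where "b = mk (app g ` el I)"
    have "dft A (%e. mk ((%i. app (e 0) i) ` el I))" by (intro df I)
    from dft_in[OF this, of "%_. g"] have bA: "b : A" unfolding b_def using gA by auto
    have elb: "el b = app g ` el I" unfolding b_def by simp
    have sb: "sm a b" by (rule sm_image[OF a(2) sI, of "app g"]) (intro df gA, use elb in simp)
    define e1 where "e1 = mk {y : el b. y : el e}"
    have ele1: "el e1 = {y : el b. y : el e}" unfolding e1_def by (rule el_mk_sub)
    have "e1 : M a" unfolding e1_def by (rule Ma.sepA) (intro Ma.dfb_mem Ma.dft_var Ma.dft_const e M_zf(3)[OF a] bA)+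
    then have "e1 : A" using a.smallK[OF a(1) _ _ bA sb] ele1 unfolding M_N[OF a] by blast
    then have "mk {y : el e1. EX q:el c. y = app s q} : W"
      by (intro w.sepA w.dfb_bex w.dfb_eq w.dft_var w.dft_app w.dft_const s w.cA A_W)
    moreover have "{y : el e1. EX q:el c. y = app s q} = el e Int app s ` el c"
    proof (intro set_eqI iffI)
      fix y assume y: "y : el e Int app s ` el c"
      then have yw: "y : el w0" using sub unfolding w0_def by blast
      obtain q where q: "q : el c" "y = app s q" using y by blast
      obtain i where i: "i : el l0" "q = app f i" using q(1) l(3) by blast
      have "opr i y : el t" unfolding elt using i yw q by blast
      then obtain u where u: "u : Gb a" "opr (opr i y) u : el rh" unfolding rh(2) by blast
      have un: "y' = y" if "y' : el w0" "opr (opr i y') u : el rh" for y'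
      proof -
        have "opr i y' : el t" unfolding rh(2) using that u(1) i(1) by (auto simp: el_prd)
        then show "y' = y" unfolding elt using i q by simp
      qed
      have "\<not> wl y y" using wlg(4)[OF w0] yw unfolding wfo_def using wf_not_refl by fastforce
      then have gg: "opr (opr i u) y : el g" unfolding elg using i(1) u yw un Gb_cc[OF oa] by blast
      have iI: "opr i u : el I" unfolding I_def el_prd using i(1) u(1) Gb_cc[OF oa] by blast
      have "app g (opr i u) = y" using app_unique[OF gg] fn[OF iI gg] by blast
      then have "y : el b" unfolding elb using iI by blast
      then show "y : {y : el e1. EX q:el c. y = app s q}" unfolding ele1 using y q by blast
    qed (use ele1 in blast)
    ultimately show "mk (el e Int app s ` el c) : W" by simp
  qed
  then show "e : W" by simp
qed

text \<open>From left to right the pieces are in \<open>A\<close> by \<open>smallK\<close>; from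
  right to left the approximation property of \<open>N\<close> over \<open>M a\<close> is used,
  whose poset is \<open>cc zero a\<close>. The criterion mentions only \<open>A\<close>, which is L
  in the sense of \<open>W\<close>, and so can be stated in \<open>W\<close>.\<close>

lemma M_char: assumes a: "limo a" "a : A" and e: "e : W" "el e <= el w0" and w0: "w0 : A"
  shows "e : M a \<longleftrightarrow> (ALL s:A. mk {y : el e. EX q:el (cc zero a). y = app s q} : A)"
proof
  interpret a: cls A a "Ga a" by (rule cls_a[OF a])
  interpret Ma: gen "M a" "cc zero a" "rr a" "Gb a" by (rule genM[OF a])
  have oa: "Ord a" using a unfolding limo_def by simp
  have cA: "cc zero a : A" using a by simp
  have sc: "sm a (cc zero a)" by (rule sm_cc[OF a(2) oa])
  {
    assume eM: "e : M a"
    show "ALL s:A. mk {y : el e. EX q:el (cc zero a). y = app s q} : A"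
    proof
      fix s assume s: "s : A"
      let ?b = "mk ((%q. app s q) ` el (cc zero a))"
      have "dft A (%e. mk ((%i. app (e 0) i) ` el (cc zero a)))" by (intro df cA)
      from dft_in[OF this, of "%_. s"] have bA: "?b : A" using s by auto
      have sb: "sm a ?b" by (rule sm_image[OF a(2) sc, of "app s"]) (intro df s, simp)
      show "mk {y : el e. EX q:el (cc zero a). y = app s q} : A"
      proof (rule a.smallK[OF a(1) _ _ bA sb])
        show "mk {y : el e. EX q:el (cc zero a). y = app s q} : a.N" unfolding M_N[OF a]
          by (intro Ma.sepA Ma.dfb_bex Ma.dfb_eq Ma.dft_var Ma.dft_app Ma.dft_const M_zf(3)[OF a] s cA eM)
      qed (auto simp: el_mk_sub)
    qed
  next
    assume K: "ALL s:A. mk {y : el e. EX q:el (cc zero a). y = app s q} : A"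
    obtain rho where rho: "rho : M a" "el e = {y : el w0. EX q:Gb a. opr y q : el rho}"
      using niceM[OF a W_N[OF e(1)] e(2) w0] by blast
    have "mk (el e) : M a"
    proof (rule Ma.approx[OF M_zf(3)[OF a w0] M_zf(3)[OF a wlg(1)[OF w0]] wlg(2-4)[OF w0] rho])
      fix s assume s: "s : M a"
      \<comment> \<open>The part of the sequence with values in \<open>w0\<close> is already in
        \<open>A\<close> by \<open>funK\<close>, so testing sequences of \<open>A\<close> is
        enough.\<close>
      define t where "t = mk {z : el (prd (cc zero a) w0). sn z = app s (fs z)}"
      have elt: "opr q y : el t \<longleftrightarrow> q : el (cc zero a) \<and> y : el w0 \<and> y = app s q" for q y unfolding t_def el_mk_sub by (auto simp: el_prd)
      have tM: "t : M a" unfolding t_def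
        by (rule Ma.sepA) (intro Ma.dfb_eq Ma.dft_var Ma.dft_app Ma.dft_const Ma.dft_fs Ma.dft_sn s M_zf(3)[OF a] prdA cA w0)+
      have "mk {z : el (prd (cc zero a) w0). z : el t} : A"
        by (rule a.funK[OF a(1) _ cA sc w0]) (use tM elt M_N[OF a] in auto)
      moreover have "{z : el (prd (cc zero a) w0). z : el t} = el t" unfolding t_def el_mk_sub by blast
      ultimately have tA: "t : A" by simp
      define e1 where "e1 = mk {y : el e. EX q:el (cc zero a). y = app t q}"
      have e1: "e1 : A" using K tA unfolding e1_def by blast
      have ele1: "el e1 = {y : el e. EX q:el (cc zero a). y = app t q}" unfolding e1_def by (rule el_mk_sub)
      have "mk {y : el e1. EX q:el (cc zero a). y = app s q} : M a"
        by (intro Ma.sepA Ma.dfb_bex Ma.dfb_eq Ma.dft_var Ma.dft_app Ma.dft_const M_zf(3)[OF a] s cA e1)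
      moreover have "{y : el e1. EX q:el (cc zero a). y = app s q} = el e Int app s ` el (cc zero a)"
      proof (intro set_eqI iffI)
        fix y assume y: "y : el e Int app s ` el (cc zero a)"
        then obtain q where q: "q : el (cc zero a)" "y = app s q" by blast
        have "opr q y : el t" unfolding elt using q y e(2) by blast
        then have "app t q = y" by (rule app_unique) (use elt q in blast)
        then show "y : {y : el e1. EX q:el (cc zero a). y = app s q}" unfolding ele1 using q y by blast
      qed (use ele1 in blast)
      ultimately show "mk (el e Int app s ` el (cc zero a)) : M a" by simp
    qed
    then show "e : M a" by simp
  }
qed

text \<open>Membership in \<open>M a\<close> is expressed in \<open>W\<close> as being decoded from
  a set of ordinals that passes the test of \<open>M_char\<close>. Definability is demanded by
  \<open>inner_model\<close>.\<close>

lemma M_dfb: assumes a: "limo a" "a : A" and l: "l0 : el a" "f : W" "app f ` el l0 = el c"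
  shows "dfb W (%e. e 0 : M a)"
proof (rule w.dfb_cong)
  interpret Ma: zf "M a" by (rule M_zf[OF a])
  let ?P = "%x. EX e:W. EX l:W. EX k:W. EX i:el l. Ord l \<and> Ord k \<and> el e <= el (prd (prd l l) k) \<and>
     (ALL s:W. s : A --> mk {y : el e. EX q:el (cc zero a). y = app s q} : A) \<and> x = val (el one) (TN (prd e one) l k i)"
  have cW: "cc zero a : W" using a A_W by simp
  show "dfb W (%e. ?P (e 0))"
    by (intro w.dfb_ex w.dfb_bex w.dfb_conj w.dfb_all w.dfb_imp w.dfb_eq w.dfb_Ord w.dfb_sub_el dfbK w.dft_sep
        w.dft_var w.dft_const w.dft_app w.dft_prd w.dft_val w.dft_TN w.oneA cW)
  fix e :: "nat => hset" assume "range e <= W"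
  define x where "x = e 0"
  have "?P x \<longleftrightarrow> x : M a"
  proof
    assume "?P x"
    then obtain d l k i where d: "d : W" "l : W" "k : W" "i : el l" "Ord l" "Ord k" "el d <= el (prd (prd l l) k)"
      "ALL s:W. s : A --> mk {y : el d. EX q:el (cc zero a). y = app s q} : A" "x = val (el one) (TN (prd d one) l k i)" by blast
    have lk: "l : A" "k : A" using d Ord_W by blast+
    have "ALL s:A. mk {y : el d. EX q:el (cc zero a). y = app s q} : A" using d(8) A_W by blast
    then have dM: "d : M a" using M_char[OF a d(1) d(7)] lk by simp
    have "i : A" using lk d(4) Atrans by blast
    then have "l : M a" "k : M a" "i : M a" using M_zf(3)[OF a] lk by blast+
    then show "x : M a" unfolding d(9) by (intro Ma.valA Ma.TNA Ma.prdA Ma.oneA dM)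
  next
    assume "x : M a"
    from Ma.set_code[OF M_zf(2)[OF a] this] obtain d l k i where d: "d : M a" "l : M a" "k : M a" "i : el l" "Ord l" "Ord k"
      "el d <= el (prd (prd l l) k)"
      "ALL H rho. el d = {z : el (prd (prd l l) k). EX r:H. opr z r : el rho} --> val H (TN rho l k i) = x" by blast
    have W: "d : W" "l : W" "k : W" using d M_W[OF a l] by blast+
    have lk: "l : A" "k : A" using W d Ord_W by blast+
    have "el d = {z : el (prd (prd l l) k). EX r:el one. opr z r : el (prd d one)}" using d(7) by (auto simp: el_prd)
    then have x: "x = val (el one) (TN (prd d one) l k i)" using d(8)[rule_format, of "el one" "prd d one"] by simp
    have "ALL s:A. mk {y : el d. EX q:el (cc zero a). y = app s q} : A" using M_char[OF a W(1) d(7)] lk d(1) by simp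
    then have "ALL s:W. s : A --> mk {y : el d. EX q:el (cc zero a). y = app s q} : A" by simp
    then show "?P x" by (intro bexI[OF _ W(1)] bexI[OF _ W(2)] bexI[OF _ W(3)] bexI[OF _ d(4)] conjI d(5-7) x)
  qed
  then show "?P (e 0) \<longleftrightarrow> e 0 : M a" unfolding x_def .
qed

end

section \<open>Intermediate models\<close>

definition bbH where "bbH P e f = mk {p : el (fs (fs P)). ALL q:el (fs (fs P)). opr q p : el (sn (fs P)) -->
   \<not> (EX u. opr (fs e) u : el (sn P) \<and> opr q u : el (sn (fs P))) \<and> (ALL s:el (sn e). q ~: el (app f s))}"

text \<open>\<open>bb\<close> evaluates infinitary propositional codes: \<open>opr z S\<close> stands for ``neither the atom \<open>z\<close> nor any
  member of \<open>S\<close> holds'', and its value is the regular open set of conditions forcing this.\<close>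

definition bb where "bb P = recF (bbH P)"

lemma el_bb: "el (bb (opr (opr c r) si) e) = {p : el c. ALL q:el c. le r q p -->
   \<not> (EX u. opr (fs e) u : el si \<and> le r q u) \<and> (ALL s:el (sn e). q ~: el (bb (opr (opr c r) si) s))}"
proof -
  have "s : TC e" if "s : el (sn e)" for s
  proof (cases "EX x y. e = opr x y")
    case True then show ?thesis using that opr_TC TC_el2 by (metis sn_opr)
  next
    case False then show ?thesis using that fs_nopr(2)[of e] by simp
  qed
  then have t: "app (lam (tc e) (bb P)) s = bb P s" if "s : el (sn e)" for s P using that by simp
  have "bb (opr (opr c r) si) e = bbH (opr (opr c r) si) e (lam (tc e) (bb (opr (opr c r) si)))" unfolding bb_def by (rule recF)
  then show ?thesis unfolding bbH_def by (simp only: fs_opr sn_opr el_mk_sub le_def) (use t in auto)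
qed

lemma (in zf) dft_bb[df]: assumes "dft A s" "dft A t" shows "dft A (%e. bb (s e) (t e))" unfolding bb_def
  by (rule dft_recF[where H=bbH, OF _ assms]) (unfold bbH_def, intro df)

lemma (in zf) bbA: "x : A ==> y : A ==> bb x y : A" using dft_in[OF dft_bb[OF dft_const dft_const], of x y "%_. x"] by auto

text \<open>\<open>W\<close> lies between \<open>B\<close> and its extension by \<open>g\<close>,
  the upper bound being expressed by nice names. The rows of the single set \<open>X\<close> list
  all subsets of the poset that are in \<open>W\<close>, and \<open>X\<close> will generate
  \<open>W\<close> over \<open>B\<close>. \<open>K\<close> supplies ordinals and index sets.\<close>

locale imd = B: gen B c r g for B c r g +
  fixes K W th X si
  assumes Wzf: "zf W" and WAC: "AC W" and BAC: "AC B" and Kzf: "zf K" and KB: "K <= B" and cK: "c : K" and BW: "B <= W" and BnW: "B ~= W"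
    and Bdfb: "dfb W (%e. e 0 : B)" and OK: "a : W ==> Ord a ==> a : K"
    and nm: "e : W ==> w : K ==> el e <= el w ==> EX rho:B. el e = {x : el w. EX u:g. opr x u : el rho}"
    and th: "th : K" and X: "X : W"
    and rows: "Y : W ==> el Y <= el c ==> EX j:el th. el Y = {p : el c. opr j p : el X}"
    and si: "si : B" and siX: "z : el X \<longleftrightarrow> (EX u:g. opr z u : el si)" and siz: "opr zero u ~: el si"
begin

interpretation w: zf W by (rule Wzf)
interpretation K: zf K by (rule Kzf)

abbreviation b where "b \<equiv> bb (opr (opr c r) si)"

lemmas el_b = el_bb[of c r si]

lemma bA: "e : B ==> b e : B" by (intro B.bbA B.oprA B.cA B.rA si)
lemma dft_b: "dft B t ==> dft B (%e. b (t e))" by (intro B.dft_bb B.dft_const B.oprA B.cA B.rA si)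
lemma b_c: "p : el (b e) ==> p : el c" by (subst (asm) el_b) blast
lemma gc: "p : g ==> p : el c" using B.Gc by blast

lemma b_iff: "p : el (b e) \<longleftrightarrow> p : el c \<and> (ALL q. le r q p -->
   \<not> (EX u. opr (fs e) u : el si \<and> le r q u) \<and> (ALL s:el (sn e). q ~: el (b s)))"
  by (subst el_b) (use B.le_c in blast)

lemma b_down: assumes "p : el (b e)" "le r q p" shows "q : el (b e)"
proof -
  have "le r q' p" if "le r q' q" for q' using B.le_trans[OF _ _ _ that assms(2)] B.le_c that assms(2) by blast
  then show ?thesis using assms(1) B.le_c[OF assms(2)] unfolding b_iff[of p e] b_iff[of q e] by blast
qed

text \<open>A violation of the neither-nor condition at \<open>q\<close> persists to all extensions
  of \<open>q\<close>, so it is incompatible with density. Together with \<open>b_down\<close> this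
  makes the values regular open.\<close>

lemma b_reg: assumes p: "p : el c" and d: "!!q. le r q p ==> EX t. le r t q \<and> t : el (b e)" shows "p : el (b e)"
  unfolding b_iff[of p e]
proof (intro conjI allI impI ballI notI p)
  fix q assume q: "le r q p"
  obtain t where t: "le r t q" "t : el (b e)" using d[OF q] by blast
  have tt: "le r t t" using B.le_refl b_c t by blast
  { assume "EX u. opr (fs e) u : el si \<and> le r q u"
    then obtain u where u: "opr (fs e) u : el si" "le r q u" by blast
    have "le r t u" using B.le_trans[OF _ _ _ t(1) u(2)] B.le_c t(1) u(2) by blast
    then show False using t(2) tt u(1) unfolding b_iff[of t] by blast }
  fix s assume "s : el (sn e)" "q : el (b s)"
  then show False using b_down[OF _ t(1)] t(2) tt unfolding b_iff[of t e] by blast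
qed

abbreviation mt where "mt d \<equiv> g Int el d ~= {}"

text \<open>The truth lemma for codes: densely, a condition lies in the value of \<open>e\<close>,
  forces its atom, or lies in the value of one of its members.\<close>

lemma mt_b: assumes e: "e : B" shows "mt (b e) \<longleftrightarrow> fs e ~: el X \<and> (ALL s:el (sn e). \<not> mt (b s))"
proof
  assume "mt (b e)"
  then obtain p where p: "p : g" "p : el (b e)" by blast
  show "fs e ~: el X \<and> (ALL s:el (sn e). \<not> mt (b s))"
  proof (intro conjI ballI notI)
    assume "fs e : el X"
    then obtain u where u: "u : g" "opr (fs e) u : el si" unfolding siX by blast
    obtain t where "t : g" "le r t p" "le r t u" using B.Gdir[OF p(1) u(1)] by blast
    then show False using p(2) u(2) unfolding b_iff[of p] by blast
  next
    fix s assume s: "s : el (sn e)" "mt (b s)"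
    then obtain u where u: "u : g" "u : el (b s)" by blast
    obtain t where "t : g" "le r t p" "le r t u" using B.Gdir[OF p(1) u(1)] by blast
    then show False using p(2) s(1) b_down[OF u(2)] unfolding b_iff[of p] by blast
  qed
next
  assume a: "fs e ~: el X \<and> (ALL s:el (sn e). \<not> mt (b s))"
  let ?Q = "%p. p : el (b e) \<or> (EX u. opr (fs e) u : el si \<and> le r p u) \<or> (EX s:el (sn e). p : el (b s))"
  have "EX p:g. ?Q p"
  proof (rule B.Ggen2)
    show "dfb B (%x. ?Q (x 0))" by (intro B.dfb_disj B.dfb_mem B.dft_var B.dfb_pex1 B.dfb_le B.dfb_bex dft_b B.dft_const B.dft_fs B.dft_sn e si)
    fix p assume p: "p : el c"
    show "EX d. le r d p \<and> ?Q d"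
    proof (cases "p : el (b e)")
      case True then show ?thesis using B.le_refl[OF p] by blast
    next
      case False then show ?thesis using p unfolding b_iff[of p e] by blast
    qed
  qed
  then obtain p where p: "p : g" "?Q p" by blast
  have "\<not> (EX u. opr (fs e) u : el si \<and> le r p u)" using a B.Gup[OF p(1)] unfolding siX by blast
  then show "mt (b e)" using p a by blast
qed

definition P1 where "P1 = opr (opr one (prd one one)) (prd X one)"

text \<open>Over the trivial poset \<open>bb\<close> computes truth values, so \<open>X\<close> alone decides which values the
  generic filter meets.\<close>

lemma mt_P1: "e : B ==> mt (b e) \<longleftrightarrow> zero : el (bb P1 e)"
proof (induction e rule: TC_induct)
  case (step e)
  have t: "s : TC e \<and> s : B" if "s : el (sn e)" for s
  proof (cases "EX x y. e = opr x y")
    case True then show ?thesis using that opr_TC TC_el2 step(2) B.oprA_D B.Atrans by (metis sn_opr)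
  next
    case False then show ?thesis using that fs_nopr(2)[of e] by simp
  qed
  have "zero : el (bb P1 e) \<longleftrightarrow> fs e ~: el X \<and> (ALL s:el (sn e). zero ~: el (bb P1 s))"
    unfolding P1_def by (subst el_bb) (auto simp: le_def el_prd)
  also have "... \<longleftrightarrow> fs e ~: el X \<and> (ALL s:el (sn e). \<not> mt (b s))" using step(1) t by blast
  finally show ?case using mt_b[OF step(2)] by blast
qed

lemma z_X: "zero ~: el X" using siX siz by blast

section \<open>Boolean operations on codes; \<open>zero\<close> is a dummy atom that never
  holds\<close>

definition ng where "ng e = opr zero (upair e e)"
definition cj where "cj e e' = opr zero (upair (ng e) (ng e'))"

lemma ngB: "e : B ==> ng e : B" "e : B ==> e' : B ==> cj e e' : B" unfolding ng_def cj_def by (simp_all add: B.pairA)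
lemma dft_ng: "dft B t ==> dft B (%e. ng (t e))" unfolding ng_def by (intro B.dft_opr B.dft_upair B.dft_const B.zeroA)
lemma b_ng: "p : el (b (ng e)) \<longleftrightarrow> p : el c \<and> (ALL q. le r q p --> q ~: el (b e))"
  unfolding b_iff[of p] ng_def by (simp add: siz)
lemma b_cj: "el (b (cj e e')) = el (b e) Int el (b e')"
proof -
  have n: "(ALL q. le r q p --> q ~: el (b (ng e))) \<longleftrightarrow> p : el (b e)" if p: "p : el c" for p e
  proof
    assume "p : el (b e)" then show "ALL q. le r q p --> q ~: el (b (ng e))" using b_down B.le_refl B.le_c unfolding b_ng by blast
  next
    assume "ALL q. le r q p --> q ~: el (b (ng e))" then show "p : el (b e)" using b_reg[OF p] B.le_c unfolding b_ng by blast
  qed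
  show ?thesis
  proof (intro set_eqI)
    fix p
    have "p : el (b (cj e e')) \<longleftrightarrow> p : el c \<and> (ALL q. le r q p --> q ~: el (b (ng e)) \<and> q ~: el (b (ng e')))"
      unfolding b_iff[of p] cj_def by (simp add: siz)
    then show "p : el (b (cj e e')) \<longleftrightarrow> p : el (b e) Int el (b e')" using n[of p e] n[of p e'] b_c by blast
  qed
qed

lemma mt_cj: assumes "mt (b e)" "mt (b e')" shows "mt (b (cj e e'))"
proof -
  obtain p q where p: "p : g" "p : el (b e)" "q : g" "q : el (b e')" using assms by blast
  obtain t where "t : g" "le r t p" "le r t q" using B.Gdir[OF p(1,3)] by blast
  then show ?thesis unfolding b_cj using b_down p by blast
qed

definition tp where "tp = opr zero zero"
lemma tpB: "tp : B" unfolding tp_def by simp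
lemma b_tp: "el (b tp) = el c" by (subst el_b) (simp add: siz tp_def)
lemma mt_tp: "mt (b tp)" unfolding b_tp using B.Gne gc by blast

text \<open>The nonzero elements below \<open>b e0\<close> of the subalgebra, complete from the
  point of view of \<open>B\<close>, that is generated by the Boolean values of the atoms of
  \<open>X\<close>. It is a set of \<open>B\<close> because all values are subsets of
  \<open>c\<close>.\<close>

definition RR where "RR e0 = mk {d : el (B.Pw c). (EX e:B. d = b e) \<and> el d ~= {} \<and> el d <= el (b e0)}"

lemma RR: assumes "e0 : B" shows "RR e0 : B" "d : el (RR e0) \<longleftrightarrow> (EX e:B. d = b e) \<and> el d ~= {} \<and> el d <= el (b e0)"
proof -
  have ne: "el d ~= {} \<longleftrightarrow> (EX x:el d. True)" for d by blast
  show "RR e0 : B" unfolding RR_def ne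
    by (rule B.sepA) (intro B.dfb_conj B.dfb_ex B.dfb_eq B.dfb_bex B.dfb_const B.dfb_sub_el dft_b B.dft_var B.dft_const assms B.PwA2 B.cA)+
  show "d : el (RR e0) \<longleftrightarrow> (EX e:B. d = b e) \<and> el d ~= {} \<and> el d <= el (b e0)"
    unfolding RR_def el_mk_sub using bA b_c by auto
qed

lemma RR_I: "e0 : B ==> e : B ==> mt (b e) ==> mt (b e0) ==> b (cj e0 e) : el (RR e0) \<and> mt (b (cj e0 e))"
  using mt_cj[of e0 e] ngB(2)[of e0 e] unfolding RR(2) b_cj by blast

definition HH where "HH e0 = {d : el (RR e0). mt d}"

lemma HH_W: assumes "e0 : B" shows "mk (HH e0) : W"
proof -
  let ?Q = "%d. EX e:W. e : B \<and> d = b e \<and> zero : el (bb P1 e)"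
  have BWi: "x : B ==> x : W" for x using BW by blast
  have BD: "dft W t ==> dfb W (%e. t e : B)" for t by (rule w.df1[where Q="%x. x : B", OF Bdfb])
  have P1W: "P1 : W" unfolding P1_def using X by simp
  have "mk {d : el (RR e0). ?Q d} : W"
    by (rule w.sepA) (intro w.dfb_ex w.dfb_conj w.dfb_eq w.dfb_mem BD w.dft_bb w.dft_var w.dft_const w.oprA w.zeroA P1W BWi B.cA B.rA si RR assms)+
  moreover have "{d : el (RR e0). ?Q d} = HH e0"
  proof -
    have "?Q d \<longleftrightarrow> mt d" if d: "d : el (RR e0)" for d
    proof
      assume "?Q d" then show "mt d" using mt_P1 by blast
    next
      assume m: "mt d"
      obtain e where "e : B" "d = b e" using d unfolding RR(2)[OF assms] by blast
      then show "?Q d" using m mt_P1 BWi by blast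
    qed
    then show ?thesis unfolding HH_def by blast
  qed
  ultimately show ?thesis by simp
qed

text \<open>If no value met by \<open>g\<close> satisfied \<open>Q\<close>, then \<open>g\<close>
  would meet the value of the joint negation \<open>?n\<close> of the codes of all
  \<open>Q\<close>-values. By density some \<open>Q\<close>-value lies below it, although its own
  code is among those negated. Collection is needed to have a set of such codes.\<close>

lemma HH_gen: assumes e0: "e0 : B" "mt (b e0)" and Q: "dfb B (%e. Q (e 0))"
    and d: "!!d. d : el (RR e0) ==> EX d':el (RR e0). el d' <= el d \<and> Q d'"
  shows "EX d:HH e0. Q d"
proof (rule ccontr)
  assume n: "\<not> ?thesis"
  have Qd: "dft B t ==> dfb B (%e. Q (t e))" for t by (rule B.df1[where Q=Q, OF Q])
  have RB: "RR e0 : B" by (rule RR[OF e0(1)])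
  have "EX Y:B. ALL d:el (RR e0). EX e:el Y. d = b e"
  proof (rule B.collection[OF _ RB])
    show "dfb B (%e. e 0 = b (e 1))" by (intro B.dfb_eq B.dft_var dft_b)
  qed (use RR(2)[OF e0(1)] in blast)
  then obtain Y where Y: "Y : B" "ALL d:el (RR e0). EX e:el Y. d = b e" by blast
  define S where "S = mk {e : el Y. b e : el (RR e0) \<and> Q (b e)}"
  have S: "S : B" unfolding S_def by (rule B.sepA[OF _ Y(1)]) (intro B.dfb_conj B.dfb_mem Qd dft_b B.dft_var B.dft_const RB)
  have elS: "e : el S \<longleftrightarrow> e : el Y \<and> b e : el (RR e0) \<and> Q (b e)" for e unfolding S_def by simp
  let ?n = "opr zero S"
  have nB: "?n : B" using S by simp
  have "\<not> mt (b s)" if "s : el S" for s using n that unfolding elS HH_def by blast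
  then have "mt (b ?n)" unfolding mt_b[OF nB] using z_X by simp
  then have "b (cj e0 ?n) : el (RR e0)" using RR_I[OF e0(1) nB _ e0(2)] by blast
  then obtain d' where d': "d' : el (RR e0)" "el d' <= el (b (cj e0 ?n))" "Q d'" using d by blast
  obtain s where s: "s : el Y" "d' = b s" using bspec[OF Y(2) d'(1)] by blast
  then have sS: "s : el S" using d' elS by simp
  obtain p where p: "p : el d'" using d'(1) unfolding RR(2)[OF e0(1)] by blast
  then have "p : el (b ?n)" using d'(2) unfolding b_cj by blast
  then have "ALL q. le r q p --> (ALL s:el (sn ?n). q ~: el (b s))" unfolding b_iff[of p ?n] by blast
  then have "ALL s:el S. p ~: el (b s)" using B.le_refl[of p] p s(2) b_c unfolding sn_opr by blast
  then show False using sS p s(2) by blast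
qed

lemma W_val: assumes e0: "e0 : B" "mt (b e0)" shows "val (HH e0) ` B = W"
proof (intro set_eqI iffI)
  fix y assume "y : val (HH e0) ` B"
  then obtain x where x: "x : B" "y = val (HH e0) x" by blast
  have "el (mk (HH e0)) = HH e0" unfolding HH_def by (rule el_mk_sub)
  then show "y : W" using w.valA[OF HH_W[OF e0(1)], of x] x BW by auto
next
  fix x assume "x : W"
  from w.set_code[OF WAC this] obtain e l k i where d: "e : W" "l : W" "k : W" "i : el l" "Ord l" "Ord k"
    "el e <= el (prd (prd l l) k)"
    "ALL H rho. el e = {z : el (prd (prd l l) k). EX r:H. opr z r : el rho} --> val H (TN rho l k i) = x" by blast
  define w0 where "w0 = prd (prd l l) k"
  have lk: "l : K" "k : K" using d OK by blast+
  then have w0: "w0 : K" unfolding w0_def by simp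
  have KBi: "x : K ==> x : B" for x using KB by blast
  have BWi: "x : B ==> x : W" for x using BW by blast
  obtain rho where rho: "rho : B" "el e = {z : el w0. EX u:g. opr z u : el rho}" using nm[OF d(1) w0] d(7) unfolding w0_def by blast
  \<comment> \<open>\<open>Y\<close> consists of the conditions in \<open>c\<close> that, judged by
    \<open>e\<close>, may belong to \<open>g\<close>; so \<open>z\<close> is in \<open>e\<close>
    just when \<open>rho\<close> pairs it with a member of \<open>Y\<close>. As a set in
    \<open>W\<close>, \<open>Y\<close> is a row \<open>j\<close> of \<open>X\<close>, and replacing
    a condition \<open>p\<close> by the Boolean value of the atom \<open>(j, p)\<close> turns
    \<open>rho\<close> into a name over \<open>RR e0\<close>.\<close>
  define Y where "Y = mk {p : el c. ALL z:el w0. opr z p : el rho --> z : el e}"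
  have elY: "el Y = {p : el c. ALL z:el w0. opr z p : el rho --> z : el e}" unfolding Y_def by (rule el_mk_sub)
  have "Y : W" unfolding Y_def
    by (rule w.sepA) (intro w.dfb_ball w.dfb_imp w.dfb_mem w.dft_opr w.dft_var w.dft_const d BWi KBi w0 rho B.cA)+
  then obtain j where j: "j : el th" "el Y = {p : el c. opr j p : el X}" using rows elY by blast
  have jB: "j : B" using j th K.Atrans KBi by blast
  define at where "at p = ng (opr (opr j p) zero)" for p
  have atB: "p : B ==> at p : B" for p unfolding at_def using jB by (simp add: ngB)
  have mat: "mt (b (at p)) \<longleftrightarrow> opr j p : el X" if p: "p : B" for p
  proof -
    have o: "opr (opr j p) zero : B" using p jB by simp
    have "mt (b (at p)) \<longleftrightarrow> \<not> mt (b (opr (opr j p) zero))" unfolding mt_b[OF atB[OF p]] using z_X by (simp add: at_def ng_def)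
    also have "... \<longleftrightarrow> opr j p : el X" unfolding mt_b[OF o] by simp
    finally show ?thesis .
  qed
  define ro where "ro = mk {z : el (prd w0 (RR e0)). EX p:el c. opr (fs z) p : el rho \<and> el (sn z) <= el (b (at p))}"
  have pB: "prd w0 (RR e0) : B" using KBi[OF w0] RR(1)[OF e0(1)] by simp
  have roB: "ro : B" unfolding ro_def
    by (rule B.sepA[OF _ pB]) (unfold at_def, intro B.dfb_bex B.dfb_conj B.dfb_mem B.dfb_sub_el B.dft_opr B.dft_fs B.dft_sn B.dft_var B.dft_const dft_b dft_ng jB B.zeroA B.cA rho)
  have elro: "opr z d : el ro \<longleftrightarrow> z : el w0 \<and> d : el (RR e0) \<and> (EX p:el c. opr z p : el rho \<and> el d <= el (b (at p)))" for z d
    unfolding ro_def el_mk_sub by (simp add: el_prd)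
  have cB: "p : B" if "p : el c" for p using that B.cA B.Atrans by blast
  have "el e = {z : el w0. EX d:HH e0. opr z d : el ro}"
  proof (intro set_eqI iffI)
    fix z assume z: "z : el e"
    then have zw: "z : el w0" unfolding rho(2) by blast
    obtain p where p: "p : g" "opr z p : el rho" using z unfolding rho(2) by blast
    have pc: "p : el c" by (rule gc[OF p(1)])
    have "p : el Y" unfolding elY using pc p unfolding rho(2) by blast
    then have "mt (b (at p))" using mat[OF cB[OF pc]] unfolding j(2) by blast
    from RR_I[OF e0(1) atB[OF cB[OF pc]] this e0(2)] have "b (cj e0 (at p)) : HH e0" "b (cj e0 (at p)) : el (RR e0)" unfolding HH_def by blast+
    moreover have "opr z (b (cj e0 (at p))) : el ro" unfolding elro using calculation zw pc p(2) b_cj by blast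
    ultimately show "z : {z : el w0. EX d:HH e0. opr z d : el ro}" using zw by blast
  next
    fix z assume "z : {z : el w0. EX d:HH e0. opr z d : el ro}"
    then obtain d p where dp: "z : el w0" "mt d" "p : el c" "opr z p : el rho" "el d <= el (b (at p))" unfolding elro HH_def by blast
    then have "mt (b (at p))" by blast
    then have "p : el Y" unfolding j(2) using mat[OF cB[OF dp(3)]] dp(3) by blast
    then show "z : el e" using dp unfolding elY by blast
  qed
  then have "val (HH e0) (TN ro l k i) = x" using d(8) unfolding w0_def by blast
  moreover have "TN ro l k i : B" by (intro B.TNA roB KBi lk K.Atrans[OF lk(1) d(4)])
  ultimately show "x : val (HH e0) ` B" by blast
qed

definition atm where "atm d \<longleftrightarrow> d : el (RR tp) \<and> (ALL d1:el (RR tp). ALL d2:el (RR tp). el d1 <= el d --> el d2 <= el d -->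
   (EX d3:el (RR tp). el d3 <= el d1 \<and> el d3 <= el d2))"

lemma RR_tp: "e0 : B ==> d : el (RR e0) \<longleftrightarrow> d : el (RR tp) \<and> el d <= el (b e0)"
  using RR(2)[OF tpB, of d] RR(2)[of e0 d] b_tp b_c by blast

text \<open>If \<open>g\<close> met an atom \<open>d\<close>, the filter \<open>HH tp\<close> would
  consist of the values compatible with \<open>d\<close> and so be a set of \<open>B\<close>, which
  would give \<open>W <= B\<close>. Hence \<open>g\<close> meets a value below which there are no
  atoms; restricting to it makes the poset split everywhere.\<close>

lemma no_atoms: "EX e0:B. mt (b e0) \<and> (ALL d:el (RR e0). \<not> atm d)"
proof -
  let ?R = "RR tp"
  have RB: "?R : B" by (rule RR[OF tpB])
  have da: "dft B t ==> dfb B (%e. atm (t e))" for t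
    by (rule B.df1[where Q=atm]) (unfold atm_def, intro B.dfb_conj B.dfb_mem B.dfb_ball B.dfb_bex B.dfb_imp B.dfb_sub_el B.dft_const B.dft_var RB)
  have "EX d:HH tp. atm d \<or> (ALL d':el ?R. el d' <= el d --> \<not> atm d')"
  proof (rule HH_gen[OF tpB mt_tp])
    show "dfb B (%e. atm (e 0) \<or> (ALL d':el ?R. el d' <= el (e 0) --> \<not> atm d'))"
      by (intro B.dfb_disj B.dfb_ball B.dfb_imp B.dfb_neg B.dfb_sub_el B.dft_const B.dft_var da RB)
  qed blast
  then obtain d where d: "d : HH tp" "atm d \<or> (ALL d':el ?R. el d' <= el d --> \<not> atm d')" by blast
  obtain e0 where e0: "e0 : B" "d = b e0" "mt (b e0)" using d(1) unfolding HH_def RR(2)[OF tpB] by blast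
  have "\<not> atm d"
  proof
    assume a: "atm d"
    have "d' : HH tp \<longleftrightarrow> d' : el ?R \<and> (EX d3:el ?R. el d3 <= el d' \<and> el d3 <= el d)" for d'
    proof
      assume h: "d' : HH tp"
      then obtain e where e: "e : B" "d' = b e" "mt (b e)" unfolding HH_def RR(2)[OF tpB] by blast
      have "b (cj e0 e) : el (RR e0)" using RR_I[OF e0(1) e(1,3) e0(3)] by blast
      then have "b (cj e0 e) : el ?R" using RR_tp[OF e0(1)] by blast
      then show "d' : el ?R \<and> (EX d3:el ?R. el d3 <= el d' \<and> el d3 <= el d)" using h unfolding HH_def e(2) e0(2)
        by (intro conjI bexI[of _ "b (cj e0 e)"]) (auto simp: b_cj)
    next
      assume "d' : el ?R \<and> (EX d3:el ?R. el d3 <= el d' \<and> el d3 <= el d)"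
      then obtain d3 where d3: "d' : el ?R" "d3 : el ?R" "el d3 <= el d'" "el d3 <= el d" by blast
      have d3B: "d3 : B" using d3(2) RB B.Atrans by blast
      have "EX x:HH e0. el x <= el d3"
      proof (rule HH_gen[OF e0(1,3)])
        show "dfb B (%e. el (e 0) <= el d3)" by (intro B.dfb_sub_el B.dft_var B.dft_const d3B)
        fix d1 assume "d1 : el (RR e0)"
        then have d1: "d1 : el ?R" "el d1 <= el d" using RR_tp[OF e0(1)] e0(2) by blast+
        then obtain d4 where "d4 : el ?R" "el d4 <= el d1" "el d4 <= el d3" using a d3 unfolding atm_def by blast
        then show "EX d':el (RR e0). el d' <= el d1 \<and> el d' <= el d3" using RR_tp[OF e0(1), of d4] d1 e0(2) by blast
      qed
      then show "d' : HH tp" using d3 unfolding HH_def by blast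
    qed
    then have "HH tp = {d' : el ?R. EX d3:el ?R. el d3 <= el d' \<and> el d3 <= el d}" by blast
    moreover have "mk {d' : el ?R. EX d3:el ?R. el d3 <= el d' \<and> el d3 <= el d} : B"
      by (rule B.sepA[OF _ RB]) (intro B.dfb_bex B.dfb_conj B.dfb_sub_el B.dft_const B.dft_var RB, use e0 bA in blast)
    ultimately have HB: "mk (HH tp) : B" by simp
    have "el (mk (HH tp)) = HH tp" unfolding HH_def by (rule el_mk_sub)
    then have "val (HH tp) x : B" if "x : B" for x using B.valA[OF HB that] by simp
    then have "W <= B" using W_val[OF tpB mt_tp] by blast
    then show False using BW BnW by blast
  qed
  then have "\<not> atm d'" if "d' : el (RR e0)" for d' using d(2) that RR_tp[OF e0(1)] e0(2) by blast
  then show ?thesis using e0 by blast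
qed

end

section \<open>Failure of the Ground and Bedrock Axioms\<close>

context zf
begin

lemma elts_A: "x : A ==> elts A mem x = el x" using elts_el el_subA by blast

lemma is_opair_opr: assumes z: "z : A" shows "is_opair A mem z x y \<longleftrightarrow> z = opr x y"
proof
  assume "is_opair A mem z x y"
  then obtain s t where st: "x : A" "y : A" "s : A" "t : A" "elts A mem s = {x}" "elts A mem t = {x, y}" "elts A mem z = {s, t}"
    unfolding is_opair_def by blast
  have "s = upair x x" "t = upair x y" using st elts_A by (auto intro!: ext_el)
  then show "z = opr x y" using st(7) elts_A[OF z] unfolding opr_def by (auto intro!: ext_el)
next
  assume e: "z = opr x y"
  then have xy: "x : A" "y : A" using oprA_D z by blast+
  then show "is_opair A mem z x y" unfolding is_opair_def e
    by (intro conjI bexI[of _ "upair x x"] bexI[of _ "upair x y"]) (simp_all add: elts_A pairA opr_def)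
qed

lemma names_A: "n : names A mem P ==> n : A" by (induction rule: names.induct)

lemma names_el: "n : names A mem P ==> z : el n ==> EX s p. s : names A mem P \<and> p : P \<and> z = opr s p"
proof (erule names.cases)
  fix n' assume "z : el n" "n = n'" "n' : A" and h: "ALL z:elts A mem n'. EX s p. s : names A mem P \<and> p : P \<and> is_opair A mem z s p"
  then have z: "z : el n'" "z : A" using Atrans by blast+
  then have "z : elts A mem n'" using elts_A[OF \<open>n' : A\<close>] by simp
  then show ?thesis using bspec[OF h] is_opair_opr[OF z(2)] by blast
qed

lemma names_values: assumes n: "n : names A mem P"
  shows "{f s |s p. s : names A mem P \<and> p : G \<and> (EX z:elts A mem n. is_opair A mem z s p)} = {f s |s p. p : G \<and> opr s p : el n}"
proof -
  have "(EX z:elts A mem n. is_opair A mem z s p) \<longleftrightarrow> opr s p : el n" for s p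
    using elts_A[OF names_A[OF n]] is_opair_opr Atrans[OF names_A[OF n]] by auto
  moreover have "s : names A mem P" if "opr s p : el n" for s p using names_el[OF n that] by auto
  ultimately show ?thesis by blast
qed

lemma names_pn: assumes Q: "dfb A (%e. Q (e 0))" and P: "P = {p : A. Q p}"
  shows "x : A --> pn Q x : names A mem P"
proof (induction x rule: TC_induct)
  case (step x)
  show ?case
  proof (intro impI names.intros ballI)
    assume x: "x : A"
    show pA: "pn Q x : A" by (rule pnA[OF Q x])
    fix z assume "z : elts A mem (pn Q x)"
    then have zz: "z : el (pn Q x)" unfolding elts_A[OF pA] .
    then obtain s p where z: "z = opr (pn Q s) p" "opr s p : el x" "Q p" unfolding el_pn by blast
    have "s : A" "p : A" using opr_elA[OF x z(2)] by auto
    then show "EX s p. s : names A mem P \<and> p : P \<and> is_opair A mem z s p"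
      using step[of s] opr_el_TC[OF z(2)] z P is_opair_opr[OF Atrans[OF pA zz]] by blast
  qed
qed

text \<open>Official names use only conditions from \<open>P\<close>, while \<open>val\<close>
  evaluates arbitrary sets; pruning shows that both produce the same extension.\<close>

lemma val_names: assumes Q: "dfb A (%e. Q (e 0))" and P: "P = {p : A. Q p}" and G: "G <= P"
  shows "val G ` names A mem P = val G ` A"
proof (intro set_eqI iffI)
  fix y assume "y : val G ` A"
  then obtain x where x: "x : A" "y = val G x" by blast
  have "G Int {p. Q p} = G" using G P by blast
  then have "y = val G (pn Q x)" using val_pn[of G Q x] x by simp
  then show "y : val G ` names A mem P" using names_pn[OF Q P] x by blast
qed (use names_A in blast)

lemma forcing_ext_I: assumes "dfb A (%e. Q (e 0))" "P = {p : A. Q p}" "G <= P" and B: "B = val G ` A" "!!x y. x : B ==> y : el x ==> y : B"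
  shows "forcing_extension A mem P G B mem"
proof -
  have eB: "elts B mem x = el x" if "x : B" for x using B(2) that by (intro elts_el) auto
  have v: "val G ` names A mem P = B" using val_names[OF assms(1-3)] B(1) by simp
  have "elts B mem (val G n) = {val G s |s p. s : names A mem P \<and> p : G \<and> (EX z:elts A mem n. is_opair A mem z s p)}"
    if n: "n : names A mem P" for n
  proof -
    have "val G n : B" using n v by blast
    then show ?thesis unfolding names_values[OF n] using eB el_val by metis
  qed
  moreover have "extensional_model B mem" unfolding extensional_model_def using eB ext_el by auto
  ultimately show ?thesis unfolding forcing_extension_def using v by blast
qed

lemma forcing_ext_D: assumes "dfb A (%e. Q (e 0))" "P = {p : A. Q p}" "G <= P" and B: "!!x y. x : B ==> y : el x ==> y : B"
    and F: "forcing_extension A mem P G B mem"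
  shows "B = val G ` A"
proof -
  obtain v where v: "v ` names A mem P = B" "ALL n:names A mem P. elts B mem (v n) =
      {v s |s p. s : names A mem P \<and> p : G \<and> (EX z:elts A mem n. is_opair A mem z s p)}"
    using F unfolding forcing_extension_def by blast
  have eB: "elts B mem x = el x" if "x : B" for x using B that by (intro elts_el) auto
  have "n : names A mem P --> v n = val G n" for n
  proof (induction n rule: TC_induct)
    case (step n)
    show ?case
    proof
      assume n: "n : names A mem P"
      have "v n : B" using v n by blast
      then have q: "el (v n) = {v s |s p. p : G \<and> opr s p : el n}" using bspec[OF v(2) n] eB unfolding names_values[OF n] by simp
      have "v s = val G s" if "opr s p : el n" for s p using step[of s] opr_el_TC[OF that] names_el[OF n that] by auto
      then have "(u = v s \<and> p : G \<and> opr s p : el n) = (u = val G s \<and> p : G \<and> opr s p : el n)" for u s p by metis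
      then have "el (v n) = el (val G n)" unfolding q el_val by (simp only:)
      then show "v n = val G n" by (rule ext_el)
    qed
  qed
  then have "v ` names A mem P = val G ` names A mem P" by (intro image_cong) auto
  then show ?thesis using v(1) val_names[OF assms(1-3)] by simp
qed

lemma ordinal_Ord: "ordinal A mem x \<longleftrightarrow> x : A \<and> Ord x"
proof (cases "x : A")
  case True
  have e1: "elts A mem x = el x" by (rule elts_A[OF True])
  have e2: "elts A mem y = el y" if "y : el x" for y using that True Atrans elts_A by blast
  have e3: "elts A mem z = el z" if "y : el x" "z : el y" for y z using that True Atrans elts_A by blast
  show ?thesis unfolding ordinal_def Ord_def e1 using True e2 e3 by simp
qed (simp add: ordinal_def)

end

context imd
begin

lemma not_GA: "\<not> GA W mem"
proof -
  interpret w: zf W by (rule Wzf)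
  obtain e0 where e0: "e0 : B" "mt (b e0)" "ALL d:el (RR e0). \<not> atm d" using no_atoms by blast
  define P where "P = el (RR e0)"
  define rl where "rl = {(d, d'). d : P \<and> d' : P \<and> el d <= el d'}"
  have RB: "RR e0 : B" by (rule RR[OF e0(1)])
  have PI: "d : P \<longleftrightarrow> (EX e:B. d = b e) \<and> el d ~= {} \<and> el d <= el (b e0)" for d unfolding P_def by (rule RR(2)[OF e0(1)])
  have PB: "d : B" if "d : P" for d using that RB B.Atrans unfolding P_def by blast
  have 1: "inner_model W mem B" unfolding inner_model_def
  proof (intro conjI ballI BW)
    show "definable W mem B" using w.definable_iff_dfb[OF BW] Bdfb by blast
    show "elts W mem x <= B" if "x : B" for x using w.elts_A[of x] B.el_subA[OF that] that BW by auto
    show "{a. ordinal W mem a} <= B" using w.ordinal_Ord OK KB by blast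
    show "ZFC B mem" by (rule zf_ZFC[OF B.zf_axioms BAC])
  qed
  have 2: "set_forcing B mem P rl" unfolding set_forcing_def
  proof (intro conjI)
    have t: "b e0 : P" unfolding PI using e0 by blast
    then have "ALL p:P. (p, b e0) : rl" unfolding rl_def using PI by blast
    then have "EX t:P. ALL p:P. (p, t) : rl" using t by blast
    moreover have "partial_order_on P rl" unfolding partial_order_on_def preorder_on_def refl_on_def trans_def antisym_def rl_def
      by (auto intro: ext_el)
    ultimately show "forcing_poset P rl" unfolding forcing_poset_def by blast
    show "EX c:B. P = elts B mem c" using RB B.elts_A[OF RB] unfolding P_def by blast
    define d where "d = mk {z : el (prd (RR e0) (RR e0)). el (fs z) <= el (sn z)}"
    have dB: "d : B" unfolding d_def by (rule B.sepA[OF _ B.prdA[OF RB RB]]) (intro B.dfb_sub_el B.dft_fs B.dft_sn B.dft_var)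
    have "(EX z:elts B mem d. is_opair B mem z p q) \<longleftrightarrow> (p, q) : rl" for p q
    proof -
      have "(EX z:elts B mem d. is_opair B mem z p q) \<longleftrightarrow> opr p q : el d"
        unfolding B.elts_A[OF dB] using B.is_opair_opr[OF B.Atrans[OF dB]] by auto
      also have "... \<longleftrightarrow> (p, q) : rl" unfolding d_def el_mk_sub rl_def P_def by (auto simp: el_prd)
      finally show ?thesis .
    qed
    then have "rl = {(p, q). EX z:elts B mem d. is_opair B mem z p q}" by auto
    then show "EX d:B. rl = {(p, q). EX z:elts B mem d. is_opair B mem z p q}" using dB by blast
  qed
  have 3: "nontrivial_poset P rl" unfolding nontrivial_poset_def
  proof
    fix p assume p: "p : P"
    then have "\<not> atm p" "p : el (RR tp)" "el p <= el (b e0)" using e0(3) RR_tp[OF e0(1), of p] unfolding P_def by blast+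
    then obtain d1 d2 where d: "d1 : el (RR tp)" "d2 : el (RR tp)" "el d1 <= el p" "el d2 <= el p"
      "\<not> (EX d3:el (RR tp). el d3 <= el d1 \<and> el d3 <= el d2)" unfolding atm_def by blast
    have i: "d : P \<longleftrightarrow> d : el (RR tp) \<and> el d <= el (b e0)" for d unfolding P_def by (rule RR_tp[OF e0(1)])
    have dP: "d1 : P" "d2 : P" unfolding i using d \<open>el p <= el (b e0)\<close> by blast+
    have "\<not> compatible P rl d1 d2" using d(5) unfolding compatible_def rl_def i by blast
    then show "EX q:P. EX q':P. (q, p) : rl \<and> (q', p) : rl \<and> \<not> compatible P rl q q'"
      using dP d(3,4) p by (intro bexI[OF _ dP(1)] bexI[OF _ dP(2)]) (simp add: rl_def)
  qed
  have HP: "HH e0 <= P" unfolding HH_def P_def by blast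
  have 4: "set_generic B mem P rl (HH e0)" unfolding set_generic_def
  proof (intro conjI ballI impI)
    show "filter_on P rl (HH e0)" unfolding filter_on_def
    proof (intro conjI ballI impI HP)
      have "b e0 : HH e0" using e0 PI[of "b e0"] unfolding HH_def P_def by blast
      then show "HH e0 ~= {}" by blast
      fix p assume p: "p : HH e0"
      { fix q assume "q : P" "(p, q) : rl" then show "q : HH e0" using p unfolding HH_def rl_def P_def by blast }
      fix q assume q: "q : HH e0"
      obtain e e' where e: "e : B" "p = b e" "mt (b e)" "e' : B" "q = b e'" "mt (b e')" "el p <= el (b e0)"
        using p q unfolding HH_def RR(2)[OF e0(1)] by blast
      let ?s = "b (cj e e')"
      have m: "mt ?s" by (rule mt_cj[OF e(3,6)])
      have s: "el ?s <= el p" "el ?s <= el q" unfolding b_cj e by blast+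
      have sP: "?s : P" unfolding PI using ngB(2)[OF e(1,4)] m s e(7) by blast
      then have "?s : HH e0" unfolding HH_def P_def using m by blast
      then show "EX s:HH e0. (s, p) : rl \<and> (s, q) : rl" using s sP p q HP unfolding rl_def by blast
    qed
    fix D assume D: "D : B" "dense_in P rl (elts B mem D)"
    have "EX d:HH e0. d : el D"
    proof (rule HH_gen[OF e0(1,2)])
      show "dfb B (%e. e 0 : el D)" by (intro B.dfb_mem B.dft_var B.dft_const D)
      fix d assume "d : el (RR e0)"
      then obtain d' where "d' : el D" "(d', d) : rl" using D(2) unfolding dense_in_def B.elts_A[OF D(1)] P_def by blast
      then show "EX d':el (RR e0). el d' <= el d \<and> d' : el D" unfolding rl_def P_def by blast
    qed
    then show "HH e0 Int elts B mem D ~= {}" unfolding B.elts_A[OF D(1)] by blast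
  qed
  have 5: "forcing_extension B mem P (HH e0) W mem"
  proof (rule B.forcing_ext_I[where Q="%p. p : el (RR e0)"])
    show "dfb B (%e. e 0 : el (RR e0))" by (intro B.dfb_mem B.dft_var B.dft_const RB)
    show "P = {p : B. p : el (RR e0)}" using PB unfolding P_def by blast
    show "W = val (HH e0) ` B" using W_val[OF e0(1,2)] by simp
  qed (use HP w.Atrans in auto)
  show ?thesis unfolding GA_def using 1 2 3 4 5 by blast
qed

end

lemma opr_ne_zero: "opr x y ~= zero" using el_zero unfolding opr_def by (metis el_upair insert_not_empty)

lemma (in tow) not_BA: "\<not> BA N mem"
proof
  assume "BA N mem"
  then obtain W P rl h where im: "inner_model N mem W" and sf: "set_forcing W mem P rl" and sg: "set_generic W mem P rl h"
    and fe: "forcing_extension W mem P h N mem" and GA: "GA W mem" unfolding BA_def by blast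
  interpret N: zf N by (rule N_zf)
  have WN: "W <= N" using im unfolding inner_model_def by blast
  have Wt: "ALL x:W. el x <= W" using im N.elts_A WN unfolding inner_model_def by blast
  have Wo: "x : W" if "x : A" "Ord x" for x using im N.ordinal_Ord A_N that unfolding inner_model_def by blast
  have "countable W" using WN N.cntA countable_subset by blast
  moreover have "ZFC W mem" using im unfolding inner_model_def by blast
  ultimately have Wz: "zf W" "AC W" using ZFC_zf Wt by blast+
  interpret w: zf W by (rule Wz)
  obtain c where c: "c : W" "P = el c" using sf w.elts_A unfolding set_forcing_def by blast
  obtain r where r0: "r : W" "rl = {(p, q). EX z:elts W mem r. is_opair W mem z p q}" using sf unfolding set_forcing_def by blast
  have r: "(p, q) : rl \<longleftrightarrow> le r p q" for p q
    unfolding r0(2) le_def w.elts_A[OF r0(1)] using w.is_opair_opr[OF w.Atrans[OF r0(1)]] by auto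
  have po: "partial_order_on P rl" using sf unfolding set_forcing_def forcing_poset_def by blast
  have fi: "filter_on P rl h" using sg unfolding set_generic_def by blast
  have gW: "gen W c r h"
  proof unfold_locales
    show "c : W" "r : W" by fact+
    show "le r p p" if "p : el c" for p using po that c(2) unfolding partial_order_on_def preorder_on_def refl_on_def r[symmetric] by blast
    show "le r p s" if "le r p q" "le r q s" for p q s
      using po that unfolding partial_order_on_def preorder_on_def trans_def r[symmetric] by blast
    show "p : el c \<and> q : el c" if "le r p q" for p q using po that c(2) unfolding partial_order_on_def preorder_on_def r[symmetric] by blast
    then show "q : h" if "p : h" "le r p q" for p q using fi that c(2) unfolding filter_on_def r[symmetric] by blast
    show "h <= el c" "h ~= {}" using fi c(2) unfolding filter_on_def by blast+
    show "EX s:h. le r s p \<and> le r s q" if "p : h" "q : h" for p q using fi that unfolding filter_on_def r by blast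
    fix D assume D: "D : W" "el D <= el c" "!!p. p : el c ==> EX d:el D. le r d p"
    then have "dense_in P rl (elts W mem D)" unfolding dense_in_def w.elts_A[OF D(1)] c(2) r by blast
    then show "h Int el D ~= {}" using sg D(1) w.elts_A[OF D(1)] unfolding set_generic_def by blast
  qed
  have "N = val h ` W"
  proof (rule w.forcing_ext_D[where Q="%p. p : el c", OF _ _ _ _ fe])
    show "dfb W (%e. e 0 : el c)" by (intro w.dfb_mem w.dft_var w.dft_const c)
    show "P = {p : W. p : el c}" using c w.Atrans by blast
    show "h <= P" using fi unfolding filter_on_def by blast
  qed (use N.Atrans in blast)
  then interpret grd A G W c r h by (intro grd.intro tow_axioms grd_axioms.intro gW Wz Wo) (rule sym)
  obtain l f where l: "l : A" "f : W" "Ord l" "app f ` el l = el c" using kappa by blast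
  obtain a where a: "a : A" "limo a" "l : el a" using limo_ex l by blast
  have oa: "Ord a" using a unfolding limo_def by simp
  define b where "b = nl a"
  have b: "b : A" "limo b" "a : el b" using nl[OF a(1)] rank_Ord[OF oa] unfolding b_def by auto
  have ob: "Ord b" using b unfolding limo_def by simp
  have lb: "l : el b" using Ord_trans[OF ob b(3) a(3)] .
  have Mb: "M b <= W" by (rule M_W[OF b(2,1) lb l(2,4)])
  obtain U where "U : M a" "U ~: M b" using M_proper[OF a(2,1)] unfolding b_def by blast
  \<comment> \<open>Two consecutive levels are used: \<open>M a\<close> is also contained in
    \<open>W\<close>, but not in \<open>M b\<close>.\<close>
  then have ne: "M b ~= W" using M_W[OF a(2,1,3) l(2,4)] by blast
  interpret Mb: gen "M b" "cc zero b" "rr b" "Gb b" by (rule genM[OF b(2,1)])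
  have AM: "x : A ==> x : M b" for x by (rule M_zf(3)[OF b(2,1)])
  let ?c = "cc zero b"
  have cA: "?c : A" using b by simp
  obtain th ff where t: "th : W" "ff : W" "Ord th" "app ff ` el th = el (w.Pw ?c)"
    using w.wellorder[OF Wz(2), of "w.Pw ?c"] w.PwA2 A_W[OF cA] by blast
  have tA: "th : A" using Ord_W t by blast
  have pA: "prd th ?c : A" using tA cA by simp
  \<comment> \<open>Row \<open>j\<close> is the \<open>j\<close>-th subset of the poset in an
    enumeration available in \<open>W\<close>.\<close>
  define X where "X = mk {z : el (prd th ?c). sn z : el (app ff (fs z))}"
  have elX: "opr j p : el X \<longleftrightarrow> j : el th \<and> p : el ?c \<and> p : el (app ff j)" for j p unfolding X_def el_mk_sub by (simp add: el_prd)
  have Xs: "el X <= el (prd th ?c)" unfolding X_def el_mk_sub by blast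
  have X: "X : W" unfolding X_def by (rule w.sepA[OF _ A_W[OF pA]]) (intro w.dfb_mem w.dft_sn w.dft_app w.dft_fs w.dft_var w.dft_const t)
  obtain rho where rho: "rho : M b" "el X = {x : el (prd th ?c). EX u:Gb b. opr x u : el rho}" using niceM[OF b(2,1) W_N[OF X] Xs pA] by blast
  \<comment> \<open>Restricting the nice name to atoms from the product excludes
    \<open>zero\<close>, which is not a pair and can therefore serve as the dummy atom.\<close>
  define si where "si = mk {z : el rho. fs z : el (prd th ?c)}"
  have elsi: "opr z u : el si \<longleftrightarrow> opr z u : el rho \<and> z : el (prd th ?c)" for z u unfolding si_def el_mk_sub by simp
  have si: "si : M b" unfolding si_def by (rule Mb.sepA[OF _ rho(1)]) (intro Mb.dfb_mem Mb.dft_fs Mb.dft_var Mb.dft_const AM pA)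
  interpret imd "M b" ?c "rr b" "Gb b" A W th X si
  proof (intro imd.intro imd_axioms.intro Mb.gen_axioms)
    show "zf W" "AC W" "AC (M b)" "zf A" "A <= M b" "?c : A" "M b <= W" "M b ~= W" "th : A" "X : W" "si : M b"
      using Wz M_zf(2)[OF b(2,1)] zf_axioms AM cA Mb ne tA X si by auto
    show "dfb W (%e. e 0 : M b)" by (rule M_dfb[OF b(2,1) lb l(2,4)])
    show "x : A" if "x : W" "Ord x" for x using Ord_W that by blast
    show "EX rho:M b. el e = {x : el v. EX u:Gb b. opr x u : el rho}" if "e : W" "v : A" "el e <= el v" for e v
      using niceM[OF b(2,1) W_N[OF that(1)] that(3,2)] .
    show "EX j:el th. el Y = {p : el ?c. opr j p : el X}" if Y: "Y : W" "el Y <= el ?c" for Y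
    proof -
      have "Y : app ff ` el th" unfolding t(4) using Y by simp
      then obtain j where "j : el th" "Y = app ff j" by blast
      then show ?thesis using Y(2) by (intro bexI[of _ j]) (auto simp: elX)
    qed
    show "z : el X \<longleftrightarrow> (EX u:Gb b. opr z u : el si)" for z unfolding rho(2) elsi by blast
    show "opr zero u ~: el si" for u unfolding elsi el_prd by (auto simp: opr_ne_zero[symmetric])
  qed
  show False using not_GA GA by blast
qed

section \<open>Invariance under isomorphism\<close>

definition iso where "iso f A E B F \<longleftrightarrow> inj_on f A \<and> B = f ` A \<and> (ALL x:A. ALL y:A. E x y \<longleftrightarrow> F (f x) (f y))"

lemma iso_sub: "iso f A E B F ==> W <= A ==> iso f W E (f ` W) F" unfolding iso_def using inj_on_subset by blast

lemma iso_inv: "iso f A E B F ==> iso (inv_into A f) B F A E" unfolding iso_def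
  by (auto simp: inj_on_inv_into inv_into_image_cancel inv_into_into f_inv_into_f image_image)

lemma elts_sub: "elts A E x <= A" unfolding elts_def by blast

text \<open>The given model lives on an arbitrary type and the extension has to live on the natural
  numbers, whereas the forcing is carried out in \<open>hset\<close>; so every notion of the
  statement is transported along bijections. Converse directions come from the inverse map.\<close>

locale isom =
  fixes f :: "'a => 'b" and A E B F assumes iso: "iso f A E B F"
begin

lemma inj: "inj_on f A" and B: "B = f ` A" and EF: "x : A ==> y : A ==> E x y \<longleftrightarrow> F (f x) (f y)"
  using iso unfolding iso_def by auto

lemma elts_f: "x : A ==> elts B F (f x) = f ` elts A E x" unfolding elts_def B using EF by auto

lemma f_eq: "S <= A ==> T <= A ==> f ` S = f ` T \<longleftrightarrow> S = T" by (rule inj_on_image_eq_iff[OF inj])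

lemma f_inj: "x : A ==> y : A ==> f x = f y \<longleftrightarrow> x = y" using inj_on_eq_iff[OF inj] by blast

lemma all_B: "(ALL x:B. P x) \<longleftrightarrow> (ALL x:A. P (f x))" unfolding B by blast
lemma Col_B: "{x : B. P x} = f ` {x : A. P (f x)}" unfolding B by blast
lemma ex_B: "(EX x:B. P x) \<longleftrightarrow> (EX x:A. P (f x))" unfolding B by blast

lemma f_sub: "S <= A ==> T <= A ==> f ` S <= f ` T \<longleftrightarrow> S <= T" using inj unfolding inj_on_def by blast

lemma sat_f: "v ` fv \<phi> <= A ==> sat A E \<phi> v \<longleftrightarrow> sat B F \<phi> (%i. f (v i))"
proof (induction \<phi> arbitrary: v)
  case (Forall i \<phi>)
  have "sat A E \<phi> (v(i := a)) \<longleftrightarrow> sat B F \<phi> ((%j. f (v j))(i := f a))" if "a : A" for a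
  proof -
    have 1: "(v(i := a)) ` fv \<phi> <= A" using Forall.prems that by auto
    have 2: "(%j. f ((v(i := a)) j)) = (%j. f (v j))(i := f a)" by auto
    show ?thesis using Forall.IH[OF 1] unfolding 2 .
  qed
  then show ?case by (simp add: B)
qed (auto simp: EF f_inj image_Un)

lemma definable_f: assumes "definable A E X" shows "X <= A" "definable B F (f ` X)"
proof -
  obtain \<phi> v where v: "v ` (fv \<phi> - {0}) <= A" "X = {a : A. sat A E \<phi> (v(0 := a))}" using assms unfolding definable_def by blast
  show "X <= A" using v by blast
  have "sat A E \<phi> (v(0 := a)) \<longleftrightarrow> sat B F \<phi> ((%j. f (v j))(0 := f a))" if "a : A" for a
  proof -
    have 1: "(v(0 := a)) ` fv \<phi> <= A" using v(1) that by auto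
    have 2: "(%j. f ((v(0 := a)) j)) = (%j. f (v j))(0 := f a)" by auto
    show ?thesis using sat_f[OF 1] unfolding 2 .
  qed
  then have "f ` X = {b : B. sat B F \<phi> ((%j. f (v j))(0 := b))}" unfolding v(2) B by auto
  moreover have "(%j. f (v j)) ` (fv \<phi> - {0}) <= B" unfolding B using v(1) by auto
  ultimately show "definable B F (f ` X)" unfolding definable_def by blast
qed

abbreviation ff where "ff \<equiv> map_prod f f"

lemma definable_rel_f: assumes "definable_rel A E R" shows "R <= A \<times> A" "definable_rel B F (ff ` R)"
proof -
  obtain \<phi> v where v: "v ` (fv \<phi> - {0,1}) <= A" "R = {(a, b). a : A \<and> b : A \<and> sat A E \<phi> (v(0 := a, 1 := b))}"
    using assms unfolding definable_rel_def by blast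
  show "R <= A \<times> A" using v by blast
  have "sat A E \<phi> (v(0 := a, 1 := b)) \<longleftrightarrow> sat B F \<phi> ((%j. f (v j))(0 := f a, 1 := f b))" if "a : A" "b : A" for a b
  proof -
    have 1: "(v(0 := a, 1 := b)) ` fv \<phi> <= A" using v(1) that by auto
    have 2: "(%j. f ((v(0 := a, 1 := b)) j)) = (%j. f (v j))(0 := f a, 1 := f b)" by auto
    show ?thesis using sat_f[OF 1] unfolding 2 .
  qed
  then have "ff ` R = {(a, b). a : B \<and> b : B \<and> sat B F \<phi> ((%j. f (v j))(0 := a, 1 := b))}" unfolding v(2) B by (auto simp: image_iff)
  moreover have "(%j. f (v j)) ` (fv \<phi> - {0,1}) <= B" unfolding B using v(1) by auto
  ultimately show "definable_rel B F (ff ` R)" unfolding definable_rel_def by blast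
qed

lemma is_opair_f: assumes "x : A" "y : A" "z : A" shows "is_opair B F (f z) (f x) (f y) \<longleftrightarrow> is_opair A E z x y"
proof -
  have s: "{x} <= A" "{x, y} <= A" using assms by auto
  have i: "f ` {x} = {f x}" "f ` {x, y} = {f x, f y}" by auto
  have "(elts B F (f s) = {f x} \<and> elts B F (f t) = {f x, f y} \<and> elts B F (f z) = {f s, f t}) \<longleftrightarrow>
    (elts A E s = {x} \<and> elts A E t = {x, y} \<and> elts A E z = {s, t})" if st: "s : A" "t : A" for s t
  proof -
    have "{s, t} <= A" "f ` {s, t} = {f s, f t}" using st by auto
    then show ?thesis unfolding elts_f[OF st(1)] elts_f[OF st(2)] elts_f[OF assms(3)] using f_eq[OF elts_sub] s i by metis
  qed
  then have "(EX s:A. EX t:A. elts B F (f s) = {f x} \<and> elts B F (f t) = {f x, f y} \<and> elts B F (f z) = {f s, f t}) \<longleftrightarrow>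
    (EX s:A. EX t:A. elts A E s = {x} \<and> elts A E t = {x, y} \<and> elts A E z = {s, t})" by (intro bex_cong HOL.refl)
  moreover have "f x : B" "f y : B" "f z : B" unfolding B using assms by auto
  ultimately show ?thesis unfolding is_opair_def ex_B using assms by blast
qed

lemma is_opair_f1: assumes o: "is_opair A E z x y" shows "is_opair B F (f z) (f x) (f y)"
proof -
  have "x : A" "y : A" "z : A" using o unfolding is_opair_def by blast+
  then show ?thesis using is_opair_f o by simp
qed

lemma inv: "isom (inv_into A f) B F A E" by unfold_locales (rule iso_inv[OF iso])

lemma g_f: "x : A ==> inv_into A f (f x) = x" by (rule inv_into_f_f[OF inj])

lemma definable_g: assumes "definable B F Y" shows "EX X. definable A E X \<and> Y = f ` X"
proof -
  interpret g: isom "inv_into A f" B F A E by (rule inv)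
  have "f ` inv_into A f ` Y = Y" using g.definable_f(1)[OF assms] B by (intro image_inv_into_cancel) auto
  then show ?thesis using g.definable_f(2)[OF assms] by metis
qed

lemma definable_rel_g: assumes "definable_rel B F Y" shows "EX X. definable_rel A E X \<and> Y = ff ` X"
proof -
  interpret g: isom "inv_into A f" B F A E by (rule inv)
  have "ff (g.ff z) = z" if "z : Y" for z using that g.definable_rel_f(1)[OF assms] B f_inv_into_f[of _ f A] by (cases z) auto
  then have "ff ` g.ff ` Y = Y" unfolding image_image by (simp cong: image_cong)
  then show ?thesis using g.definable_rel_f(2)[OF assms] by metis
qed

lemma ff_mem: "a : A ==> b : A ==> R <= A \<times> A ==> (f a, f b) : ff ` R \<longleftrightarrow> (a, b) : R"
proof
  assume a: "a : A" "b : A" "R <= A \<times> A" "(f a, f b) : ff ` R"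
  then obtain a' b' where ab: "(a', b') : R" "f a = f a'" "f b = f b'" by auto
  then have "a' : A" "b' : A" using a(3) by auto
  then have "a = a'" "b = b'" using ab(2,3) f_inj a(1,2) by blast+
  then show "(a, b) : R" using ab by simp
qed force

lemma f_Int: "S <= A ==> T <= A ==> f ` S Int f ` T = f ` (S Int T)" using inj_on_image_Int[OF inj] by blast

lemma ZFC_f: assumes Z: "ZFC A E" shows "ZFC B F"
proof -
  note Z' = Z[unfolded ZFC_def]
  note Z1 = Z'[THEN conjunct1] and Y1 = Z'[THEN conjunct2]
  note Z2 = Y1[THEN conjunct1] and Y2 = Y1[THEN conjunct2]
  note Z3 = Y2[THEN conjunct1] and Y3 = Y2[THEN conjunct2]
  note Z4 = Y3[THEN conjunct1] and Y4 = Y3[THEN conjunct2]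
  note Z5 = Y4[THEN conjunct1] and Y5 = Y4[THEN conjunct2]
  note Z6 = Y5[THEN conjunct1] and Y6 = Y5[THEN conjunct2]
  note Z7 = Y6[THEN conjunct1] and Y7 = Y6[THEN conjunct2]
  note Z8 = Y7[THEN conjunct1] and Y8 = Y7[THEN conjunct2]
  have e: "elts A E x <= A" for x by (rule elts_sub)
  have y: "y : A" if "y : elts A E x" for x y using that e by blast
  have "extensional_model A E" by (rule Z1)
  then have ext: "extensional_model B F" unfolding extensional_model_def all_B by (simp add: elts_f f_eq[OF e e] f_inj)
  have fnd: "ALL x:B. elts B F x ~= {} --> (EX y:elts B F x. elts B F y Int elts B F x = {})" unfolding all_B
  proof (intro ballI impI)
    fix x assume x: "x : A" "elts B F (f x) ~= {}"
    then have "elts A E x ~= {}" using elts_f by auto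
    then obtain y where y: "y : elts A E x" "elts A E y Int elts A E x = {}" using Z2 x by blast
    have "y : A" using y e by blast
    then have "elts B F (f y) Int elts B F (f x) = {}" using y x elts_f f_Int[OF e e] by auto
    then show "EX y:elts B F (f x). elts B F y Int elts B F (f x) = {}" using y elts_f[OF x(1)] by blast
  qed
  have pr: "ALL x:B. ALL y:B. EX z:B. elts B F z = {x, y}" unfolding all_B ex_B
  proof (intro ballI)
    fix x y assume "x : A" "y : A"
    then obtain z where z: "z : A" "elts A E z = {x, y}" using Z3 by blast
    then show "EX z:A. elts B F (f z) = {f x, f y}" by (intro bexI[of _ z]) (simp_all add: elts_f)
  qed
  have un: "ALL x:B. EX u:B. elts B F u = (\<Union>y\<in>elts B F x. elts B F y)" unfolding all_B ex_B
  proof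
    fix x assume x: "x : A"
    then obtain u where u: "u : A" "elts A E u = (\<Union>y\<in>elts A E x. elts A E y)" using Z4 by blast
    then have "elts B F (f u) = (\<Union>y\<in>elts B F (f x). elts B F y)" using x y by (simp add: elts_f image_UN)
    then show "EX u:A. elts B F (f u) = (\<Union>y\<in>elts B F (f x). elts B F y)" using u by blast
  qed
  have pw: "ALL x:B. EX p:B. elts B F p = {y : B. elts B F y <= elts B F x}" unfolding all_B ex_B
  proof
    fix x assume x: "x : A"
    then obtain p where p: "p : A" "elts A E p = {y : A. elts A E y <= elts A E x}" using Z5 by blast
    have "elts B F (f y) <= elts B F (f x) \<longleftrightarrow> elts A E y <= elts A E x" if "y : A" for y
      using f_sub[OF e e] elts_f x that by simp
    then have "{y : A. elts B F (f y) <= elts B F (f x)} = {y : A. elts A E y <= elts A E x}" by blast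
    then have "elts B F (f p) = {y : B. elts B F y <= elts B F (f x)}" unfolding Col_B elts_f[OF p(1)] p(2) by (simp only:)
    then show "EX p:A. elts B F (f p) = {y : B. elts B F y <= elts B F (f x)}" using p by blast
  qed
  have inf: "EX w:B. (EX e:elts B F w. elts B F e = {}) \<and> (ALL x:elts B F w. EX s:elts B F w. elts B F s = insert x (elts B F x))" unfolding ex_B
  proof -
    obtain w where w: "w : A" "EX e:elts A E w. elts A E e = {}" "ALL x:elts A E w. EX s:elts A E w. elts A E s = insert x (elts A E x)" using Z6 by blast
    have "EX e:elts B F (f w). elts B F e = {}" using w(2) y unfolding elts_f[OF w(1)] by (auto simp: elts_f)
    moreover have "ALL x:elts B F (f w). EX s:elts B F (f w). elts B F s = insert x (elts B F x)" unfolding elts_f[OF w(1)]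
    proof (rule ballI, elim imageE)
      fix x' x assume "x' = f x" "x : elts A E w"
      moreover obtain s where "s : elts A E w" "elts A E s = insert x (elts A E x)" using w(3) calculation by blast
      ultimately show "EX s:f ` elts A E w. elts B F s = insert x' (elts B F x')" using y by (intro bexI[of _ "f s"]) (simp_all add: elts_f)
    qed
    ultimately show "EX w:A. (EX e:elts B F (f w). elts B F e = {}) \<and> (ALL x:elts B F (f w). EX s:elts B F (f w). elts B F s = insert x (elts B F x))"
      using w(1) by blast
  qed
  have sep: "ALL X. definable B F X --> (ALL x:B. EX y:B. elts B F y = elts B F x Int X)" unfolding all_B ex_B
  proof (intro allI impI ballI)
    fix Y x assume "definable B F Y" and x: "x : A"
    then obtain X where X: "definable A E X" "Y = f ` X" using definable_g by blast
    then obtain u where "u : A" "elts A E u = elts A E x Int X" using Z7 x by blast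
    then show "EX u:A. elts B F (f u) = elts B F (f x) Int Y" unfolding X(2) elts_f[OF x] f_Int[OF e definable_f(1)[OF X(1)]]
      by (intro bexI[of _ u]) (simp_all add: elts_f)
  qed
  have rep: "ALL R. definable_rel B F R --> (ALL x:B. (ALL a:elts B F x. EX! b. (a, b) : R) -->
           (EX y:B. ALL a:elts B F x. EX b:elts B F y. (a, b) : R))" unfolding all_B ex_B
  proof (intro allI impI ballI)
    fix Y x assume "definable_rel B F Y" and x: "x : A" and h: "ALL a:elts B F (f x). EX! b. (a, b) : Y"
    then obtain R where R: "definable_rel A E R" "Y = ff ` R" using definable_rel_g by blast
    note RA = definable_rel_f(1)[OF R(1)]
    have "EX! b. (a, b) : R" if a: "a : elts A E x" for a
    proof -
      have aA: "a : A" using a y by blast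
      have "EX! b. (f a, b) : Y" using h a unfolding elts_f[OF x] by blast
      then obtain b where b: "(f a, b) : Y" "!!b'. (f a, b') : Y ==> b' = b" by blast
      then obtain a' b0 where ab: "(a', b0) : R" "f a = f a'" "b = f b0" unfolding R(2) by auto
      then have "a' : A" using RA by blast
      then have b0: "(a, b0) : R" "b = f b0" using ab f_inj[OF aA] by auto
      have "b' = b0" if "(a, b') : R" for b'
      proof -
        have "(f a, f b') : Y" using that unfolding R(2) by force
        then have "f b' = f b0" using b(2) b0 by blast
        then show ?thesis using f_inj RA that b0 by blast
      qed
      then show ?thesis using b0 by blast
    qed
    then obtain u where u: "u : A" "ALL a:elts A E x. EX b:elts A E u. (a, b) : R" using Z8[rule_format, OF R(1) x] by blast
    have "ALL a:elts B F (f x). EX b:elts B F (f u). (a, b) : Y" unfolding elts_f[OF x] elts_f[OF u(1)] R(2)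
    proof (rule ballI, elim imageE)
      fix a' a assume a: "a' = f a" "a : elts A E x"
      then obtain b where "b : elts A E u" "(a, b) : R" using u by blast
      then show "EX b:f ` elts A E u. (a', b) : ff ` R" unfolding a by (intro bexI[of _ "f b"]) force+
    qed
    then show "EX u:A. ALL a:elts B F (f x). EX b:elts B F (f u). (a, b) : Y" using u(1) by blast
  qed
  have ac: "ALL x:B. (ALL y:elts B F x. elts B F y ~= {}) \<and>
        (ALL y:elts B F x. ALL z:elts B F x. y ~= z --> elts B F y Int elts B F z = {}) -->
        (EX c:B. ALL y:elts B F x. EX! z. z : elts B F c Int elts B F y)" unfolding all_B ex_B
  proof (intro ballI impI, elim conjE)
    fix x assume x: "x : A" and h: "ALL y:elts B F (f x). elts B F y ~= {}" "ALL y:elts B F (f x). ALL z:elts B F (f x). y ~= z --> elts B F y Int elts B F z = {}"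
    have h1: "ALL y:elts A E x. elts A E y ~= {}" using h(1) y unfolding elts_f[OF x] by (auto simp: elts_f)
    have h2: "elts A E u Int elts A E z = {}" if u: "u : elts A E x" "z : elts A E x" "u ~= z" for u z
    proof -
      have "u : A" "z : A" using u y by blast+
      then have "f ` elts A E u Int f ` elts A E z = {}" using h(2) u f_inj unfolding elts_f[OF x] by (metis elts_f image_eqI)
      then show ?thesis using f_Int[OF e e] by auto
    qed
    from h1 h2 obtain c where c: "c : A" "ALL u:elts A E x. EX! z. z : elts A E c Int elts A E u" using bspec[OF Y8 x] by blast
    have "EX! z. z : elts B F (f c) Int elts B F (f u)" if u: "u : elts A E x" for u
    proof -
      have uA: "u : A" using u y by blast
      obtain z where "elts A E c Int elts A E u = {z}" using c(2) u by blast
      then have "elts B F (f c) Int elts B F (f u) = {f z}" unfolding elts_f[OF uA] elts_f[OF c(1)] f_Int[OF e e] by simp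
      then show ?thesis by auto
    qed
    then show "EX c:A. ALL y:elts B F (f x). EX! z. z : elts B F (f c) Int elts B F y" unfolding elts_f[OF x] using c(1) by blast
  qed
  show ?thesis unfolding ZFC_def by (intro conjI ext fnd pr un pw inf sep rep ac)
qed

lemma sub_isom: "W <= A ==> isom f W E (f ` W) F" by unfold_locales (rule iso_sub[OF iso])

lemma ordinal_f: assumes x: "x : A" shows "ordinal B F (f x) \<longleftrightarrow> ordinal A E x"
proof -
  have y: "y : A" if "y : elts A E z" for y z by (rule subsetD[OF elts_sub that])
  have s: "elts B F (f u) <= elts B F (f v) \<longleftrightarrow> elts A E u <= elts A E v" if "u : A" "v : A" for u v
    using f_sub[OF elts_sub elts_sub] that by (simp add: elts_f)
  have fx: "f x : B" unfolding B using x by blast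
  have 1: "(ALL y:elts B F (f x). elts B F y <= elts B F (f x)) \<longleftrightarrow> (ALL y:elts A E x. elts A E y <= elts A E x)"
    unfolding elts_f[OF x] ball_simps using s[OF y x] elts_f[OF x] by simp
  have "(ALL z:elts B F (f y). elts B F z <= elts B F (f y)) \<longleftrightarrow> (ALL z:elts A E y. elts A E z <= elts A E y)" if "y : A" for y
    unfolding elts_f[OF that] ball_simps using s[OF y that] elts_f[OF that] by simp
  then have "(ALL y:elts B F (f x). ALL z:elts B F y. elts B F z <= elts B F y) \<longleftrightarrow> (ALL y:elts A E x. ALL z:elts A E y. elts A E z <= elts A E y)"
    unfolding elts_f[OF x] ball_simps using y by simp
  then show ?thesis unfolding ordinal_def 1 using fx x by blast
qed

lemma inner_model_f: assumes "inner_model A E W" shows "W <= A" "inner_model B F (f ` W)"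
proof -
  show W: "W <= A" using assms unfolding inner_model_def by blast
  have t: "elts A E x <= W" if "x : W" for x using assms that unfolding inner_model_def by blast
  have "elts B F y <= f ` W" if "y : f ` W" for y using that t elts_f W by blast
  moreover have "{a. ordinal B F a} <= f ` W"
  proof
    fix a assume "a : {a. ordinal B F a}"
    then have a: "ordinal B F a" "a : B" unfolding ordinal_def by auto
    then obtain x where x: "x : A" "a = f x" unfolding B by blast
    then have "x : W" using a(1) ordinal_f assms unfolding inner_model_def by blast
    then show "a : f ` W" using x by blast
  qed
  moreover have "ZFC (f ` W) F" using isom.ZFC_f[OF sub_isom[OF W]] assms unfolding inner_model_def by blast
  ultimately show "inner_model B F (f ` W)" using W definable_f(2) assms unfolding inner_model_def B by blast
qed

lemma forcing_poset_f: assumes P: "P <= A" and "forcing_poset P r" shows "r <= P \<times> P" "forcing_poset (f ` P) (ff ` r)"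
proof -
  have po: "r <= P \<times> P" "refl_on P r" "trans r" "antisym r" and t: "EX t:P. ALL p:P. (p, t) : r"
    using assms(2) unfolding forcing_poset_def partial_order_on_def preorder_on_def by auto
  show rP: "r <= P \<times> P" by fact
  have rA: "r <= A \<times> A" using P rP by blast
  have m: "(f p, f q) : ff ` r \<longleftrightarrow> (p, q) : r" if "p : P" "q : P" for p q by (rule ff_mem[OF _ _ rA]) (use that P in auto)
  have d: "EX p:P. EX q:P. x = f p \<and> y = f q \<and> (p, q) : r" if "(x, y) : ff ` r" for x y using that rP by auto
  have "trans (ff ` r)"
  proof (rule transI)
    fix x y z assume "(x, y) : ff ` r" "(y, z) : ff ` r"
    then obtain p q q' s where a: "p : P" "q : P" "x = f p" "y = f q" "(p, q) : r" "q' : P" "s : P" "y = f q'" "z = f s" "(q', s) : r" using d by metis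
    then have "q = q'" using f_inj P by blast
    then have "(p, s) : r" using a po(3) unfolding trans_def by blast
    then show "(x, z) : ff ` r" using m[OF a(1,7)] a(3,9) by simp
  qed
  moreover have "antisym (ff ` r)"
  proof (rule antisymI)
    fix x y assume xy: "(x, y) : ff ` r" "(y, x) : ff ` r"
    then obtain p q where a: "p : P" "q : P" "x = f p" "y = f q" using d by metis
    then have "(p, q) : r" "(q, p) : r" using m[OF a(1,2)] m[OF a(2,1)] xy by simp_all
    then show "x = y" using a po(4) unfolding antisym_def by blast
  qed
  moreover have "refl_on (f ` P) (ff ` r)" using po(2) m unfolding refl_on_def by blast
  moreover have "ff ` r <= f ` P \<times> f ` P" using rP by auto
  moreover have "EX t:f ` P. ALL p:f ` P. (p, t) : ff ` r" using t m by blast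
  ultimately show "forcing_poset (f ` P) (ff ` r)" unfolding forcing_poset_def partial_order_on_def preorder_on_def by blast
qed

context fixes P r assumes P: "P <= A" and r: "r <= P \<times> P"
begin

lemma r_f: "p : P ==> q : P ==> (f p, f q) : ff ` r \<longleftrightarrow> (p, q) : r" by (rule ff_mem) (use P r in auto)

lemma dense_f: assumes "D <= A" shows "dense_in (f ` P) (ff ` r) (f ` D) \<longleftrightarrow> dense_in P r D"
  unfolding dense_in_def f_sub[OF assms P]
proof (rule conj_cong[OF HOL.refl])
  assume "D <= P"
  then have "(EX d:D. (f d, f p) : ff ` r) \<longleftrightarrow> (EX d:D. (d, p) : r)" if "p : P" for p using that by (intro bex_cong HOL.refl r_f) auto
  then show "(ALL p:f ` P. EX d:f ` D. (d, p) : ff ` r) \<longleftrightarrow> (ALL p:P. EX d:D. (d, p) : r)" unfolding ball_simps bex_simps by (intro ball_cong HOL.refl)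
qed

lemma nontrivial_f: "nontrivial_poset P r ==> nontrivial_poset (f ` P) (ff ` r)"
proof -
  have c: "compatible (f ` P) (ff ` r) (f q) (f q') \<longleftrightarrow> compatible P r q q'" if "q : P" "q' : P" for q q'
    unfolding compatible_def bex_simps by (intro bex_cong HOL.refl conj_cong r_f that)
  have "nontrivial_poset (f ` P) (ff ` r) \<longleftrightarrow> nontrivial_poset P r" unfolding nontrivial_poset_def ball_simps bex_simps
    by (intro ball_cong bex_cong HOL.refl conj_cong r_f arg_cong[where f=Not] c)
  then show "nontrivial_poset P r ==> nontrivial_poset (f ` P) (ff ` r)" by blast
qed

lemma filter_f: assumes "filter_on P r G" shows "G <= P" "filter_on (f ` P) (ff ` r) (f ` G)"
proof -
  show G: "G <= P" using assms unfolding filter_on_def by blast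
  have "f q : f ` G" if "p : G" "q : P" "(f p, f q) : ff ` r" for p q
  proof -
    have "(p, q) : r" using r_f[of p q] that G by auto
    then show ?thesis using assms that unfolding filter_on_def by blast
  qed
  moreover have "EX s:G. (f s, f p) : ff ` r \<and> (f s, f q) : ff ` r" if pq: "p : G" "q : G" for p q
  proof -
    obtain s where "s : G" "(s, p) : r" "(s, q) : r" using assms pq unfolding filter_on_def by blast
    then show ?thesis using r_f[of s p] r_f[of s q] G pq by blast
  qed
  moreover have "f ` G <= f ` P" "f ` G ~= {}" using assms unfolding filter_on_def by auto
  ultimately show "filter_on (f ` P) (ff ` r) (f ` G)" unfolding filter_on_def ball_simps bex_simps by simp
qed

lemma set_generic_f: assumes "set_generic A E P r G" shows "G <= P" "set_generic B F (f ` P) (ff ` r) (f ` G)"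
proof -
  have fi: "filter_on P r G" using assms unfolding set_generic_def by blast
  show G: "G <= P" by (rule filter_f[OF fi])
  have "f ` G Int elts B F (f d) ~= {}" if d: "d : A" "dense_in (f ` P) (ff ` r) (elts B F (f d))" for d
  proof -
    have "dense_in P r (elts A E d)" using d(2) unfolding elts_f[OF d(1)] dense_f[OF elts_sub] .
    then show ?thesis using assms d(1) unfolding set_generic_def elts_f[OF d(1)] by blast
  qed
  then show "set_generic B F (f ` P) (ff ` r) (f ` G)" using filter_f(2)[OF fi] unfolding set_generic_def all_B by blast
qed

lemma class_generic_f: assumes "class_generic A E P r G" shows "G <= P" "class_generic B F (f ` P) (ff ` r) (f ` G)"
proof -
  have fi: "filter_on P r G" using assms unfolding class_generic_def by blast
  show G: "G <= P" by (rule filter_f[OF fi])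
  have "f ` G Int Y ~= {}" if d: "definable B F Y" "dense_in (f ` P) (ff ` r) Y" for Y
  proof -
    obtain X where X: "definable A E X" "Y = f ` X" using definable_g[OF d(1)] by blast
    have "dense_in P r X" using d(2) unfolding X(2) dense_f[OF definable_f(1)[OF X(1)]] .
    then show ?thesis using assms X unfolding class_generic_def by blast
  qed
  then show "class_generic B F (f ` P) (ff ` r) (f ` G)" using filter_f(2)[OF fi] unfolding class_generic_def by blast
qed

end

lemma set_forcing_f: assumes "set_forcing A E P r" shows "P <= A" "r <= P \<times> P" "set_forcing B F (f ` P) (ff ` r)"
proof -
  obtain c where c: "c : A" "P = elts A E c" using assms unfolding set_forcing_def by blast
  obtain d where d: "d : A" "r = {(p, q). EX z:elts A E d. is_opair A E z p q}" using assms unfolding set_forcing_def by blast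
  have po: "forcing_poset P r" using assms unfolding set_forcing_def by blast
  show P: "P <= A" unfolding c by (rule elts_sub)
  note f = forcing_poset_f[OF P po]
  show "r <= P \<times> P" by (rule f)
  have "ff ` r = {(p, q). EX z:elts B F (f d). is_opair B F z p q}"
  proof (intro set_eqI iffI)
    fix x assume "x : ff ` r"
    then obtain p q z where z: "x = (f p, f q)" "z : elts A E d" "is_opair A E z p q" unfolding d(2) by auto
    then have "is_opair B F (f z) (f p) (f q)" using is_opair_f1 by blast
    then show "x : {(p, q). EX z:elts B F (f d). is_opair B F z p q}" unfolding elts_f[OF d(1)] using z by blast
  next
    fix x assume "x : {(p, q). EX z:elts B F (f d). is_opair B F z p q}"
    then obtain p q z where z: "x = (p, q)" "z : elts A E d" "is_opair B F (f z) p q" unfolding elts_f[OF d(1)] by blast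
    then obtain p0 q0 where pq: "p0 : A" "q0 : A" "p = f p0" "q = f q0" unfolding is_opair_def B by blast
    have "z : A" by (rule subsetD[OF elts_sub z(2)])
    then have "is_opair A E z p0 q0" using is_opair_f[OF pq(1,2)] z(3) unfolding pq(3,4) by simp
    then have "(p0, q0) : r" unfolding d(2) using z(2) by blast
    then show "x : ff ` r" unfolding z(1) pq by force
  qed
  moreover have "f ` P = elts B F (f c)" using c elts_f by simp
  ultimately show "set_forcing B F (f ` P) (ff ` r)" unfolding set_forcing_def ex_B using f(2) c(1) d(1) by blast
qed

lemma class_forcing_f: assumes "class_forcing A E P r" shows "P <= A" "r <= P \<times> P" "class_forcing B F (f ` P) (ff ` r)"
proof -
  have a: "forcing_poset P r" "definable A E P" "definable_rel A E r" "\<not> (EX c:A. P = elts A E c)" using assms unfolding class_forcing_def by blast+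
  show P: "P <= A" by (rule definable_f[OF a(2)])
  show "r <= P \<times> P" by (rule forcing_poset_f[OF P a(1)])
  have "\<not> (EX c:A. f ` P = elts B F (f c))" using a(4) f_eq[OF P elts_sub] elts_f by auto
  then show "class_forcing B F (f ` P) (ff ` r)" unfolding class_forcing_def ex_B
    using forcing_poset_f(2)[OF P a(1)] definable_f(2)[OF a(2)] definable_rel_f(2)[OF a(3)] by blast
qed

lemma names_sub: "names A E P <= A" by (auto elim: names.cases)

lemma names_f1: "P <= A ==> n : names A E P ==> f n : names B F (f ` P)"
proof (rotate_tac 1, induction rule: names.induct)
  case (1 n)
  show ?case
  proof (rule names.intros)
    show "f n : B" unfolding B using 1 by blast
    show "ALL z:elts B F (f n). EX s p. s : names B F (f ` P) \<and> p : f ` P \<and> is_opair B F z s p" unfolding elts_f[OF 1(1)]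
    proof (rule ballI, elim imageE)
      fix z' z assume z: "z' = f z" "z : elts A E n"
      then obtain s p where sp: "f s : names B F (f ` P)" "p : P" "is_opair A E z s p" using 1 by blast
      then have "is_opair B F (f z) (f s) (f p)" using is_opair_f1 by blast
      then show "EX s p. s : names B F (f ` P) \<and> p : f ` P \<and> is_opair B F z' s p" using sp z by blast
    qed
  qed
qed

lemma names_f: assumes P: "P <= A" shows "names B F (f ` P) = f ` names A E P"
proof (intro set_eqI iffI)
  interpret g: isom "inv_into A f" B F A E by (rule inv)
  fix m assume m: "m : names B F (f ` P)"
  have fP: "f ` P <= B" unfolding B using P by blast
  have "inv_into A f ` f ` P = P" by (rule inv_into_image_cancel[OF inj P])
  then have "inv_into A f m : names A E P" using g.names_f1[OF fP m] by simp
  moreover have "f (inv_into A f m) = m" using m g.names_sub B by (intro f_inv_into_f) blast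
  ultimately show "m : f ` names A E P" by (metis imageI)
qed (use names_f1[OF P] in blast)

text \<open>Ground model and extension are moved by two unrelated isomorphisms; the new evaluation
  is the old one conjugated by them.\<close>

lemma forcing_extension_f: assumes C: "isom k C E' D F'" and P: "P <= A" and G: "G <= P" and fe: "forcing_extension A E P G C E'"
  shows "forcing_extension B F (f ` P) (f ` G) D F'"
proof -
  interpret C: isom k C E' D F' by (rule C)
  obtain v where v: "v ` names A E P = C" and ve': "ALL n:names A E P. elts C E' (v n) =
      {v s |s p. s : names A E P \<and> p : G \<and> (EX z:elts A E n. is_opair A E z s p)}" using fe unfolding forcing_extension_def by (elim conjE exE)
  note ve = bspec[OF ve']
  let ?v = "%m. k (v (inv_into A f m))"
  have vf: "?v (f n) = k (v n)" if "n : names A E P" for n using g_f that names_sub by (metis subsetD)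
  have "?v ` names B F (f ` P) = k ` v ` names A E P" unfolding names_f[OF P] image_image using vf by (intro image_cong) auto
  then have 1: "?v ` names B F (f ` P) = D" unfolding v C.B .
  have 2: "elts D F' (?v m) = {?v s |s p. s : names B F (f ` P) \<and> p : f ` G \<and> (EX z:elts B F m. is_opair B F z s p)}"
    if m: "m : names B F (f ` P)" for m
  proof -
    obtain n where n: "n : names A E P" "m = f n" using m unfolding names_f[OF P] by blast
    have nA: "n : A" by (rule subsetD[OF names_sub n(1)])
    have vC: "v n : C" unfolding v[symmetric] using n(1) by (rule imageI)
    have op: "(EX z:elts B F (f n). is_opair B F z (f s) (f p)) \<longleftrightarrow> (EX z:elts A E n. is_opair A E z s p)" if "s : A" "p : A" for s p
      unfolding elts_f[OF nA] bex_simps by (intro bex_cong HOL.refl is_opair_f that) (erule subsetD[OF elts_sub])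
    have GA: "p : A" if "p : G" for p using that P G by blast
    have NA: "s : A" if "s : names A E P" for s by (rule subsetD[OF names_sub that])
    have "elts D F' (?v m) = k ` elts C E' (v n)" unfolding n(2) vf[OF n(1)] by (rule C.elts_f[OF vC])
    also have "... = {?v s |s p. s : f ` names A E P \<and> p : f ` G \<and> (EX z:elts B F (f n). is_opair B F z s p)}"
    proof (intro set_eqI iffI)
      fix x assume "x : k ` elts C E' (v n)"
      then obtain s p where sp: "x = k (v s)" "s : names A E P" "p : G" "EX z:elts A E n. is_opair A E z s p" unfolding ve[OF n(1)] by blast
      then have "x = ?v (f s)" "EX z:elts B F (f n). is_opair B F z (f s) (f p)" using vf op[OF NA GA] by auto
      then show "x : {?v s |s p. s : f ` names A E P \<and> p : f ` G \<and> (EX z:elts B F (f n). is_opair B F z s p)}" using sp by blast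
    next
      fix x assume "x : {?v s |s p. s : f ` names A E P \<and> p : f ` G \<and> (EX z:elts B F (f n). is_opair B F z s p)}"
      then obtain s p where sp: "x = ?v (f s)" "s : names A E P" "p : G" "EX z:elts B F (f n). is_opair B F z (f s) (f p)" by blast
      then have "x = k (v s)" "EX z:elts A E n. is_opair A E z s p" using vf op[OF NA GA] by auto
      then show "x : k ` elts C E' (v n)" unfolding ve[OF n(1)] using sp by blast
    qed
    finally show ?thesis unfolding names_f[OF P] n(2) .
  qed
  have "extensional_model C E'" using fe unfolding forcing_extension_def by blast
  then have "extensional_model D F'" unfolding extensional_model_def C.all_B by (simp add: C.elts_f C.f_eq[OF elts_sub elts_sub] C.f_inj)
  then show ?thesis unfolding forcing_extension_def using 1 2 by (intro conjI exI[of _ ?v]) auto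
qed

lemma ground_f: assumes "inner_model A E W" "set_forcing W E P r" "set_generic W E P r G" "forcing_extension W E P G A E"
  shows "inner_model B F (f ` W)" "set_forcing (f ` W) F (f ` P) (ff ` r)" "set_generic (f ` W) F (f ` P) (ff ` r) (f ` G)"
    "forcing_extension (f ` W) F (f ` P) (f ` G) B F" "nontrivial_poset P r ==> nontrivial_poset (f ` P) (ff ` r)"
proof -
  note W = inner_model_f[OF assms(1)]
  interpret W: isom f W E "f ` W" F by (rule sub_isom[OF W(1)])
  note P = W.set_forcing_f[OF assms(2)]
  note G = W.set_generic_f[OF P(1,2) assms(3)]
  show "inner_model B F (f ` W)" "set_forcing (f ` W) F (f ` P) (ff ` r)" "set_generic (f ` W) F (f ` P) (ff ` r) (f ` G)"
    by (rule W(2) P(3) G(2))+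
  show "forcing_extension (f ` W) F (f ` P) (f ` G) B F" by (rule W.forcing_extension_f[OF isom_axioms P(1) G(1) assms(4)])
  show "nontrivial_poset P r ==> nontrivial_poset (f ` P) (ff ` r)" by (rule W.nontrivial_f[OF P(1,2)])
qed

lemma not_GA_f: assumes "\<not> GA A E" shows "\<not> GA B F"
proof -
  obtain W P r G where a: "inner_model A E W" "set_forcing W E P r" "set_generic W E P r G" "forcing_extension W E P G A E" "nontrivial_poset P r"
    using assms unfolding GA_def by blast
  note g = ground_f[OF a(1-4)]
  show ?thesis unfolding GA_def not_not by (intro exI conjI) (rule g(1) g(2) g(5)[OF a(5)] g(3) g(4))+
qed

lemma BA_f: assumes "BA A E" shows "BA B F"
proof -
  obtain W P r G where a: "inner_model A E W" "set_forcing W E P r" "set_generic W E P r G" "forcing_extension W E P G A E" "GA W E"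
    using assms unfolding BA_def by blast
  interpret W: isom f W E "f ` W" F by (rule sub_isom[OF inner_model_f(1)[OF a(1)]])
  have "GA (f ` W) F" using isom.not_GA_f[OF W.inv] a(5) by blast
  then show ?thesis unfolding BA_def using ground_f[OF a(1-4)] by blast
qed

end

section \<open>Generic filters and the transitive collapse\<close>

instance fm :: countable by countable_datatype

lemma countable_definable: assumes A: "countable A" shows "countable {X. definable A E X}"
proof (cases "A = {}")
  case True
  then have "{X. definable A E X} <= {{}}" unfolding definable_def by auto
  then show ?thesis by (rule countable_subset) simp
next
  case False
  then obtain a0 where a0: "a0 : A" by blast
  let ?S = "%(\<phi>, xs). {a : A. sat A E \<phi> ((%i. if i < length xs then xs ! i else a0)(0 := a))}"
  have "{X. definable A E X} <= ?S ` (UNIV \<times> lists A)"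
  proof
    fix X assume "X : {X. definable A E X}"
    then obtain \<phi> v where v: "v ` (fv \<phi> - {0}) <= A" "X = {a : A. sat A E \<phi> (v(0 := a))}" unfolding definable_def by blast
    \<comment> \<open>One more than every free variable, so that the list \<open>xs\<close> reaches
      all of them; its entry at 0 is overwritten by the argument.\<close>
    define n where "n = Suc (Max (insert 0 (fv \<phi>)))"
    define xs where "xs = map (%i. if i : fv \<phi> - {0} then v i else a0) [0..<n]"
    have "i < n" if "i : fv \<phi>" for i using that unfolding n_def by (simp add: le_imp_less_Suc)
    then have "sat A E \<phi> (v(0 := a)) \<longleftrightarrow> sat A E \<phi> ((%i. if i < length xs then xs ! i else a0)(0 := a))" for a
      by (intro sat_cong_fv) (auto simp: xs_def)
    then have "X = ?S (\<phi>, xs)" unfolding v(2) by simp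
    moreover have "xs : lists A" unfolding xs_def using subsetD[OF v(1) imageI] a0 by auto
    ultimately show "X : ?S ` (UNIV \<times> lists A)" by blast
  qed
  then show ?thesis by (rule countable_subset) (use A in \<open>intro countable_image countable_SIGMA countableI_type countable_lists\<close>)
qed

text \<open>The Rasiowa-Sikorski construction: a descending sequence through the enumerated dense
  sets, closed upwards.\<close>

lemma generic_exists: assumes fp: "forcing_poset P r" and c: "countable \<D>"
  shows "EX G. filter_on P r G \<and> (ALL D:\<D>. dense_in P r D --> G Int D ~= {})"
proof -
  have po: "r <= P \<times> P" "refl_on P r" "trans r" and "EX t:P. ALL p:P. (p, t) : r"
    using fp unfolding forcing_poset_def partial_order_on_def preorder_on_def by auto
  then obtain t where t: "t : P" "ALL p:P. (p, t) : r" by blast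
  \<comment> \<open>\<open>P\<close> itself is dense and is added so that the family to be
    enumerated is nonempty.\<close>
  define S where "S = insert P {D : \<D>. dense_in P r D}"
  have "dense_in P r P" using po(2) unfolding dense_in_def refl_on_def by blast
  then have Sd: "dense_in P r D" if "D : S" for D using that unfolding S_def by blast
  have Sc: "countable S" "S ~= {}" unfolding S_def using c by (auto intro: countable_subset)
  define D where "D = from_nat_into S"
  define s where "s = rec_nat t (%n p. SOME d. d : D n \<and> (d, p) : r)"
  have step: "s (Suc n) : D n \<and> (s (Suc n), s n) : r \<and> s (Suc n) : P" if "s n : P" for n
  proof -
    have d: "dense_in P r (D n)" unfolding D_def by (rule Sd[OF from_nat_into[OF Sc(2)]])
    then have "EX d. d : D n \<and> (d, s n) : r" using that unfolding dense_in_def by blast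
    moreover have "s (Suc n) = (SOME d. d : D n \<and> (d, s n) : r)" unfolding s_def by simp
    ultimately have "s (Suc n) : D n \<and> (s (Suc n), s n) : r" using someI_ex[of "%d. d : D n \<and> (d, s n) : r"] by simp
    then show ?thesis using d unfolding dense_in_def by blast
  qed
  have sP: "s n : P" for n by (induction n) (use t step in \<open>auto simp: s_def\<close>)
  have mono: "(s (n + k), s n) : r" for n k
  proof (induction k)
    case 0 then show ?case using po(2) sP unfolding refl_on_def by simp
  next
    case (Suc k)
    have "(s (Suc (n + k)), s (n + k)) : r" using step sP by blast
    then show ?case using Suc po(3) unfolding trans_def by (metis add_Suc_right)
  qed
  define G where "G = {q : P. EX n. (s n, q) : r}"
  have "filter_on P r G" unfolding filter_on_def
  proof (intro conjI ballI impI)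
    show "G <= P" unfolding G_def by blast
    show "G ~= {}" unfolding G_def using mono[of 0 0] sP[of 0] by blast
    fix p assume p: "p : G"
    { fix q assume "q : P" "(p, q) : r" then show "q : G" using p po(3) unfolding G_def trans_def by blast }
    fix q assume q: "q : G"
    obtain n m where nm: "(s n, p) : r" "(s m, q) : r" using p q unfolding G_def by blast
    have "(s (n + m), s n) : r" "(s (n + m), s m) : r" using mono[of n m] mono[of m n] by (simp_all add: add.commute)
    then have "(s (n + m), p) : r" "(s (n + m), q) : r" using nm po(3) unfolding trans_def by blast+
    moreover have "s (n + m) : G" unfolding G_def using sP[of "n + m"] mono[of "n + m" 0] by auto
    ultimately show "EX s:G. (s, p) : r \<and> (s, q) : r" by blast
  qed
  moreover have "G Int X ~= {}" if X: "X : \<D>" "dense_in P r X" for X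
  proof -
    have "X : S" unfolding S_def using X by blast
    then obtain n where "D n = X" unfolding D_def using from_nat_into_surj[OF Sc(1)] by blast
    then have "s (Suc n) : X" using step[OF sP] by blast
    moreover have "s (Suc n) : G" unfolding G_def using sP mono[of "Suc n" 0] by auto
    ultimately show ?thesis by blast
  qed
  ultimately show ?thesis by blast
qed

context zfL
begin

definition PP where "PP = {p. Pc zero p}"
definition pr where "pr = {(p, q). Pc zero p \<and> Pc zero q \<and> el q <= el p}"

lemma class_forcing: "class_forcing A mem PP pr"
proof -
  have P: "PP <= A" unfolding PP_def using PcA by blast
  have "partial_order_on PP pr" unfolding partial_order_on_def preorder_on_def refl_on_def trans_def antisym_def pr_def PP_def
    by (auto intro: ext_el)
  moreover have "EX t:PP. ALL p:PP. (p, t) : pr" unfolding pr_def PP_def using Pc_zero by (intro bexI[of _ zero]) auto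
  ultimately have 1: "forcing_poset PP pr" unfolding forcing_poset_def by blast
  have "dfb A (%e. e 0 : PP)" unfolding PP_def mem_Collect_eq by (intro df zeroA)
  then have 2: "definable A mem PP" using definable_iff_dfb[OF P] by blast
  have pA: "pr <= A \<times> A" unfolding pr_def using PcA by blast
  have "dfb A (%e. (e 0, e 1) : pr)" unfolding pr_def mem_Collect_eq prod.case by (intro df zeroA)
  then have 3: "definable_rel A mem pr" using definable_rel_iff_dfb[OF pA] by blast
  \<comment> \<open>Every set occurs as a coordinate: the condition whose only entry is
    \<open>(c, zero)\<close> would be an element of \<open>c\<close> and contain \<open>c\<close> in
    its transitive closure.\<close>
  have "PP ~= elts A mem c" if c: "c : A" for c
  proof
    assume e: "PP = elts A mem c"
    let ?z = "opr c zero"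
    have "upair ?z ?z : el c" using Pc_sing[OF c, of zero zero] e elts_A[OF c] unfolding PP_def by auto
    moreover have "c : TC (upair ?z ?z)" using opr_TC(1)[of c zero] TC_el[of ?z "upair ?z ?z"] TC_trans by auto
    ultimately have "c : TC c" using TC_el TC_trans by blast
    then show False by simp
  qed
  then show ?thesis unfolding class_forcing_def using 1 2 3 by blast
qed

lemma tow_generic: assumes g: "class_generic A mem PP pr G" shows "tow A G"
proof -
  have f: "G <= PP" "G ~= {}" "ALL p:G. ALL q:PP. (p, q) : pr --> q : G" "ALL p:G. ALL q:G. EX s:G. (s, p) : pr \<and> (s, q) : pr"
    using g unfolding class_generic_def filter_on_def by blast+
  show ?thesis
  proof unfold_locales
    show "zero : A" by simp
    show GP: "Pc zero p" if "p : G" for p using that f(1) unfolding PP_def by blast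
    show up: "q : G" if "p : G" "Pc zero q" "el q <= el p" for p q using that f(3) GP unfolding PP_def pr_def by blast
    show "zero : G" using f(2) up Pc_zero by fastforce
    show "EX s:G. el p <= el s \<and> el q <= el s" if "p : G" "q : G" for p q using f(4) that unfolding pr_def by blast
    fix Q assume Q: "dfb A (%e. Q (e 0))" and d: "!!p. Pc zero p ==> EX d. Pc zero d \<and> el p <= el d \<and> Q d"
    let ?D = "{p. Pc zero p \<and> Q p}"
    have D: "?D <= A" using PcA by blast
    have "definable A mem ?D" unfolding definable_iff_dfb[OF D] mem_Collect_eq by (intro dfb_conj Q) (intro df zeroA)
    moreover have "dense_in PP pr ?D" unfolding dense_in_def PP_def pr_def using d by auto
    ultimately have "G Int ?D ~= {}" using g unfolding class_generic_def by blast
    then show "EX p:G. Q p" by blast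
  qed
qed

lemma generic: "EX G. class_generic A mem PP pr G"
proof -
  have "forcing_poset PP pr" using class_forcing unfolding class_forcing_def by blast
  from generic_exists[OF this countable_definable[OF cntA, of mem]] show ?thesis unfolding class_generic_def by blast
qed

end

section \<open>Constructible universe and transitive collapse\<close>

lemma wf_mem_rel: "wf (mem_rel A mem)" by (rule wf_subset[OF wf_mem]) (auto simp: mem_rel_def elts_def)

lemma Lset_sub: "wf (mem_rel A E) ==> x : A ==> Lset A E x <= A" by (subst Lset_unfold) (auto simp: Def_pow_def)

context isom
begin

lemma Def_pow_f: assumes X: "X <= A" shows "Def_pow B F (f ` X) = f ` Def_pow A E X"
proof -
  interpret X: isom f X E "f ` X" F by (rule sub_isom[OF X])
  have "definable (f ` X) F (elts B F (f x)) \<longleftrightarrow> definable X E (elts A E x)" if x: "x : A" for x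
  proof
    assume "definable X E (elts A E x)" then show "definable (f ` X) F (elts B F (f x))" unfolding elts_f[OF x] by (rule X.definable_f)
  next
    assume "definable (f ` X) F (elts B F (f x))"
    then obtain S where S: "definable X E S" "f ` elts A E x = f ` S" using X.definable_g unfolding elts_f[OF x] by blast
    have "S <= A" using X.definable_f(1)[OF S(1)] X by blast
    then have "elts A E x = S" using f_eq[OF elts_sub] S(2) by blast
    then show "definable X E (elts A E x)" using S by simp
  qed
  then have "{x : A. definable (f ` X) F (elts B F (f x))} = {x : A. definable X E (elts A E x)}" by blast
  then show ?thesis unfolding Def_pow_def Col_B by (simp only:)
qed

lemma L_f: assumes w: "wf (mem_rel A E)" "wf (mem_rel B F)" shows "L B F = f ` L A E" "L A E <= A"
proof -
  have Lf: "x : A --> Lset B F (f x) = f ` Lset A E x" for x using w(1)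
  proof (induction x rule: wf_induct_rule)
    case (less x)
    show ?case
    proof
      assume x: "x : A"
      have fx: "f x : B" unfolding B using x by blast
      have IH: "Lset B F (f y) = f ` Lset A E y" "y : A" if "y : elts A E x" for y
        using less[of y] that x subsetD[OF elts_sub that] unfolding mem_rel_def by auto
      have "Lset B F (f x) = (\<Union>y\<in>elts A E x. Def_pow B F (Lset B F (f y)))" unfolding Lset_unfold[OF w(2) fx] elts_f[OF x] by simp
      also have "... = (\<Union>y\<in>elts A E x. f ` Def_pow A E (Lset A E y))" using IH Def_pow_f[OF Lset_sub[OF w(1)]] by simp
      finally show "Lset B F (f x) = f ` Lset A E x" unfolding Lset_unfold[OF w(1) x] image_UN .
    qed
  qed
  have "{a. ordinal B F a} = f ` {a. ordinal A E a}"
  proof -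
    have "ordinal B F b \<longleftrightarrow> (EX a. ordinal A E a \<and> b = f a)" for b
    proof
      assume o: "ordinal B F b"
      then obtain a where "a : A" "b = f a" unfolding ordinal_def B by blast
      then show "EX a. ordinal A E a \<and> b = f a" using ordinal_f o by blast
    next
      assume "EX a. ordinal A E a \<and> b = f a"
      then obtain a where "ordinal A E a" "b = f a" by blast
      moreover from this have "a : A" unfolding ordinal_def by blast
      ultimately show "ordinal B F b" using ordinal_f by simp
    qed
    then show ?thesis by blast
  qed
  moreover have oA: "a : A" if "ordinal A E a" for a using that unfolding ordinal_def by blast
  ultimately show "L B F = f ` L A E" unfolding L_def image_UN using Lf by simp
  show "L A E <= A" unfolding L_def using oA Lset_sub[OF w(1)] by blast
qed

end

lemma (in zf) L_LK: "L A mem = LK"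
proof -
  have D: "Def_pow A mem (el X) = el (DefP X)" if X: "X : A" "el X ~= {} --> zero : el X" for X
  proof (intro set_eqI)
    fix y
    have "definable (el X) mem (el y) --> el y <= el X" unfolding definable_def by blast
    moreover have "y : el (DefP X) --> y : A" using X DefPA Atrans by blast
    ultimately show "y : Def_pow A mem (el X) \<longleftrightarrow> y : el (DefP X)" unfolding Def_pow_def using DefP_definable[OF X, of y] elts_A[of y] by auto
  qed
  have Lh: "a : A --> Ord a --> Lset A mem a = el (Lh a)" for a
  proof (induction a rule: el_induct)
    case (step a)
    show ?case
    proof (intro impI)
      assume a: "a : A" "Ord a"
      have b: "b : A" "Ord b" "Lset A mem b = el (Lh b)" if "b : el a" for b using that a step Atrans Ord_in by blast+
      \<comment> \<open>The link between external and internal definability requires nonempty stages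
        to contain \<open>zero\<close>, the default value of assignments.\<close>
      have z: "el (Lh b) ~= {} --> zero : el (Lh b)" if ba: "b : el a" for b
      proof
        assume "el (Lh b) ~= {}"
        then have "el b ~= {}" unfolding el_Lh[OF b(1)[OF ba]] by blast
        then have "zero : el b" using Ord_linear[OF Ord_zero b(2)[OF ba]] by auto
        moreover have "zero : el (DefP (Lh zero))" using Ord_DefP[OF zeroA Ord_zero] .
        ultimately show "zero : el (Lh b)" unfolding el_Lh[OF b(1)[OF ba]] by blast
      qed
      have "Lset A mem a = (\<Union>b\<in>el a. Def_pow A mem (Lset A mem b))" unfolding Lset_unfold[OF wf_mem_rel a(1)] elts_A[OF a(1)] ..
      also have "... = (\<Union>b\<in>el a. el (DefP (Lh b)))" using b z D[OF LhA] by (intro SUP_cong) auto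
      finally show "Lset A mem a = el (Lh a)" unfolding el_Lh[OF a(1)] .
    qed
  qed
  have "L A mem = (\<Union>a\<in>{a. a : A \<and> Ord a}. el (Lh a))" unfolding L_def ordinal_Ord using Lh by (intro SUP_cong) auto
  also have "... = LK" unfolding LK_def using LhA Atrans by blast
  finally show ?thesis .
qed

text \<open>Mostowski's collapse; countability of the model ensures that its values are hereditarily
  countable sets.\<close>

lemma collapse: assumes "countable_transitive_model M E"
  shows "EX f A. iso f M E A mem \<and> countable A \<and> (ALL x:A. el x <= A)"
proof -
  have c: "countable M" and w: "wf (mem_rel M E)" and Z: "ZFC M E" using assms unfolding countable_transitive_model_def by auto
  have "extensional_model M E" using Z unfolding ZFC_def by (rule conjunct1)
  then have ex: "x = y" if "x : M" "y : M" "elts M E x = elts M E y" for x y using that unfolding extensional_model_def by blast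
  define f where "f = wfrec (mem_rel M E) (%f x. mk (f ` elts M E x))"
  have f: "f x = mk (f ` elts M E x)" if "x : M" for x
  proof -
    have "cut f (mem_rel M E) x ` elts M E x = f ` elts M E x" by (intro image_cong) (auto simp: cut_def mem_rel_def that)
    then show ?thesis unfolding f_def by (subst wfrec[OF w]) (simp add: f_def)
  qed
  have elf: "el (f x) = f ` elts M E x" if "x : M" for x
    unfolding f[OF that] by (rule el_mk) (rule countable_image, rule countable_subset[OF elts_sub c])
  have inj: "x : M --> (ALL y:M. f x = f y --> x = y)" for x using w
  proof (induction x rule: wf_induct_rule)
    case (less x)
    show ?case
    proof (intro impI ballI)
      fix y assume xy: "x : M" "y : M" "f x = f y"
      have eq: "f ` elts M E x = f ` elts M E y" using elf xy by metis
      have IH: "z = z'" if "z : elts M E x" "z' : M" "f z = f z'" for z z'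
        using less[of z] that xy(1) subsetD[OF elts_sub that(1)] unfolding mem_rel_def by auto
      have "elts M E x = elts M E y"
      proof (intro set_eqI iffI)
        fix z assume z: "z : elts M E x"
        then obtain z' where z': "z' : elts M E y" "f z = f z'" using eq by blast
        then show "z : elts M E y" using IH[OF z subsetD[OF elts_sub z'(1)] z'(2)] by simp
      next
        fix z assume z: "z : elts M E y"
        then have "f z : f ` elts M E x" unfolding eq by blast
        then obtain z' where z': "z' : elts M E x" "f z' = f z" by force
        then show "z : elts M E x" using IH[OF z'(1) subsetD[OF elts_sub z] z'(2)] by simp
      qed
      then show "x = y" by (rule ex[OF xy(1,2)])
    qed
  qed
  have "E x y \<longleftrightarrow> f x : el (f y)" if xy: "x : M" "y : M" for x y
  proof
    assume "E x y" then show "f x : el (f y)" unfolding elf[OF xy(2)] elts_def using xy by blast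
  next
    assume "f x : el (f y)"
    then obtain z where z: "f x = f z" "z : elts M E y" unfolding elf[OF xy(2)] by blast
    then have "x = z" using inj[of x] xy(1) subsetD[OF elts_sub z(2)] by blast
    then show "E x y" using z unfolding elts_def by blast
  qed
  moreover have "inj_on f M" using inj unfolding inj_on_def by blast
  ultimately have "iso f M E (f ` M) mem" unfolding iso_def by blast
  moreover have "ALL x:f ` M. el x <= f ` M" using elf elts_sub by fastforce
  ultimately show ?thesis using c by blast
qed

theorem theoremT:
  fixes M :: "'a set" and E :: "'a \<Rightarrow> 'a \<Rightarrow> bool"
  assumes "countable_transitive_model M E"
  shows "\<exists>P r G. \<exists>(N :: nat set) F.
    class_forcing (L M E) E P r \<and> class_generic (L M E) E P r G \<and>
    forcing_extension (L M E) E P G N F \<and>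
    ZFC N F \<and> \<not> BA N F"
proof -
  have w: "wf (mem_rel M E)" and Z: "ZFC M E" using assms unfolding countable_transitive_model_def by auto
  obtain f A where f: "iso f M E A mem" "countable A" "\<forall>x\<in>A. el x \<subseteq> A" using collapse[OF assms] by blast
  interpret f: isom f M E A mem by unfold_locales (rule f)
  interpret A: zf A by (rule ZFC_zf(1)[OF f(2,3) f.ZFC_f[OF Z]])
  note Lf = f.L_f[OF w wf_mem_rel]
  define K where "K = A.LK"
  have fK: "f ` L M E = K" unfolding K_def A.L_LK[symmetric] Lf(1) ..
  have "isom f (L M E) E K mem" using f.sub_isom[OF Lf(2)] unfolding fK .
  from isom.inv[OF this] interpret g: isom "inv_into (L M E) f" K mem "L M E" E .
  interpret K: zfL K unfolding K_def by (rule A.LK_zfL)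
  obtain G where G: "class_generic K mem K.PP K.pr G" using K.generic by blast
  interpret T: tow K G by (rule K.tow_generic[OF G])
  \<comment> \<open>Numbering the countable extension turns it into a structure on natural
    numbers.\<close>
  define k where "k = to_nat_on T.N"
  define F where "F a b \<longleftrightarrow> inv_into T.N k a \<in> el (inv_into T.N k b)" for a b
  have kinj: "inj_on k T.N" unfolding k_def by (rule inj_on_to_nat_on[OF T.cntN])
  interpret k: isom k T.N mem "k ` T.N" F
    by unfold_locales (simp add: iso_def kinj F_def)
  note P = g.class_forcing_f[OF K.class_forcing]
  note GG = g.class_generic_f[OF P(1,2) G]
  have "forcing_extension K mem K.PP G T.N mem"
  proof (rule K.forcing_ext_I[where Q="K.Pc zero"])
    show "dfb K (\<lambda>e. K.Pc zero (e 0))" by (intro K.dfb_Pc K.dft_const K.dft_var K.zeroA)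
    show "K.PP = {p \<in> K. K.Pc zero p}" unfolding K.PP_def using K.PcA by blast
    show "T.N = val G ` K" by (rule T.N_def)
  qed (use GG(1) T.N_trans in auto)
  from g.forcing_extension_f[OF k.isom_axioms P(1) GG(1) this]
  have "forcing_extension (L M E) E (inv_into (L M E) f ` K.PP) (inv_into (L M E) f ` G) (k ` T.N) F" .
  moreover have "ZFC (k ` T.N) F" by (rule k.ZFC_f[OF zf_ZFC[OF T.N_zf T.N_AC]])
  moreover have "\<not> BA (k ` T.N) F" using isom.BA_f[OF k.inv] T.not_BA by blast
  ultimately show ?thesis using P(3) GG(2) by blast
qed

end
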